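(* Let $Q$ be a quantile function in $\mathbb{L}^1$. Let $\mathbf{Y}=(Y_i)_{i\in\mathbb{Z}}$, $Y_i=Y_0\circ T^i$, be the stationary sequence described in the context, with $P_{Y_0}$ the distribution of $Y_0$. Let $X_i=f(Y_i)-\mathbb{E}(f(Y_i))$, where $f$ belongs to $\widetilde{\mathcal{F}}(Q,P_{Y_0})$, and let $S_n=\sum_{k=1}^nX_k$. Let $R(u)=\alpha_{2,\mathbf{Y}}^{-1}(u)Q(u)$ for $u\in[0,1]$. 1. Assume that, for $p\ge2$, $$\sup_{x>0}x^{p-1}\int_0^1Q(u)\mathbf{1}_{R(u)>x}\,du<\infty .$$ Then, if $p>2$, for any $a\in(p-1,p)$ and any $x>0$, $$\mathbb{P}\Big(\frac1n\max_{1\le k\le n}|S_k|\ge x\Big)\ll\frac1{n^ax^{2a}}+\frac1{n^{p-1}x^p}.$$ If $p=2$, for any $a\in(1,2)$, any $c\in(0,1)$ and any $x>0$, $$\mathbb{P}\Big(\frac1n\max_{1\le k\le n}|S_k|\ge x\Big)\ll\frac1{n^{ac}x^{a(1+c)}}+\frac1{nx^2}.$$ 2. Assume that, for $p\ge2$, $$\int_0^1(\alpha_{2,\mathbf{Y}}^{-1}(u))^{p-1}Q^p(u)\,du<\infty .$$ Then, for any $a\in(p-1,p)$ and any $x>0$, $$\sum_{n>0}n^{p-2}\,\mathbb{P}\Big(\frac1n\max_{1\le k\le n}|S_k|\ge x\Big)\ll\frac1{x^{2a}}+\frac1{x^p}.$$ Here $\ll$ means that the left-hand side is at most $C$ times the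 right-hand side, for a positive constant $C$ not depending on $n$ nor on $x$ (in item 2, not depending on $x$), for all positive integers $n$ and all $x>0$.
   Context: Stationary sequence. $(\Omega,\mathcal{A},\mathbb{P})$ is a probability space, $T:\Omega\to\Omega$ is a bijective bi-measurable transformation preserving $\mathbb{P}$, and $\mathcal{F}_0\subseteq\mathcal{A}$ is a sub-$\sigma$-algebra with $\mathcal{F}_0\subseteq T^{-1}(\mathcal{F}_0)$. $Y_0$ is an $\mathcal{F}_0$-measurable integrable real-valued random variable with distribution $P_{Y_0}$, and $Y_i=Y_0\circ T^i$ for $i\in\mathbb{Z}$. Dependency coefficients. For an integrable random variable $Z$ put $Z^{(0)}=Z-\mathbb{E}(Z)$. For a random vector $V=(V_1,\dots,V_k)$ in $\mathbb{R}^k$ and a $\sigma$-algebra $\mathcal{F}$ let $$\alpha(\mathcal{F},V)=\sup_{(x_1,\dots,x_k)\in\mathbb{R}^k}\Big\|\mathbb{E}\Big(\prod_{j=1}^k(\mathbf{1}_{V_j\le x_j})^{(0)}\Big|\mathcal{F}\Big)-\mathbb{E}\Big(\prod_{j=1}^k(\mathbf{1}_{V_j\le x_j})^{(0)}\Big)\Big\|_1 .$$ For $k\ge1$ let $\alpha_{k,\mathbf{Y}}(0)=1/2$ and, for $n>0$, $\alpha_{k,\mathbf{Y}}(n)=\max_{1\le l\le k}\ \sup_{n\le i_1\le\dots\le i_l}\alpha(\mathcal{F}_0,(Y_{i_1},\dots,Y_{i_l}))$. For $u\in[0,1]$ let $\alpha_{k,\mathbf{Y}}^{-1}(u)=\min\{q\in\mathbb{N}:\alpha_{k,\mathbf{Y}}(q)\le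 u\}=\sum_{n=0}^\infty\mathbf{1}_{u<\alpha_{k,\mathbf{Y}}(n)}$ (possibly $+\infty$; here $\mathbb{N}$ contains $0$). Quantile functions. A tail function is a function $H:\mathbb{R}^+\to[0,1]$ that is non-increasing, right-continuous and converges to $0$ at infinity. The associated quantile function is $Q=H^{-1}$, $Q(u)=\inf\{t\ge0:H(t)\le u\}$ for $u\in[0,1]$, with $\inf\emptyset=\infty$. $Q$ belongs to $\mathbb{L}^p$ if $\int_0^1Q^p(u)\,du<\infty$; it is integrable if it belongs to $\mathbb{L}^1$. Function classes. For a probability measure $\mu$ on $\mathbb{R}$ and an integrable quantile function $Q=H^{-1}$, $\widetilde{\mathrm{Mon}}(Q,\mu)$ is the set of functions $g$ which are monotonic on some open interval of $\mathbb{R}$ and null elsewhere and such that $\mu(|g|>t)\le H(t)$ for all $t\in\mathbb{R}^+$. $\widetilde{\mathcal{F}}(Q,\mu)$ is the closure in $\mathbb{L}^1(\mu)$ of the set of functions of the form $\sum_{\ell=1}^L a_\ell f_\ell$ with $\sum_{\ell=1}^L|a_\ell|\le1$ and $f_\ell\in\widetilde{\mathrm{Mon}}(Q,\mu)$. *)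

theory Defs
  imports "HOL-Probability.Probability"
begin

definition centered :: "'a measure \<Rightarrow> ('a \<Rightarrow> real) \<Rightarrow> 'a \<Rightarrow> real" where
  "centered M Z = (\<lambda>\<omega>. Z \<omega> - integral\<^sup>L M Z)"

text \<open>Integer iterates of a bijection of the carrier \<^term>\<open>space M\<close>.\<close>

definition int_iterate :: "'a measure \<Rightarrow> ('a \<Rightarrow> 'a) \<Rightarrow> int \<Rightarrow> 'a \<Rightarrow> 'a" where
  "int_iterate M T i =
     (if 0 \<le> i then T ^^ nat i else (inv_into (space M) T) ^^ nat (- i))"

definition bimeasurable_mpt :: "'a measure \<Rightarrow> ('a \<Rightarrow> 'a) \<Rightarrow> bool" where
  "bimeasurable_mpt M T \<longleftrightarrow>
     bij_betw T (space M) (space M) \<and>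
     T \<in> measurable M M \<and> inv_into (space M) T \<in> measurable M M \<and>
     distr M M T = M"

text \<open>Only the coordinates \<open>V 1, \<dots>, V k\<close> of \<open>V\<close> and of the thresholds \<open>x\<close> are used.
  The values lie in \<open>ennreal\<close>, so that every supremum below is a genuine one.\<close>

definition alpha_vec ::
  "'a measure \<Rightarrow> 'a measure \<Rightarrow> nat \<Rightarrow> (nat \<Rightarrow> 'a \<Rightarrow> real) \<Rightarrow> ennreal" where
  "alpha_vec M F k V =
     (SUP x :: nat \<Rightarrow> real.
        let W = (\<lambda>\<omega>. \<Prod>j = 1..k. centered M (\<lambda>\<omega>'. indicator {..x j} (V j \<omega>')) \<omega>)
        in \<integral>\<^sup>+\<omega>. ennreal \<bar>real_cond_exp M F W \<omega> - integral\<^sup>L M W\<bar> \<partial>M)"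

text \<open>Index tuples \<open>n \<le> i\<^sub>1 \<le> \<dots> \<le> i\<^sub>l\<close> are functions that are monotone on \<open>{1..l}\<close>.\<close>

definition alpha_coeff ::
  "'a measure \<Rightarrow> 'a measure \<Rightarrow> nat \<Rightarrow> (int \<Rightarrow> 'a \<Rightarrow> real) \<Rightarrow> nat \<Rightarrow> ennreal" where
  "alpha_coeff M F k Y n =
     (if n = 0 then ennreal (1 / 2)
      else MAX l\<in>{1..k}.
             SUP i\<in>{i :: nat \<Rightarrow> int. int n \<le> i 1 \<and> mono_on {1..l} i}.
               alpha_vec M F l (\<lambda>j. Y (i j)))"

text \<open>The infimum over the empty set is \<open>\<infinity>\<close>, here and in the quantile function below.\<close>

definition alpha_inv ::
  "'a measure \<Rightarrow> 'a measure \<Rightarrow> nat \<Rightarrow> (int \<Rightarrow> 'a \<Rightarrow> real) \<Rightarrow> real \<Rightarrow> ennreal" where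
  "alpha_inv M F k Y u = (INF q\<in>{q :: nat. alpha_coeff M F k Y q \<le> ennreal u}. of_nat q)"

definition tail_function :: "(real \<Rightarrow> real) \<Rightarrow> bool" where
  "tail_function H \<longleftrightarrow>
     (\<forall>t\<ge>0. 0 \<le> H t \<and> H t \<le> 1) \<and>
     antimono_on {0..} H \<and>
     (\<forall>t\<ge>0. continuous (at_right t) H) \<and>
     (H \<longlongrightarrow> 0) at_top"

definition quantile_function :: "(real \<Rightarrow> real) \<Rightarrow> real \<Rightarrow> ennreal" where
  "quantile_function H u = (INF t\<in>{t. 0 \<le> t \<and> H t \<le> u}. ennreal t)"

text \<open>The classes attached to \<open>Q\<close> are parametrised by the tail function \<open>H\<close> with
  \<open>Q = H\<^sup>-\<^sup>1\<close>; it is uniquely determined by \<open>Q\<close> on \<open>{0..}\<close>.\<close>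

definition Mon_class :: "(real \<Rightarrow> real) \<Rightarrow> real measure \<Rightarrow> (real \<Rightarrow> real) set" where
  "Mon_class H \<mu> =
     {g. (\<exists>I. open I \<and> is_interval I \<and> (mono_on I g \<or> antimono_on I g) \<and> (\<forall>x. x \<notin> I \<longrightarrow> g x = 0)) \<and>
         (\<forall>t\<ge>0. measure \<mu> {x \<in> space \<mu>. \<bar>g x\<bar> > t} \<le> H t)}"

definition Mon_combinations :: "(real \<Rightarrow> real) \<Rightarrow> real measure \<Rightarrow> (real \<Rightarrow> real) set" where
  "Mon_combinations H \<mu> =
     {h. \<exists>(L :: nat) (a :: nat \<Rightarrow> real) (g :: nat \<Rightarrow> real \<Rightarrow> real).
           (\<Sum>l = 1..L. \<bar>a l\<bar>) \<le> 1 \<and> (\<forall>l\<in>{1..L}. g l \<in> Mon_class H \<mu>) \<and>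
           h = (\<lambda>x. \<Sum>l = 1..L. a l * g l x)}"

text \<open>The elements of the \<open>L\<^sup>1\<close>-closure are represented by actual integrable functions.\<close>

definition F_class :: "(real \<Rightarrow> real) \<Rightarrow> real measure \<Rightarrow> (real \<Rightarrow> real) set" where
  "F_class H \<mu> =
     {f. integrable \<mu> f \<and>
         (\<forall>\<epsilon>>0. \<exists>h\<in>Mon_combinations H \<mu>. (\<integral>\<^sup>+x. ennreal \<bar>f x - h x\<bar> \<partial>\<mu>) < ennreal \<epsilon>)}"

text \<open>Real powers on \<open>[0, \<infinity>]\<close>; only used with positive exponents.\<close>

definition ennreal_powr :: "ennreal \<Rightarrow> real \<Rightarrow> ennreal" where
  "ennreal_powr x p = (if x = \<infinity> then \<infinity> else ennreal (enn2real x powr p))"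

end

theory Submission
  imports Defs
begin

text \<open>Write \<open>\<rho> = \<alpha>\<inverse> Q\<close> for the function \<open>R\<close> of the theorem and \<open>l = n x\<close>. Everything follows from one deviation inequality, which
involves \<open>\<rho>\<close> only through two integrals over \<open>(0, 1)\<close>. With \<open>\<Phi> t = min (t powr b1) (t powr b2)\<close>, \<open>b2 < p - 1 < b1\<close>,
\<open>P (max |S k| \<ge> l) \<le> C ((n \<integral> Q min \<rho> l / l\<^sup>2) powr a + (n / l) \<integral> Q \<Phi> (\<rho> / l))\<close>;
this is \<open>F_class_deviation\<close>.

Under the weak condition the second integral is \<open>O (l powr (1 - p))\<close>, by slicing \<open>\<rho> / l\<close> dyadically: \<open>b2 < p - 1\<close> makes the
slices above 1 summable, \<open>p - 1 < b1\<close> those below 1. The first integral is bounded if \<open>p > 2\<close>, and \<open>O (l powr (1 - c))\<close> if \<open>p = 2\<close>,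
where \<open>\<integral> Q \<rho>\<close> may diverge; this is the reason for the exponent \<open>c\<close>. Under the strong condition the inequality is summed over \<open>n\<close> under the
integral sign, since \<open>\<Sum>n. n powr (p - 2) * \<Phi> (t / n) = O (t powr (p - 1))\<close>.

The deviation inequality rests on truncation and blocking. A convex combination of monotone functions is truncated at height
\<open>L = Q v\<close> with \<open>\<rho> v \<le> l / 16\<close>; what is cut off costs \<open>(n / l) \<integral> Q\<close> over \<open>(0, v)\<close>. The partial sums are cut into blocks of length \<open>q\<close>, about \<open>l / (16 L)\<close>,
so that a block never exceeds a fraction of \<open>l\<close> and \<open>\<alpha> q \<le> v\<close>. Subtracting from each block its conditional expectation two blocks back
leaves two martingales, over even and odd blocks, at an \<open>L\<^sup>1\<close> cost of \<open>\<alpha> q\<close>. Each is controlled by its moment of order \<open>2 a\<close>: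
\<open>martingale_rosenthal\<close> reduces it to the moments of single blocks, bounded by \<open>projective_moment_bound\<close>, and to the moment of order \<open>a\<close> of the
sum of conditional variances. The latter is where pairs of variables must be nearly independent of the past, i.e. where \<open>\<alpha>\<close> of order 2 enters:
\<open>predictable_sum_moment\<close> compares that sum with its mean.

All estimates of mixing use only pairings with bounded past variables, for indicators of lower sets; a monotone function
truncated at \<open>L\<close> is a uniform limit of combinations of such indicators with total weight \<open>4 L\<close>. The past of time \<open>i\<close> is \<open>T\<^sup>-\<^sup>i F0\<close>.\<close>

lemmas integral_ge_0 = Bochner_Integration.integral_nonneg
  and expect_sum = Bochner_Integration.integral_sum
  and expect_cong = Bochner_Integration.integral_cong
  and integrable_cmult = Bochner_Integration.integrable_mult_right
  and integrable_setsum = Bochner_Integration.integrable_sum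
  and integrable_dominated = Bochner_Integration.integrable_bound

abbreviation (in prob_space) expect (binder "\<E>" 10) where
  "expect f \<equiv> expectation f"

section \<open>Real powers\<close>

text \<open>Up to the factor \<open>t + 1\<close>, the derivative of \<open>|x| powr (t + 1)\<close>.\<close>

definition spow :: "real \<Rightarrow> real \<Rightarrow> real" where
 "spow t x = sgn x * \<bar>x\<bar> powr t"

lemma bernoulli_powr_le:
 fixes z s :: real
 assumes "1 <= s" "0 <= z"
 shows "1 + s * (z - 1) <= z powr s"
proof (cases "z = 0")
 case True
 then show ?thesis using assms by simp
next
 case False
 have "(z powr s) powr (1/s) * 1 powr (1 - 1/s) <= (1/s) * (z powr s) + (1 - 1/s) * 1"
  using assms False by (intro Youngs_inequality_0) (auto simp: field_simps)
 then have "z <= (1/s) * (z powr s) + (1 - 1/s)"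
  using assms False by (simp add: powr_powr)
 then have "s * z <= s * ((1/s) * (z powr s) + (1 - 1/s))"
  using assms by (intro mult_left_mono) auto
 also have "... = z powr s + s - 1" using assms by (simp add: field_simps)
 finally show ?thesis by (simp add: algebra_simps)
qed

lemma bernoulli_powr_ge:
 fixes z s :: real
 assumes "0 < s" "s <= 1" "0 <= z"
 shows "z powr s <= 1 + s * (z - 1)"
proof (cases "z = 0")
 case True
 then show ?thesis using assms by simp
next
 case False
 have "z powr s * 1 powr (1 - s) <= s * z + (1 - s) * 1"
  using assms False by (intro Youngs_inequality_0) auto
 then show ?thesis by (simp add: algebra_simps)
qed

text \<open>Convexity: the graph lies above its tangents. This linear bound replaces Jensen and conditional Jensen throughout, because it can be multiplied by a bounded past variable and integrated.\<close>

lemma abs_powr_tangent: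
 fixes x y s :: real
 assumes "1 < s"
 shows "\<bar>x\<bar> powr s + s * spow (s - 1) x * (y - x) <= \<bar>y\<bar> powr s"
proof (cases "x = 0")
 case True
 then show ?thesis by (simp add: spow_def)
next
 case False
 define z where "z = y / x"
 have y: "y = z * x" using False by (simp add: z_def)
 have e: "\<bar>x\<bar> powr s + s * spow (s - 1) x * (y - x) = \<bar>x\<bar> powr s * (1 + s * (z - 1))"
 proof -
  have "sgn x * x = \<bar>x\<bar>" by (simp add: abs_sgn mult.commute)
  moreover have "spow (s - 1) x * (y - x) = \<bar>x\<bar> powr (s - 1) * (sgn x * x) * (z - 1)"
   by (simp add: spow_def y algebra_simps)
  ultimately have "spow (s - 1) x * (y - x) = \<bar>x\<bar> powr (s - 1) * \<bar>x\<bar> * (z - 1)"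
   by simp
  also have "\<bar>x\<bar> powr (s - 1) * \<bar>x\<bar> = \<bar>x\<bar> powr s"
   using False powr_add[of "\<bar>x\<bar>" "s - 1" 1] by simp
  finally show ?thesis by (metis (no_types, opaque_lifting) distrib_left mult.assoc mult.commute mult.right_neutral mult.left_commute)
 qed
 have "1 + s * (z - 1) <= \<bar>z\<bar> powr s"
 proof (cases "0 <= z")
  case True
  then show ?thesis using bernoulli_powr_le[of s z] assms by simp
 next
  case False
  then have "s * z <= 0" using assms by (simp add: mult_nonneg_nonpos)
  then have "1 + s * (z - 1) <= 0" using assms by (simp add: algebra_simps)
  then show ?thesis by (meson order_trans powr_ge_zero)
 qed
 then have "\<bar>x\<bar> powr s * (1 + s * (z - 1)) <= \<bar>x\<bar> powr s * \<bar>z\<bar> powr s"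
  by (intro mult_left_mono) auto
 also have "... = \<bar>y\<bar> powr s" by (simp add: y abs_mult powr_mult mult.commute)
 finally show ?thesis using e by simp
qed

lemma powr_add_le:
 fixes x y s :: real
 assumes "0 <= s" "0 <= x" "0 <= y"
 shows "(x + y) powr s <= 2 powr s * (x powr s + y powr s)"
proof -
 have "(x + y) powr s <= (2 * max x y) powr s"
  using assms by (intro powr_mono2) auto
 also have "... = 2 powr s * max x y powr s" using assms by (simp add: powr_mult)
 also have "max x y powr s <= x powr s + y powr s" by (simp add: max_def)
 finally show ?thesis by simp
qed

lemma powr_diff_le:
 fixes x y t :: real
 assumes "1 < t" "0 <= x" "x <= y"
 shows "y powr t - x powr t <= t * y powr (t - 1) * (y - x)"
 using abs_powr_tangent[of t y x] assms
 by (cases "y = 0") (auto simp: spow_def algebra_simps)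

lemma spow_diff_le:
 fixes x d t :: real
 assumes t: "1 < t"
 shows "\<bar>spow t (x + d) - spow t x\<bar> <= (t * 2 powr t) * (\<bar>d\<bar> * (\<bar>x\<bar> powr (t - 1) + \<bar>d\<bar> powr (t - 1)))"
proof -
 define y where "y = x + d"
 have C: "2 <= t * 2 powr t"
 proof -
  have "(2::real) powr 1 <= 2 powr t" using t by (intro powr_mono) auto
  then show ?thesis using t mult_mono[of 1 t 2 "2 powr t"] by simp
 qed
 have same: "\<bar>b powr t - a powr t\<bar> <= (t * 2 powr t) * (\<bar>b - a\<bar> * (\<bar>a\<bar> powr (t - 1) + \<bar>b - a\<bar> powr (t - 1)))"
  if "0 <= a" "0 <= b" for a b :: real
 proof -
  have "\<bar>b powr t - a powr t\<bar> <= t * (a + \<bar>b - a\<bar>) powr (t - 1) * \<bar>b - a\<bar>"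
  proof (cases "a <= b")
   case True
   then show ?thesis using powr_diff_le[of t a b] powr_mono2[of t a b] t that by simp
  next
   case False
   then have "a powr t - b powr t <= t * a powr (t - 1) * (a - b)"
    using powr_diff_le[of t b a] t that by simp
   also have "... <= t * (a + \<bar>b - a\<bar>) powr (t - 1) * (a - b)"
    using t that False by (intro mult_right_mono mult_left_mono powr_mono2) auto
   finally show ?thesis using False powr_mono2[of t b a] t that by simp
  qed
  also have "... <= t * (2 powr (t - 1) * (a powr (t - 1) + \<bar>b - a\<bar> powr (t - 1))) * \<bar>b - a\<bar>"
   using t that by (intro mult_right_mono mult_left_mono powr_add_le) auto
  also have "... <= t * (2 powr t * (a powr (t - 1) + \<bar>b - a\<bar> powr (t - 1))) * \<bar>b - a\<bar>"
   using t that by (intro mult_right_mono mult_left_mono powr_mono) auto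
  finally show ?thesis using that by (simp add: mult_ac)
 qed
 have opp: "a powr t + b powr t <= (t * 2 powr t) * ((a + b) * (a powr (t - 1) + (a + b) powr (t - 1)))"
  if "0 <= a" "0 <= b" for a b :: real
 proof (cases "a + b = 0")
  case True
  then have "a = 0" "b = 0" using that by auto
  then show ?thesis by simp
 next
  case False
  have "a powr t + b powr t <= (a + b) powr t + (a + b) powr t"
   using that t by (intro add_mono powr_mono2) auto
  also have "... = 2 * ((a + b) * (a + b) powr (t - 1))"
   using False that powr_add[of "a + b" 1 "t - 1"] by simp
  also have "... <= (t * 2 powr t) * ((a + b) * (a powr (t - 1) + (a + b) powr (t - 1)))"
   using C that by (intro mult_mono) auto
  finally show ?thesis .
 qed
 show ?thesis
 proof (cases "0 <= x")
  case x: True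
  show ?thesis
  proof (cases "0 <= y")
   case True
   then show ?thesis using same[of x y] x y_def by (auto simp: spow_def sgn_if split: if_splits)
  next
   case False
   have "\<bar>spow t y - spow t x\<bar> = \<bar>- ((-y) powr t) - x powr t\<bar>"
    using False x by (auto simp: spow_def sgn_if)
   also have "... = x powr t + (-y) powr t"
    using powr_ge_zero[of "-y" t] powr_ge_zero[of x t] by linarith
   finally have "\<bar>spow t y - spow t x\<bar> = x powr t + (-y) powr t" .
   then show ?thesis using opp[of x "-y"] x y_def False by simp
  qed
 next
  case x: False
  show ?thesis
  proof (cases "0 <= y")
   case True
   have "\<bar>spow t y - spow t x\<bar> = \<bar>y powr t + (-x) powr t\<bar>"
    using True x by (auto simp: spow_def sgn_if)
   then have "\<bar>spow t y - spow t x\<bar> = (-x) powr t + y powr t"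
    using powr_ge_zero[of "-x" t] powr_ge_zero[of y t] by linarith
   then show ?thesis using opp[of "-x" "y"] x y_def True by (simp add: )
  next
   case False
   then show ?thesis using same[of "-x" "-y"] x y_def by (auto simp: spow_def sgn_if)
  qed
 qed
qed

text \<open>The second-order Taylor bound. The remainder separates the regimes \<open>|d| \<le> |x|\<close> and \<open>|d| > |x|\<close>; its constant is that of \<open>spow_diff_le\<close> after one application of the tangent inequality at \<open>x + d\<close>.\<close>

lemma abs_powr_taylor:
 fixes x d r :: real
 assumes r: "2 < r"
 shows "\<bar>x + d\<bar> powr r <= \<bar>x\<bar> powr r + r * spow (r - 1) x * d
      + (r * ((r - 1) * 2 powr (r - 1))) * (\<bar>x\<bar> powr (r - 2) * d\<^sup>2 + \<bar>d\<bar> powr r)"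
proof -
 have "\<bar>x + d\<bar> powr r + r * spow (r - 1) (x + d) * (x - (x + d)) <= \<bar>x\<bar> powr r"
  using r by (intro abs_powr_tangent) auto
 then have "\<bar>x + d\<bar> powr r <= \<bar>x\<bar> powr r + r * spow (r - 1) x * d
   + r * ((spow (r - 1) (x + d) - spow (r - 1) x) * d)"
  by (simp add: algebra_simps)
 also have "(spow (r - 1) (x + d) - spow (r - 1) x) * d <= \<bar>spow (r - 1) (x + d) - spow (r - 1) x\<bar> * \<bar>d\<bar>"
  by (metis abs_ge_self abs_mult)
 also have "\<bar>spow (r - 1) (x + d) - spow (r - 1) x\<bar> <=
   ((r - 1) * 2 powr (r - 1)) * (\<bar>d\<bar> * (\<bar>x\<bar> powr (r - 1 - 1) + \<bar>d\<bar> powr (r - 1 - 1)))"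
  using r by (intro spow_diff_le) auto
 also have "((r - 1) * 2 powr (r - 1)) * (\<bar>d\<bar> * (\<bar>x\<bar> powr (r - 1 - 1) + \<bar>d\<bar> powr (r - 1 - 1))) * \<bar>d\<bar>
   = ((r - 1) * 2 powr (r - 1)) * (\<bar>x\<bar> powr (r - 2) * d\<^sup>2 + \<bar>d\<bar> powr r)"
 proof -
  have "\<bar>d\<bar> * \<bar>d\<bar> = d\<^sup>2" by (simp add: power2_eq_square)
  moreover have "\<bar>d\<bar> powr (r - 2) * d\<^sup>2 = \<bar>d\<bar> powr r"
  proof (cases "d = 0")
   case False
   have "\<bar>d\<bar> powr r = \<bar>d\<bar> powr (r - 2) * \<bar>d\<bar> powr 2" by (subst powr_add[symmetric]) simp
   also have "\<bar>d\<bar> powr 2 = d\<^sup>2" using False by (simp add: powr_numeral)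
   finally show ?thesis by (rule sym)
  qed simp
  moreover have "r - 1 - 1 = r - 2" by simp
  moreover have "K * (\<bar>d\<bar> * (u + v)) * \<bar>d\<bar> = K * (u * (\<bar>d\<bar> * \<bar>d\<bar>) + v * (\<bar>d\<bar> * \<bar>d\<bar>))" for K u v :: real
   by (simp only: distrib_left mult_ac)
  ultimately show ?thesis by metis
 qed
 finally show ?thesis using r by (simp add: mult_left_mono mult_right_mono algebra_simps)
qed

text \<open>Young inequality with a free parameter: the first term dominates where \<open>v \<le> \<tau> u\<close>, the second elsewhere.\<close>

lemma young_cut:
 fixes u v a \<tau> :: real
 assumes "0 <= u" "0 <= v" "1 < a" "0 < \<tau>"
 shows "u powr (a - 1) * v <= \<tau> * u powr a + \<tau> powr (1 - a) * v powr a"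
proof (cases "v <= \<tau> * u")
 case True
 have "u powr (a - 1) * v <= u powr (a - 1) * (\<tau> * u)"
  using True by (intro mult_left_mono) auto
 also have "... = \<tau> * u powr a"
  using assms powr_add[of u "a - 1" 1] by (cases "u = 0") auto
 finally show ?thesis by (simp add: add_increasing2)
next
 case False
 have v: "0 < v" using False assms by (smt (verit) mult_nonneg_nonneg)
 have "u <= v / \<tau>" using False assms by (simp add: field_simps)
 then have "u powr (a - 1) * v <= (v / \<tau>) powr (a - 1) * v"
  using assms by (intro mult_right_mono powr_mono2) auto
 also have "... = \<tau> powr (1 - a) * v powr a"
  using v assms powr_add[of v "a - 1" 1] powr_minus[of \<tau> "a - 1"] 
  by (simp add: powr_divide field_simps)
 finally show ?thesis using assms by (simp add: add_increasing)
qed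

text \<open>Some term is at least its share of the sum: otherwise adding up \<open>G k < w k * sum G A\<close> would contradict that the weights have sum at most 1.\<close>

lemma sum_powr_le_weighted:
 fixes w G :: "'b \<Rightarrow> real"
 assumes fin: "finite A" and s: "0 < s" and w: "\<And>k. k \<in> A ==> 0 < w k" "sum w A <= 1"
  and G: "\<And>k. k \<in> A ==> 0 <= G k"
 shows "(sum G A) powr s <= (\<Sum>k\<in>A. w k powr (- s) * G k powr s)"
proof (cases "sum G A = 0")
 case True
 then show ?thesis by (auto intro!: sum_nonneg)
next
 case False
 define T where "T = sum G A"
 have "0 <= T" unfolding T_def by (intro sum_nonneg G)
 then have T: "0 < T" using False unfolding T_def by linarith
 obtain k where k: "k \<in> A" "w k * T <= G k"
 proof (rule ccontr)
  assume "\<not> thesis"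
  then have "\<And>k. k \<in> A ==> G k < w k * T" using that by force
  moreover have "A \<noteq> {}" using False by auto
  ultimately have "sum G A < (\<Sum>k\<in>A. w k * T)" using fin by (intro sum_strict_mono) auto
  also have "... = sum w A * T" by (simp add: sum_distrib_right)
  also have "... <= 1 * T" using w T by (intro mult_right_mono) auto
  finally show False by (simp add: T_def)
 qed
 have "T powr s <= (G k / w k) powr s"
  using k w T s by (intro powr_mono2) (auto simp: field_simps)
 also have "... = w k powr (- s) * G k powr s"
  using k w(1)[of k] G[of k] by (simp add: powr_divide powr_minus field_simps)
 also have "... <= (\<Sum>k\<in>A. w k powr (- s) * G k powr s)"
  using k fin by (intro member_le_sum) auto
 finally show ?thesis by (simp add: T_def)
qed

lemma sum_powr_le:
 fixes \<theta> :: real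
 assumes "0 < \<theta>"
 shows "(\<Sum>m<q. real (Suc m) powr (\<theta> - 1)) <= (1 + 1/\<theta>) * real q powr \<theta>"
proof (cases "1 <= \<theta>")
 case True
 have "(\<Sum>m<q. real (Suc m) powr (\<theta> - 1)) <= (\<Sum>m<q. real q powr (\<theta> - 1))"
  using True by (intro sum_mono powr_mono2) auto
 also have "... = real q powr \<theta>"
  using powr_add[of "real q" 1 "\<theta> - 1"] by (cases "q = 0") auto
 also have "... <= (1 + 1/\<theta>) * real q powr \<theta>" using assms by (simp add: distrib_right)
 finally show ?thesis .
next
 case False
 have step: "\<theta> * real (Suc m) powr (\<theta> - 1) <= real (Suc m) powr \<theta> - real m powr \<theta>" for m
 proof -
  define z where "z = real m / real (Suc m)"
  have "z powr \<theta> <= 1 + \<theta> * (z - 1)" using False assms by (intro bernoulli_powr_ge) (auto simp: z_def)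
  then have "real (Suc m) powr \<theta> * z powr \<theta> <= real (Suc m) powr \<theta> * (1 + \<theta> * (z - 1))"
   by (intro mult_left_mono) auto
  moreover have "real (Suc m) powr \<theta> * z powr \<theta> = real m powr \<theta>"
   by (simp add: z_def powr_divide)
  moreover have "z - 1 = - (1 / real (Suc m))" by (simp add: z_def field_simps)
  moreover have "real (Suc m) powr \<theta> / real (Suc m) = real (Suc m) powr (\<theta> - 1)"
   by (simp add: powr_diff)
  moreover have "real (Suc m) powr \<theta> * (1 + \<theta> * (- (1 / real (Suc m)))) =
    real (Suc m) powr \<theta> - \<theta> * (real (Suc m) powr \<theta> / real (Suc m))"
   by (simp add: algebra_simps)
  ultimately show ?thesis by (simp del: of_nat_Suc)
 qed
 have "\<theta> * (\<Sum>m<q. real (Suc m) powr (\<theta> - 1)) <= real q powr \<theta>"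
 proof (induction q)
  case (Suc q)
  then show ?case using step[of q] by (simp add: algebra_simps)
 qed simp
 then have "(\<Sum>m<q. real (Suc m) powr (\<theta> - 1)) <= (1/\<theta>) * real q powr \<theta>"
  using assms by (simp add: field_simps)
 also have "... <= (1 + 1/\<theta>) * real q powr \<theta>" by (intro mult_right_mono) auto
 finally show ?thesis .
qed

lemma sum_powr_tail_le:
 fixes \<eta> :: real
 assumes "0 < \<eta>" "\<eta> <= 1" "1 <= k"
 shows "(\<Sum>n\<in>{k..N}. real n powr (- 1 - \<eta>)) <= (1 + 1/\<eta>) * real k powr (- \<eta>)"
proof -
 have step: "\<eta> * real (Suc n) powr (- 1 - \<eta>) <= real n powr (- \<eta>) - real (Suc n) powr (- \<eta>)"
  if "1 <= n" for n :: nat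
 proof -
  define z where "z = real n / real (Suc n)"
  have z: "0 < z" using that by (simp add: z_def)
  have "z powr \<eta> <= 1 + \<eta> * (z - 1)" using assms z by (intro bernoulli_powr_ge) auto
  moreover have "z - 1 = - (1 / real (Suc n))" by (simp add: z_def field_simps)
  ultimately have "z powr \<eta> <= 1 - \<eta> / real (Suc n)" by simp
  then have "real n powr (-\<eta>) * z powr \<eta> <= real n powr (-\<eta>) * (1 - \<eta> / real (Suc n))"
   by (intro mult_left_mono) auto
  moreover have "real n powr (-\<eta>) * z powr \<eta> = real (Suc n) powr (-\<eta>)"
   using that by (simp add: z_def powr_divide powr_minus inverse_eq_divide)
  moreover have "real (Suc n) powr (-\<eta>) * (\<eta> / real (Suc n)) <= real n powr (-\<eta>) * (\<eta> / real (Suc n))"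
   using that assms by (intro mult_right_mono powr_mono2') auto
  moreover have "real (Suc n) powr (-\<eta>) * (\<eta> / real (Suc n)) = \<eta> * real (Suc n) powr (- 1 - \<eta>)"
  proof -
   have "- 1 - \<eta> = - \<eta> - 1" by simp
   then show ?thesis using powr_diff[of "real (Suc n)" "-\<eta>" 1] by (simp only: powr_one) simp
  qed
  ultimately show ?thesis by (simp add: algebra_simps)
 qed
 have "\<eta> * (\<Sum>n\<in>{k..N}. real n powr (- 1 - \<eta>)) <= \<eta> * real k powr (- 1 - \<eta>) + real k powr (- \<eta>) - real N powr (-\<eta>)" if "k <= N"
  using that
 proof (induction N rule: dec_induct)
  case base
  then show ?case by simp
 next
  case (step n)
  then show ?case using \<open>\<And>n. 1 <= n ==> _ n\<close>[of n] assms by (simp add: algebra_simps)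
 qed
 then have "\<eta> * (\<Sum>n\<in>{k..N}. real n powr (- 1 - \<eta>)) <= \<eta> * real k powr (- 1 - \<eta>) + real k powr (- \<eta>)"
  using assms by (cases "k <= N") (auto intro: order_trans)
 also have "real k powr (- 1 - \<eta>) <= real k powr (- \<eta>)"
  using assms by (intro powr_mono) auto
 finally have "\<eta> * (\<Sum>n\<in>{k..N}. real n powr (- 1 - \<eta>)) <= (\<eta> + 1) * real k powr (- \<eta>)"
  using assms by (simp add: algebra_simps)
 then show ?thesis using assms by (simp add: field_simps)
qed

section \<open>Bounded variables and conditional expectations\<close>

text \<open>Boundedness is required everywhere, not almost everywhere, so that sums, products and powers stay in the class without exceptional sets.\<close>

definition brv :: "'a measure \<Rightarrow> ('a \<Rightarrow> real) \<Rightarrow> bool" where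
 "brv F Z \<longleftrightarrow> Z \<in> borel_measurable F \<and> (\<exists>B. \<forall>w. \<bar>Z w\<bar> <= B)"

named_theorems brv_intros

lemma brvI: "Z \<in> borel_measurable F ==> (\<And>w. \<bar>Z w\<bar> <= B) ==> brv F Z"
 by (auto simp: brv_def)

lemma brvE: assumes "brv F Z" obtains B where "0 < B" "\<And>w. \<bar>Z w\<bar> <= B"
proof -
 from assms obtain B where B: "\<And>w. \<bar>Z w\<bar> <= B" by (auto simp: brv_def)
 show ?thesis by (rule that[of "max B 1"]) (auto simp: B le_max_iff_disj)
qed

lemma brv_meas: "brv F Z ==> Z \<in> borel_measurable F" by (simp add: brv_def)

lemma brv_const [brv_intros]: "brv F (\<lambda>w. c)"
 by (rule brvI[where B="\<bar>c\<bar>"]) auto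

lemma brv_cmult [brv_intros]: "brv F Z ==> brv F (\<lambda>w. c * Z w)"
proof -
 assume Z: "brv F Z"
 obtain B where B: "0 < B" "\<And>w. \<bar>Z w\<bar> <= B" using brvE[OF Z] by metis
 show ?thesis
  by (rule brvI[where B="\<bar>c\<bar> * B"]) (use B brv_meas[OF Z] in \<open>auto simp: abs_mult intro!: mult_left_mono\<close>)
qed

lemma brv_add [brv_intros]: "brv F Z ==> brv F W ==> brv F (\<lambda>w. Z w + W w)"
proof -
 assume Z: "brv F Z" and W: "brv F W"
 obtain B where B: "\<And>w. \<bar>Z w\<bar> <= B" using brvE[OF Z] by metis
 obtain C where C: "\<And>w. \<bar>W w\<bar> <= C" using brvE[OF W] by metis
 show ?thesis
  by (rule brvI[where B="B + C"])
    (use brv_meas[OF Z] brv_meas[OF W] B C in \<open>auto intro: order_trans[OF abs_triangle_ineq] add_mono\<close>)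
qed

lemma brv_minus [brv_intros]: "brv F Z ==> brv F (\<lambda>w. - Z w)"
 using brv_cmult[of F Z "-1"] by simp

lemma brv_diff [brv_intros]: "brv F Z ==> brv F W ==> brv F (\<lambda>w. Z w - W w)"
 using brv_add[OF _ brv_minus, of F Z W] by simp

lemma brv_mult [brv_intros]: "brv F Z ==> brv F W ==> brv F (\<lambda>w. Z w * W w)"
proof -
 assume Z: "brv F Z" and W: "brv F W"
 obtain B where B: "0 < B" "\<And>w. \<bar>Z w\<bar> <= B" using brvE[OF Z] by metis
 obtain C where C: "\<And>w. \<bar>W w\<bar> <= C" using brvE[OF W] by metis
 show ?thesis
  by (rule brvI[where B="B * C"])
    (use brv_meas[OF Z] brv_meas[OF W] B C in \<open>auto simp: abs_mult intro!: mult_mono\<close>)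
qed

lemma brv_abs [brv_intros]: "brv F Z ==> brv F (\<lambda>w. \<bar>Z w\<bar>)"
 by (auto simp: brv_def)

lemma brv_divide [brv_intros]: "brv F Z ==> brv F (\<lambda>w. Z w / c)"
 using brv_cmult[of F Z "1/c"] by simp

lemma brv_power2 [brv_intros]: "brv F Z ==> brv F (\<lambda>w. (Z w)\<^sup>2)"
 unfolding power2_eq_square by (intro brv_mult)

lemma brv_powr [brv_intros]: 
 assumes "brv F Z" "0 <= s" shows "brv F (\<lambda>w. \<bar>Z w\<bar> powr s)"
proof -
 obtain B where B: "0 < B" "\<And>w. \<bar>Z w\<bar> <= B" using brvE[OF assms(1)] by metis
 show ?thesis
  by (rule brvI[where B="B powr s"]) (use brv_meas[OF assms(1)] assms B in \<open>auto intro!: powr_mono2\<close>)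
qed

lemma brv_powr_nonneg: 
 assumes "brv F Z" "0 <= s" "\<And>w. 0 <= Z w" shows "brv F (\<lambda>w. Z w powr s)"
 using brv_powr[OF assms(1,2)] assms(3) by simp

lemma brv_spow [brv_intros]:
 assumes "brv F Z" "0 <= s" shows "brv F (\<lambda>w. spow s (Z w))"
proof -
 obtain B where B: "0 < B" "\<And>w. \<bar>Z w\<bar> <= B" using brvE[OF assms(1)] by metis
 have *: "\<bar>spow s z\<bar> <= \<bar>z\<bar> powr s" for z by (auto simp: spow_def abs_mult sgn_if)
 show ?thesis
 proof (rule brvI[where B="B powr s"])
  show "(\<lambda>w. spow s (Z w)) \<in> borel_measurable F"
   using brv_meas[OF assms(1)] unfolding spow_def by measurable
  show "\<bar>spow s (Z w)\<bar> <= B powr s" for w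
   using *[of "Z w"] B powr_mono2[of s "\<bar>Z w\<bar>" B] assms by force
 qed
qed

lemma brv_sum [brv_intros]: "(\<And>i. i \<in> A ==> brv F (Z i)) ==> brv F (\<lambda>w. \<Sum>i\<in>A. Z i w)"
proof (induction A rule: infinite_finite_induct)
 case (insert x A)
 then show ?case by (simp add: brv_add)
qed (auto intro: brv_const)

lemma brv_indicator [brv_intros]: "A \<in> sets F ==> brv F (\<lambda>w. indicat_real A w)"
 by (rule brvI[where B=1]) (auto simp: indicator_def)

lemma brv_mono: "brv F Z ==> subalgebra G F ==> brv G Z"
 unfolding brv_def using measurable_from_subalg by blast

lemma (in prob_space) brv_integrable: "brv M Z ==> integrable M Z"
 unfolding brv_def
proof (elim conjE exE)
 fix B assume "Z \<in> borel_measurable M" "\<forall>w. \<bar>Z w\<bar> <= B"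
 then show "integrable M Z" by (intro integrable_const_bound[where B=B]) auto
qed

text \<open>A version of the conditional expectation, characterised by pairings with bounded past variables only.\<close>

definition is_cexp :: "'a measure \<Rightarrow> 'a measure \<Rightarrow> ('a \<Rightarrow> real) \<Rightarrow> ('a \<Rightarrow> real) \<Rightarrow> bool" where
 "is_cexp M F Z W \<longleftrightarrow> brv F W \<and> (\<forall>\<xi>. brv F \<xi> --> (\<integral>w. \<xi> w * Z w \<partial>M) = (\<integral>w. \<xi> w * W w \<partial>M))"

text \<open>The library version satisfies the bounds almost everywhere; clamping it to them changes it on a null set only.\<close>

lemma (in prob_space) is_cexp_exists:
 assumes F: "subalgebra M F" and Z: "brv M Z" and bd: "\<And>w. lo <= Z w" "\<And>w. Z w <= hi"
 obtains W where "is_cexp M F Z W" "\<And>w. lo <= W w" "\<And>w. W w <= hi"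
proof -
 interpret finite_measure_subalgebra M F using F by unfold_locales
 define W where "W = (\<lambda>w. max lo (min hi (real_cond_exp M F Z w)))"
 have int: "integrable M Z" by (rule brv_integrable[OF Z])
 have "AE w in M. real_cond_exp M F Z w <= hi"
  by (rule real_cond_exp_le_c[OF int]) (simp add: bd)
 moreover have "AE w in M. real_cond_exp M F Z w \<ge> lo"
  by (rule real_cond_exp_ge_c[OF int]) (simp add: bd)
 ultimately have eq: "AE w in M. W w = real_cond_exp M F Z w"
  by eventually_elim (auto simp: W_def)
 have lohi: "lo <= hi" using bd order_trans by blast
 have b: "lo <= W w" "W w <= hi" for w using lohi by (auto simp: W_def)
 have meas: "W \<in> borel_measurable F" unfolding W_def by measurable
 have brvW: "brv F W"
 proof (rule brvI[OF meas])
  show "\<bar>W w\<bar> <= max \<bar>lo\<bar> \<bar>hi\<bar>" for w using b[of w] by linarith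
 qed
 have "(\<integral>w. \<xi> w * Z w \<partial>M) = (\<integral>w. \<xi> w * W w \<partial>M)" if xi: "brv F \<xi>" for \<xi>
 proof -
  have xiM: "brv M \<xi>" using brv_mono[OF xi F] .
  have "(\<integral>w. \<xi> w * Z w \<partial>M) = (\<integral>w. \<xi> w * real_cond_exp M F Z w \<partial>M)"
   by (rule real_cond_exp_intg(2)[symmetric])
     (use xiM Z xi in \<open>auto intro!: brv_integrable brv_intros dest: brv_meas\<close>)
  also have "... = (\<integral>w. \<xi> w * W w \<partial>M)"
   using eq brv_meas[OF xiM] measurable_from_subalg[OF F meas]
   by (intro integral_cong_AE) (auto elim: eventually_mono)
  finally show ?thesis .
 qed
 then have "is_cexp M F Z W" using brvW by (simp add: is_cexp_def)
 then show ?thesis using b that by blast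
qed

lemma is_cexp_brv: "is_cexp M F Z W ==> brv F W" by (simp add: is_cexp_def)
lemma is_cexpD: "is_cexp M F Z W ==> brv F \<xi> ==> (\<integral>w. \<xi> w * Z w \<partial>M) = (\<integral>w. \<xi> w * W w \<partial>M)"
 by (simp add: is_cexp_def)

lemma (in prob_space) is_cexp_add:
 assumes "subalgebra M F" "is_cexp M F Z W" "is_cexp M F Z' W'" "brv M Z" "brv M Z'"
 shows "is_cexp M F (\<lambda>w. Z w + Z' w) (\<lambda>w. W w + W' w)"
 unfolding is_cexp_def
proof (intro conjI allI impI)
 show "brv F (\<lambda>w. W w + W' w)" using assms by (intro brv_intros) (auto dest: is_cexp_brv)
 fix \<xi> assume xi: "brv F \<xi>"
 note m = brv_mono[OF _ assms(1)]
 have i: "integrable M (\<lambda>w. \<xi> w * Z w)" "integrable M (\<lambda>w. \<xi> w * Z' w)"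
   "integrable M (\<lambda>w. \<xi> w * W w)" "integrable M (\<lambda>w. \<xi> w * W' w)"
  using assms m[OF xi] m[OF is_cexp_brv[OF assms(2)]] m[OF is_cexp_brv[OF assms(3)]]
  by (auto intro!: brv_integrable brv_intros)
 show "(\<integral>w. \<xi> w * (Z w + Z' w) \<partial>M) = (\<integral>w. \<xi> w * (W w + W' w) \<partial>M)"
  using i is_cexpD[OF assms(2) xi] is_cexpD[OF assms(3) xi] by (simp add: distrib_left)
qed

text \<open>Conditional Jensen, weighted by \<open>\<zeta>\<close>. The tangent inequality at \<open>W\<close> has slope \<open>spow (s - 1) W\<close>, which is bounded and past-measurable, so its linear term integrates to 0.\<close>

lemma (in prob_space) is_cexp_powr_le:
 assumes F: "subalgebra M F" and c: "is_cexp M F Z W" and Z: "brv M Z" and s: "1 <= s"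
  and z: "brv F z" "\<And>w. 0 <= z w"
 shows "(\<integral>w. z w * \<bar>W w\<bar> powr s \<partial>M) <= (\<integral>w. z w * \<bar>Z w\<bar> powr s \<partial>M)"
proof (cases "s = 1")
 case True
 have W: "brv F W" using c by (rule is_cexp_brv)
 note m = brv_mono[OF _ F]
 have sg: "brv F (\<lambda>w. sgn (W w))"
  by (rule brvI[where B=1]) (use brv_meas[OF W] in \<open>auto simp: sgn_if\<close>)
 have "(\<integral>w. z w * \<bar>W w\<bar> powr s \<partial>M) = (\<integral>w. (z w * sgn (W w)) * W w \<partial>M)"
 proof (rule expect_cong)
  show "z w * \<bar>W w\<bar> powr s = z w * sgn (W w) * W w" for w
   using True by (cases "W w \<ge> 0") (auto simp: sgn_if)
 qed simp
 also have "... = (\<integral>w. (z w * sgn (W w)) * Z w \<partial>M)"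
  using is_cexpD[OF c, of "\<lambda>w. z w * sgn (W w)"] brv_mult[OF z(1) sg] by simp
 also have "... <= (\<integral>w. z w * \<bar>Z w\<bar> powr s \<partial>M)"
 proof (rule integral_mono)
  show "integrable M (\<lambda>w. z w * sgn (W w) * Z w)"
   using m[OF z(1)] m[OF sg] Z by (intro brv_integrable brv_intros)
  show "integrable M (\<lambda>w. z w * \<bar>Z w\<bar> powr s)"
   using m[OF z(1)] Z s by (intro brv_integrable brv_intros) auto
  show "z w * sgn (W w) * Z w <= z w * \<bar>Z w\<bar> powr s" for w
  proof -
   have "sgn (W w) * Z w <= \<bar>Z w\<bar>" by (auto simp: sgn_if)
   then show ?thesis using mult_left_mono[OF _ z(2)[of w]] True by (simp add: mult.assoc)
  qed
 qed
 finally show ?thesis .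
next
 case False
 then have s: "1 < s" using s by simp
 have W: "brv F W" using c by (rule is_cexp_brv)
 note m = brv_mono[OF _ F]
 note ms = m[OF z(1)] m[OF W] Z
 have "(\<integral>w. z w * \<bar>W w\<bar> powr s \<partial>M) + (\<integral>w. (z w * (s * spow (s - 1) (W w))) * (Z w - W w) \<partial>M)
  = (\<integral>w. z w * (\<bar>W w\<bar> powr s + s * spow (s - 1) (W w) * (Z w - W w)) \<partial>M)"
  using ms s by (subst Bochner_Integration.integral_add[symmetric])
   (auto intro!: brv_integrable brv_intros expect_cong simp: algebra_simps)
 also have "... <= (\<integral>w. z w * \<bar>Z w\<bar> powr s \<partial>M)"
  using ms s z(2) by (intro integral_mono brv_integrable brv_intros mult_left_mono abs_powr_tangent) auto
 also have "(\<integral>w. (z w * (s * spow (s - 1) (W w))) * (Z w - W w) \<partial>M) = 0"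
 proof -
  have *: "brv F (\<lambda>w. z w * (s * spow (s - 1) (W w)))"
   using z W s by (intro brv_intros) auto
  show ?thesis using is_cexpD[OF c *] m[OF *] ms
   by (simp add: right_diff_distrib brv_integrable brv_intros)
 qed
 finally show ?thesis by simp
qed

lemma (in prob_space) is_cexp_moment_le:
 assumes F: "subalgebra M F" and c: "is_cexp M F Z W" and Z: "brv M Z" and s: "1 <= s"
 shows "(\<integral>w. \<bar>W w\<bar> powr s \<partial>M) <= (\<integral>w. \<bar>Z w\<bar> powr s \<partial>M)"
 using is_cexp_powr_le[OF assms, of "\<lambda>_. 1"] by (simp add: brv_const)

text \<open>The dual variable that attains the norm is the sign of \<open>W\<close>.\<close>

lemma (in prob_space) is_cexp_L1_dual:
 assumes F: "subalgebra M F" and c: "is_cexp M F Z W" and Z: "brv M Z"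
  and dual: "\<And>\<xi>. brv F \<xi> ==> (\<And>w. \<bar>\<xi> w\<bar> <= 1) ==> (\<integral>w. \<xi> w * Z w \<partial>M) <= b"
 shows "(\<integral>w. \<bar>W w\<bar> \<partial>M) <= b"
proof -
 have W: "brv F W" using c by (rule is_cexp_brv)
 have sg: "brv F (\<lambda>w. sgn (W w))"
  by (rule brvI[where B=1]) (use brv_meas[OF W] in \<open>auto simp: sgn_if\<close>)
 have "(\<integral>w. \<bar>W w\<bar> \<partial>M) = (\<integral>w. sgn (W w) * W w \<partial>M)" by (simp add: abs_sgn mult_ac)
 also have "... = (\<integral>w. sgn (W w) * Z w \<partial>M)" using is_cexpD[OF c sg] by simp
 also have "... <= b" by (rule dual[OF sg]) (auto simp: sgn_if)
 finally show ?thesis .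
qed

section \<open>Moments of sums from projections on the past\<close>

definition taylor_const :: "real \<Rightarrow> real" where
 "taylor_const r = r * ((r - 1) * 2 powr (r - 1))"

lemma taylor_const_ge_1: "2 < r ==> 1 <= taylor_const r"
proof -
 assume r: "2 < r"
 have "1 <= (2::real) powr (r - 1)" using r by (simp add: ge_one_powr_ge_zero)
 then have "1 <= (r - 1) * 2 powr (r - 1)" using r mult_mono[of 1 "r - 1" 1 "2 powr (r - 1)"] by simp
 then show ?thesis using r mult_mono[of 1 r 1 "(r - 1) * 2 powr (r - 1)"] by (simp add: taylor_const_def)
qed

definition filtration_on :: "'a measure \<Rightarrow> (nat \<Rightarrow> 'a measure) \<Rightarrow> bool" where
 "filtration_on M F \<longleftrightarrow> (\<forall>k. subalgebra M (F k)) \<and> (\<forall>j k. j <= k --> sets (F j) \<subseteq> sets (F k))"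

lemma filtration_subalg: "filtration_on M F ==> subalgebra M (F k)"
 by (simp add: filtration_on_def)

lemma filtration_brv_mono: "filtration_on M F ==> j <= k ==> brv (F j) Z ==> brv (F k) Z"
 by (rule brv_mono[of "F j"]) (simp_all add: filtration_on_def subalgebra_def)

lemma filtration_brv_M: "filtration_on M F ==> brv (F j) Z ==> brv M Z"
 by (rule brv_mono) (auto simp: filtration_on_def)

lemma powr_abs_square: "\<bar>x\<bar> powr (2 * a - 2) = (x\<^sup>2) powr (a - 1)" "\<bar>x\<bar> powr (2 * a) = (x\<^sup>2) powr a" for x a :: real
proof -
 have x2: "x\<^sup>2 = \<bar>x\<bar> powr 2" by (simp add: powr_numeral)
 show "\<bar>x\<bar> powr (2 * a - 2) = (x\<^sup>2) powr (a - 1)" "\<bar>x\<bar> powr (2 * a) = (x\<^sup>2) powr a"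
  unfolding x2 powr_powr by (simp_all add: algebra_simps)
qed

context prob_space begin

definition dd_const :: "real \<Rightarrow> real \<Rightarrow> real" where
 "dd_const a e = 1 + 4 * taylor_const (2 * a) *
   (1 / (2 * taylor_const (2 * a) * (1 + (a - 1) / e))) powr (1 - a)"

text \<open>A bound of Dedecker--Doukhan type, with a power weight on the lag. Expand \<open>|S k| powr r\<close>, \<open>r = 2 a\<close>, to second order at \<open>S (k - 1)\<close>. In the linear term
the factor \<open>spow (r - 1) (S (k - 1))\<close> is telescoped over earlier times \<open>j\<close>, so that its increment at \<open>j\<close>, of size \<open>|x j| |S| powr (r - 2)\<close>, meets the
projection of \<open>x k\<close> on the past of \<open>j\<close>. The Young inequality with lag-dependent parameters \<open>\<tau> (k - j)\<close>, of total weight at most one half over all pairs,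
absorbs the powers of \<open>S\<close> into the largest moment \<open>K\<close>.\<close>

lemma projective_moment_bound:
 fixes a e :: real and F :: "nat \<Rightarrow> 'a measure" and x :: "nat \<Rightarrow> 'a \<Rightarrow> real" and c :: "nat \<Rightarrow> real"
 assumes a: "1 < a" and e: "0 < e" "e < a - 1"
  and F: "filtration_on M F"
  and x: "\<And>k. k \<in> {1..n} ==> brv (F k) (x k)"
  and nq: "n <= q" "1 <= q"
  and c: "\<And>m. 0 <= c m"
  and c0: "\<And>k. k \<in> {1..n} ==> (\<E> w. \<bar>x k w\<bar> powr (2 * a)) <= c 0"
  and cm: "\<And>j k. 1 <= j ==> j < k ==> k <= n ==>
    \<exists>W. is_cexp M (F j) (x k) W \<and> (\<E> w. \<bar>x j w * W w\<bar> powr a) <= c (k - j)"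
 shows "(\<E> w. \<bar>\<Sum>k=1..n. x k w\<bar> powr (2 * a)) <=
   dd_const a e * real q powr (a + e) * (\<Sum>m<q. real (Suc m) powr (a - 1 - e) * c m)"
proof -
 define r where "r = 2 * a"
 define tc where "tc = taylor_const r"
 have r: "2 < r" using a by (simp add: r_def)
 have tc: "1 <= tc" using taylor_const_ge_1[OF r] by (simp add: tc_def)
 define S where "S k w = (\<Sum>i=1..k. x i w)" for k w
 have S0: "S 0 = (\<lambda>w. 0)" by (auto simp: S_def)
 have SS: "S (Suc k) = (\<lambda>w. S k w + x (Suc k) w)" for k by (auto simp: S_def)
 have xF: "brv (F k) (x j)" if "1 <= j" "j <= k" "j <= n" for j k
  using filtration_brv_mono[OF F that(2) x] that by auto
 have SF: "brv (F k) (S k)" if "k <= n" for k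
  unfolding S_def using that by (intro brv_sum xF) auto
 have xM: "brv M (x j)" if "1 <= j" "j <= n" for j using filtration_brv_M[OF F xF[OF that(1) _ that(2)]] by blast
 have SM: "brv M (S k)" if "k <= n" for k using filtration_brv_M[OF F SF[OF that]] .
 obtain W where W: "\<And>j k. 1 <= j ==> j < k ==> k <= n ==> is_cexp M (F j) (x k) (W j k)"
   and Wc: "\<And>j k. 1 <= j ==> j < k ==> k <= n ==> (\<E> w. \<bar>x j w * W j k w\<bar> powr a) <= c (k - j)"
  using cm by metis
 define z where "z j k w = (if j = k then (x k w)\<^sup>2 else \<bar>x j w * W j k w\<bar>)" for j k w
 have z0: "0 <= z j k w" for j k w by (simp add: z_def)
 have WM: "brv M (W j k)" if "1 <= j" "j < k" "k <= n" for j k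
  using filtration_brv_M[OF F is_cexp_brv[OF W[OF that]]] .
 have zM: "brv M (z j k)" if "1 <= j" "j <= k" "k <= n" for j k
 proof (cases "j = k")
  case True
  then have "z j k = (\<lambda>w. (x k w)\<^sup>2)" by (auto simp: z_def)
  then show ?thesis using xM[of k] that by (auto intro!: brv_intros)
 next
  case False
  then have "z j k = (\<lambda>w. \<bar>x j w * W j k w\<bar>)" by (auto simp: z_def)
  then show ?thesis using False xM[of j] WM[of j k] that by (auto intro!: brv_intros)
 qed
 have zc: "(\<E> w. z j k w powr a) <= c (k - j)" if "1 <= j" "j <= k" "k <= n" for j k
 proof (cases "j = k")
  case True
  then show ?thesis using c0[of k] that by (simp add: z_def powr_abs_square[symmetric])
 next
  case False
  then show ?thesis using Wc[of j k] that by (simp add: z_def)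
 qed
 define V where "V j w = \<bar>S (j - 1) w\<bar> powr (r - 2) + \<bar>x j w\<bar> powr (r - 2)" for j w
 have VM: "brv M (V j)" if "1 <= j" "j <= n" for j
  unfolding V_def using SM[of "j - 1"] xM[of j] that r by (intro brv_intros) auto
 have cross: "r * (\<E> w. spow (r - 1) (S (k - 1) w) * x k w) <=
   tc * (\<Sum>j=1..<k. (\<E> w. V j w * z j k w))" if k: "1 <= k" "k <= n" for k
 proof -
  define \<phi> where "\<phi> j w = spow (r - 1) (S j w) - spow (r - 1) (S (j - 1) w)" for j w
  have \<phi>F: "brv (F j) (\<phi> j)" if "1 <= j" "j < k" for j
   unfolding \<phi>_def using that k r SF[of j] filtration_brv_mono[OF F _ SF[of "j - 1"], of j]
   by (intro brv_intros) auto
  have \<phi>M: "brv M (\<phi> j)" if "1 <= j" "j < k" for j using filtration_brv_M[OF F \<phi>F[OF that]] .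
  have tele: "(\<Sum>j=1..<k. \<phi> j w) = spow (r - 1) (S (k - 1) w)" for w
   using k(1)
  proof (induction k rule: dec_induct)
   case base
   then show ?case by (simp add: S0 spow_def)
  next
   case (step k)
   then show ?case by (simp add: \<phi>_def)
  qed
  have "(\<E> w. spow (r - 1) (S (k - 1) w) * x k w)
    = (\<E> w. \<Sum>j=1..<k. \<phi> j w * x k w)"
   by (simp only: tele sum_distrib_right[symmetric])
  also have "... = (\<Sum>j=1..<k. (\<E> w. \<phi> j w * x k w))"
   using \<phi>M xM k by (intro expect_sum brv_integrable brv_intros) auto
  also have "... = (\<Sum>j=1..<k. (\<E> w. \<phi> j w * W j k w))"
   using W \<phi>F k by (intro sum.cong is_cexpD[where M=M]) auto
  finally have "r * (\<E> w. spow (r - 1) (S (k - 1) w) * x k w)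
    = (\<Sum>j=1..<k. r * (\<E> w. \<phi> j w * W j k w))" by (simp add: sum_distrib_left)
  also have "... <= (\<Sum>j=1..<k. tc * (\<E> w. V j w * z j k w))"
  proof (rule sum_mono)
   fix j assume j: "j \<in> {1..<k}"
   have "r * (\<E> w. \<phi> j w * W j k w) = (\<E> w. r * (\<phi> j w * W j k w))" by simp
   also have "... <= (\<E> w. tc * (V j w * z j k w))"
   proof (rule integral_mono)
    show "integrable M (\<lambda>w. r * (\<phi> j w * W j k w))"
     using j k \<phi>M[of j] WM[of j k] by (intro brv_integrable brv_intros) auto
    show "integrable M (\<lambda>w. tc * (V j w * z j k w))"
     using j k VM[of j] zM[of j k] by (intro brv_integrable brv_intros) auto
    fix w
    have Sj: "S j w = S (j - 1) w + x j w" using SS[of "j - 1"] j by simp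
    have "\<bar>\<phi> j w\<bar> <= ((r - 1) * 2 powr (r - 1)) * (\<bar>x j w\<bar> * (\<bar>S (j - 1) w\<bar> powr (r - 1 - 1) + \<bar>x j w\<bar> powr (r - 1 - 1)))"
     unfolding \<phi>_def Sj using r by (intro spow_diff_le) auto
    then have "r * \<bar>\<phi> j w\<bar> <= r * (((r - 1) * 2 powr (r - 1)) * (\<bar>x j w\<bar> * V j w))"
     using r by (intro mult_left_mono) (auto simp: V_def)
    then have "r * \<bar>\<phi> j w\<bar> <= tc * (\<bar>x j w\<bar> * V j w)" by (simp add: tc_def taylor_const_def mult_ac)
    then have "r * \<bar>\<phi> j w\<bar> * \<bar>W j k w\<bar> <= tc * (\<bar>x j w\<bar> * V j w) * \<bar>W j k w\<bar>"
     by (rule mult_right_mono) simp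
    moreover have "r * (\<phi> j w * W j k w) <= r * \<bar>\<phi> j w\<bar> * \<bar>W j k w\<bar>"
     using r by (simp add: abs_mult[symmetric] mult.assoc)
    ultimately show "r * (\<phi> j w * W j k w) <= tc * (V j w * z j k w)"
     using j by (simp add: z_def abs_mult mult_ac)
   qed
   also have "... = tc * (\<E> w. V j w * z j k w)" by simp
   finally show "r * (\<E> w. \<phi> j w * W j k w) <= tc * (\<E> w. V j w * z j k w)" .
  qed
  finally show ?thesis by (simp add: sum_distrib_left)
 qed
 have step: "(\<E> w. \<bar>S k w\<bar> powr r) <= (\<E> w. \<bar>S (k - 1) w\<bar> powr r) +
   tc * (\<Sum>j=1..k. (\<E> w. V j w * z j k w))" if k: "1 <= k" "k <= n" for k
 proof -
  have bS: "brv M (S (k - 1))" and bx: "brv M (x k)" and bV: "brv M (V k)" and bz: "brv M (z k k)"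
   using SM[of "k - 1"] xM[of k] VM[of k] zM[of k k] k by auto
  have Sk: "S k w = S (k - 1) w + x k w" for w using SS[of "k - 1"] k by simp
  have "(\<E> w. \<bar>S k w\<bar> powr r) <= (\<E> w. \<bar>S (k - 1) w\<bar> powr r
    + r * (spow (r - 1) (S (k - 1) w) * x k w) + tc * (V k w * z k k w))"
  proof (rule integral_mono)
   show "integrable M (\<lambda>w. \<bar>S k w\<bar> powr r)" using SM[of k] k r by (intro brv_integrable brv_intros) auto
   show "integrable M (\<lambda>w. \<bar>S (k - 1) w\<bar> powr r + r * (spow (r - 1) (S (k - 1) w) * x k w) + tc * (V k w * z k k w))"
    using bS bx bV bz r by (intro brv_integrable brv_intros) auto
   fix w
   have "\<bar>x k w\<bar> powr r = \<bar>x k w\<bar> powr (r - 2) * (x k w)\<^sup>2"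
   proof (cases "x k w = 0")
    case False
    have "\<bar>x k w\<bar> powr r = \<bar>x k w\<bar> powr (r - 2) * \<bar>x k w\<bar> powr 2"
     by (subst powr_add[symmetric]) simp
    then show ?thesis using False by (simp add: powr_numeral)
   qed simp
   then show "\<bar>S k w\<bar> powr r <= \<bar>S (k - 1) w\<bar> powr r + r * (spow (r - 1) (S (k - 1) w) * x k w) + tc * (V k w * z k k w)"
    using abs_powr_taylor[OF r, of "S (k - 1) w" "x k w"]
    unfolding Sk V_def z_def tc_def taylor_const_def by (simp add: algebra_simps)
  qed
  also have "... = (\<E> w. \<bar>S (k - 1) w\<bar> powr r) + r * (\<E> w. spow (r - 1) (S (k - 1) w) * x k w)
    + tc * (\<E> w. V k w * z k k w)"
   using bS bx bV bz r
   by (subst Bochner_Integration.integral_add, (intro brv_integrable brv_intros; auto)+)+ simp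
  also have "... <= (\<E> w. \<bar>S (k - 1) w\<bar> powr r) + tc * (\<Sum>j=1..<k. (\<E> w. V j w * z j k w))
    + tc * (\<E> w. V k w * z k k w)"
   using cross[OF k] by simp
  also have "... = (\<E> w. \<bar>S (k - 1) w\<bar> powr r) + tc * (\<Sum>j=1..k. (\<E> w. V j w * z j k w))"
   using k by (simp add: sum.last_plus distrib_left flip: atLeastLessThanSuc_atLeastAtMost)
  finally show ?thesis .
 qed
 have tot: "(\<E> w. \<bar>S k w\<bar> powr r) <= tc * (\<Sum>i=1..k. \<Sum>j=1..i. (\<E> w. V j w * z j i w))" if "k <= n" for k
  using that
 proof (induction k)
  case 0
  then show ?case using r by (simp add: S0)
 next
  case (Suc k)
  then show ?case using step[of "Suc k"] by (simp add: distrib_left)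
 qed
 define K where "K = (MAX k\<in>{..n}. (\<E> w. \<bar>S k w\<bar> powr r))"
 have KS: "(\<E> w. \<bar>S k w\<bar> powr r) <= K" if "k <= n" for k
  unfolding K_def using that by (intro Max_ge) auto
 define e' where "e' = e / (a - 1)"
 have e': "0 < e'" "e' < 1" using a e by (auto simp: e'_def)
 define D where "D = 1 / (2 * tc * (1 + 1 / e'))"
 have D: "0 < D" using tc e' by (auto simp: D_def intro!: divide_pos_pos mult_pos_pos add_pos_pos)
 \<comment> \<open>Normalised so that the \<open>q\<^sup>2\<close> pairs together absorb at most \<open>K / 2\<close>.\<close>
 define \<tau> where "\<tau> m = D * real q powr (- 1 - e') * real (Suc m) powr (e' - 1)" for m
 have q: "0 < real q" using nq by simp
 have \<tau>: "0 < \<tau> m" for m using D q by (simp add: \<tau>_def)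
 have \<tau>sum: "(\<Sum>m<q. \<tau> m) <= 1 / (2 * tc * q)"
 proof -
  have "(\<Sum>m<q. \<tau> m) = D * real q powr (- 1 - e') * (\<Sum>m<q. real (Suc m) powr (e' - 1))"
   by (simp add: \<tau>_def sum_distrib_left)
  also have "... <= D * real q powr (- 1 - e') * ((1 + 1 / e') * real q powr e')"
   using D e' by (intro mult_left_mono sum_powr_le) auto
  also have "... = D * (1 + 1/e') * (real q powr (- 1 - e') * real q powr e')" by simp
  also have "real q powr (- 1 - e') * real q powr e' = 1 / q"
   using q by (subst powr_add[symmetric]) (simp add: powr_minus field_simps)
  also have "D * (1 + 1/e') = 1 / (2 * tc)"
  proof -
   have "0 < 1 + 1/e'" using e' by (simp add: add_pos_pos)
   then show ?thesis unfolding D_def by simp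
  qed
  finally show ?thesis by simp
 qed
 define R where "R = (\<Sum>m<q. \<tau> m powr (1 - a) * c m)"
 have R0: "0 <= R" unfolding R_def using c by (intro sum_nonneg) auto
 have pair: "(\<E> w. V j w * z j i w) <= \<tau> (i - j) * (K + c 0) + 2 * (\<tau> (i - j) powr (1 - a) * c (i - j))"
  if "1 <= j" "j <= i" "i <= n" for i j
 proof -
  let ?t = "\<tau> (i - j)"
  have bS: "brv M (S (j - 1))" and bx: "brv M (x j)" and bV: "brv M (V j)" and bz: "brv M (z j i)"
   using SM[of "j - 1"] xM[of j] VM[of j] zM[of j i] that by auto
  have bza: "brv M (\<lambda>w. z j i w powr a)" using brv_powr_nonneg[OF bz] z0 a by auto
  have "(\<E> w. V j w * z j i w) <= (\<E> w. ?t * (\<bar>S (j - 1) w\<bar> powr r + \<bar>x j w\<bar> powr r) + 2 * (?t powr (1 - a) * z j i w powr a))"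
  proof (rule integral_mono)
   show "integrable M (\<lambda>w. V j w * z j i w)" using bV bz by (intro brv_integrable brv_intros)
   show "integrable M (\<lambda>w. ?t * (\<bar>S (j - 1) w\<bar> powr r + \<bar>x j w\<bar> powr r) + 2 * (?t powr (1 - a) * z j i w powr a))"
    using bS bx bza r by (intro brv_integrable brv_intros) auto
   fix w
   have "\<bar>y\<bar> powr (r - 2) * z j i w <= ?t * \<bar>y\<bar> powr r + ?t powr (1 - a) * z j i w powr a" for y
    unfolding r_def powr_abs_square using \<tau> z0 a by (intro young_cut) auto
   from this[of "S (j - 1) w"] this[of "x j w"]
   show "V j w * z j i w <= ?t * (\<bar>S (j - 1) w\<bar> powr r + \<bar>x j w\<bar> powr r) + 2 * (?t powr (1 - a) * z j i w powr a)"
    unfolding V_def by (simp add: distrib_left distrib_right)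
  qed
  also have "... = ?t * ((\<E> w. \<bar>S (j - 1) w\<bar> powr r) + (\<E> w. \<bar>x j w\<bar> powr r)) + 2 * (?t powr (1 - a) * (\<E> w. z j i w powr a))"
  proof -
   have "integrable M (\<lambda>w. \<bar>S (j - 1) w\<bar> powr r)" "integrable M (\<lambda>w. \<bar>x j w\<bar> powr r)" "integrable M (\<lambda>w. z j i w powr a)"
    using bS bx bza r by (auto intro!: brv_integrable brv_powr)
   then show ?thesis by simp
  qed
  also have "... <= ?t * (K + c 0) + 2 * (?t powr (1 - a) * c (i - j))"
  proof (intro add_mono mult_left_mono)
   show "(\<E> w. \<bar>S (j - 1) w\<bar> powr r) <= K" using KS[of "j - 1"] that by auto
   show "(\<E> w. \<bar>x j w\<bar> powr r) <= c 0" using c0[of j] that by (auto simp: r_def)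
   show "(\<E> w. z j i w powr a) <= c (i - j)" using zc[of j i] that by auto
  qed (use \<tau>[of "i - j"] in auto)
  finally show ?thesis .
 qed
 have K0: "0 <= K" using KS[of 0] by (simp add: S0)
 have main: "K <= (K + c 0) / 2 + 2 * tc * real q * R"
 proof -
  have "(\<E> w. \<bar>S k w\<bar> powr r) <= (K + c 0) / 2 + 2 * tc * real q * R" if k: "k <= n" for k
  proof -
   have "(\<E> w. \<bar>S k w\<bar> powr r) <= tc * (\<Sum>i=1..k. \<Sum>j=1..i. (\<E> w. V j w * z j i w))"
    using tot[OF k] .
   also have "... <= tc * (\<Sum>i=1..k. \<Sum>j=1..i. \<tau> (i - j) * (K + c 0) + 2 * (\<tau> (i - j) powr (1 - a) * c (i - j)))"
    using k tc by (intro mult_left_mono sum_mono pair) auto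
   also have "... <= tc * (\<Sum>i=1..k. 1 / (2 * tc * q) * (K + c 0) + 2 * R)"
   proof (intro mult_left_mono sum_mono)
    fix i assume i: "i \<in> {1..k}"
    have re: "(\<Sum>j=1..i. f (i - j)) = (\<Sum>m<i. f m)" for f :: "nat \<Rightarrow> real"
     by (rule sum.reindex_bij_witness[where i="\<lambda>m. i - m" and j="\<lambda>j. i - j"]) auto
    have sub: "(\<Sum>m<i. f m) <= (\<Sum>m<q. f m)" if "\<And>m. 0 <= f m" for f :: "nat \<Rightarrow> real"
     using i k nq that by (intro sum_mono2) auto
    have "(\<Sum>j=1..i. \<tau> (i - j) * (K + c 0) + 2 * (\<tau> (i - j) powr (1 - a) * c (i - j)))
      = (\<Sum>m<i. \<tau> m * (K + c 0) + 2 * (\<tau> m powr (1 - a) * c m))"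
     by (rule re)
    also have "... = (\<Sum>m<i. \<tau> m) * (K + c 0) + 2 * (\<Sum>m<i. \<tau> m powr (1 - a) * c m)"
     by (simp only: sum.distrib sum_distrib_left sum_distrib_right)
    also have "... <= 1 / (2 * tc * q) * (K + c 0) + 2 * R"
     using K0 c \<tau>sum sub[of \<tau>] sub[of "\<lambda>m. \<tau> m powr (1 - a) * c m"] \<tau>
     by (intro add_mono mult_right_mono) (auto simp: R_def less_imp_le)
    finally show "(\<Sum>j=1..i. \<tau> (i - j) * (K + c 0) + 2 * (\<tau> (i - j) powr (1 - a) * c (i - j))) <= 1 / (2 * tc * q) * (K + c 0) + 2 * R" .
   qed (use tc in auto)
   also have "... = tc * (real k * (1 / (2 * tc * q) * (K + c 0) + 2 * R))" by simp
   also have "... <= tc * (real q * (1 / (2 * tc * q) * (K + c 0) + 2 * R))"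
    using tc k nq K0 c R0 by (intro mult_left_mono mult_right_mono add_nonneg_nonneg mult_nonneg_nonneg) auto
   also have "... = (K + c 0) / 2 + 2 * tc * real q * R"
    using tc q by (simp add: field_simps)
   finally show ?thesis .
  qed
  moreover obtain k where "k <= n" "K = (\<E> w. \<bar>S k w\<bar> powr r)"
  proof -
   have "K \<in> (\<lambda>k. (\<E> w. \<bar>S k w\<bar> powr r)) ` {..n}" unfolding K_def by (intro Max_in) auto
   then show ?thesis using that by auto
  qed
  ultimately show ?thesis by metis
 qed
 define Sg where "Sg = (\<Sum>m<q. real (Suc m) powr (a - 1 - e) * c m)"
 have Req: "real q * R = D powr (1 - a) * (real q powr (a + e) * Sg)"
 proof -
  have e1: "e' * (a - 1) = e" using a by (simp add: e'_def)
  have "\<tau> m powr (1 - a) = D powr (1 - a) * (real q powr (a - 1 + e) * real (Suc m) powr (a - 1 - e))" for m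
  proof -
   have "\<tau> m powr (1 - a) = D powr (1 - a) * (real q powr ((- 1 - e') * (1 - a)) * real (Suc m) powr ((e' - 1) * (1 - a)))"
    using D by (simp add: \<tau>_def powr_mult powr_powr)
   also have "(- 1 - e') * (1 - a) = a - 1 + e" using e1 by (simp add: algebra_simps)
   also have "(e' - 1) * (1 - a) = a - 1 - e" using e1 by (simp add: algebra_simps)
   finally show ?thesis .
  qed
  then have "R = D powr (1 - a) * (real q powr (a - 1 + e) * Sg)"
   by (simp add: R_def Sg_def sum_distrib_left mult_ac)
  moreover have "real q * real q powr (a - 1 + e) = real q powr (a + e)"
   using q powr_add[of "real q" 1 "a - 1 + e"] by simp
  ultimately show ?thesis by (simp add: mult_ac)
 qed
 have c0le: "c 0 <= real q powr (a + e) * Sg"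
 proof -
  have "c 0 = real (Suc 0) powr (a - 1 - e) * c 0" by simp
  also have "... <= Sg" unfolding Sg_def using nq c by (intro member_le_sum) auto
  also have "... <= real q powr (a + e) * Sg"
  proof -
   have "1 <= real q powr (a + e)" using nq a e by (intro ge_one_powr_ge_zero) auto
   moreover have "0 <= Sg" unfolding Sg_def using c by (intro sum_nonneg) auto
   ultimately show ?thesis using mult_right_mono[of 1 "real q powr (a + e)" Sg] by simp
  qed
  finally show ?thesis .
 qed
 have "K <= c 0 + 4 * tc * (real q * R)"
 proof -
  define Z where "Z = tc * (real q * R)"
  have "K <= (K + c 0) / 2 + 2 * Z" using main by (simp only: Z_def mult.assoc)
  then have "K <= c 0 + 4 * Z" by (simp add: field_simps)
  then show ?thesis by (simp only: Z_def mult.assoc)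
 qed
 also have "... <= real q powr (a + e) * Sg + 4 * tc * (D powr (1 - a) * (real q powr (a + e) * Sg))"
  using c0le Req by simp
 also have "... = dd_const a e * real q powr (a + e) * Sg"
  unfolding dd_const_def D_def e'_def tc_def r_def by (simp add: algebra_simps)
 finally have "K <= dd_const a e * real q powr (a + e) * Sg" .
 then show ?thesis using KS[of n] unfolding Sg_def S_def r_def by simp
qed

end

section \<open>Martingales: maximal and Rosenthal inequalities\<close>

context prob_space begin

text \<open>The absolute power of a martingale is a submartingale: the linear term of the tangent inequality at the partial sum vanishes.\<close>

lemma martingale_abs_powr_mono:
 fixes G :: "nat \<Rightarrow> 'a measure" and D :: "nat \<Rightarrow> 'a \<Rightarrow> real"
 assumes G: "filtration_on M G"
  and D: "\<And>k. k \<in> {1..n} ==> brv (G k) (D k)"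
  and mart: "\<And>k \<zeta>. k \<in> {1..n} ==> brv (G (k - 1)) \<zeta> ==> (\<E> w. \<zeta> w * D k w) = 0"
  and s: "1 < s" and k: "k <= n" and \<zeta>: "brv (G k) \<zeta>" "\<And>w. 0 <= \<zeta> w"
 shows "(\<E> w. \<zeta> w * \<bar>\<Sum>i=1..k. D i w\<bar> powr s) <= (\<E> w. \<zeta> w * \<bar>\<Sum>i=1..n. D i w\<bar> powr s)"
proof -
 define S where "S k w = (\<Sum>i=1..k. D i w)" for k w
 have DM: "brv M (D i)" if "i \<in> {1..n}" for i using filtration_brv_M[OF G D[OF that]] .
 have SF: "brv (G k) (S k)" 
  unfolding S_def using k by (intro brv_sum filtration_brv_mono[OF G _ D]) auto
 have SM: "brv M (S k)" "brv M (S n)" unfolding S_def using k by (auto intro!: brv_sum DM)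
 have zM: "brv M \<zeta>" using filtration_brv_M[OF G \<zeta>(1)] .
 define g where "g w = \<zeta> w * (s * spow (s - 1) (S k w))" for w
 have gF: "brv (G k) g" unfolding g_def using s SF \<zeta> by (intro brv_intros) auto
 have gM: "brv M g" using filtration_brv_M[OF G gF] .
 have inc: "S n w - S k w = (\<Sum>i=Suc k..n. D i w)" for w
 proof -
  have "S n w = S k w + (\<Sum>i=Suc k..n. D i w)"
   unfolding S_def using sum.ub_add_nat[of 1 k "\<lambda>i. D i w" "n - k"] k by simp
  then show ?thesis by simp
 qed
 have "(\<E> w. g w * (S n w - S k w)) = (\<E> w. \<Sum>i=Suc k..n. g w * D i w)"
  by (simp only: inc sum_distrib_left)
 also have "... = (\<Sum>i=Suc k..n. (\<E> w. g w * D i w))"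
  by (intro expect_sum brv_integrable brv_intros gM DM) auto
 also have "... = 0"
  by (intro sum.neutral ballI mart filtration_brv_mono[OF G _ gF]) auto
 finally have z: "(\<E> w. g w * (S n w - S k w)) = 0" .
 have "(\<E> w. \<zeta> w * \<bar>S k w\<bar> powr s) = (\<E> w. \<zeta> w * \<bar>S k w\<bar> powr s) + (\<E> w. g w * (S n w - S k w))"
  using z by simp
 also have "... = (\<E> w. \<zeta> w * \<bar>S k w\<bar> powr s + g w * (S n w - S k w))"
  by (rule Bochner_Integration.integral_add[symmetric])
    (use zM SM gM s in \<open>auto intro!: brv_integrable brv_intros\<close>)
 also have "... <= (\<E> w. \<zeta> w * \<bar>S n w\<bar> powr s)"
 proof (rule integral_mono)
  fix w
  show "\<zeta> w * \<bar>S k w\<bar> powr s + g w * (S n w - S k w) <= \<zeta> w * \<bar>S n w\<bar> powr s"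
   using mult_left_mono[OF abs_powr_tangent[OF s, of "S k w" "S n w"] \<zeta>(2)[of w]]
   by (simp add: g_def algebra_simps)
 qed (use zM SM gM s in \<open>auto intro!: brv_integrable brv_intros\<close>)
 finally show ?thesis by (simp add: S_def)
qed

text \<open>The Doob inequality, by decomposing the event according to the first passage time; on each piece \<open>martingale_abs_powr_mono\<close> moves from that time to the terminal one.\<close>

lemma martingale_maximal:
 fixes G :: "nat \<Rightarrow> 'a measure" and D :: "nat \<Rightarrow> 'a \<Rightarrow> real"
 assumes G: "filtration_on M G"
  and D: "\<And>k. k \<in> {1..n} ==> brv (G k) (D k)"
  and mart: "\<And>k z. k \<in> {1..n} ==> brv (G (k - 1)) z ==> (\<E> w. z w * D k w) = 0"
  and s: "1 < s" and l: "0 < l"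
 shows "prob {w \<in> space M. \<exists>k\<in>{1..n}. l <= \<bar>\<Sum>i=1..k. D i w\<bar>} <= (\<E> w. \<bar>\<Sum>i=1..n. D i w\<bar> powr s) / l powr s"
proof -
 define S where "S k w = (\<Sum>i=1..k. D i w)" for k w
 have DM: "brv M (D i)" if "i \<in> {1..n}" for i using filtration_brv_M[OF G D[OF that]] .
 have SF: "brv (G k) (S j)" if "j <= k" "k <= n" for j k
  unfolding S_def using that by (intro brv_sum filtration_brv_mono[OF G _ D]) auto
 have SM: "brv M (S k)" if "k <= n" for k using filtration_brv_M[OF G SF[OF _ that]] by auto
 define A where "A k = {w \<in> space M. l <= \<bar>S k w\<bar> \<and> (\<forall>j\<in>{1..<k}. \<bar>S j w\<bar> < l)}" for k
 have sp: "space (G k) = space M" for k using filtration_subalg[OF G, of k] by (simp add: subalgebra_def)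
 have A: "A k \<in> sets (G k)" if "k \<in> {1..n}" for k
 proof -
  have Sm: "S j \<in> borel_measurable (G k)" if "j <= k" for j
   using brv_meas[OF SF[OF that]] \<open>k \<in> {1..n}\<close> by auto
  have "A k = {w \<in> space (G k). l <= \<bar>S k w\<bar> \<and> (\<forall>j\<in>{1..<k}. \<bar>S j w\<bar> < l)}" by (simp add: A_def sp)
  also have "... \<in> sets (G k)"
  proof (intro sets.sets_Collect_conj sets.sets_Collect_finite_All)
   show "{w \<in> space (G k). l <= \<bar>S k w\<bar>} \<in> sets (G k)" using Sm[of k] by measurable
   show "{w \<in> space (G k). \<bar>S j w\<bar> < l} \<in> sets (G k)" if "j \<in> {1..<k}" for j
   proof -
    have [measurable]: "S j \<in> borel_measurable (G k)" using Sm[of j] that by auto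
    show ?thesis by measurable
   qed
  qed simp
  finally show ?thesis .
 qed
 have AM: "A k \<in> events" if "k \<in> {1..n}" for k 
  using A[OF that] filtration_subalg[OF G, of k] by (auto simp: subalgebra_def)
 have disj: "disjoint_family_on A {1..n}"
  unfolding disjoint_family_on_def
 proof (intro ballI impI)
  fix i j assume ij: "i \<in> {1..n}" "j \<in> {1..n}" "i \<noteq> j"
  have False if wt: "w \<in> A i" "w \<in> A j" and "i < j" "i \<in> {1..n}" for w i j
  proof -
   have "l <= \<bar>S i w\<bar>" "\<bar>S i w\<bar> < l" using that by (simp_all add: A_def)
   then show False by simp
  qed
  then show "A i \<inter> A j = {}" using ij by (metis disjoint_iff linorder_neqE_nat)
 qed
 have un: "{w \<in> space M. \<exists>k\<in>{1..n}. l <= \<bar>S k w\<bar>} = (\<Union>k\<in>{1..n}. A k)"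
 proof (intro equalityI subsetI)
  fix w assume wt: "w \<in> {w \<in> space M. \<exists>k\<in>{1..n}. l <= \<bar>S k w\<bar>}"
  define k where "k = (LEAST k. k \<in> {1..n} \<and> l <= \<bar>S k w\<bar>)"
  have k: "k \<in> {1..n} \<and> l <= \<bar>S k w\<bar>" unfolding k_def by (rule LeastI_ex) (use wt in auto)
  have "\<bar>S j w\<bar> < l" if "j \<in> {1..<k}" for j
   using not_less_Least[of j "\<lambda>k. k \<in> {1..n} \<and> l <= \<bar>S k w\<bar>"] that k by (fold k_def) auto
  then show "w \<in> (\<Union>k\<in>{1..n}. A k)" using k wt by (auto simp: A_def)
 qed (auto simp: A_def)
 have "prob (\<Union>k\<in>{1..n}. A k) * l powr s = (\<Sum>k=1..n. prob (A k)) * l powr s"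
  using AM disj by (subst finite_measure_finite_Union) auto
 also have "... = (\<Sum>k=1..n. (\<E> w. indicator (A k) w * l powr s))"
  using AM by (simp add: sum_distrib_right)
 also have "... <= (\<Sum>k=1..n. (\<E> w. indicator (A k) w * \<bar>S n w\<bar> powr s))"
 proof (rule sum_mono)
  fix k assume k: "k \<in> {1..n}"
  have iM: "brv M (\<lambda>w. indicator (A k) w)" using AM[OF k] by (rule brv_indicator)
  have "(\<E> w. indicator (A k) w * l powr s) <= (\<E> w. indicator (A k) w * \<bar>S k w\<bar> powr s)"
  proof (rule integral_mono)
   show "indicator (A k) w * l powr s <= indicator (A k) w * \<bar>S k w\<bar> powr s" for w
    using l s by (auto simp: A_def indicator_def intro!: powr_mono2)
  qed (use iM SM[of k] k s in \<open>auto intro!: brv_integrable brv_intros\<close>)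
  also have "... <= (\<E> w. indicator (A k) w * \<bar>S n w\<bar> powr s)"
   using martingale_abs_powr_mono[OF G D mart s _ brv_indicator[OF A[OF k]], of n] k by (auto simp: S_def)
  finally show "(\<E> w. indicator (A k) w * l powr s) <= (\<E> w. indicator (A k) w * \<bar>S n w\<bar> powr s)" .
 qed
 also have "... = (\<E> w. (\<Sum>k=1..n. indicator (A k) w) * \<bar>S n w\<bar> powr s)"
  unfolding sum_distrib_right using SM[of n] AM s
  by (intro expect_sum[symmetric] brv_integrable brv_intros) auto
 also have "... <= (\<E> w. \<bar>S n w\<bar> powr s)"
 proof (rule integral_mono)
  fix w
  have "(\<Sum>k=1..n. indicat_real (A k) w) = indicator (\<Union>k\<in>{1..n}. A k) w"
   using disj by (intro indicator_UN_disjoint[symmetric]) auto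
  also have "... <= 1" by (simp add: indicator_def)
  finally show "(\<Sum>k=1..n. indicator (A k) w) * \<bar>S n w\<bar> powr s <= \<bar>S n w\<bar> powr s"
   by (simp add: mult_left_le_one_le sum_nonneg)
 qed (use SM[of n] AM s in \<open>auto intro!: brv_integrable brv_intros\<close>)
 finally have "prob (\<Union>k\<in>{1..n}. A k) * l powr s <= (\<E> w. \<bar>S n w\<bar> powr s)" .
 then show ?thesis using un l unfolding S_def by (simp add: field_simps)
qed

text \<open>The Taylor bound makes the moment grow at step \<open>k\<close> by at most a constant times \<open>|S (k - 1)| powr (2 a - 2) * \<xi> k\<close>, since the linear term vanishes and \<open>\<xi>\<close> majorises the conditional
variance. Replacing each partial sum by the terminal one, by the submartingale property, gives the factor \<open>\<Sum> \<xi>\<close>, and the Young inequality absorbs \<open>|S n| powr (2 a)\<close>.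
The condition on \<open>a\<close> is what makes \<open>2 a - 2 > 1\<close>, as the submartingale property requires.\<close>

lemma martingale_rosenthal:
 fixes G :: "nat \<Rightarrow> 'a measure" and D \<xi> :: "nat \<Rightarrow> 'a \<Rightarrow> real"
 assumes G: "filtration_on M G"
  and D: "\<And>k. k \<in> {1..n} ==> brv (G k) (D k)"
  and mart: "\<And>k z. k \<in> {1..n} ==> brv (G (k - 1)) z ==> (\<E> w. z w * D k w) = 0"
  and a: "3/2 < a"
  and \<xi>: "\<And>k. k \<in> {1..n} ==> brv (G (k - 1)) (\<xi> k)" "\<And>k w. 0 <= \<xi> k w"
  and var: "\<And>k z. k \<in> {1..n} ==> brv (G (k - 1)) z ==> (\<And>w. 0 <= z w) ==>
    (\<E> w. z w * (D k w)\<^sup>2) <= (\<E> w. z w * \<xi> k w)"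
 shows "(\<E> w. \<bar>\<Sum>i=1..n. D i w\<bar> powr (2 * a)) <=
  2 * taylor_const (2 * a) * ((2 * taylor_const (2 * a)) powr (a - 1) * (\<E> w. (\<Sum>i=1..n. \<xi> i w) powr a)
    + (\<Sum>i=1..n. (\<E> w. \<bar>D i w\<bar> powr (2 * a))))"
proof -
 define r where "r = 2 * a"
 define tc where "tc = taylor_const r"
 have r: "3 < r" "2 < r" using a by (simp_all add: r_def)
 have tc: "1 <= tc" using taylor_const_ge_1[OF r(2)] by (simp add: tc_def)
 define S where "S k w = (\<Sum>i=1..k. D i w)" for k w
 have DM: "brv M (D i)" if "i \<in> {1..n}" for i using filtration_brv_M[OF G D[OF that]] .
 have \<xi>M: "brv M (\<xi> i)" if "i \<in> {1..n}" for i using filtration_brv_M[OF G \<xi>(1)[OF that]] .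
 have SF: "brv (G k) (S j)" if "j <= k" "k <= n" for j k
  unfolding S_def using that by (intro brv_sum filtration_brv_mono[OF G _ D]) auto
 have SM: "brv M (S k)" if "k <= n" for k using filtration_brv_M[OF G SF[OF _ that]] by auto
 have step: "(\<E> w. \<bar>S k w\<bar> powr r) <= (\<E> w. \<bar>S (k - 1) w\<bar> powr r) +
   tc * ((\<E> w. \<bar>S n w\<bar> powr (r - 2) * \<xi> k w) + (\<E> w. \<bar>D k w\<bar> powr r))" if k: "k \<in> {1..n}" for k
 proof -
  have bS: "brv M (S (k - 1))" and bD: "brv M (D k)" and bx: "brv M (\<xi> k)" using SM[of "k - 1"] DM[OF k] \<xi>M[OF k] k by auto
  have bF: "brv (G (k - 1)) (S (k - 1))" using SF[of "k - 1" "k - 1"] k by auto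
  have Sk: "S k w = S (k - 1) w + D k w" for w
  proof -
   obtain m where "k = Suc m" using k by (cases k) auto
   then show ?thesis by (simp add: S_def)
  qed
  have "(\<E> w. \<bar>S k w\<bar> powr r) <= (\<E> w. \<bar>S (k - 1) w\<bar> powr r
    + r * (spow (r - 1) (S (k - 1) w) * D k w) + tc * (\<bar>S (k - 1) w\<bar> powr (r - 2) * (D k w)\<^sup>2 + \<bar>D k w\<bar> powr r))"
  proof (rule integral_mono)
   show "integrable M (\<lambda>w. \<bar>S k w\<bar> powr r)" using SM[of k] k r by (intro brv_integrable brv_intros) auto
   show "integrable M (\<lambda>w. \<bar>S (k - 1) w\<bar> powr r + r * (spow (r - 1) (S (k - 1) w) * D k w) + tc * (\<bar>S (k - 1) w\<bar> powr (r - 2) * (D k w)\<^sup>2 + \<bar>D k w\<bar> powr r))"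
    using bS bD r by (intro brv_integrable brv_intros) auto
   fix w
   show "\<bar>S k w\<bar> powr r <= \<bar>S (k - 1) w\<bar> powr r + r * (spow (r - 1) (S (k - 1) w) * D k w) + tc * (\<bar>S (k - 1) w\<bar> powr (r - 2) * (D k w)\<^sup>2 + \<bar>D k w\<bar> powr r)"
    using abs_powr_taylor[OF r(2), of "S (k - 1) w" "D k w"]
    unfolding Sk tc_def taylor_const_def by (simp add: algebra_simps)
  qed
  also have "... = (\<E> w. \<bar>S (k - 1) w\<bar> powr r) + r * (\<E> w. spow (r - 1) (S (k - 1) w) * D k w)
    + tc * ((\<E> w. \<bar>S (k - 1) w\<bar> powr (r - 2) * (D k w)\<^sup>2) + (\<E> w. \<bar>D k w\<bar> powr r))"
  proof -
   have "integrable M (\<lambda>w. \<bar>S (k - 1) w\<bar> powr r)" "integrable M (\<lambda>w. spow (r - 1) (S (k - 1) w) * D k w)"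
    "integrable M (\<lambda>w. \<bar>S (k - 1) w\<bar> powr (r - 2) * (D k w)\<^sup>2)" "integrable M (\<lambda>w. \<bar>D k w\<bar> powr r)"
    using bS bD r by (auto intro!: brv_integrable brv_intros)
   then show ?thesis by simp
  qed
  also have "(\<E> w. spow (r - 1) (S (k - 1) w) * D k w) = 0"
   using bF r k by (intro mart brv_spow) auto
  also have "(\<E> w. \<bar>S (k - 1) w\<bar> powr (r - 2) * (D k w)\<^sup>2) <= (\<E> w. \<bar>S (k - 1) w\<bar> powr (r - 2) * \<xi> k w)"
   using bF r k by (intro var brv_powr) auto
  also have "... <= (\<E> w. \<bar>S n w\<bar> powr (r - 2) * \<xi> k w)"
   using martingale_abs_powr_mono[OF G D mart, of n "r - 2" "k - 1" "\<xi> k"] r k \<xi> by (auto simp: S_def mult.commute)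
  finally show ?thesis using tc by simp
 qed
 have "(\<E> w. \<bar>S k w\<bar> powr r) <= 
   tc * ((\<Sum>i=1..k. (\<E> w. \<bar>S n w\<bar> powr (r - 2) * \<xi> i w)) + (\<Sum>i=1..k. (\<E> w. \<bar>D i w\<bar> powr r)))" if "k <= n" for k
  using that
 proof (induction k)
  case 0
  then show ?case using r by (simp add: S_def)
 next
  case (Suc k)
  then show ?case using step[of "Suc k"] by (simp add: distrib_left)
 qed
 from this[of n] have "(\<E> w. \<bar>S n w\<bar> powr r) <= 
   tc * ((\<Sum>i=1..n. (\<E> w. \<bar>S n w\<bar> powr (r - 2) * \<xi> i w)) + (\<Sum>i=1..n. (\<E> w. \<bar>D i w\<bar> powr r)))" by simp
 also have "(\<Sum>i=1..n. (\<E> w. \<bar>S n w\<bar> powr (r - 2) * \<xi> i w)) = (\<E> w. \<bar>S n w\<bar> powr (r - 2) * (\<Sum>i=1..n. \<xi> i w))"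
  unfolding sum_distrib_left using SM[of n] \<xi>M r
  by (intro expect_sum[symmetric] brv_integrable brv_intros) auto
 also have "... <= (\<E> w. (1 / (2 * tc)) * \<bar>S n w\<bar> powr r + (1 / (2 * tc)) powr (1 - a) * (\<Sum>i=1..n. \<xi> i w) powr a)"
 proof (rule integral_mono)
  have b: "brv M (\<lambda>w. \<Sum>i=1..n. \<xi> i w)" using \<xi>M by (intro brv_sum) auto
  show "integrable M (\<lambda>w. \<bar>S n w\<bar> powr (r - 2) * (\<Sum>i=1..n. \<xi> i w))"
   using SM[of n] b r by (intro brv_integrable brv_mult brv_powr) auto
  show "integrable M (\<lambda>w. (1 / (2 * tc)) * \<bar>S n w\<bar> powr r + (1 / (2 * tc)) powr (1 - a) * (\<Sum>i=1..n. \<xi> i w) powr a)"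
   using SM[of n] b r a \<xi>(2) by (intro brv_integrable brv_add brv_cmult brv_powr brv_powr_nonneg sum_nonneg) auto
  show "\<bar>S n w\<bar> powr (r - 2) * (\<Sum>i=1..n. \<xi> i w) <= (1 / (2 * tc)) * \<bar>S n w\<bar> powr r + (1 / (2 * tc)) powr (1 - a) * (\<Sum>i=1..n. \<xi> i w) powr a" for w
   unfolding r_def powr_abs_square using tc a \<xi>(2) by (intro young_cut sum_nonneg) auto
 qed
 also have "... = (1 / (2 * tc)) * (\<E> w. \<bar>S n w\<bar> powr r) + (1 / (2 * tc)) powr (1 - a) * (\<E> w. (\<Sum>i=1..n. \<xi> i w) powr a)"
 proof -
  have b: "brv M (\<lambda>w. \<Sum>i=1..n. \<xi> i w)" using \<xi>M by (intro brv_sum) auto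
  have "integrable M (\<lambda>w. \<bar>S n w\<bar> powr r)" "integrable M (\<lambda>w. (\<Sum>i=1..n. \<xi> i w) powr a)"
   using SM[of n] b r a \<xi>(2) by (auto intro!: brv_integrable brv_powr brv_powr_nonneg sum_nonneg)
  then show ?thesis by simp
 qed
 also have "(1 / (2 * tc)) powr (1 - a) = (2 * tc) powr (a - 1)"
  using tc powr_minus_divide[of "2 * tc" "1 - a"] by (simp add: powr_divide)
 finally have *: "(\<E> w. \<bar>S n w\<bar> powr r) <= tc * ((1 / (2 * tc)) * (\<E> w. \<bar>S n w\<bar> powr r) +
    (2 * tc) powr (a - 1) * (\<E> w. (\<Sum>i=1..n. \<xi> i w) powr a) + (\<Sum>i=1..n. (\<E> w. \<bar>D i w\<bar> powr r)))"
  using tc by simp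
 have "tc * (1 / (2 * tc)) = 1/2" using tc by simp
 then have "tc * ((1 / (2 * tc)) * E + u + v) = E / 2 + tc * (u + v)" for E u v :: real
  by (simp only: distrib_left mult.assoc[symmetric])
 with * have "(\<E> w. \<bar>S n w\<bar> powr r) <= 2 * (tc * ((2 * tc) powr (a - 1) * (\<E> w. (\<Sum>i=1..n. \<xi> i w) powr a) + (\<Sum>i=1..n. (\<E> w. \<bar>D i w\<bar> powr r))))"
  by simp
 then show ?thesis by (simp add: S_def r_def tc_def mult.assoc)
qed

end

section \<open>Moments of sums of predictable variables\<close>

text \<open>Each increment of \<open>T\<close> is counted at most \<open>d\<close> times.\<close>

lemma sum_shift_difference_le:
 fixes T :: "nat \<Rightarrow> real"
 assumes "mono T" "T 0 = 0"
 shows "(\<Sum>i=1..N. T (i - b) - T (i - (b + d))) <= real d * T N"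
proof -
 have one: "(\<Sum>i=1..N. T (i - b) - T (i - Suc b)) = T (N - b)" for b
 proof (induction N)
  case (Suc N)
  show ?case
  proof (cases "N < b")
   case True
   then show ?thesis using Suc assms by simp
  next
   case False
   then show ?thesis using Suc by (simp add: Suc_diff_le)
  qed
 qed (use assms in simp)
 show ?thesis
 proof (induction d)
  case (Suc d)
  have "(\<Sum>i=1..N. T (i - b) - T (i - (b + Suc d))) = (\<Sum>i=1..N. T (i - b) - T (i - (b + d))) + (\<Sum>i=1..N. T (i - (b + d)) - T (i - Suc (b + d)))"
   by (simp add: sum.distrib[symmetric])
  also have "... <= real d * T N + T N"
   unfolding one using Suc monoD[OF assms(1), of "N - (b + d)" N] by simp
  finally show ?case by (simp add: algebra_simps)
 qed simp
qed

text \<open>If \<open>s \<le> 1\<close> this is concavity of the power, if \<open>s > 1\<close> it follows from \<open>g powr s \<le> T powr (s - 1) * g\<close>.\<close>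

lemma sum_powr_concentration:
 fixes g :: "'b \<Rightarrow> real"
 assumes fin: "finite A" "A \<noteq> {}" and g: "\<And>i. i \<in> A ==> 0 <= g i" "\<And>i. i \<in> A ==> g i <= T"
  and sum: "sum g A <= \<beta> * real (card A) * T" and \<beta>: "0 < \<beta>" "\<beta> <= 1" and s: "0 < s"
 shows "(\<Sum>i\<in>A. g i powr s) <= real (card A) * (\<beta> powr (min s 1) * T powr s)"
proof -
 have T: "0 <= T" using g fin by (meson all_not_in_conv order_trans)
 have card: "0 < real (card A)" using fin by (simp add: card_gt_0_iff)
 show ?thesis
 proof (cases "T = 0")
  case True
  then have "g i = 0" if "i \<in> A" for i using g that by force
  then show ?thesis using True by simp
 next
  case False
  then have T: "0 < T" using T by simp
  show ?thesis
  proof (cases "1 <= s")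
   case True
   have "(\<Sum>i\<in>A. g i powr s) <= (\<Sum>i\<in>A. g i * T powr (s - 1))"
   proof (rule sum_mono)
    fix i assume i: "i \<in> A"
    show "g i powr s <= g i * T powr (s - 1)"
    proof (cases "g i = 0")
     case False
     then have "g i powr s = g i * g i powr (s - 1)" using g(1)[OF i] powr_add[of "g i" 1 "s - 1"] by simp
     also have "... <= g i * T powr (s - 1)" using g[OF i] True by (intro mult_left_mono powr_mono2) auto
     finally show ?thesis .
    qed simp
   qed
   also have "... = sum g A * T powr (s - 1)" by (simp add: sum_distrib_right)
   also have "... <= (\<beta> * real (card A) * T) * T powr (s - 1)" using sum by (intro mult_right_mono) auto
   also have "... = real (card A) * (\<beta> * T powr s)" using T powr_add[of T 1 "s - 1"] by simp
   finally have "(\<Sum>i\<in>A. g i powr s) <= real (card A) * (\<beta> * T powr s)" .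
   moreover have "min s 1 = 1" using True by simp
   ultimately show ?thesis using \<beta> by (simp only: powr_one)
  next
   case False
   define \<mu> where "\<mu> = \<beta> * T"
   have \<mu>: "0 < \<mu>" using T \<beta> by (simp add: \<mu>_def)
   have "(\<Sum>i\<in>A. (g i / \<mu>) powr s) <= (\<Sum>i\<in>A. 1 + s * (g i / \<mu> - 1))"
    using False s g \<mu> by (intro sum_mono bernoulli_powr_ge) auto
   also have "... = real (card A) + s * (sum g A / \<mu> - real (card A))"
    by (simp add: sum.distrib sum_distrib_left[symmetric] sum_subtractf sum_divide_distrib)
   also have "... <= real (card A)"
   proof -
    have "sum g A / \<mu> <= real (card A)" using sum \<mu> by (simp add: \<mu>_def field_simps)
    then show ?thesis using s by (simp add: mult_nonneg_nonpos)
   qed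
   finally have "\<mu> powr s * (\<Sum>i\<in>A. (g i / \<mu>) powr s) <= \<mu> powr s * real (card A)"
    by (intro mult_left_mono) auto
   also have "\<mu> powr s * (\<Sum>i\<in>A. (g i / \<mu>) powr s) = (\<Sum>i\<in>A. g i powr s)"
    unfolding sum_distrib_left using \<mu> g by (intro sum.cong) (auto simp: powr_divide)
   finally show ?thesis using False T \<beta> by (simp add: \<mu>_def powr_mult min_def mult_ac)
  qed
 qed
qed

lemma geometric_powr_sum_le:
 assumes "0 < (\<delta>::real)"
 shows "(\<Sum>k\<le>K. 2 powr (- \<delta> * real k)) <= 1 / (1 - 2 powr (- \<delta>))"
proof -
 define x where "x = (2::real) powr (- \<delta>)"
 have x: "0 < x" "x < 1" using assms by (auto simp: x_def powr_less_one)
 have "2 powr (- \<delta> * real k) = x ^ k" for k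
 proof -
  have "2 powr (- \<delta> * real k) = x powr real k" by (simp only: powr_powr x_def)
  then show ?thesis using x by (simp add: powr_realpow)
 qed
 then have "(\<Sum>k\<le>K. 2 powr (- \<delta> * real k)) = (\<Sum>k\<le>K. x ^ k)" by simp
 also have "... = (1 - x ^ Suc K) / (1 - x)" using x by (simp add: sum_gp0)
 also have "... <= 1 / (1 - x)" using x by (intro divide_right_mono) auto
 finally show ?thesis by (simp add: x_def)
qed

lemma sum_reverse_atMost: "(\<Sum>k\<le>K. f (K - k)) = (\<Sum>k\<le>(K::nat). f k)"
 by (rule sum.reindex_bij_witness[where i="\<lambda>k. K - k" and j="\<lambda>k. K - k"]) auto

text \<open>Geometrically decreasing from both ends of \<open>{..K}\<close>: the weights must be summable in \<open>k\<close>, yet cost little both for small lags and for lags near the full length.\<close>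

lemma two_sided_weights:
 fixes s \<delta> :: real
 assumes "0 < s" "0 < \<delta>"
 obtains w :: "nat \<Rightarrow> nat \<Rightarrow> real" and C where "0 < C" "\<And>K k. 0 < w K k" "\<And>K. (\<Sum>k\<le>K. w K k) <= 1"
  "\<And>K k. w K k powr (- s) <= C * 2 powr (\<delta> * real k)"
  "\<And>K k. k <= K ==> w K k powr (- s) <= C * 2 powr (\<delta> * real (K - k))"
proof -
 define d where "d = \<delta> / s"
 have d: "0 < d" using assms by (simp add: d_def)
 define x where "x = (2::real) powr (- d)"
 have x: "0 < x" "x < 1" using d by (auto simp: x_def powr_less_one)
 define c where "c = (1 - x) / 2"
 have c: "0 < c" using x by (simp add: c_def)
 define w where "w K k = c * (2 powr (- d * real k) + 2 powr (- d * real (K - k)))" for K k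
 have pw: "(c * 2 powr (- d * real k)) powr (- s) = c powr (- s) * 2 powr (\<delta> * real k)" for k
  using c assms by (simp add: powr_mult powr_powr d_def)
 show ?thesis
 proof (rule that[of "c powr (- s)" w])
  show "0 < c powr (- s)" using c by simp
  show "0 < w K k" for K k unfolding w_def using c by (intro mult_pos_pos add_pos_pos) auto
  show "(\<Sum>k\<le>K. w K k) <= 1" for K
  proof -
   have "(\<Sum>k\<le>K. w K k) = c * ((\<Sum>k\<le>K. 2 powr (- d * real k)) + (\<Sum>k\<le>K. 2 powr (- d * real (K - k))))"
    by (simp add: w_def sum_distrib_left sum.distrib distrib_left)
   also have "(\<Sum>k\<le>K. 2 powr (- d * real (K - k))) = (\<Sum>k\<le>K. 2 powr (- d * real k))"
    by (rule sum_reverse_atMost)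
   also have "c * ((\<Sum>k\<le>K. 2 powr (- d * real k)) + (\<Sum>k\<le>K. 2 powr (- d * real k))) <= c * (1 / (1 - x) + 1 / (1 - x))"
    using c geometric_powr_sum_le[OF d, of K] by (intro mult_left_mono add_mono) (auto simp: x_def)
   also have "... = 1" using x by (simp add: c_def field_simps)
   finally show ?thesis .
  qed
  show "w K k powr (- s) <= c powr (- s) * 2 powr (\<delta> * real k)" for K k
   unfolding pw[symmetric] w_def using c assms by (intro powr_mono2') auto
  show "w K k powr (- s) <= c powr (- s) * 2 powr (\<delta> * real (K - k))" for K k
   unfolding pw[symmetric] w_def using c assms by (intro powr_mono2') auto
 qed
qed

context prob_space begin

text \<open>The moment of order \<open>a\<close> of a sum of past-measurable variables, compared with that of its mean \<open>N c\<close>, up to the mixing error \<open>\<rho>\<close> over dyadic lags. The constant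
is uniform in the filtration and in the variables, so that one serves for all block lengths and truncations.\<close>

definition predictable_bound :: "real \<Rightarrow> real \<Rightarrow> real \<Rightarrow> bool" where
 "predictable_bound a \<delta> C \<longleftrightarrow> 0 < C \<and> (\<forall>(G :: nat \<Rightarrow> 'a measure) \<xi> N K \<Lambda> c \<rho>. filtration_on M G --> 2 ^ K <= N --> N < 2 ^ Suc K -->
   0 <= \<Lambda> --> 0 <= c --> (\<forall>i\<in>{1..N}. brv (G (i - 1)) (\<xi> i) \<and> (\<forall>w. 0 <= \<xi> i w \<and> \<xi> i w <= \<Lambda>)) -->
   (\<forall>i\<in>{1..N}. \<forall>j. \<forall>z \<Gamma>. 1 <= j --> j < i --> brv (G (j - 1)) z --> (\<forall>w. 0 <= z w \<and> z w <= \<Gamma>) -->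
    (\<E> w. z w * \<xi> i w) <= c * expectation z + \<Gamma> * \<rho> (i - j)) --> (\<forall>m. 0 <= \<rho> m) -->
   (\<E> w. (\<Sum>i=1..N. \<xi> i w) powr a) <=
    C * ((real N * c) powr a + (\<Sum>i=1..N. (\<E> w. \<xi> i w powr a))
     + real N * \<Lambda> powr (a - 1) * (\<Sum>k\<le>K. 2 powr (real k * (a - 1 + \<delta>)) * \<rho> (2 ^ k))))"

text \<open>Let \<open>T\<close> be the partial sums. The increment of \<open>T powr a\<close> at \<open>i\<close> is about \<open>T (i - 1) powr (a - 1) * \<xi> i\<close>, and \<open>T (i - 1)\<close> is split into the
increments \<open>g k i\<close> of \<open>T\<close> over the dyadic lags between \<open>2 ^ k\<close> and \<open>2 ^ (k + 1)\<close>. At such a distance \<open>\<xi> i\<close> may be replaced by \<open>c\<close> at the price \<open>\<rho> (2 ^ k)\<close>. Averaging over \<open>i\<close>, the increments over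
lags \<open>2 ^ k\<close> carry only the fraction \<open>2 ^ k / N\<close> of the total, so that all scales together contribute a bounded multiple of \<open>N c * T N powr (a - 1)\<close>, which the Young inequality absorbs.\<close>

lemma predictable_sum_moment:
 fixes a \<delta> :: real
 assumes a: "1 < a" and \<delta>: "0 < \<delta>"
 shows "\<exists>C. predictable_bound a \<delta> C"
proof -
 define s where "s = a - 1"
 have s: "0 < s" using a by (simp add: s_def)
 define \<sigma> where "\<sigma> = min s 1"
 have \<sigma>: "0 < \<sigma>" "\<sigma> <= 1" using s by (auto simp: \<sigma>_def)
 \<comment> \<open>The weights may lose at most \<open>2 powr (\<delta> k)\<close>, and less than the gain \<open>2 powr (\<sigma> (K - k))\<close> at large scales.\<close>
 define \<epsilon> where "\<epsilon> = min \<delta> (\<sigma> / 2)"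
 have \<epsilon>: "0 < \<epsilon>" "\<epsilon> <= \<delta>" "\<epsilon> <= \<sigma> / 2" using \<sigma> \<delta> by (auto simp: \<epsilon>_def)
 obtain wt :: "nat \<Rightarrow> nat \<Rightarrow> real" and Cw where Cw: "0 < Cw" and w0: "\<And>K k. 0 < wt K k" and w1: "\<And>K. (\<Sum>k\<le>K. wt K k) <= 1"
  and wl: "\<And>K k. wt K k powr (- s) <= Cw * 2 powr (\<epsilon> * real k)"
  and wr: "\<And>K k. k <= K ==> wt K k powr (- s) <= Cw * 2 powr (\<epsilon> * real (K - k))"
  using two_sided_weights[OF s \<epsilon>(1)] by metis
 define g0 where "g0 = 1 / (1 - (2::real) powr (- (\<sigma> / 2)))"
 have g0: "0 < g0" using \<sigma> by (simp add: g0_def powr_less_one)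
 define A where "A = a * 2 powr s"
 have A: "0 < A" using a by (simp add: A_def)
 define B where "B = A * Cw * g0"
 have B: "0 < B" using A Cw g0 by (simp add: B_def)
 define C where "C = 2 * (2 powr s * B powr a + A + A * Cw)"
 have C: "0 < C" unfolding C_def using A B Cw by (intro mult_pos_pos add_pos_pos) auto
 show ?thesis unfolding predictable_bound_def
 proof (intro exI[of _ C] conjI allI impI, rule C)
  fix G :: "nat \<Rightarrow> 'a measure" and \<xi> :: "nat \<Rightarrow> 'a \<Rightarrow> real" and N K :: nat and \<Lambda> c :: real and \<rho> :: "nat \<Rightarrow> real"
  assume G: "filtration_on M G" and NK: "2 ^ K <= N" "N < 2 ^ Suc K" and \<Lambda>: "0 <= \<Lambda>" and c: "0 <= c"
   and \<xi>: "\<forall>i\<in>{1..N}. brv (G (i - 1)) (\<xi> i) \<and> (\<forall>w. 0 <= \<xi> i w \<and> \<xi> i w <= \<Lambda>)"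
   and mix: "\<forall>i\<in>{1..N}. \<forall>j. \<forall>z \<Gamma>. 1 <= j --> j < i --> brv (G (j - 1)) z --> (\<forall>w. 0 <= z w \<and> z w <= \<Gamma>) -->
    (\<E> w. z w * \<xi> i w) <= c * expectation z + \<Gamma> * \<rho> (i - j)" and \<rho>: "\<forall>m. 0 <= \<rho> m"
  have N: "1 <= N" using NK(1) by (meson one_le_numeral one_le_power order_trans)
  define T where "T k w = (\<Sum>i\<in>{1..k} \<inter> {..N}. \<xi> i w)" for k w
  have T0: "T 0 w = 0" for w by (simp add: T_def)
  have TS: "T (Suc k) w = T k w + \<xi> (Suc k) w" if "Suc k <= N" for k w
  proof -
   have "{1..Suc k} \<inter> {..N} = insert (Suc k) ({1..k} \<inter> {..N})" using that by auto
   then show ?thesis unfolding T_def by simp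
  qed
  have Tmono: "mono (\<lambda>k. T k w)" for w
   unfolding T_def using \<xi> by (intro monoI sum_mono2) auto
  have Tnn: "0 <= T k w" for k w using monoD[OF Tmono[of w], of 0 k] T0 by simp
  have TG: "brv (G j) (T k)" if "k - 1 <= j" for j k
   unfolding T_def
  proof (rule brv_sum)
   fix i assume i: "i \<in> {1..k} \<inter> {..N}"
   then have "brv (G (i - 1)) (\<xi> i)" using \<xi> by auto
   then show "brv (G j) (\<xi> i)" by (rule filtration_brv_mono[OF G, rotated]) (use i that in auto)
  qed
  have TM: "brv M (T k)" for k using filtration_brv_M[OF G TG[of k "k - 1"]] by simp
  have \<xi>M: "brv M (\<xi> i)" if "i \<in> {1..N}" for i using filtration_brv_M[OF G] \<xi> that by blast
  have \<xi>0: "0 <= \<xi> i w" if "i \<in> {1..N}" for i w using \<xi> that by blast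
  define g where "g k i w = T (i - 2 ^ k) w - T (i - 2 ^ Suc k) w" for k i w
  have g_nn: "0 <= g k i w" for k i w unfolding g_def using monoD[OF Tmono[of w], of "i - 2 ^ Suc k" "i - 2 ^ k"] by simp
  have gM: "brv M (g k i)" for k i unfolding g_def using TM by (intro brv_diff)
  have gsM: "brv M (\<lambda>w. g k i w powr s)" for k i using gM g_nn s by (intro brv_powr_nonneg) auto
  have TpM: "brv M (\<lambda>w. T k w powr t)" if "0 <= t" for k t using TM Tnn that by (intro brv_powr_nonneg) auto
  have \<xi>aM: "brv M (\<lambda>w. \<xi> i w powr t)" if "i \<in> {1..N}" "0 <= t" for i t using \<xi>M \<xi>0 that by (intro brv_powr_nonneg) auto
  have tele: "(\<Sum>k\<le>K. g k i w) = T (i - 1) w" if "i \<in> {1..N}" for i w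
  proof -
   have "(\<Sum>k\<le>m. g k i w) = T (i - 1) w - T (i - 2 ^ Suc m) w" for m
    by (induction m) (auto simp: g_def)
   moreover have "i - 2 ^ Suc K = 0" using that NK by auto
   ultimately show ?thesis using T0 by simp
  qed
  have gb: "g k i w <= 2 ^ k * \<Lambda>" if "i \<in> {1..N}" for k i w
  proof -
   have "T (j + d) w <= T j w + real d * \<Lambda>" if "j + d <= N" for j d
    using that
   proof (induction d)
    case (Suc d)
    have "\<xi> (Suc (j + d)) w <= \<Lambda>" using \<xi> Suc.prems by auto
    then show ?case using Suc TS[of "j + d" w] by (simp add: algebra_simps)
   qed simp
   note bnd = this[of "i - 2 ^ Suc k" "(i - 2 ^ k) - (i - 2 ^ Suc k)"]
   have "g k i w <= real ((i - 2 ^ k) - (i - 2 ^ Suc k)) * \<Lambda>"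
   proof -
    have le: "i - 2 ^ Suc k <= i - 2 ^ k" by (intro diff_le_mono2) simp
    have "i - 2 ^ Suc k + ((i - 2 ^ k) - (i - 2 ^ Suc k)) = i - 2 ^ k" using le by (rule le_add_diff_inverse)
    moreover have "i - 2 ^ k <= N" using \<open>i \<in> {1..N}\<close> by auto
    ultimately show ?thesis using bnd unfolding g_def by (simp only:) simp
   qed
   also have "... <= real (2 ^ k) * \<Lambda>" using \<Lambda> by (intro mult_right_mono) (auto simp del: of_nat_power of_nat_numeral)
   finally show ?thesis by simp
  qed
  have near: "(\<E> w. g k i w powr s * \<xi> i w) <= c * (\<E> w. g k i w powr s) + (2 powr (real k * s) * \<Lambda> powr s) * \<rho> (2 ^ k)"
   if i: "i \<in> {1..N}" for k i
  proof (cases "i <= 2 ^ k")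
   case True
   then have "g k i = (\<lambda>w. 0)" by (auto simp: g_def T0)
   then show ?thesis using \<rho> s by simp
  next
   case False
   define j where "j = i - 2 ^ k"
   have j: "1 <= j" "j < i" "i - j = 2 ^ k" using False i by (auto simp: j_def)
   have gG: "brv (G (j - 1)) (\<lambda>w. g k i w powr s)"
   proof -
    have "i - 2 ^ Suc k - 1 <= j - 1" unfolding j_def by (simp add: diff_le_mono2 diff_le_mono)
    then have "brv (G (j - 1)) (g k i)" unfolding g_def by (intro brv_diff TG) (auto simp: j_def)
    then show ?thesis using g_nn s by (intro brv_powr_nonneg) auto
   qed
   have "\<forall>w. 0 <= g k i w powr s \<and> g k i w powr s <= (2 ^ k * \<Lambda>) powr s"
    using gb[OF i] g_nn s by (auto intro!: powr_mono2)
   then have "(\<E> w. g k i w powr s * \<xi> i w) <= c * (\<E> w. g k i w powr s) + (2 ^ k * \<Lambda>) powr s * \<rho> (i - j)"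
    using mix i j gG by blast
   also have "(2 ^ k * \<Lambda>) powr s = 2 powr (real k * s) * \<Lambda> powr s"
    using \<Lambda> by (simp add: powr_mult powr_realpow[symmetric] powr_powr)
   finally show ?thesis using j by simp
  qed
  define X where "X = (\<E> w. T N w powr a)"
  have conc: "(\<Sum>i=1..N. g k i w powr s) <= real N * (2 powr (- \<sigma> * real (K - k)) * T N w powr s)" if k: "k <= K" for k w
  proof -
   have "(\<Sum>i=1..N. g k i w powr s) <= real (card {1..N}) * ((2 ^ k / real N) powr (min s 1) * T N w powr s)"
   proof (rule sum_powr_concentration)
    show "g k i w <= T N w" if "i \<in> {1..N}" for i
    proof -
     have "g k i w <= T (i - 2 ^ k) w" using Tnn by (simp add: g_def)
     also have "... <= T N w" using that by (intro monoD[OF Tmono]) auto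
     finally show ?thesis .
    qed
    have "(\<Sum>i=1..N. g k i w) <= 2 ^ k * T N w"
     using sum_shift_difference_le[OF Tmono[of w] T0, of "2 ^ k" "2 ^ k" N] by (simp add: g_def mult_2)
    then show "(\<Sum>i=1..N. g k i w) <= 2 ^ k / real N * real (card {1..N}) * T N w" using N by simp
    have "(2::nat) ^ k <= 2 ^ K" using k by (intro power_increasing) auto
    then have "(2::nat) ^ k <= N" using NK(1) by linarith
    then have "2 ^ k <= real N" by (metis of_nat_le_iff of_nat_numeral of_nat_power)
    then show "2 ^ k / real N <= 1" using N by simp
   qed (use g_nn N s in auto)
   also have "(2 ^ k / real N) powr (min s 1) <= 2 powr (- \<sigma> * real (K - k))"
   proof -
    have "2 ^ K <= real N" using NK(1) by (metis of_nat_le_iff of_nat_numeral of_nat_power)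
    then have "2 ^ k / real N <= 2 ^ k / 2 ^ K" by (intro divide_left_mono) (use N in auto)
    also have "... = 2 powr (- real (K - k))" using k by (simp add: powr_realpow[symmetric] powr_diff[symmetric] of_nat_diff)
    finally have "(2 ^ k / real N) powr \<sigma> <= (2 powr (- real (K - k))) powr \<sigma>" using \<sigma> N by (intro powr_mono2) auto
    then show ?thesis by (simp add: powr_powr \<sigma>_def[symmetric] mult.commute)
   qed
   finally show ?thesis by (simp add: mult_left_mono mult_right_mono)
  qed
  have step: "(\<E> w. T i w powr a) <= (\<E> w. T (i - 1) w powr a) + A * (\<E> w. \<xi> i w powr a)
    + A * (\<Sum>k\<le>K. wt K k powr (- s) * (\<E> w. g k i w powr s * \<xi> i w))" if i: "i \<in> {1..N}" for i
  proof -
   have "(\<E> w. T i w powr a) <= (\<E> w. T (i - 1) w powr a + A * \<xi> i w powr a + A * (\<Sum>k\<le>K. wt K k powr (- s) * (g k i w powr s * \<xi> i w)))"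
   proof (rule integral_mono)
    show "integrable M (\<lambda>w. T i w powr a)" using TpM a by (intro brv_integrable) auto
    show "integrable M (\<lambda>w. T (i - 1) w powr a + A * \<xi> i w powr a + A * (\<Sum>k\<le>K. wt K k powr (- s) * (g k i w powr s * \<xi> i w)))"
     using TpM \<xi>aM[OF i] gsM \<xi>M[OF i] a by (intro brv_integrable brv_add brv_cmult brv_sum brv_mult) auto
    fix w
    have Ti: "T i w = T (i - 1) w + \<xi> i w" using TS[of "i - 1" w] i by simp
    have "T i w powr a - T (i - 1) w powr a <= a * T i w powr s * \<xi> i w"
     using powr_diff_le[OF a Tnn[of "i - 1" w], of "T i w"] Ti \<xi>0[OF i, of w] by (simp add: s_def)
    also have "... <= a * (2 powr s * (T (i - 1) w powr s + \<xi> i w powr s)) * \<xi> i w"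
     unfolding Ti using a s Tnn \<xi>0[OF i] by (intro mult_right_mono mult_left_mono powr_add_le) auto
    also have "... = A * (\<xi> i w powr s * \<xi> i w) + A * (T (i - 1) w powr s * \<xi> i w)"
     by (simp add: A_def algebra_simps)
    also have "\<xi> i w powr s * \<xi> i w = \<xi> i w powr a"
     using \<xi>0[OF i, of w] powr_add[of "\<xi> i w" s 1] by (cases "\<xi> i w = 0") (auto simp: s_def)
    also have "T (i - 1) w powr s * \<xi> i w <= (\<Sum>k\<le>K. wt K k powr (- s) * g k i w powr s) * \<xi> i w"
     unfolding tele[OF i, symmetric] using s w0 w1 g_nn \<xi>0[OF i] by (intro mult_right_mono sum_powr_le_weighted) auto
    finally show "T i w powr a <= T (i - 1) w powr a + A * \<xi> i w powr a + A * (\<Sum>k\<le>K. wt K k powr (- s) * (g k i w powr s * \<xi> i w))"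
     using A by (simp add: sum_distrib_right mult.assoc mult_left_mono)
   qed
   also have "... = (\<E> w. T (i - 1) w powr a) + A * (\<E> w. \<xi> i w powr a)
     + A * (\<Sum>k\<le>K. wt K k powr (- s) * (\<E> w. g k i w powr s * \<xi> i w))"
   proof -
    have 1: "integrable M (\<lambda>w. T (i - 1) w powr a)" "integrable M (\<lambda>w. \<xi> i w powr a)"
     using TpM \<xi>aM[OF i] a by (auto intro!: brv_integrable)
    have 2: "integrable M (\<lambda>w. wt K k powr (- s) * (g k i w powr s * \<xi> i w))" for k
     using gsM \<xi>M[OF i] by (intro brv_integrable brv_cmult brv_mult) auto
    have 3: "integrable M (\<lambda>w. \<Sum>k\<le>K. wt K k powr (- s) * (g k i w powr s * \<xi> i w))"
     using 2 by (intro integrable_setsum) auto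
    show ?thesis using 1 3 expect_sum[of "{..K}" M "\<lambda>k w. wt K k powr (- s) * (g k i w powr s * \<xi> i w)"] 2 by simp
   qed
   finally show ?thesis .
  qed
  have "(\<E> w. T m w powr a) <= A * (\<Sum>i=1..m. (\<E> w. \<xi> i w powr a))
    + A * (\<Sum>i=1..m. \<Sum>k\<le>K. wt K k powr (- s) * (\<E> w. g k i w powr s * \<xi> i w))" if "m <= N" for m
   using that
  proof (induction m)
   case 0
   then show ?case using a by (simp add: T0)
  next
   case (Suc m)
   then show ?case using step[of "Suc m"] by (simp add: distrib_left)
  qed
  from this[of N] have "X <= A * (\<Sum>i=1..N. (\<E> w. \<xi> i w powr a))
    + A * (\<Sum>i=1..N. \<Sum>k\<le>K. wt K k powr (- s) * (\<E> w. g k i w powr s * \<xi> i w))" by (simp add: X_def)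
  also have "(\<Sum>i=1..N. \<Sum>k\<le>K. wt K k powr (- s) * (\<E> w. g k i w powr s * \<xi> i w))
    <= (\<Sum>i=1..N. \<Sum>k\<le>K. wt K k powr (- s) * (c * (\<E> w. g k i w powr s) + (2 powr (real k * s) * \<Lambda> powr s) * \<rho> (2 ^ k)))"
   by (intro sum_mono mult_left_mono near) auto
  also have "... = c * (\<Sum>k\<le>K. wt K k powr (- s) * (\<Sum>i=1..N. (\<E> w. g k i w powr s)))
    + real N * \<Lambda> powr s * (\<Sum>k\<le>K. wt K k powr (- s) * 2 powr (real k * s) * \<rho> (2 ^ k))"
   by (subst sum.swap) (simp add: sum.distrib sum_distrib_left distrib_left mult_ac)
  also have "(\<Sum>k\<le>K. wt K k powr (- s) * 2 powr (real k * s) * \<rho> (2 ^ k)) <= Cw * (\<Sum>k\<le>K. 2 powr (real k * (s + \<delta>)) * \<rho> (2 ^ k))"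
   unfolding sum_distrib_left
  proof (rule sum_mono)
   fix k
   have "wt K k powr (- s) * 2 powr (real k * s) <= Cw * 2 powr (\<epsilon> * real k) * 2 powr (real k * s)"
    using wl by (intro mult_right_mono) auto
   also have "... = Cw * 2 powr (\<epsilon> * real k + real k * s)" by (simp add: powr_add)
   also have "... <= Cw * 2 powr (real k * (s + \<delta>))"
    using Cw \<epsilon>(2) by (intro mult_left_mono powr_mono) (auto simp: algebra_simps mult_right_mono)
   finally show "wt K k powr (- s) * 2 powr (real k * s) * \<rho> (2 ^ k) <= Cw * (2 powr (real k * (s + \<delta>)) * \<rho> (2 ^ k))"
    using \<rho> mult_right_mono by (metis mult.assoc)
  qed
  also have "(\<Sum>k\<le>K. wt K k powr (- s) * (\<Sum>i=1..N. (\<E> w. g k i w powr s))) <= Cw * g0 * real N * (\<E> w. T N w powr s)"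
  proof -
   have "(\<Sum>k\<le>K. wt K k powr (- s) * (\<Sum>i=1..N. (\<E> w. g k i w powr s)))
     <= (\<Sum>k\<le>K. (Cw * 2 powr (\<epsilon> * real (K - k))) * (real N * (2 powr (- \<sigma> * real (K - k)) * (\<E> w. T N w powr s))))"
   proof (intro sum_mono mult_mono)
    fix k assume k: "k \<in> {..K}"
    show "wt K k powr (- s) <= Cw * 2 powr (\<epsilon> * real (K - k))" using wr k by auto
    have "(\<Sum>i=1..N. (\<E> w. g k i w powr s)) = (\<E> w. \<Sum>i=1..N. g k i w powr s)"
     using gsM by (intro expect_sum[symmetric] brv_integrable) auto
    also have "... <= (\<E> w. real N * (2 powr (- \<sigma> * real (K - k)) * T N w powr s))"
     using conc[of k] k gsM TpM s by (intro integral_mono brv_integrable brv_sum brv_cmult) auto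
    finally show "(\<Sum>i=1..N. (\<E> w. g k i w powr s)) <= real N * (2 powr (- \<sigma> * real (K - k)) * (\<E> w. T N w powr s))" by simp
   qed (use Cw in \<open>auto intro!: sum_nonneg integral_ge_0\<close>)
   also have "... = Cw * real N * (\<E> w. T N w powr s) * (\<Sum>k\<le>K. 2 powr (- (\<sigma> - \<epsilon>) * real (K - k)))"
    unfolding sum_distrib_left
   proof (rule sum.cong)
    fix k
    have "2 powr (- (\<sigma> - \<epsilon>) * real (K - k)) = 2 powr (\<epsilon> * real (K - k)) * 2 powr (- \<sigma> * real (K - k))"
     by (simp add: powr_add[symmetric] algebra_simps)
    then show "(Cw * 2 powr (\<epsilon> * real (K - k))) * (real N * (2 powr (- \<sigma> * real (K - k)) * (\<E> w. T N w powr s)))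
      = Cw * real N * (\<E> w. T N w powr s) * 2 powr (- (\<sigma> - \<epsilon>) * real (K - k))" by simp
   qed simp
   also have "... <= Cw * real N * (\<E> w. T N w powr s) * g0"
   proof (intro mult_left_mono)
    have "(\<Sum>k\<le>K. 2 powr (- (\<sigma> - \<epsilon>) * real (K - k))) <= (\<Sum>k\<le>K. 2 powr (- (\<sigma> / 2) * real (K - k)))"
     using \<epsilon>(3) by (intro sum_mono powr_mono mult_right_mono) auto
    also have "... = (\<Sum>k\<le>K. 2 powr (- (\<sigma> / 2) * real k))" by (rule sum_reverse_atMost)
    also have "... <= g0" unfolding g0_def using \<sigma> by (intro geometric_powr_sum_le) auto
    finally show "(\<Sum>k\<le>K. 2 powr (- (\<sigma> - \<epsilon>) * real (K - k))) <= g0" .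
   qed (use Cw in \<open>auto intro!: mult_nonneg_nonneg integral_ge_0\<close>)
   finally show ?thesis by (simp add: mult_ac)
  qed
  finally have X1: "X <= A * (\<Sum>i=1..N. (\<E> w. \<xi> i w powr a)) + A * (c * (Cw * g0 * real N * (\<E> w. T N w powr s))
    + real N * \<Lambda> powr s * (Cw * (\<Sum>k\<le>K. 2 powr (real k * (s + \<delta>)) * \<rho> (2 ^ k))))"
   using A c Cw by (simp add: mult_left_mono)
  have young: "B * (real N * c) * (\<E> w. T N w powr s) <= X / 2 + 2 powr s * (B * (real N * c)) powr a"
  proof -
   have "B * (real N * c) * (\<E> w. T N w powr s) = (\<E> w. T N w powr s * (B * (real N * c)))" by simp
   also have "... <= (\<E> w. 1/2 * T N w powr a + (1/2) powr (1 - a) * (B * (real N * c)) powr a)"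
   proof (rule integral_mono)
    show "T N w powr s * (B * (real N * c)) <= 1/2 * T N w powr a + (1/2) powr (1 - a) * (B * (real N * c)) powr a" for w
     unfolding s_def using Tnn B c a by (intro young_cut) auto
    have "brv M (\<lambda>w. T N w powr s)" "brv M (\<lambda>w. T N w powr a)" using TpM s a by auto
    then show "integrable M (\<lambda>w. T N w powr s * (B * (real N * c)))" 
      "integrable M (\<lambda>w. 1/2 * T N w powr a + (1/2) powr (1 - a) * (B * (real N * c)) powr a)"
     by (auto intro!: brv_integrable brv_intros)
   qed
   also have "... = X / 2 + (1/2) powr (1 - a) * (B * (real N * c)) powr a"
   proof -
    have "integrable M (\<lambda>w. T N w powr a)" using TpM a by (intro brv_integrable) auto
    then show ?thesis by (simp add: X_def prob_space)
   qed
   also have "(1/2::real) powr (1 - a) = 2 powr s" using powr_minus_divide[of "2" "1 - a"] by (simp add: powr_divide s_def)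
   finally show ?thesis .
  qed
  define U where "U = real N * \<Lambda> powr s * (\<Sum>k\<le>K. 2 powr (real k * (s + \<delta>)) * \<rho> (2 ^ k))"
  define W where "W = (\<Sum>i=1..N. (\<E> w. \<xi> i w powr a))"
  define Y where "Y = (real N * c) powr a"
  have nn: "0 <= U" "0 <= W" "0 <= Y" unfolding U_def W_def Y_def using \<rho>
   by (auto intro!: mult_nonneg_nonneg sum_nonneg integral_ge_0)
  have "X <= A * W + B * (real N * c) * (\<E> w. T N w powr s) + A * Cw * U"
   using X1 by (simp add: U_def W_def B_def algebra_simps)
  also have "... <= A * W + (X / 2 + 2 powr s * (B powr a * Y)) + A * Cw * U"
   using young B N c by (simp add: Y_def powr_mult)
  finally have "X <= 2 * (A * W + 2 powr s * (B powr a * Y) + A * Cw * U)" by simp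
  also have "... <= C * (Y + W + U)"
  proof -
   have "A * W <= (2 powr s * B powr a + A + A * Cw) * W" "(2 powr s * B powr a) * Y <= (2 powr s * B powr a + A + A * Cw) * Y"
    "A * Cw * U <= (2 powr s * B powr a + A + A * Cw) * U"
    using nn A B Cw by (intro mult_right_mono; simp)+
   then show ?thesis by (simp add: C_def algebra_simps)
  qed
  finally have fin: "X <= C * (Y + W + U)" .
  show "(\<E> w. (\<Sum>i=1..N. \<xi> i w) powr a) <=
    C * ((real N * c) powr a + (\<Sum>i=1..N. (\<E> w. \<xi> i w powr a))
     + real N * \<Lambda> powr (a - 1) * (\<Sum>k\<le>K. 2 powr (real k * (a - 1 + \<delta>)) * \<rho> (2 ^ k)))"
  proof -
   have "T N = (\<lambda>w. \<Sum>i=1..N. \<xi> i w)"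
   proof
    fix w
    have "{1..N} \<inter> {..N} = {1..N}" by auto
    then show "T N w = (\<Sum>i=1..N. \<xi> i w)" by (simp only: T_def)
   qed
   then show ?thesis using fin
    by (simp add: X_def Y_def W_def U_def s_def)
  qed
 qed
qed

end

section \<open>Functions of bounded variation and lower sets\<close>

definition downset :: "real set \<Rightarrow> bool" where
 "downset D \<longleftrightarrow> (\<forall>x\<in>D. \<forall>y\<le>x. y \<in> D)"

lemma downset_cases:
 assumes "downset D"
 shows "D = {} \<or> D = UNIV \<or> (\<exists>x. D = {..x}) \<or> (\<exists>x. D = {..<x})"
proof (cases "D = {} \<or> D = UNIV")
 case False
 then obtain a b where ab: "a \<in> D" "b \<notin> D" by blast
 have ub: "x <= b" if "x \<in> D" for x using that ab assms unfolding downset_def by (meson linear)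
 then have bdd: "bdd_above D" by (auto simp: bdd_above_def)
 have up: "x <= Sup D" if "x \<in> D" for x using cSup_upper[OF that bdd] .
 have lo: "x \<in> D" if xs: "x < Sup D" for x
 proof -
  have "D \<noteq> {}" using ab by blast
  then obtain y where "y \<in> D" "x < y" using less_cSup_iff[of D x] xs bdd by auto
  then show ?thesis using assms by (auto simp: downset_def)
 qed
 show ?thesis
 proof (cases "Sup D \<in> D")
  case True
  then have "D = {..Sup D}" using up assms by (auto simp: downset_def)
  then show ?thesis by blast
 next
  case False
  then have "D = {..<Sup D}" using up lo by (force simp: less_le)
  then show ?thesis by blast
 qed
qed auto

lemma downset_borel: "downset D ==> D \<in> sets borel"
 using downset_cases[of D] by auto

text \<open>The coefficients involve only closed half-lines; open ones, the line and the empty set are pointwise limits of these.\<close>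

lemma downset_approx:
 assumes "downset D"
 shows "\<exists>x :: nat \<Rightarrow> real. \<forall>y. (\<lambda>n. indicat_real {..x n} y) \<longlonglongrightarrow> indicat_real D y"
 using downset_cases[OF assms]
proof (elim disjE exE)
 assume D: "D = {}"
 show ?thesis
 proof (intro exI[of _ "\<lambda>n. - real n"] allI)
  fix y :: real
  obtain N :: nat where "- y < real N" using reals_Archimedean2 by blast
  then have "eventually (\<lambda>n. indicat_real {..- real n} y = 0) sequentially"
   by (intro eventually_sequentiallyI[of N]) (auto simp: indicator_def)
  then show "(\<lambda>n. indicat_real {..- real n} y) \<longlonglongrightarrow> indicat_real D y"
   using D by (simp add: tendsto_eventually)
 qed
next
 assume D: "D = UNIV"
 show ?thesis
 proof (intro exI[of _ "\<lambda>n. real n"] allI)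
  fix y :: real
  obtain N :: nat where "y < real N" using reals_Archimedean2 by blast
  then have "eventually (\<lambda>n. indicat_real {..real n} y = 1) sequentially"
   by (intro eventually_sequentiallyI[of N]) (auto simp: indicator_def)
  then show "(\<lambda>n. indicat_real {..real n} y) \<longlonglongrightarrow> indicat_real D y"
   using D by (simp add: tendsto_eventually)
 qed
next
 fix x assume D: "D = {..x}"
 show ?thesis by (intro exI[of _ "\<lambda>n. x"]) (simp add: D)
next
 fix x assume D: "D = {..<x}"
 show ?thesis
 proof (intro exI[of _ "\<lambda>n. x - 1 / real (Suc n)"] allI)
  fix y :: real
  show "(\<lambda>n. indicat_real {..x - 1 / real (Suc n)} y) \<longlonglongrightarrow> indicat_real D y"
  proof (cases "y < x")
   case True
   then obtain N where N: "inverse (real (Suc N)) < x - y" using reals_Archimedean[of "x - y"] by auto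
   have "1 / real (Suc n) <= inverse (real (Suc N))" if "N <= n" for n
    using that by (auto simp: field_simps)
   then have "eventually (\<lambda>n. indicat_real {..x - 1 / real (Suc n)} y = 1) sequentially"
    using N by (intro eventually_sequentiallyI[of N]) (force simp: indicator_def)
   then show ?thesis using D True by (simp add: tendsto_eventually)
  next
   case False
   have "x - 1 / real (Suc n) < y" for n
   proof -
    have "0 < 1 / real (Suc n)" by simp
    then show ?thesis using False by linarith
   qed
   then have "eventually (\<lambda>n. indicat_real {..x - 1 / real (Suc n)} y = 0) sequentially"
    by (intro always_eventually) (auto simp: indicator_def not_le)
   then show ?thesis using D False by (simp add: tendsto_eventually)
  qed
 qed
qed

text \<open>A quantitative form of bounded variation: uniform limits of step functions over lower sets with total weight at most \<open>B\<close>.\<close>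

definition bv_bounded :: "real \<Rightarrow> (real \<Rightarrow> real) \<Rightarrow> bool" where
 "bv_bounded B h \<longleftrightarrow> (\<forall>\<epsilon>>0. \<exists>(n :: nat) c D. (\<forall>i<n. downset (D i)) \<and> (\<Sum>i<n. \<bar>c i\<bar>) <= B \<and>
   (\<forall>y. \<bar>h y - (\<Sum>i<n. c i * indicat_real (D i) y)\<bar> <= \<epsilon>))"

lemma bv_boundedE:
 assumes "bv_bounded B h" "0 < \<epsilon>"
 obtains n :: nat and D :: "nat \<Rightarrow> real set" and c :: "nat \<Rightarrow> real" where "\<And>i. i < n ==> downset (D i)" "(\<Sum>i<n. \<bar>c i\<bar>) <= B"
   "\<And>y. \<bar>h y - (\<Sum>i<n. c i * indicat_real (D i) y)\<bar> <= \<epsilon>"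
proof -
 from assms(1)[unfolded bv_bounded_def, rule_format, OF assms(2)]
 obtain n :: nat and c D where *: "\<forall>i<n. downset (D i)" "(\<Sum>i<n. \<bar>c i\<bar>) <= B"
   "\<forall>y. \<bar>h y - (\<Sum>i<n. c i * indicat_real (D i) y)\<bar> <= \<epsilon>" by (elim exE conjE)
 show ?thesis by (rule that[of n D c]) (simp_all only: *)
qed

lemma bv_boundedI:
 assumes "\<And>\<epsilon>. 0 < \<epsilon> ==> \<exists>(n :: nat) c D. (\<forall>i<n. downset (D i)) \<and> (\<Sum>i<n. \<bar>c i\<bar>) <= B \<and>
   (\<forall>y. \<bar>h y - (\<Sum>i<n. c i * indicat_real (D i) y)\<bar> <= \<epsilon>)"
 shows "bv_bounded B h"
 using assms by (simp only: bv_bounded_def) simp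

lemma bv_bounded_add:
 assumes "bv_bounded B h" "bv_bounded B' h'"
 shows "bv_bounded (B + B') (\<lambda>y. h y + h' y)"
 unfolding bv_bounded_def
proof (intro allI impI)
 fix \<epsilon> :: real assume "0 < \<epsilon>"
 then have e: "0 < \<epsilon> / 2" by simp
 obtain n :: nat and c D where 1: "\<And>i. i < n ==> downset (D i)" "(\<Sum>i<n. \<bar>c i\<bar>) <= B"
   "\<And>y. \<bar>h y - (\<Sum>i<n. c i * indicat_real (D i) y)\<bar> <= \<epsilon> / 2"
  by (rule bv_boundedE[OF assms(1) e]) (rule that; simp)
 obtain n' :: nat and c' D' where 2: "\<And>i. i < n' ==> downset (D' i)" "(\<Sum>i<n'. \<bar>c' i\<bar>) <= B'"
   "\<And>y. \<bar>h' y - (\<Sum>i<n'. c' i * indicat_real (D' i) y)\<bar> <= \<epsilon> / 2"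
  by (rule bv_boundedE[OF assms(2) e]) (rule that; simp)
 have split: "(\<Sum>i<n+n'. if i < n then f i else g (i - n)) = (\<Sum>i<n. f i) + (\<Sum>i<n'. g i)" for f g :: "nat \<Rightarrow> real"
 proof -
  have "(\<Sum>i<n+m. if i < n then f i else g (i - n)) = (\<Sum>i<n. f i) + (\<Sum>i<m. g i)" for m
   by (induction m) auto
  then show ?thesis .
 qed
 show "\<exists>(n :: nat) c D. (\<forall>i<n. downset (D i)) \<and> (\<Sum>i<n. \<bar>c i\<bar>) <= B + B' \<and>
   (\<forall>y. \<bar>h y + h' y - (\<Sum>i<n. c i * indicat_real (D i) y)\<bar> <= \<epsilon>)"
 proof (intro exI[of _ "n + n'"] exI[of _ "\<lambda>i. if i < n then c i else c' (i - n)"]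
     exI[of _ "\<lambda>i. if i < n then D i else D' (i - n)"] conjI allI impI)
  fix i assume "i < n + n'"
  then show "downset (if i < n then D i else D' (i - n))" using 1(1) 2(1) by auto
 next
  have "(\<Sum>i<n+n'. \<bar>if i < n then c i else c' (i - n)\<bar>) = (\<Sum>i<n+n'. if i < n then \<bar>c i\<bar> else \<bar>c' (i - n)\<bar>)"
   by (intro sum.cong) auto
  then show "(\<Sum>i<n+n'. \<bar>if i < n then c i else c' (i - n)\<bar>) <= B + B'"
   using split[of "\<lambda>i. \<bar>c i\<bar>" "\<lambda>i. \<bar>c' i\<bar>"] 1(2) 2(2) by simp
 next
  fix y
  have "(\<Sum>i<n+n'. (if i < n then c i else c' (i - n)) * indicat_real (if i < n then D i else D' (i - n)) y)
   = (\<Sum>i<n+n'. if i < n then c i * indicat_real (D i) y else c' (i - n) * indicat_real (D' (i - n)) y)"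
   by (intro sum.cong) auto
  also have "... = (\<Sum>i<n. c i * indicat_real (D i) y) + (\<Sum>i<n'. c' i * indicat_real (D' i) y)"
   by (rule split[of "\<lambda>i. c i * indicat_real (D i) y" "\<lambda>i. c' i * indicat_real (D' i) y"])
  finally show "\<bar>h y + h' y - (\<Sum>i<n+n'. (if i < n then c i else c' (i - n)) * indicat_real (if i < n then D i else D' (i - n)) y)\<bar> <= \<epsilon>"
   using 1(3)[of y] 2(3)[of y] by linarith
 qed
qed

lemma bv_bounded_scale:
 assumes "bv_bounded B h" shows "bv_bounded (\<bar>a\<bar> * B) (\<lambda>y. a * h y)"
 unfolding bv_bounded_def
proof (intro allI impI)
 fix \<epsilon> :: real assume e: "0 < \<epsilon>"
 obtain n :: nat and c D where 1: "\<And>i. i < n ==> downset (D i)" "(\<Sum>i<n. \<bar>c i\<bar>) <= B"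
   "\<And>y. \<bar>h y - (\<Sum>i<n. c i * indicat_real (D i) y)\<bar> <= \<epsilon> / (\<bar>a\<bar> + 1)"
 proof (rule bv_boundedE[OF assms(1)])
  show "0 < \<epsilon> / (\<bar>a\<bar> + 1)" using e by (simp add: add_nonneg_pos)
 qed (rule that; simp)
 show "\<exists>(n :: nat) c D. (\<forall>i<n. downset (D i)) \<and> (\<Sum>i<n. \<bar>c i\<bar>) <= \<bar>a\<bar> * B \<and>
   (\<forall>y. \<bar>a * h y - (\<Sum>i<n. c i * indicat_real (D i) y)\<bar> <= \<epsilon>)"
 proof (intro exI[of _ n] exI[of _ "\<lambda>i. a * c i"] exI[of _ D] conjI allI impI)
  show "(\<Sum>i<n. \<bar>a * c i\<bar>) <= \<bar>a\<bar> * B"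
   using 1(2) by (simp add: abs_mult sum_distrib_left[symmetric] mult_left_mono)
  fix y
  have "\<bar>a * h y - (\<Sum>i<n. a * c i * indicat_real (D i) y)\<bar> = \<bar>a\<bar> * \<bar>h y - (\<Sum>i<n. c i * indicat_real (D i) y)\<bar>"
   by (simp add: mult.assoc sum_distrib_left[symmetric] right_diff_distrib[symmetric] abs_mult)
  also have "... <= \<bar>a\<bar> * (\<epsilon> / (\<bar>a\<bar> + 1))" using 1(3) by (intro mult_left_mono) auto
  also have "... = (\<bar>a\<bar> / (\<bar>a\<bar> + 1)) * \<epsilon>" by simp
  also have "... <= 1 * \<epsilon>" using e by (intro mult_right_mono) auto
  finally show "\<bar>a * h y - (\<Sum>i<n. a * c i * indicat_real (D i) y)\<bar> <= \<epsilon>" by simp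
 qed (use 1 in auto)
qed

lemma bv_bounded_zero: "0 <= B ==> bv_bounded B (\<lambda>y. 0)"
 by (rule bv_boundedI, rule exI[of _ 0], rule exI[of _ "\<lambda>_. 0"], rule exI[of _ "\<lambda>_. {}"]) auto

lemma bv_bounded_combination:
 assumes "\<And>i. i \<in> A ==> bv_bounded B (h i)" "finite A" "0 <= B"
 shows "bv_bounded ((\<Sum>i\<in>A. \<bar>a i\<bar>) * B) (\<lambda>y. \<Sum>i\<in>A. a i * h i y)"
 using assms(2,1)
proof (induction A rule: finite_induct)
 case empty
 then show ?case by (simp add: bv_bounded_zero)
next
 case (insert i A)
 then show ?case using bv_bounded_add[OF bv_bounded_scale[of B "h i" "a i"], of "(\<Sum>i\<in>A. \<bar>a i\<bar>) * B"]
  by (simp add: distrib_right)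
qed

lemma bv_bounded_borel:
 assumes "bv_bounded B h" shows "h \<in> borel_measurable borel"
proof -
 have "\<forall>m. \<exists>k. k \<in> borel_measurable borel \<and> (\<forall>y. \<bar>h y - k y\<bar> <= 1 / real (Suc m))"
 proof
  fix m
  obtain n :: nat and c D where 0: "\<And>i. i < n ==> downset (D i)" "(\<Sum>i<n. \<bar>c i\<bar>) <= B"
   "\<And>y. \<bar>h y - (\<Sum>i<n. c i * indicat_real (D i) y)\<bar> <= 1 / real (Suc m)"
  proof (rule bv_boundedE[OF assms(1)])
   show "0 < 1 / real (Suc m)" by simp
  qed (rule that; simp)
  note 1 = 0(1,3)
  have "(\<lambda>y. \<Sum>i<n. c i * indicat_real (D i) y) \<in> borel_measurable borel"
   using 1(1) downset_borel by (intro borel_measurable_sum borel_measurable_times borel_measurable_indicator) auto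
  then show "\<exists>k. k \<in> borel_measurable borel \<and> (\<forall>y. \<bar>h y - k y\<bar> <= 1 / real (Suc m))" using 1(2) by blast
 qed
 then obtain k where k: "\<And>m. k m \<in> borel_measurable borel" "\<And>m y. \<bar>h y - k m y\<bar> <= 1 / real (Suc m)" by metis
 have "(\<lambda>m. k m y) \<longlonglongrightarrow> h y" for y
 proof (rule LIMSEQ_I)
  fix r :: real assume "0 < r"
  then obtain N where N: "inverse (real (Suc N)) < r" using reals_Archimedean by blast
  have "norm (k m y - h y) < r" if "N <= m" for m
  proof -
   have "norm (k m y - h y) <= 1 / real (Suc m)" using k(2)[of y m] by (simp add: abs_minus_commute)
   also have "... <= inverse (real (Suc N))" using that by (auto simp: field_simps)
   finally show ?thesis using N by simp
  qed
  then show "\<exists>N. \<forall>m\<ge>N. norm (k m y - h y) < r" by blast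
 qed
 then show ?thesis using k(1) by (intro borel_measurable_LIMSEQ_real[of borel k h]) auto
qed

text \<open>An interval is the difference of the lower set that it generates and the part of the latter that lies below it.\<close>

lemma order_convex_indicator:
 fixes J :: "real set"
 assumes "\<And>x y z. x \<in> J ==> z \<in> J ==> x <= y ==> y <= z ==> y \<in> J"
 obtains D E where "downset D" "downset E" "indicat_real J = (\<lambda>y. indicat_real D y - indicat_real E y)"
proof (rule that[of "{y. \<exists>z\<in>J. y <= z}" "{y. \<exists>z\<in>J. y <= z} - J"])
 show "downset {y. \<exists>z\<in>J. y <= z}" unfolding downset_def using order.trans by fastforce
 show "downset ({y. \<exists>z\<in>J. y <= z} - J)"
  unfolding downset_def
 proof (intro ballI allI impI)
  fix x y assume x: "x \<in> {y. \<exists>z\<in>J. y <= z} - J" and yx: "y <= x"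
  then obtain z where z: "z \<in> J" "x <= z" "x \<notin> J" by blast
  have "y \<notin> J" using assms[of y z x] yx z by blast
  moreover have "y <= z" using yx z(2) by (rule order_trans)
  ultimately show "y \<in> {y. \<exists>z\<in>J. y <= z} - J" using z(1) by blast
 qed
 show "indicat_real J = (\<lambda>y. indicat_real {y. \<exists>z\<in>J. y <= z} y - indicat_real ({y. \<exists>z\<in>J. y <= z} - J) y)"
  by (auto simp: indicator_def fun_eq_iff)
qed

lemma floor_count:
 assumes "0 <= (v::real)" "v <= real n"
 shows "\<bar>v - (\<Sum>k=1..n. if real k <= v then 1 else 0)\<bar> <= 1"
proof -
 define m where "m = nat \<lfloor>v\<rfloor>"
 have m: "real m <= v" "v < real m + 1" using assms by (auto simp: m_def)
 have "real k <= v \<longleftrightarrow> k <= m" for k using m by linarith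
 then have "(\<Sum>k=1..n. if real k <= v then 1 else 0) = (\<Sum>k\<in>{1..n}. if k \<in> {..m} then 1 else (0::real))" by simp
 also have "... = (\<Sum>k\<in>{1..n} \<inter> {..m}. 1)" by (rule sum.inter_restrict[symmetric]) simp
 also have "{1..n} \<inter> {..m} = {1..m}"
 proof -
  have "m <= n" using m assms by linarith
  then show ?thesis by auto
 qed
 finally have "(\<Sum>k=1..n. if real k <= v then 1 else 0) = real m" by simp
 then show ?thesis using m by simp
qed

text \<open>The levels \<open>k B / n\<close> cut \<open>h\<close> into \<open>n\<close> layers of thickness \<open>B / n\<close>. Each level set is an interval, i.e. a difference of two lower sets, whence the factor 2.\<close>

lemma bv_bounded_layers:
 assumes B: "0 < B" and conv: "\<And>t x y z. 0 < t ==> t <= h x ==> t <= h z ==> x <= y ==> y <= z ==> t <= h y"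
  and h: "\<And>y. 0 <= h y" "\<And>y. h y <= B"
 shows "bv_bounded (2 * B) h"
proof -
 have "\<exists>k. bv_bounded (2 * B) k \<and> (\<forall>y. \<bar>h y - k y\<bar> <= \<epsilon>)" if e: "0 < \<epsilon>" for \<epsilon>
 proof -
  obtain n :: nat where n: "B / \<epsilon> < real n" using reals_Archimedean2 by blast
  have n0: "0 < real n" using n B e by (metis divide_pos_pos order_less_trans)
  define k where "k y = (\<Sum>i=1..n. (B / n) * indicat_real {y. real i * (B / n) <= h y} y)" for y
  have "bv_bounded ((\<Sum>i\<in>{1..n}. \<bar>B / n\<bar>) * 2) k"
   unfolding k_def
  proof (rule bv_bounded_combination)
   fix i assume i: "i \<in> {1..n}"
   have pos: "0 < real i * (B / n)" using i B n0 by auto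
   obtain D E where DE: "downset D" "downset E" "indicat_real {y. real i * (B / n) <= h y} = (\<lambda>y. indicat_real D y - indicat_real E y)"
   proof (rule order_convex_indicator[of "{y. real i * (B / n) <= h y}"])
    fix x y z assume "x \<in> {y. real i * (B / n) <= h y}" "z \<in> {y. real i * (B / n) <= h y}" "x <= y" "y <= z"
    then show "y \<in> {y. real i * (B / n) <= h y}" using conv[OF pos, of x z y] by blast
   qed
   have one: "bv_bounded 1 (indicat_real D)" if "downset D" for D
    unfolding bv_bounded_def using that
    by (intro allI impI exI[of _ 1] exI[of _ "\<lambda>_. 1"] exI[of _ "\<lambda>_. D"]) auto
   show "bv_bounded 2 (indicat_real {y. real i * (B / n) <= h y})"
   proof -
    have "indicat_real {y. real i * (B / n) <= h y} = (\<lambda>y. indicat_real D y + (-1) * indicat_real E y)"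
     unfolding DE(3) by simp
    then show ?thesis using bv_bounded_add[OF one[OF DE(1)] bv_bounded_scale[OF one[OF DE(2)], of "-1"]] by simp
   qed
  qed auto
  then have "bv_bounded (2 * B) k" using n0 B by (simp add: mult.commute)
  moreover have "\<bar>h y - k y\<bar> <= \<epsilon>" for y
  proof -
   have ky: "k y = (B / n) * (\<Sum>i=1..n. if real i <= h y * n / B then 1 else 0)"
    unfolding k_def sum_distrib_left using B n0 by (intro sum.cong) (auto simp: indicator_def field_simps)
   then have "\<bar>h y - k y\<bar> = (B / n) * \<bar>h y * n / B - (\<Sum>i=1..n. if real i <= h y * n / B then 1 else 0)\<bar>"
   proof -
    have "h y = (B / n) * (h y * n / B)" using B n0 by simp
    then have "\<bar>h y - k y\<bar> = \<bar>(B / n) * (h y * n / B - (\<Sum>i=1..n. if real i <= h y * n / B then 1 else 0))\<bar>"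
     using ky by (simp only: right_diff_distrib)
    then show ?thesis using B n0 by (simp only: abs_mult) simp
   qed
   also have "... <= (B / n) * 1"
    using B n0 h[of y] by (intro mult_left_mono floor_count) (auto simp: field_simps)
   also have "... <= \<epsilon>" using n n0 e by (simp add: field_simps)
   finally show ?thesis .
  qed
  ultimately show ?thesis by blast
 qed
 note appr = this
 show ?thesis
 proof (rule bv_boundedI)
  fix \<epsilon> :: real assume "0 < \<epsilon>"
  then have e: "0 < \<epsilon> / 2" by simp
  obtain k where k: "bv_bounded (2 * B) k" "\<And>y. \<bar>h y - k y\<bar> <= \<epsilon> / 2" using appr[OF e] by blast
  obtain n :: nat and c D where 1: "\<And>i. i < n ==> downset (D i)" "(\<Sum>i<n. \<bar>c i\<bar>) <= 2 * B"
   "\<And>y. \<bar>k y - (\<Sum>i<n. c i * indicat_real (D i) y)\<bar> <= \<epsilon> / 2"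
   by (rule bv_boundedE[OF k(1) e]) (rule that; simp)
  have "\<bar>h y - (\<Sum>i<n. c i * indicat_real (D i) y)\<bar> <= \<epsilon>" for y using k(2)[of y] 1(3)[of y] by linarith
  then show "\<exists>(n :: nat) c D. (\<forall>i<n. downset (D i)) \<and> (\<Sum>i<n. \<bar>c i\<bar>) <= 2 * B \<and>
   (\<forall>y. \<bar>h y - (\<Sum>i<n. c i * indicat_real (D i) y)\<bar> <= \<epsilon>)"
   using 1(1,2) by (intro exI[of _ n] exI[of _ c] exI[of _ D] conjI allI impI) simp_all
 qed
qed

definition clip :: "real \<Rightarrow> real \<Rightarrow> real" where
 "clip B y = max (- B) (min B y)"

text \<open>The positive and the negative part of a function that is monotone on an interval and null elsewhere have intervals as their level sets; each contributes \<open>2 B\<close>.\<close>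

lemma bv_bounded_clip_monotone:
 assumes I: "is_interval I" and mono: "mono_on I g \<or> antimono_on I g" and out: "\<And>x. x \<notin> I ==> g x = 0" and B: "0 <= B"
 shows "bv_bounded (4 * B) (\<lambda>x. clip B (g x))"
proof (cases "B = 0")
 case True
 then show ?thesis by (simp add: clip_def bv_bounded_zero)
next
 case False
 then have B: "0 < B" using B by simp
 have conv: "t <= f y" if f: "mono_on I f \<or> antimono_on I f" "\<And>x. x \<notin> I ==> f x = 0"
   and t: "0 < t" "t <= f x" "t <= f z" "x <= y" "y <= z" for f :: "real \<Rightarrow> real" and t x y z
 proof -
  have "x \<in> I" "z \<in> I" using f(2) t by force+
  moreover from this have "y \<in> I" using I t unfolding is_interval_1 by blast
  ultimately have "f x <= f y \<or> f z <= f y"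
   using f(1) t(4,5) by (elim disjE) (auto dest: monotone_onD)
  then show ?thesis using t by linarith
 qed
 have part: "bv_bounded (2 * B) (\<lambda>x. max 0 (min B (f x)))"
  if f: "mono_on I f \<or> antimono_on I f" "\<And>x. x \<notin> I ==> f x = 0" for f :: "real \<Rightarrow> real"
 proof (rule bv_bounded_layers[OF B])
  fix t x y z :: real
  assume t: "0 < t" "t <= max 0 (min B (f x))" "t <= max 0 (min B (f z))" "x <= y" "y <= z"
  have "t <= f x" "t <= f z" "t <= B" using t(1-3) by linarith+
  then have "t <= f y" using conv[of f t x z y] f t by blast
  then show "t <= max 0 (min B (f y))" using \<open>t <= B\<close> by simp
 qed (use B in auto)
 have neg: "mono_on I (\<lambda>x. - g x) \<or> antimono_on I (\<lambda>x. - g x)" using mono unfolding monotone_on_def by auto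
 have "bv_bounded (2 * B + \<bar>-1\<bar> * (2 * B)) (\<lambda>x. max 0 (min B (g x)) + (-1) * max 0 (min B (- g x)))"
  by (intro bv_bounded_add bv_bounded_scale part mono neg) (use out in auto)
 moreover have "max 0 (min B (g x)) + (-1) * max 0 (min B (- g x)) = clip B (g x)" for x
  using B by (auto simp: clip_def max_def min_def)
 ultimately show ?thesis by simp
qed

section \<open>Quantile functions and truncation\<close>

definition unif01 :: "real measure" where
 "unif01 = restrict_space lborel {0<..<1}"

lemma space_unif01 [simp]: "space unif01 = {0<..<1}"
 by (simp add: unif01_def space_restrict_space)

lemma emeasure_unif01: "A \<in> sets borel ==> A \<subseteq> {0<..<1} ==> emeasure unif01 A = emeasure lborel A"
 unfolding unif01_def by (subst emeasure_restrict_space) auto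

lemma prob_space_unif01: "prob_space unif01"
proof
 show "emeasure unif01 (space unif01) = 1"
  by (simp add: emeasure_unif01)
qed

lemma measurable_unif01: "f \<in> borel_measurable borel ==> f \<in> borel_measurable unif01"
 unfolding unif01_def by (intro measurable_restrict_space1) simp

lemma nn_integral_unif01:
 "(\<integral>\<^sup>+u. f u \<partial>unif01) = (\<integral>\<^sup>+u\<in>{0<..<1}. f u \<partial>lborel)"
 unfolding unif01_def by (rule nn_integral_restrict_space) auto

lemma nn_integral_unif01_le:
 "(\<integral>\<^sup>+u. f u \<partial>unif01) <= (\<integral>\<^sup>+u\<in>{0..1}. f u \<partial>lborel)"
 unfolding nn_integral_unif01 by (intro nn_integral_mono) (auto simp: indicator_def)

lemma antimono_measurable_unif01:
 fixes f :: "real \<Rightarrow> real"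
 assumes "\<And>u v. 0 < u ==> u <= v ==> v < 1 ==> f v <= f u"
 shows "f \<in> borel_measurable unif01"
proof -
 have "(\<lambda>u. - f u) \<in> borel_measurable (restrict_space borel {0<..<1})"
  by (rule borel_measurable_mono_on_fnc) (auto simp: monotone_on_def assms)
 then have "(\<lambda>u. - (- f u)) \<in> borel_measurable (restrict_space borel {0<..<1})" by measurable
 then show ?thesis unfolding unif01_def
  by (simp cong: measurable_cong_sets add: sets_restrict_space)
qed

text \<open>The layer-cake formula.\<close>

lemma nn_integral_tail:
 assumes "sigma_finite_measure M" and Z: "Z \<in> borel_measurable M"
 shows "(\<integral>\<^sup>+w. ennreal (Z w) \<partial>M) = (\<integral>\<^sup>+t. indicator {0..} t * emeasure M {w \<in> space M. t < Z w} \<partial>lborel)"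
proof -
 interpret sigma_finite_measure M by fact
 interpret pair_sigma_finite M lborel by unfold_locales
 have "(\<integral>\<^sup>+w. ennreal (Z w) \<partial>M) = (\<integral>\<^sup>+w. \<integral>\<^sup>+t. indicator {0..} t * indicator {t. t < Z w} t \<partial>lborel \<partial>M)"
 proof (rule nn_integral_cong)
  fix w
  have "(\<integral>\<^sup>+t. indicator {0..} t * indicator {t. t < Z w} t \<partial>lborel) = (\<integral>\<^sup>+t. indicator {0..<Z w} t \<partial>lborel)"
   by (intro nn_integral_cong) (auto simp: indicator_def)
  also have "... = ennreal (Z w)"
   by (cases "0 <= Z w") (auto simp: ennreal_neg)
  finally show "ennreal (Z w) = (\<integral>\<^sup>+t. indicator {0..} t * indicator {t. t < Z w} t \<partial>lborel)" by simp
 qed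
 also have "... = (\<integral>\<^sup>+w. \<integral>\<^sup>+t. indicator {0..} t * (if t < Z w then 1 else 0) \<partial>lborel \<partial>M)"
  by (intro nn_integral_cong) (auto simp: indicator_def)
 also have "... = (\<integral>\<^sup>+t. \<integral>\<^sup>+w. indicator {0..} t * (if t < Z w then 1 else 0) \<partial>M \<partial>lborel)"
  by (rule Fubini'[symmetric]) (use Z in measurable)
 also have "... = (\<integral>\<^sup>+t. indicator {0..} t * emeasure M {w \<in> space M. t < Z w} \<partial>lborel)"
 proof (rule nn_integral_cong)
  fix t
  have "(\<integral>\<^sup>+w. indicator {0..} t * (if t < Z w then 1 else 0) \<partial>M) = indicator {0..} t * (\<integral>\<^sup>+w. (if t < Z w then 1 else 0) \<partial>M)"
   using Z by (intro nn_integral_cmult) measurable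
  also have "(\<integral>\<^sup>+w. (if t < Z w then 1 else 0) \<partial>M) = (\<integral>\<^sup>+w. indicator {w \<in> space M. t < Z w} w \<partial>M)"
   by (intro nn_integral_cong) (auto simp: indicator_def)
  also have "... = emeasure M {w \<in> space M. t < Z w}"
   using Z by (intro nn_integral_indicator) measurable
  finally show "(\<integral>\<^sup>+w. indicator {0..} t * (if t < Z w then 1 else 0) \<partial>M) = indicator {0..} t * emeasure M {w \<in> space M. t < Z w}" .
 qed
 finally show ?thesis .
qed

lemma nn_integral_le_of_tails:
 assumes "sigma_finite_measure M" "sigma_finite_measure N"
  and Z: "Z \<in> borel_measurable M" and W: "W \<in> borel_measurable N"
  and tails: "\<And>t. 0 <= t ==> emeasure M {w \<in> space M. t < Z w} <= emeasure N {w \<in> space N. t < W w}"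
 shows "(\<integral>\<^sup>+w. ennreal (Z w) \<partial>M) <= (\<integral>\<^sup>+w. ennreal (W w) \<partial>N)"
 unfolding nn_integral_tail[OF assms(1) Z] nn_integral_tail[OF assms(2) W]
 by (intro nn_integral_mono) (auto simp: indicator_def tails)

text \<open>Finite-valued on \<open>(0, 1)\<close>; the default at points where the quantile is infinite does not matter for integrals over \<open>unif01\<close>.\<close>

definition quant :: "(real \<Rightarrow> real) \<Rightarrow> real \<Rightarrow> real" where
 "quant H u = enn2real (quantile_function H u)"

lemma tail_function_eventually_le:
 assumes H: "tail_function H" and u: "0 < u"
 obtains t where "0 <= t" "H t <= u"
proof -
 have "eventually (\<lambda>t. H t < u) at_top"
  using H u unfolding tail_function_def by (auto intro: order_tendstoD)
 then obtain N where N: "\<And>t. N <= t ==> H t < u" by (auto simp: eventually_at_top_linorder)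
 show ?thesis using N[of "max 0 N"] by (intro that[of "max 0 N"]) auto
qed

lemma quantile_function_finite:
 assumes H: "tail_function H" and u: "0 < u"
 shows "quantile_function H u < \<infinity>"
proof -
 obtain t where t: "0 <= t" "H t <= u" using tail_function_eventually_le[OF H u] by blast
 have "quantile_function H u <= ennreal t" unfolding quantile_function_def
  by (rule INF_lower) (use t in auto)
 then show ?thesis by (simp add: le_less_trans)
qed

lemma quantile_function_eq: "tail_function H ==> 0 < u ==> quantile_function H u = ennreal (quant H u)"
 using quantile_function_finite[of H u] by (simp add: quant_def)

lemma quant_nonneg [simp]: "0 <= quant H u" by (simp add: quant_def)

lemma quant_le: 
 assumes "0 <= t" "H t <= u" shows "quant H u <= t"
proof -
 have "quantile_function H u <= ennreal t" unfolding quantile_function_def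
  by (rule INF_lower) (use assms in auto)
 then show ?thesis using assms by (simp add: quant_def enn2real_leI)
qed

lemma less_quant:
 assumes H: "tail_function H" and u: "0 < u" and t: "0 <= t" "u < H t"
 shows "t < quant H u"
proof -
 have "continuous (at_right t) H" using H t by (simp add: tail_function_def)
 then have "(H \<longlongrightarrow> H t) (at_right t)" by (simp add: continuous_within)
 then have "eventually (\<lambda>s. u < H s) (at_right t)" using t by (auto intro: order_tendstoD)
 then obtain b where b: "t < b" "\<And>s. t < s ==> s < b ==> u < H s"
  unfolding eventually_at_right[OF less_add_one[of t]] by blast
 define s where "s = (t + b) / 2"
 have s: "t < s" "u < H s" using b by (auto simp: s_def)
 have "ennreal s <= quantile_function H u"
  unfolding quantile_function_def
 proof (rule INF_greatest)
  fix r assume r: "r \<in> {t. 0 <= t \<and> H t <= u}"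
  have "s <= r"
  proof (rule ccontr)
   assume "\<not> s <= r"
   then have "H s <= H r" using H r s t unfolding tail_function_def monotone_on_def by auto
   then show False using r s by simp
  qed
  then show "ennreal s <= ennreal r" by (rule ennreal_leI)
 qed
 then have "s <= quant H u"
  using quantile_function_eq[OF H u] by (simp add: ennreal_le_iff)
 then show ?thesis using s by simp
qed

lemma less_quant_iff:
 assumes "tail_function H" "0 < u" "0 <= t"
 shows "t < quant H u \<longleftrightarrow> u < H t"
 using less_quant[OF assms] quant_le[of t H u] assms by (meson leD not_less)

lemma quant_antimono:
 assumes H: "tail_function H" and u: "0 < u" "u <= v"
 shows "quant H v <= quant H u"
proof (rule ccontr)
 assume "\<not> quant H v <= quant H u"
 then have "v < H (quant H u)" using less_quant_iff[OF H, of v "quant H u"] u by auto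
 then have "quant H u < quant H u" using less_quant_iff[OF H u(1), of "quant H u"] u by auto
 then show False by simp
qed

lemma quant_measurable [measurable]: "tail_function H ==> quant H \<in> borel_measurable unif01"
 by (intro antimono_measurable_unif01 quant_antimono) auto

lemma measure_quant_tail:
 assumes H: "tail_function H" and t: "0 <= t"
 shows "measure unif01 {u \<in> space unif01. t < quant H u} = H t"
proof -
 have Ht: "0 <= H t" "H t <= 1" using H t by (auto simp: tail_function_def)
 have eq: "{u \<in> space unif01. t < quant H u} = {0<..<H t} \<inter> {0<..<1}"
  using less_quant_iff[OF H _ t] by auto
 have "emeasure unif01 {u \<in> space unif01. t < quant H u} = emeasure lborel ({0<..<H t} \<inter> {0<..<1})"
  unfolding eq by (rule emeasure_unif01) auto
 also have "{0<..<H t} \<inter> {0<..<1} = {0<..<H t}" using Ht by auto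
 also have "emeasure lborel {0<..<H t} = ennreal (H t)" using Ht by simp
 finally show ?thesis using Ht by (simp add: measure_def)
qed

text \<open>The quantile has tail exactly \<open>H\<close> under the uniform law, hence dominates every variable with a smaller tail in all increasing functionals.\<close>

lemma tail_dominated_moment:
 assumes H: "tail_function H" and \<mu>: "prob_space \<mu>" and Z: "Z \<in> borel_measurable \<mu>"
  and tail: "\<And>t. 0 <= t ==> measure \<mu> {x \<in> space \<mu>. t < Z x} <= H t"
  and B: "0 <= B" and r: "0 < r"
 shows "(\<integral>\<^sup>+x. ennreal (max 0 (min (Z x) L - B) powr r) \<partial>\<mu>) <= (\<integral>\<^sup>+u. ennreal (max 0 (min (quant H u) L - B) powr r) \<partial>unif01)"
  "(\<integral>\<^sup>+x. ennreal (max 0 (Z x - B)) \<partial>\<mu>) <= (\<integral>\<^sup>+u. ennreal (max 0 (quant H u - B)) \<partial>unif01)"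
proof -
 interpret \<mu>: prob_space \<mu> by fact
 interpret U: prob_space unif01 by (rule prob_space_unif01)
 have sf: "sigma_finite_measure \<mu>" "sigma_finite_measure unif01" by unfold_locales
 have em: "emeasure \<mu> {x \<in> space \<mu>. t < Z x} <= emeasure unif01 {u \<in> space unif01. t < quant H u}" if "0 <= t" for t
  using tail[OF that] measure_quant_tail[OF H that]
  by (simp add: \<mu>.emeasure_eq_measure U.emeasure_eq_measure ennreal_leI)
 have key: "t < max 0 (min z L - B) powr r \<longleftrightarrow> t powr (1/r) + B < L \<and> t powr (1/r) + B < z" if "0 <= t" for t z
 proof -
  have "t < max 0 (min z L - B) powr r \<longleftrightarrow> t powr (1/r) < max 0 (min z L - B)"
  proof
   assume "t < max 0 (min z L - B) powr r"
   then have "t powr (1/r) < (max 0 (min z L - B) powr r) powr (1/r)" using that r by (intro powr_less_mono2) auto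
   then show "t powr (1/r) < max 0 (min z L - B)" using r by (simp add: powr_powr)
  next
   assume "t powr (1/r) < max 0 (min z L - B)"
   then have "(t powr (1/r)) powr r < max 0 (min z L - B) powr r" using r by (intro powr_less_mono2) auto
   then show "t < max 0 (min z L - B) powr r" using r that by (simp add: powr_powr)
  qed
  also have "... \<longleftrightarrow> t powr (1/r) + B < L \<and> t powr (1/r) + B < z" using powr_ge_zero[of t "1/r"] by (auto simp: less_max_iff_disj less_diff_eq not_less)
  finally show ?thesis .
 qed
 show "(\<integral>\<^sup>+x. ennreal (max 0 (min (Z x) L - B) powr r) \<partial>\<mu>) <= (\<integral>\<^sup>+u. ennreal (max 0 (min (quant H u) L - B) powr r) \<partial>unif01)"
 proof (rule nn_integral_le_of_tails[OF sf])
  fix t :: real assume t: "0 <= t"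
  show "emeasure \<mu> {x \<in> space \<mu>. t < max 0 (min (Z x) L - B) powr r} <= emeasure unif01 {u \<in> space unif01. t < max 0 (min (quant H u) L - B) powr r}"
   unfolding key[OF t] using em[of "t powr (1/r) + B"] B by (cases "t powr (1/r) + B < L") auto
 qed (use Z H in measurable)
 show "(\<integral>\<^sup>+x. ennreal (max 0 (Z x - B)) \<partial>\<mu>) <= (\<integral>\<^sup>+u. ennreal (max 0 (quant H u - B)) \<partial>unif01)"
 proof (rule nn_integral_le_of_tails[OF sf])
  fix t :: real assume t: "0 <= t"
  have "t < max 0 (z - B) \<longleftrightarrow> t + B < z" for z using t by (auto simp: max_def)
  then show "emeasure \<mu> {x \<in> space \<mu>. t < max 0 (Z x - B)} <= emeasure unif01 {u \<in> space unif01. t < max 0 (quant H u - B)}"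
   using em[of "t + B"] t B by simp
 qed (use Z H in measurable)
qed

text \<open>Jensen; the missing mass \<open>1 - \<Sum> |a l|\<close> is placed at 0.\<close>

lemma convex_combination_powr_le:
 fixes a d :: "'b \<Rightarrow> real"
 assumes fin: "finite A" and a: "(\<Sum>l\<in>A. \<bar>a l\<bar>) <= 1" and r: "1 <= r"
 shows "\<bar>\<Sum>l\<in>A. a l * d l\<bar> powr r <= (\<Sum>l\<in>A. \<bar>a l\<bar> * \<bar>d l\<bar> powr r)"
proof -
 define x where "x = (\<Sum>l\<in>A. \<bar>a l\<bar> * \<bar>d l\<bar>)"
 have x: "0 <= x" unfolding x_def by (intro sum_nonneg) auto
 have le: "\<bar>\<Sum>l\<in>A. a l * d l\<bar> <= x" unfolding x_def abs_mult[symmetric] by (rule sum_abs)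
 show ?thesis
 proof (cases "r = 1")
  case True
  then show ?thesis using le by (simp add: x_def)
 next
  case False
  then have r: "1 < r" using r by simp
  define S where "S = (\<Sum>l\<in>A. \<bar>a l\<bar>)"
  have "\<bar>\<Sum>l\<in>A. a l * d l\<bar> powr r <= x powr r" using le r by (intro powr_mono2) auto
  also have "... <= x powr r + (1 - S) * ((r - 1) * x powr r)"
   using a r by (simp add: S_def)
  also have "... = S * x powr r + r * x powr (r - 1) * (x - S * x)"
  proof -
   have "x powr (r - 1) * x = x powr r" using x powr_add[of x "r - 1" 1] by (cases "x = 0") auto
   then have "r * x powr (r - 1) * (x - S * x) = r * (1 - S) * x powr r" by (simp add: algebra_simps)
   then show ?thesis by (simp add: algebra_simps)
  qed
  also have "... = (\<Sum>l\<in>A. \<bar>a l\<bar> * (\<bar>x\<bar> powr r + r * spow (r - 1) x * (\<bar>d l\<bar> - x)))"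
  proof -
   have "spow (r - 1) x = x powr (r - 1)" using x by (cases "x = 0") (auto simp: spow_def)
   moreover have "(\<Sum>l\<in>A. \<bar>a l\<bar> * (\<bar>d l\<bar> - x)) = x - S * x"
    by (simp add: x_def S_def right_diff_distrib sum_subtractf sum_distrib_right)
   ultimately show ?thesis using x
    by (simp add: distrib_left sum.distrib S_def sum_distrib_right[symmetric] mult.left_commute[of "\<bar>_\<bar>"] sum_distrib_left[symmetric])
  qed
  also have "... <= (\<Sum>l\<in>A. \<bar>a l\<bar> * \<bar>d l\<bar> powr r)"
   using abs_powr_tangent[OF r, of x] by (intro sum_mono mult_left_mono) (auto, metis abs_abs)
  finally show ?thesis .
 qed
qed

lemma clip_abs: "0 <= B ==> \<bar>clip B y\<bar> <= B"
 by (auto simp: clip_def)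

lemma clip_diff_abs: "0 <= B ==> B <= L ==> \<bar>clip L y - clip B y\<bar> = max 0 (min \<bar>y\<bar> L - B)"
 by (auto simp: clip_def max_def min_def)

lemma clip_rest_abs: "0 <= B ==> \<bar>y - clip B y\<bar> = max 0 (\<bar>y\<bar> - B)"
 by (auto simp: clip_def max_def min_def)

lemma bv_bounded_mono: 
 assumes "bv_bounded B h" "B <= B'" shows "bv_bounded B' h"
proof (rule bv_boundedI)
 fix \<epsilon> :: real assume "0 < \<epsilon>"
 then obtain n :: nat and c D where 1: "\<And>i. i < n ==> downset (D i)" "(\<Sum>i<n. \<bar>c i\<bar>) <= B"
   "\<And>y. \<bar>h y - (\<Sum>i<n. c i * indicat_real (D i) y)\<bar> <= \<epsilon>"
  by (rule bv_boundedE[OF assms(1)]) (rule that; simp)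
 then show "\<exists>(n :: nat) c D. (\<forall>i<n. downset (D i)) \<and> (\<Sum>i<n. \<bar>c i\<bar>) <= B' \<and>
   (\<forall>y. \<bar>h y - (\<Sum>i<n. c i * indicat_real (D i) y)\<bar> <= \<epsilon>)"
  using assms(2) by (intro exI[of _ n] exI[of _ c] exI[of _ D] conjI allI impI) auto
qed

lemma Mon_class_clip_bv:
 assumes "g \<in> Mon_class H \<mu>" "0 <= B" shows "bv_bounded (4 * B) (\<lambda>x. clip B (g x))"
proof -
 from assms(1) obtain I where "is_interval I" "mono_on I g \<or> antimono_on I g" "\<forall>x. x \<notin> I --> g x = 0"
  unfolding Mon_class_def by blast
 then show ?thesis using bv_bounded_clip_monotone[of I g B] assms(2) by blast
qed

lemma Mon_class_borel:
 assumes "g \<in> Mon_class H \<mu>" shows "g \<in> borel_measurable borel"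
proof (rule borel_measurable_LIMSEQ_real[where u="\<lambda>n x. clip (real n) (g x)"])
 show "(\<lambda>x. clip (real n) (g x)) \<in> borel_measurable borel" for n
  using bv_bounded_borel[OF Mon_class_clip_bv[OF assms]] by simp
 fix x
 obtain N :: nat where N: "\<bar>g x\<bar> < real N" using reals_Archimedean2 by blast
 have "eventually (\<lambda>n. clip (real n) (g x) = g x) sequentially"
  by (rule eventually_sequentiallyI[of N]) (use N in \<open>auto simp: clip_def max_def min_def\<close>)
 then show "(\<lambda>n. clip (real n) (g x)) \<longlonglongrightarrow> g x" by (rule tendsto_eventually)
qed

text \<open>All that is needed of a convex combination of monotone functions: truncations at every height whose errors are measured by the quantile alone, uniformly in the number of functions combined.\<close>

definition truncation_family :: "(real \<Rightarrow> real) \<Rightarrow> real measure \<Rightarrow> (real \<Rightarrow> real) \<Rightarrow> (real \<Rightarrow> real \<Rightarrow> real) \<Rightarrow> bool" where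
 "truncation_family H \<mu> h lo \<longleftrightarrow> h \<in> borel_measurable borel \<and>
   (\<forall>B\<ge>0. bv_bounded (4 * B) (lo B) \<and> (\<forall>x. \<bar>lo B x\<bar> <= B) \<and>
    (\<integral>\<^sup>+x. ennreal \<bar>h x - lo B x\<bar> \<partial>\<mu>) <= (\<integral>\<^sup>+u. ennreal (max 0 (quant H u - B)) \<partial>unif01)) \<and>
   (\<forall>B L r. 0 <= B --> B <= L --> 1 <= r -->
    (\<integral>x. \<bar>lo L x - lo B x\<bar> powr r \<partial>\<mu>) <= (\<integral>u. max 0 (min (quant H u) L - B) powr r \<partial>unif01))"

text \<open>Each monotone function is clipped separately, before the combination is formed. Clipping the combination would spoil the bound on the variation.\<close>

lemma Mon_combination_truncation:
 assumes H: "tail_function H" and \<mu>: "prob_space \<mu>" and sets: "sets \<mu> = sets borel"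
  and h: "h \<in> Mon_combinations H \<mu>"
 shows "\<exists>lo. truncation_family H \<mu> h lo"
proof -
 interpret \<mu>: prob_space \<mu> by fact
 interpret U: prob_space unif01 by (rule prob_space_unif01)
 obtain K :: nat and a :: "nat \<Rightarrow> real" and g :: "nat \<Rightarrow> real \<Rightarrow> real"
  where a: "(\<Sum>l = 1..K. \<bar>a l\<bar>) <= 1" and g: "\<And>l. l \<in> {1..K} ==> g l \<in> Mon_class H \<mu>"
   and h: "h = (\<lambda>x. \<Sum>l = 1..K. a l * g l x)"
  using h unfolding Mon_combinations_def by blast
 have gb: "g l \<in> borel_measurable borel" if "l \<in> {1..K}" for l using Mon_class_borel[OF g[OF that]] .
 have g\<mu>: "g l \<in> borel_measurable \<mu>" if "l \<in> {1..K}" for l using gb[OF that] sets by (simp cong: measurable_cong_sets)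
 have tail: "measure \<mu> {x \<in> space \<mu>. t < \<bar>g l x\<bar>} <= H t" if "l \<in> {1..K}" "0 <= t" for l t
  using g[OF that(1)] that(2) unfolding Mon_class_def by auto
 define lo where "lo B x = (\<Sum>l=1..K. a l * clip B (g l x))" for B x
 have bv: "bv_bounded (4 * B) (lo B)" if B: "0 <= B" for B
 proof -
  have "bv_bounded ((\<Sum>l\<in>{1..K}. \<bar>a l\<bar>) * (4 * B)) (lo B)"
   unfolding lo_def using B by (intro bv_bounded_combination Mon_class_clip_bv[OF g]) auto
  moreover have "(\<Sum>l\<in>{1..K}. \<bar>a l\<bar>) * (4 * B) <= 4 * B" using a B mult_right_mono[OF a, of "4 * B"] by simp
  ultimately show ?thesis by (rule bv_bounded_mono)
 qed
 have bd: "\<bar>lo B x\<bar> <= B" if B: "0 <= B" for B x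
 proof -
  have "\<bar>lo B x\<bar> <= (\<Sum>l=1..K. \<bar>a l\<bar> * \<bar>clip B (g l x)\<bar>)" unfolding lo_def abs_mult[symmetric] by (rule sum_abs)
  also have "... <= (\<Sum>l=1..K. \<bar>a l\<bar> * B)" using clip_abs[OF B] by (intro sum_mono mult_left_mono) auto
  also have "... <= 1 * B" unfolding sum_distrib_right[symmetric] using a B by (intro mult_right_mono)
  finally show ?thesis by simp
 qed
 have lob: "lo B \<in> borel_measurable borel" if "0 <= B" for B using bv_bounded_borel[OF bv[OF that]] .
 have lo\<mu>: "lo B \<in> borel_measurable \<mu>" if "0 <= B" for B using lob[OF that] sets by (simp cong: measurable_cong_sets)
 have rest: "(\<integral>\<^sup>+x. ennreal \<bar>h x - lo B x\<bar> \<partial>\<mu>) <= (\<integral>\<^sup>+u. ennreal (max 0 (quant H u - B)) \<partial>unif01)" if B: "0 <= B" for B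
 proof -
  let ?J = "\<integral>\<^sup>+u. ennreal (max 0 (quant H u - B)) \<partial>unif01"
  have "(\<integral>\<^sup>+x. ennreal \<bar>h x - lo B x\<bar> \<partial>\<mu>) <= (\<integral>\<^sup>+x. (\<Sum>l=1..K. ennreal \<bar>a l\<bar> * ennreal (max 0 (\<bar>g l x\<bar> - B))) \<partial>\<mu>)"
  proof (rule nn_integral_mono)
   fix x
   have "h x - lo B x = (\<Sum>l=1..K. a l * (g l x - clip B (g l x)))"
    by (simp add: h lo_def right_diff_distrib sum_subtractf)
   then have "\<bar>h x - lo B x\<bar> <= (\<Sum>l=1..K. \<bar>a l\<bar> * max 0 (\<bar>g l x\<bar> - B))"
    using sum_abs[of "\<lambda>l. a l * (g l x - clip B (g l x))" "{1..K}"] by (simp add: abs_mult clip_rest_abs[OF B])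
   then have "ennreal \<bar>h x - lo B x\<bar> <= ennreal (\<Sum>l=1..K. \<bar>a l\<bar> * max 0 (\<bar>g l x\<bar> - B))" by (rule ennreal_leI)
   also have "... = (\<Sum>l=1..K. ennreal \<bar>a l\<bar> * ennreal (max 0 (\<bar>g l x\<bar> - B)))"
    by (subst sum_ennreal[symmetric]) (auto simp: ennreal_mult)
   finally show "ennreal \<bar>h x - lo B x\<bar> <= (\<Sum>l=1..K. ennreal \<bar>a l\<bar> * ennreal (max 0 (\<bar>g l x\<bar> - B)))" .
  qed
  also have "... = (\<Sum>l=1..K. \<integral>\<^sup>+x. ennreal \<bar>a l\<bar> * ennreal (max 0 (\<bar>g l x\<bar> - B)) \<partial>\<mu>)"
  proof (rule nn_integral_sum)
   fix l assume "l \<in> {1..K}"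
   note [measurable] = g\<mu>[OF this]
   show "(\<lambda>x. ennreal \<bar>a l\<bar> * ennreal (max 0 (\<bar>g l x\<bar> - B))) \<in> borel_measurable \<mu>" by measurable
  qed
  also have "... <= (\<Sum>l=1..K. ennreal \<bar>a l\<bar> * ?J)"
  proof (rule sum_mono)
   fix l assume l: "l \<in> {1..K}"
   note [measurable] = g\<mu>[OF l]
   have "(\<integral>\<^sup>+x. ennreal \<bar>a l\<bar> * ennreal (max 0 (\<bar>g l x\<bar> - B)) \<partial>\<mu>) = ennreal \<bar>a l\<bar> * (\<integral>\<^sup>+x. ennreal (max 0 (\<bar>g l x\<bar> - B)) \<partial>\<mu>)"
    by (rule nn_integral_cmult) measurable
   also have "... <= ennreal \<bar>a l\<bar> * ?J"
    using tail_dominated_moment(2)[OF H \<mu> _ tail[OF l] B, of 1] by (intro mult_left_mono) auto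
   finally show "(\<integral>\<^sup>+x. ennreal \<bar>a l\<bar> * ennreal (max 0 (\<bar>g l x\<bar> - B)) \<partial>\<mu>) <= ennreal \<bar>a l\<bar> * ?J" .
  qed
  also have "... = ennreal (\<Sum>l=1..K. \<bar>a l\<bar>) * ?J"
   by (simp add: sum_distrib_right[symmetric])
  also have "... <= 1 * ?J" using a by (intro mult_right_mono) auto
  finally show ?thesis by simp
 qed
 have mom: "(\<integral>x. \<bar>lo L x - lo B x\<bar> powr r \<partial>\<mu>) <= (\<integral>u. max 0 (min (quant H u) L - B) powr r \<partial>unif01)"
  if B: "0 <= B" "B <= L" and r: "1 <= r" for B L r
 proof -
  let ?J = "\<integral>u. max 0 (min (quant H u) L - B) powr r \<partial>unif01"
  define d where "d l x = max 0 (min \<bar>g l x\<bar> L - B)" for l x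
  have dm: "(\<lambda>x. d l x powr r) \<in> borel_measurable \<mu>" if "l \<in> {1..K}" for l
  proof -
   note [measurable] = g\<mu>[OF that]
   show ?thesis unfolding d_def by measurable
  qed
  have di: "integrable \<mu> (\<lambda>x. d l x powr r)" if "l \<in> {1..K}" for l
   by (rule \<mu>.integrable_const_bound[where B="L powr r"])
     (use dm[OF that] B r in \<open>auto simp: d_def intro!: powr_mono2\<close>)
  have ui: "integrable unif01 (\<lambda>u. max 0 (min (quant H u) L - B) powr r)"
   by (rule U.integrable_const_bound[where B="L powr r"])
     (use H B r in \<open>auto intro!: powr_mono2 measurable_compose[OF quant_measurable]\<close>)
  have one: "(\<integral>x. d l x powr r \<partial>\<mu>) <= ?J" if l: "l \<in> {1..K}" for l
  proof -
   have "ennreal (\<integral>x. d l x powr r \<partial>\<mu>) = (\<integral>\<^sup>+x. ennreal (d l x powr r) \<partial>\<mu>)"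
    using di[OF l] by (intro nn_integral_eq_integral[symmetric]) auto
   also have "... <= (\<integral>\<^sup>+u. ennreal (max 0 (min (quant H u) L - B) powr r) \<partial>unif01)"
    unfolding d_def using tail_dominated_moment(1)[OF H \<mu> _ tail[OF l] B(1)] g\<mu>[OF l] r by auto
   also have "... = ennreal ?J" using ui by (intro nn_integral_eq_integral) auto
   finally show ?thesis by (simp add: ennreal_le_iff)
  qed
  have J0: "0 <= ?J" by simp
  have "(\<integral>x. \<bar>lo L x - lo B x\<bar> powr r \<partial>\<mu>) <= (\<integral>x. (\<Sum>l=1..K. \<bar>a l\<bar> * d l x powr r) \<partial>\<mu>)"
  proof (rule integral_mono)
   show "integrable \<mu> (\<lambda>x. \<bar>lo L x - lo B x\<bar> powr r)"
   proof (rule \<mu>.integrable_const_bound[where B="(2 * L) powr r"])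
    show "AE x in \<mu>. norm (\<bar>lo L x - lo B x\<bar> powr r) <= (2 * L) powr r"
    proof (intro AE_I2)
     fix x
     have "\<bar>lo L x - lo B x\<bar> <= 2 * L" using bd[of L x] bd[of B x] B by linarith
     then show "norm (\<bar>lo L x - lo B x\<bar> powr r) <= (2 * L) powr r" using r by (auto intro: powr_mono2)
    qed
    note [measurable] = lo\<mu>
    show "(\<lambda>x. \<bar>lo L x - lo B x\<bar> powr r) \<in> borel_measurable \<mu>" using lo\<mu>[of L] lo\<mu>[of B] B by auto
   qed
   show "integrable \<mu> (\<lambda>x. \<Sum>l=1..K. \<bar>a l\<bar> * d l x powr r)" using di by (intro integrable_setsum) auto
   fix x
   have "lo L x - lo B x = (\<Sum>l=1..K. a l * (clip L (g l x) - clip B (g l x)))"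
    by (simp add: lo_def right_diff_distrib sum_subtractf)
   then show "\<bar>lo L x - lo B x\<bar> powr r <= (\<Sum>l=1..K. \<bar>a l\<bar> * d l x powr r)"
    using convex_combination_powr_le[OF _ a r, of "\<lambda>l. clip L (g l x) - clip B (g l x)"] by (simp add: d_def clip_diff_abs[OF B])
  qed
  also have "... = (\<Sum>l=1..K. \<bar>a l\<bar> * (\<integral>x. d l x powr r \<partial>\<mu>))"
   using di by (subst expect_sum) auto
  also have "... <= (\<Sum>l=1..K. \<bar>a l\<bar> * ?J)" using one by (intro sum_mono mult_left_mono) auto
  also have "... = (\<Sum>l=1..K. \<bar>a l\<bar>) * ?J" by (simp add: sum_distrib_right)
  also have "... <= 1 * ?J" using a J0 by (intro mult_right_mono)
  finally show ?thesis by simp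
 qed
 have "h \<in> borel_measurable borel" unfolding h using gb by (intro borel_measurable_sum borel_measurable_times) auto
 then show ?thesis unfolding truncation_family_def using bv bd rest mom by blast
qed

section \<open>Mixing coefficients for lower sets\<close>

text \<open>The covariance of a past variable and a later one.\<close>

definition (in prob_space) assoc :: "('a \<Rightarrow> real) \<Rightarrow> ('a \<Rightarrow> real) \<Rightarrow> real" where
 "assoc \<xi> f = (\<E> w. \<xi> w * f w) - expectation \<xi> * expectation f"

context prob_space begin

lemma assoc_diff_le:
 assumes "brv M \<xi>" "brv M f" "brv M g" "\<And>w. \<bar>\<xi> w\<bar> <= 1" "\<And>w. \<bar>f w - g w\<bar> <= \<epsilon>"
 shows "\<bar>assoc \<xi> f - assoc \<xi> g\<bar> <= 2 * \<epsilon>"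
proof -
 have i: "integrable M f" "integrable M g" "integrable M \<xi>" "integrable M (\<lambda>w. \<xi> w * f w)" "integrable M (\<lambda>w. \<xi> w * g w)"
  using assms by (auto intro!: brv_integrable brv_mult)
 have e0: "0 <= \<epsilon>" using assms(5) abs_ge_zero order_trans by blast
 have bd: "\<bar>expectation h\<bar> <= c" if "brv M h" "\<And>w. \<bar>h w\<bar> <= c" for h c
 proof -
  have "\<bar>expectation h\<bar> <= (\<E> w. \<bar>h w\<bar>)" by (rule integral_abs_bound)
  also have "... <= (\<E> w. c)" using that by (intro integral_mono brv_integrable brv_abs brv_const) auto
  finally show ?thesis by (simp add: prob_space)
 qed
 have "\<bar>(\<E> w. \<xi> w * (f w - g w))\<bar> <= \<epsilon>"
 proof (rule bd)
  show "brv M (\<lambda>w. \<xi> w * (f w - g w))" using assms by (intro brv_mult brv_diff)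
  show "\<bar>\<xi> w * (f w - g w)\<bar> <= \<epsilon>" for w
   using mult_mono[OF assms(4,5)[of w]] by (simp add: abs_mult)
 qed
 moreover have "\<bar>expectation \<xi> * (\<E> w. f w - g w)\<bar> <= 1 * \<epsilon>"
  unfolding abs_mult using assms e0 by (intro mult_mono bd brv_diff) auto
 moreover have "assoc \<xi> f - assoc \<xi> g = (\<E> w. \<xi> w * (f w - g w)) - expectation \<xi> * (\<E> w. f w - g w)"
  using i by (simp add: assoc_def right_diff_distrib)
 ultimately show ?thesis by linarith
qed

lemma assoc_sum:
 assumes "brv M \<xi>" "\<And>i. i \<in> A ==> brv M (f i)"
 shows "assoc \<xi> (\<lambda>w. \<Sum>i\<in>A. c i * f i w) = (\<Sum>i\<in>A. c i * assoc \<xi> (f i))"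
proof -
 have "(\<E> w. \<xi> w * (\<Sum>i\<in>A. c i * f i w)) = (\<E> w. \<Sum>i\<in>A. c i * (\<xi> w * f i w))"
  by (simp add: sum_distrib_left mult_ac)
 also have "... = (\<Sum>i\<in>A. (\<E> w. c i * (\<xi> w * f i w)))"
  using assms by (intro expect_sum brv_integrable brv_cmult brv_mult) auto
 also have "... = (\<Sum>i\<in>A. c i * (\<E> w. \<xi> w * f i w))" by simp
 finally have 1: "(\<E> w. \<xi> w * (\<Sum>i\<in>A. c i * f i w)) = (\<Sum>i\<in>A. c i * (\<E> w. \<xi> w * f i w))" .
 have "(\<E> w. \<Sum>i\<in>A. c i * f i w) = (\<Sum>i\<in>A. (\<E> w. c i * f i w))"
  using assms by (intro expect_sum brv_integrable brv_cmult) auto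
 then have 2: "(\<E> w. \<Sum>i\<in>A. c i * f i w) = (\<Sum>i\<in>A. c i * expectation (f i))" by simp
 show ?thesis unfolding assoc_def 1 2
  by (simp add: sum_distrib_left sum_subtractf right_diff_distrib mult_ac)
qed

lemma assoc_const_diff:
 assumes "brv M \<xi>" "brv M f" shows "assoc \<xi> (\<lambda>w. f w - c) = assoc \<xi> f"
proof -
 have i: "integrable M f" "integrable M \<xi>" "integrable M (\<lambda>w. \<xi> w * f w)" using assms by (auto intro!: brv_integrable brv_mult)
 then show ?thesis by (simp add: assoc_def right_diff_distrib prob_space)
qed

lemma abs_expectation_powr_le:
 assumes f: "brv M f" and s: "1 <= s"
 shows "\<bar>expectation f\<bar> powr s <= (\<E> w. \<bar>f w\<bar> powr s)"
proof (cases "s = 1")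
 case True
 then show ?thesis using integral_abs_bound[of M f] by simp
next
 case False
 then have s: "1 < s" using s by simp
 let ?c = "expectation f"
 have i: "integrable M f" "integrable M (\<lambda>w. \<bar>f w\<bar> powr s)" using f s by (auto intro!: brv_integrable brv_powr)
 have "\<bar>?c\<bar> powr s = (\<E> w. \<bar>?c\<bar> powr s + s * spow (s - 1) ?c * (f w - ?c))"
  using i by (simp add: prob_space)
 also have "... <= (\<E> w. \<bar>f w\<bar> powr s)"
  using i s by (intro integral_mono abs_powr_tangent) auto
 finally show ?thesis .
qed

text \<open>Centering at most doubles an \<open>L\<close>-norm.\<close>

lemma centered_powr_le:
 assumes f: "brv M f" and s: "1 <= s"
 shows "(\<E> w. \<bar>f w - expectation f\<bar> powr s) <= 2 powr (s + 1) * (\<E> w. \<bar>f w\<bar> powr s)"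
proof -
 have i: "integrable M (\<lambda>w. \<bar>f w\<bar> powr s)" using f s by (auto intro!: brv_integrable brv_powr)
 have "(\<E> w. \<bar>f w - expectation f\<bar> powr s) <= (\<E> w. 2 powr s * (\<bar>f w\<bar> powr s + \<bar>expectation f\<bar> powr s))"
 proof (rule integral_mono)
  show "integrable M (\<lambda>w. \<bar>f w - expectation f\<bar> powr s)" using f s by (intro brv_integrable brv_powr brv_diff brv_const) auto
  show "integrable M (\<lambda>w. 2 powr s * (\<bar>f w\<bar> powr s + \<bar>expectation f\<bar> powr s))" using i by simp
  show "\<bar>f w - expectation f\<bar> powr s <= 2 powr s * (\<bar>f w\<bar> powr s + \<bar>expectation f\<bar> powr s)" for w
  proof -
   have "\<bar>f w - expectation f\<bar> powr s <= (\<bar>f w\<bar> + \<bar>expectation f\<bar>) powr s"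
    using s by (intro powr_mono2 abs_triangle_ineq4) auto
   also have "... <= 2 powr s * (\<bar>f w\<bar> powr s + \<bar>expectation f\<bar> powr s)" using s by (intro powr_add_le) auto
   finally show ?thesis .
  qed
 qed
 also have "... = 2 powr s * ((\<E> w. \<bar>f w\<bar> powr s) + \<bar>expectation f\<bar> powr s)" using i by (simp add: prob_space)
 also have "... <= 2 powr s * ((\<E> w. \<bar>f w\<bar> powr s) + (\<E> w. \<bar>f w\<bar> powr s))"
  using abs_expectation_powr_le[OF f s] by (intro mult_left_mono) auto
 finally show ?thesis by (simp add: powr_add)
qed

end

text \<open>Abstract form of the dependence, with the time index in \<open>int\<close>. The normalisation \<open>4 * al\<close> leaves \<open>al \<le> 1/2\<close>, the value at lag 0.\<close>

locale alpha_dependent = prob_space M for M :: "'a measure" +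
 fixes F :: "int \<Rightarrow> 'a measure" and Y :: "int \<Rightarrow> 'a \<Rightarrow> real" and al :: "nat \<Rightarrow> real" and \<mu> :: "real measure"
 assumes F_sub: "subalgebra M (F i)"
  and F_mono: "i <= j ==> sets (F i) \<subseteq> sets (F j)"
  and Y_meas: "Y i \<in> borel_measurable (F i)"
  and law: "distr M borel (Y i) = \<mu>"
  and al_0: "al 0 = 1 / 2" and al_antimono: "m <= n ==> al n <= al m" and al_nonneg: "0 <= al m"
  and mix1: "\<And>\<xi> D m i j. 1 <= m ==> i + int m <= j ==> downset D ==> brv (F i) \<xi> ==> (\<And>w. \<bar>\<xi> w\<bar> <= 1) ==>
    \<bar>assoc \<xi> (\<lambda>w. indicat_real D (Y j w))\<bar> <= 4 * al m"
  and mix2: "\<And>\<xi> D E m i j k. 1 <= m ==> i + int m <= j ==> j <= k ==> downset D ==> downset E ==> brv (F i) \<xi> ==> (\<And>w. \<bar>\<xi> w\<bar> <= 1) ==>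
    \<bar>assoc \<xi> (\<lambda>w. (indicat_real D (Y j w) - measure \<mu> D) * (indicat_real E (Y k w) - measure \<mu> E))\<bar> <= 4 * al m"
begin

lemma Y_measM [measurable]: "Y i \<in> borel_measurable M"
 using measurable_from_subalg[OF F_sub Y_meas] .

lemma F_brv_mono: "i <= j ==> brv (F i) f ==> brv (F j) f"
 by (rule brv_mono[of "F i"]) (use F_mono F_sub in \<open>simp_all add: subalgebra_def\<close>)

lemma F_brv_M: "brv (F i) f ==> brv M f" by (rule brv_mono[OF _ F_sub])

lemma \<mu>_prob: "prob_space \<mu>"
 using prob_space_distr[OF Y_measM[of 0]] law by simp

lemma \<mu>_sets: "sets \<mu> = sets borel" using law[of 0] by (metis sets_distr)

lemma brv_compose_Y: 
 assumes "h \<in> borel_measurable borel" "\<And>y. \<bar>h y\<bar> <= A" shows "brv (F i) (\<lambda>w. h (Y i w))"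
 by (rule brvI[of _ _ A]) (use assms measurable_compose[OF Y_meas assms(1)] in auto)

lemma brv_downset_Y: "downset D ==> brv (F i) (\<lambda>w. indicat_real D (Y i w))"
 by (rule brv_compose_Y[of "indicat_real D" 1]) (simp_all add: borel_measurable_indicator downset_borel indicator_def)

lemma integral_Y: 
 fixes h :: "real \<Rightarrow> real" assumes "h \<in> borel_measurable borel" shows "(\<E> w. h (Y i w)) = (\<integral>y. h y \<partial>\<mu>)"
 using integral_distr[OF Y_measM[of i] assms] law[of i] by simp

definition ctr :: "(real \<Rightarrow> real) \<Rightarrow> int \<Rightarrow> 'a \<Rightarrow> real" where
 "ctr h i w = h (Y i w) - (\<integral>y. h y \<partial>\<mu>)"

lemma brv_ctr: "h \<in> borel_measurable borel ==> (\<And>y. \<bar>h y\<bar> <= A) ==> i <= k ==> brv (F k) (ctr h i)"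
 unfolding ctr_def by (intro brv_diff brv_const F_brv_mono[of i k] brv_compose_Y[of h A])

lemma integral_bounded_le:
 fixes h :: "real \<Rightarrow> real" assumes "h \<in> borel_measurable borel" "\<And>y. \<bar>h y\<bar> <= A" shows "\<bar>\<integral>y. h y \<partial>\<mu>\<bar> <= A"
proof -
 interpret \<mu>: prob_space \<mu> by (rule \<mu>_prob)
 have hm: "h \<in> borel_measurable \<mu>" using assms(1) \<mu>_sets by (simp cong: measurable_cong_sets)
 have i: "integrable \<mu> h" by (rule \<mu>.integrable_const_bound[where B=A]) (use assms hm in auto)
 have "\<bar>\<integral>y. h y \<partial>\<mu>\<bar> <= (\<integral>y. \<bar>h y\<bar> \<partial>\<mu>)" by (rule integral_abs_bound)
 also have "... <= (\<integral>y. A \<partial>\<mu>)" using i assms by (intro integral_mono) auto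
 finally show ?thesis by (simp add: \<mu>.prob_space)
qed

lemma ctr_abs_le:
 assumes "h \<in> borel_measurable borel" "\<And>y. \<bar>h y\<bar> <= A" shows "\<bar>ctr h i w\<bar> <= 2 * A"
proof -
 have "\<bar>h (Y i w)\<bar> <= A" "\<bar>\<integral>y. h y \<partial>\<mu>\<bar> <= A" using assms integral_bounded_le by auto
 then show ?thesis unfolding ctr_def by linarith
qed

lemma ctr_expectation:
 assumes "h \<in> borel_measurable borel" "\<And>y. \<bar>h y\<bar> <= A" shows "expectation (ctr h i) = 0"
proof -
 have "integrable M (\<lambda>w. h (Y i w))" by (intro brv_integrable F_brv_M[of i] brv_compose_Y[of h A] assms)
 then have "(\<E> w. h (Y i w) - (\<integral>y. h y \<partial>\<mu>)) = 0"
  using integral_Y[OF assms(1), of i] by (simp add: prob_space)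
 then show ?thesis unfolding ctr_def .
qed

lemma ctr_diff_le:
 assumes "h \<in> borel_measurable borel" "\<And>y. \<bar>h y\<bar> <= A" "g \<in> borel_measurable borel" "\<And>y. \<bar>g y\<bar> <= A'" "\<And>y. \<bar>h y - g y\<bar> <= \<epsilon>"
 shows "\<bar>ctr h i w - ctr g i w\<bar> <= 2 * \<epsilon>"
proof -
 have "(\<E> w. h (Y i w) - g (Y i w)) = (\<E> w. h (Y i w)) - (\<E> w. g (Y i w))"
 proof (rule Bochner_Integration.integral_diff)
  show "integrable M (\<lambda>w. h (Y i w))" by (intro brv_integrable F_brv_M[of i] brv_compose_Y[of h A] assms)
  show "integrable M (\<lambda>w. g (Y i w))" by (intro brv_integrable F_brv_M[of i] brv_compose_Y[of g A'] assms)
 qed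
 then have "ctr h i w - ctr g i w = (h (Y i w) - g (Y i w)) - (\<integral>y. h y - g y \<partial>\<mu>)"
  using integral_Y[of h i] integral_Y[of g i] integral_Y[of "\<lambda>y. h y - g y" i] assms by (simp add: ctr_def)
 moreover have "\<bar>\<integral>y. h y - g y \<partial>\<mu>\<bar> <= \<epsilon>" using assms by (intro integral_bounded_le) auto
 ultimately show ?thesis using assms(5)[of "Y i w"] by linarith
qed

lemma step_function_props:
 fixes n :: nat and c :: "nat \<Rightarrow> real" and D :: "nat \<Rightarrow> real set"
 assumes D: "\<And>i. i < n ==> downset (D i)"
 defines "g \<equiv> \<lambda>y. \<Sum>i<n. c i * indicat_real (D i) y"
 shows "g \<in> borel_measurable borel" "\<bar>g y\<bar> <= (\<Sum>i<n. \<bar>c i\<bar>)"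
  "ctr g k w = (\<Sum>i<n. c i * (indicat_real (D i) (Y k w) - measure \<mu> (D i)))"
proof -
 show gm: "g \<in> borel_measurable borel" unfolding g_def
  using D downset_borel by (intro borel_measurable_sum borel_measurable_times borel_measurable_indicator) auto
 have "\<bar>g y\<bar> <= (\<Sum>i<n. \<bar>c i * indicat_real (D i) y\<bar>)" unfolding g_def by (rule sum_abs)
 also have "... <= (\<Sum>i<n. \<bar>c i\<bar>)" by (intro sum_mono) (auto simp: indicator_def)
 finally show "\<bar>g y\<bar> <= (\<Sum>i<n. \<bar>c i\<bar>)" .
 interpret \<mu>: prob_space \<mu> by (rule \<mu>_prob)
 have Dm: "D i \<in> sets \<mu>" if "i < n" for i using downset_borel[OF D[OF that]] \<mu>_sets by simp
 have sp: "space \<mu> = UNIV" using \<mu>_sets sets_eq_imp_space_eq by fastforce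
 have "(\<integral>y. g y \<partial>\<mu>) = (\<Sum>i<n. \<integral>y. c i * indicat_real (D i) y \<partial>\<mu>)"
  unfolding g_def using Dm by (intro expect_sum) (auto simp: less_top[symmetric])
 also have "... = (\<Sum>i<n. c i * measure \<mu> (D i))" using Dm sp by simp
 finally show "ctr g k w = (\<Sum>i<n. c i * (indicat_real (D i) (Y k w) - measure \<mu> (D i)))"
  by (simp add: ctr_def g_def right_diff_distrib sum_subtractf)
qed

text \<open>By uniform approximation it suffices to add up the bounds for indicators.\<close>

lemma mix_bv1:
 assumes m: "1 <= m" "i + int m <= j" and h: "bv_bounded B h" "\<And>y. \<bar>h y\<bar> <= A" and \<xi>: "brv (F i) \<xi>" "\<And>w. \<bar>\<xi> w\<bar> <= 1"
 shows "\<bar>(\<E> w. \<xi> w * ctr h j w)\<bar> <= 4 * B * al m"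
proof -
 have hm: "h \<in> borel_measurable borel" using bv_bounded_borel[OF h(1)] .
 have \<xi>M: "brv M \<xi>" using F_brv_M[OF \<xi>(1)] .
 have cM: "brv M (ctr h j)" using F_brv_M[OF brv_ctr[OF hm h(2) order_refl]] .
 have "\<bar>assoc \<xi> (ctr h j)\<bar> <= 4 * B * al m + \<epsilon>" if e: "0 < \<epsilon>" for \<epsilon>
 proof -
  have e4: "0 < \<epsilon> / 4" using e by simp
  obtain n :: nat and c D where 1: "\<And>i. i < n ==> downset (D i)" "(\<Sum>i<n. \<bar>c i\<bar>) <= B"
   "\<And>y. \<bar>h y - (\<Sum>i<n. c i * indicat_real (D i) y)\<bar> <= \<epsilon> / 4"
   by (rule bv_boundedE[OF h(1) e4]) (rule that; simp)
  define g where "g y = (\<Sum>i<n. c i * indicat_real (D i) y)" for y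
  note sp = step_function_props[of n D c, OF 1(1), folded g_def]
  have gM: "brv M (ctr g j)" using F_brv_M[OF brv_ctr[OF sp(1,2) order_refl]] .
  have "\<bar>assoc \<xi> (ctr h j) - assoc \<xi> (ctr g j)\<bar> <= 2 * (2 * (\<epsilon> / 4))"
   by (intro assoc_diff_le \<xi>M cM gM \<xi>(2) ctr_diff_le[OF hm h(2) sp(1,2)]) (use 1(3) in \<open>auto simp: g_def\<close>)
  moreover have "\<bar>assoc \<xi> (ctr g j)\<bar> <= 4 * B * al m"
  proof -
   have b: "brv M (\<lambda>w. indicat_real (D i) (Y j w))" if "i < n" for i using F_brv_M[OF brv_downset_Y[OF 1(1)[OF that]]] .
   have "assoc \<xi> (ctr g j) = assoc \<xi> (\<lambda>w. \<Sum>i<n. c i * (indicat_real (D i) (Y j w) - measure \<mu> (D i)))"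
    by (intro arg_cong[of _ _ "assoc \<xi>"] ext sp(3))
   also have "... = (\<Sum>i<n. c i * assoc \<xi> (\<lambda>w. indicat_real (D i) (Y j w) - measure \<mu> (D i)))"
    using b by (intro assoc_sum \<xi>M brv_diff brv_const) auto
   also have "... = (\<Sum>i<n. c i * assoc \<xi> (\<lambda>w. indicat_real (D i) (Y j w)))"
    using b by (intro sum.cong refl) (simp add: assoc_const_diff[OF \<xi>M])
   finally have "\<bar>assoc \<xi> (ctr g j)\<bar> <= (\<Sum>i<n. \<bar>c i * assoc \<xi> (\<lambda>w. indicat_real (D i) (Y j w))\<bar>)" by simp
   also have "... <= (\<Sum>i<n. \<bar>c i\<bar> * (4 * al m))"
    unfolding abs_mult using 1(1) by (intro sum_mono mult_left_mono mix1[OF m _ \<xi>]) auto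
   also have "... <= B * (4 * al m)" unfolding sum_distrib_right[symmetric] using 1(2) al_nonneg by (intro mult_right_mono) auto
   finally show ?thesis by simp
  qed
  ultimately show ?thesis by linarith
 qed
 then have "\<bar>assoc \<xi> (ctr h j)\<bar> <= 4 * B * al m" by (rule field_le_epsilon)
 then show ?thesis using ctr_expectation[OF hm h(2)] by (simp add: assoc_def)
qed

text \<open>The product of two step functions expands into products of centered indicators; the total weight of the expansion is at most \<open>B\<^sup>2\<close>.\<close>

lemma mix_bv2:
 assumes m: "1 <= m" "i + int m <= j" "j <= k" and h: "bv_bounded B h" "\<And>y. \<bar>h y\<bar> <= A" and \<xi>: "brv (F i) \<xi>" "\<And>w. \<bar>\<xi> w\<bar> <= 1"
 shows "\<bar>assoc \<xi> (\<lambda>w. ctr h j w * ctr h k w)\<bar> <= 4 * B\<^sup>2 * al m"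
proof -
 have hm: "h \<in> borel_measurable borel" using bv_bounded_borel[OF h(1)] .
 have \<xi>M: "brv M \<xi>" using F_brv_M[OF \<xi>(1)] .
 have cM: "brv M (ctr h j)" for j using F_brv_M[OF brv_ctr[OF hm h(2) order_refl]] .
 have A: "0 <= A" using h(2) abs_ge_zero order_trans by blast
 have "\<bar>assoc \<xi> (\<lambda>w. ctr h j w * ctr h k w)\<bar> <= 4 * B\<^sup>2 * al m + \<epsilon>" if e: "0 < \<epsilon>" for \<epsilon>
 proof -
  define \<delta> where "\<delta> = min 1 (\<epsilon> / (16 * A + 8))"
  have \<delta>: "0 < \<delta>" "\<delta> <= 1" using e A by (auto simp: \<delta>_def intro!: divide_pos_pos)
  obtain n :: nat and c D where 1: "\<And>i. i < n ==> downset (D i)" "(\<Sum>i<n. \<bar>c i\<bar>) <= B"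
   "\<And>y. \<bar>h y - (\<Sum>i<n. c i * indicat_real (D i) y)\<bar> <= \<delta>"
   by (rule bv_boundedE[OF h(1) \<delta>(1)]) (rule that; simp)
  define g where "g y = (\<Sum>i<n. c i * indicat_real (D i) y)" for y
  note sp = step_function_props[of n D c, OF 1(1), folded g_def]
  have gM: "brv M (ctr g j)" for j using F_brv_M[OF brv_ctr[OF sp(1,2) order_refl]] .
  have d: "\<bar>ctr h j w - ctr g j w\<bar> <= 2 * \<delta>" for j w
   by (intro ctr_diff_le[OF hm h(2) sp(1,2)]) (use 1(3) in \<open>auto simp: g_def\<close>)
  have ca: "\<bar>ctr h j w\<bar> <= 2 * A" for j w by (rule ctr_abs_le[OF hm h(2)])
  have "\<bar>ctr h j w * ctr h k w - ctr g j w * ctr g k w\<bar> <= 2 * \<delta> * (4 * A + 2)" for w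
  proof -
   have "\<bar>ctr h j w * ctr h k w - ctr g j w * ctr g k w\<bar> = \<bar>ctr h j w * (ctr h k w - ctr g k w) + (ctr h j w - ctr g j w) * ctr g k w\<bar>"
    by (simp add: algebra_simps)
   also have "... <= \<bar>ctr h j w\<bar> * \<bar>ctr h k w - ctr g k w\<bar> + \<bar>ctr h j w - ctr g j w\<bar> * \<bar>ctr g k w\<bar>"
    unfolding abs_mult[symmetric] by (rule abs_triangle_ineq)
   also have "... <= (2 * A) * (2 * \<delta>) + (2 * \<delta>) * (2 * A + 2)"
   proof (intro add_mono mult_mono d ca)
    show "\<bar>ctr g k w\<bar> <= 2 * A + 2" using d[of k w] ca[of k w] \<delta> by linarith
   qed (use A \<delta> in auto)
   finally show ?thesis by (simp add: algebra_simps)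
  qed
  then have "\<bar>assoc \<xi> (\<lambda>w. ctr h j w * ctr h k w) - assoc \<xi> (\<lambda>w. ctr g j w * ctr g k w)\<bar> <= 2 * (2 * \<delta> * (4 * A + 2))"
   by (intro assoc_diff_le \<xi>M brv_mult cM gM \<xi>(2))
  also have "... = (16 * A + 8) * \<delta>" by (simp add: algebra_simps)
  also have "... <= (16 * A + 8) * (\<epsilon> / (16 * A + 8))" using A by (intro mult_left_mono) (auto simp: \<delta>_def)
  also have "... = \<epsilon>" using A by simp
  finally have 2: "\<bar>assoc \<xi> (\<lambda>w. ctr h j w * ctr h k w) - assoc \<xi> (\<lambda>w. ctr g j w * ctr g k w)\<bar> <= \<epsilon>" .
  have 3: "\<bar>assoc \<xi> (\<lambda>w. ctr g j w * ctr g k w)\<bar> <= 4 * B\<^sup>2 * al m"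
  proof -
   define f where "f p w = (indicat_real (D (fst p)) (Y j w) - measure \<mu> (D (fst p))) * (indicat_real (D (snd p)) (Y k w) - measure \<mu> (D (snd p)))" for p w
   have b: "brv M (\<lambda>w. indicat_real (D i) (Y j w))" if "i < n" for i j using F_brv_M[OF brv_downset_Y[OF 1(1)[OF that]]] .
   have "assoc \<xi> (\<lambda>w. ctr g j w * ctr g k w) = assoc \<xi> (\<lambda>w. \<Sum>p\<in>{..<n} \<times> {..<n}. (c (fst p) * c (snd p)) * f p w)"
    by (intro arg_cong[of _ _ "assoc \<xi>"] ext)
      (simp add: sp(3) sum_product sum.cartesian_product f_def case_prod_beta mult_ac)
   also have "... = (\<Sum>p\<in>{..<n} \<times> {..<n}. (c (fst p) * c (snd p)) * assoc \<xi> (f p))"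
    unfolding f_def using b by (intro assoc_sum \<xi>M brv_diff brv_const brv_mult) auto
   finally have "\<bar>assoc \<xi> (\<lambda>w. ctr g j w * ctr g k w)\<bar> <= (\<Sum>p\<in>{..<n} \<times> {..<n}. \<bar>(c (fst p) * c (snd p)) * assoc \<xi> (f p)\<bar>)" by simp
   also have "... <= (\<Sum>p\<in>{..<n} \<times> {..<n}. (\<bar>c (fst p)\<bar> * \<bar>c (snd p)\<bar>) * (4 * al m))"
    unfolding abs_mult f_def using 1(1) by (intro sum_mono mult_left_mono mix2[OF m _ _ \<xi>]) auto
   also have "... = (\<Sum>p\<in>{..<n} \<times> {..<n}. \<bar>c (fst p)\<bar> * \<bar>c (snd p)\<bar>) * (4 * al m)"
    by (rule sum_distrib_right[symmetric])
   also have "... <= (B * B) * (4 * al m)"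
   proof (intro mult_right_mono)
    have eq: "(\<Sum>p\<in>{..<n} \<times> {..<n}. \<bar>c (fst p)\<bar> * \<bar>c (snd p)\<bar>) = (\<Sum>i<n. \<bar>c i\<bar>) * (\<Sum>i<n. \<bar>c i\<bar>)"
     unfolding sum_product sum.cartesian_product case_prod_beta ..
    have s: "0 <= (\<Sum>i<n. \<bar>c i\<bar>)" by (intro sum_nonneg) auto
    then have "0 <= B" using 1(2) by linarith
    then show "(\<Sum>p\<in>{..<n} \<times> {..<n}. \<bar>c (fst p)\<bar> * \<bar>c (snd p)\<bar>) <= B * B" unfolding eq using s 1(2) by (intro mult_mono)
   qed (use al_nonneg in simp)
   finally show ?thesis by (simp add: power2_eq_square mult_ac)
  qed
  show ?thesis using 2 3 by linarith
 qed
 then show ?thesis by (rule field_le_epsilon)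
qed

end

section \<open>Moments of truncated variables\<close>

context alpha_dependent begin

text \<open>The moment of order \<open>s\<close> of the truncated quantile over the part of \<open>(0, 1)\<close> where the coefficient of lag \<open>m\<close> still exceeds \<open>u\<close>.\<close>

definition lev :: "(real \<Rightarrow> real) \<Rightarrow> real \<Rightarrow> nat \<Rightarrow> real \<Rightarrow> real" where
 "lev H L m s = (\<integral>u. indicator {..<al m} u * min (quant H u) L powr s \<partial>unif01)"

lemma al_le_half: "al m <= 1 / 2" using al_antimono[of 0 m] al_0 by simp

lemma cap_measurable [measurable]: "tail_function H ==> (\<lambda>u. min (quant H u) L) \<in> borel_measurable unif01"
 using quant_measurable[of H] by measurable

lemma indicator_unif01_measurable [measurable]: "indicat_real {..<c} \<in> borel_measurable unif01"
 by (intro measurable_unif01) auto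

lemma lev_integrable:
 assumes "tail_function H" "0 <= L" "0 <= s"
 shows "integrable unif01 (\<lambda>u. indicator {..<c} u * min (quant H u) L powr s)"
proof -
 interpret U: prob_space unif01 by (rule prob_space_unif01)
 note [measurable] = cap_measurable[OF assms(1)]
 show ?thesis
 proof (rule U.integrable_const_bound[where B="L powr s"])
  show "(\<lambda>u. indicator {..<c} u * min (quant H u) L powr s) \<in> borel_measurable unif01" by measurable
 qed (use assms in \<open>auto simp: indicator_def intro!: powr_mono2\<close>)
qed

lemma lev_nonneg: "0 <= lev H L m s"
 unfolding lev_def by (intro integral_ge_0) auto

lemma integral_indicator_unif01: "0 <= c ==> c <= 1 ==> (\<integral>u. indicat_real {..<c} u \<partial>unif01) = c"
proof -
 interpret U: prob_space unif01 by (rule prob_space_unif01)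
 assume c: "0 <= c" "c <= 1"
 have "(\<integral>u. indicat_real {..<c} u \<partial>unif01) = measure unif01 ({..<c} \<inter> {0<..<1})" by simp
 also have "... = measure unif01 {0<..<c}"
 proof -
  have "{..<c} \<inter> {0<..<1} = {0<..<c}" using c by auto
  then show ?thesis by simp
 qed
 also have "emeasure unif01 {0<..<c} = ennreal c" using c by (subst emeasure_unif01) auto
 then have "measure unif01 {0<..<c} = c" using c by (simp add: measure_def)
 finally show ?thesis .
qed

text \<open>The level is \<open>Q (al m)\<close>, truncated at \<open>L\<close>: below \<open>al m\<close> the quantile exceeds it, above it there is no excess.\<close>

lemma split_level:
 assumes H: "tail_function H" and L: "0 <= L"
 obtains B where "0 <= B" "B <= L" "\<forall>s\<ge>0. B powr s * al m <= lev H L m s"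
  "\<forall>s\<ge>1. (\<integral>u. max 0 (min (quant H u) L - B) powr s \<partial>unif01) <= lev H L m s"
  "\<forall>s\<ge>1. \<forall>t\<ge>0. B powr t * (\<integral>u. max 0 (min (quant H u) L - B) powr s \<partial>unif01) <= lev H L m (t + s)"
proof -
 interpret U: prob_space unif01 by (rule prob_space_unif01)
 define B where "B = (if 0 < al m then min (quant H (al m)) L else L)"
 have B: "0 <= B" "B <= L" using L by (auto simp: B_def)
 have lo: "B <= min (quant H u) L" if "u < al m" "u \<in> {0<..<1}" for u
  using that quant_antimono[OF H, of u "al m"] by (auto simp: B_def)
 have hi: "min (quant H u) L <= B" if "\<not> u < al m" "u \<in> {0<..<1}" for u
  using that quant_antimono[OF H, of "al m" u] al_nonneg[of m] by (auto simp: B_def)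
 have im: "integrable unif01 (\<lambda>u. max 0 (min (quant H u) L - B) powr s)" if "0 <= s" for s
 proof -
  note [measurable] = cap_measurable[OF H]
  show ?thesis
   by (rule U.integrable_const_bound[where B="L powr s"]) (use that B L in \<open>auto intro!: powr_mono2\<close>)
 qed
 have up: "B powr t * (\<integral>u. max 0 (min (quant H u) L - B) powr s \<partial>unif01) <= lev H L m (t + s)" if s: "1 <= s" "0 <= t" for s t
 proof -
  have "B powr t * (\<integral>u. max 0 (min (quant H u) L - B) powr s \<partial>unif01) = (\<integral>u. B powr t * max 0 (min (quant H u) L - B) powr s \<partial>unif01)" by simp
  also have "... <= lev H L m (t + s)"
   unfolding lev_def
  proof (rule integral_mono)
   show "integrable unif01 (\<lambda>u. B powr t * max 0 (min (quant H u) L - B) powr s)" using im s by simp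
   show "integrable unif01 (\<lambda>u. indicator {..<al m} u * min (quant H u) L powr (t + s))" using H L s by (intro lev_integrable) auto
   fix u assume u: "u \<in> space unif01"
   show "B powr t * max 0 (min (quant H u) L - B) powr s <= indicator {..<al m} u * min (quant H u) L powr (t + s)"
   proof (cases "u < al m")
    case True
    have q: "0 <= min (quant H u) L" using L by simp
    have "B powr t * max 0 (min (quant H u) L - B) powr s <= min (quant H u) L powr t * min (quant H u) L powr s"
     using lo[OF True] u s B q by (intro mult_mono powr_mono2) auto
    then show ?thesis using True by (simp add: powr_add)
   next
    case False
    then show ?thesis using hi[OF False] u s by simp
   qed
  qed
  finally show ?thesis .
 qed
 show ?thesis
 proof (rule that[OF B]; intro allI impI)
  fix s :: real assume s: "0 <= s"
  have "B powr s * al m = (\<integral>u. indicat_real {..<al m} u * B powr s \<partial>unif01)"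
   using integral_indicator_unif01[of "al m"] al_nonneg[of m] al_le_half[of m] by simp
  also have "... <= lev H L m s" unfolding lev_def
  proof (rule integral_mono)
   show "integrable unif01 (\<lambda>u. indicat_real {..<al m} u * B powr s)"
   proof (rule U.integrable_const_bound[where B="B powr s"])
    show "(\<lambda>u. indicat_real {..<al m} u * B powr s) \<in> borel_measurable unif01" by measurable
   qed (auto simp: indicator_def)
   show "integrable unif01 (\<lambda>u. indicator {..<al m} u * min (quant H u) L powr s)" using H L s by (rule lev_integrable)
   show "indicat_real {..<al m} u * B powr s <= indicator {..<al m} u * min (quant H u) L powr s" if "u \<in> space unif01" for u
    using lo[of u] that s B by (auto simp: indicator_def intro!: powr_mono2)
  qed
  finally show "B powr s * al m <= lev H L m s" .
 next
  fix s :: real assume s: "1 <= s"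
  have "(\<integral>u. max 0 (min (quant H u) L - B) powr s \<partial>unif01) <= lev H L m s"
   unfolding lev_def
  proof (rule integral_mono)
   show "integrable unif01 (\<lambda>u. max 0 (min (quant H u) L - B) powr s)" using im s by simp
   show "integrable unif01 (\<lambda>u. indicator {..<al m} u * min (quant H u) L powr s)" using H L s by (intro lev_integrable) auto
   fix u assume u: "u \<in> space unif01"
   show "max 0 (min (quant H u) L - B) powr s <= indicator {..<al m} u * min (quant H u) L powr s"
   proof (cases "u < al m")
    case True
    then show ?thesis using s B L by (auto intro!: powr_mono2)
   next
    case False
    then show ?thesis using hi[OF False] u s by simp
   qed
  qed
  then show "(\<integral>u. max 0 (min (quant H u) L - B) powr s \<partial>unif01) <= lev H L m s" .
 qed (rule up)
qed

lemma truncated_split: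
 assumes tf: "truncation_family H \<mu> h lo" and B: "0 <= B" "B <= L"
 shows "brv (F i) (ctr (lo B) i)" "\<bar>ctr (lo B) i w\<bar> <= 2 * B" 
  "brv (F i) (\<lambda>w. ctr (lo L) i w - ctr (lo B) i w)"
  "1 <= s ==> (\<E> w. \<bar>ctr (lo L) i w - ctr (lo B) i w\<bar> powr s) <= 2 powr (s + 1) * (\<integral>u. max 0 (min (quant H u) L - B) powr s \<partial>unif01)"
proof -
 have L: "0 <= L" using B by simp
 have bv: "bv_bounded (4 * C) (lo C)" and bd: "\<And>x. \<bar>lo C x\<bar> <= C" if "0 <= C" for C
  using tf that unfolding truncation_family_def by auto
 have lm: "lo C \<in> borel_measurable borel" if "0 <= C" for C using bv_bounded_borel[OF bv[OF that]] .
 show 1: "brv (F i) (ctr (lo B) i)" by (rule brv_ctr[OF lm bd order_refl]) (use B in auto)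
 show 2: "\<bar>ctr (lo B) i w\<bar> <= 2 * B" using ctr_abs_le[OF lm[OF B(1)] bd[OF B(1)]] .
 have 3: "brv (F i) (ctr (lo L) i)" by (rule brv_ctr[OF lm bd order_refl]) (use L in auto)
 show "brv (F i) (\<lambda>w. ctr (lo L) i w - ctr (lo B) i w)" using 1 3 by (rule brv_diff[rotated])
 assume s: "1 <= s"
 define d where "d y = lo L y - lo B y" for y
 have dm: "d \<in> borel_measurable borel" unfolding d_def using lm B L by (intro borel_measurable_diff) auto
 have db: "\<bar>d y\<bar> <= L + B" for y using bd[OF L, of y] bd[OF B(1), of y] by (auto simp: d_def)
 have bY: "brv M (\<lambda>w. d (Y i w))" by (rule F_brv_M[OF brv_compose_Y[OF dm db]])
 have bl: "brv M (\<lambda>w. lo C (Y i w))" if "0 <= C" for C by (rule F_brv_M[OF brv_compose_Y[OF lm[OF that] bd[OF that]]])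
 have eq: "ctr (lo L) i w - ctr (lo B) i w = d (Y i w) - (\<E> w. d (Y i w))" for w
  using integral_Y[OF lm[OF L], of i] integral_Y[OF lm[OF B(1)], of i] brv_integrable[OF bl[OF L]] brv_integrable[OF bl[OF B(1)]]
  by (simp add: ctr_def d_def)
 have "(\<E> w. \<bar>ctr (lo L) i w - ctr (lo B) i w\<bar> powr s) <= 2 powr (s + 1) * (\<E> w. \<bar>d (Y i w)\<bar> powr s)"
  unfolding eq by (rule centered_powr_le[OF bY s])
 also have "(\<E> w. \<bar>d (Y i w)\<bar> powr s) = (\<integral>y. \<bar>d y\<bar> powr s \<partial>\<mu>)"
  by (rule integral_Y[of "\<lambda>y. \<bar>d y\<bar> powr s"]) (use dm in measurable)
 also have "... <= (\<integral>u. max 0 (min (quant H u) L - B) powr s \<partial>unif01)"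
  using tf B s unfolding truncation_family_def d_def by blast
 finally show "(\<E> w. \<bar>ctr (lo L) i w - ctr (lo B) i w\<bar> powr s) <= 2 powr (s + 1) * (\<integral>u. max 0 (min (quant H u) L - B) powr s \<partial>unif01)" by simp
qed

lemma truncated_moment_le:
 assumes H: "tail_function H" and tf: "truncation_family H \<mu> h lo" and L: "0 <= L" and a: "1 <= a"
 shows "(\<E> w. \<bar>ctr (lo L) i w\<bar> powr (2 * a)) <= 16 powr (a + 1) * lev H L 0 (2 * a)"
proof -
 obtain B where B: "0 <= B" "B <= L" and l: "\<forall>s\<ge>0. B powr s * al 0 <= lev H L 0 s"
  "\<forall>s\<ge>1. (\<integral>u. max 0 (min (quant H u) L - B) powr s \<partial>unif01) <= lev H L 0 s"
  "\<forall>s\<ge>1. \<forall>t\<ge>0. B powr t * (\<integral>u. max 0 (min (quant H u) L - B) powr s \<partial>unif01) <= lev H L 0 (t + s)"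
  by (rule split_level[OF H L, of 0])
 note l1 = l(1)[rule_format] and l2 = l(2)[rule_format] and l3 = l(3)[rule_format]
 note ts = truncated_split[OF tf B]
 define I where "I = lev H L 0 (2 * a)"
 have bM: "brv M (ctr (lo B) i)" "brv M (\<lambda>w. ctr (lo L) i w - ctr (lo B) i w)" using F_brv_M ts by blast+
 have "(\<E> w. \<bar>ctr (lo L) i w\<bar> powr (2 * a)) <= (\<E> w. 2 powr (2 * a) * ((2 * B) powr (2 * a) + \<bar>ctr (lo L) i w - ctr (lo B) i w\<bar> powr (2 * a)))"
 proof (rule integral_mono)
  have "brv M (\<lambda>w. ctr (lo B) i w + (ctr (lo L) i w - ctr (lo B) i w))" using bM by (rule brv_add)
  then show "integrable M (\<lambda>w. \<bar>ctr (lo L) i w\<bar> powr (2 * a))" using a by (intro brv_integrable brv_powr) auto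
  show "integrable M (\<lambda>w. 2 powr (2 * a) * ((2 * B) powr (2 * a) + \<bar>ctr (lo L) i w - ctr (lo B) i w\<bar> powr (2 * a)))"
   using bM a by (intro brv_integrable brv_cmult brv_add brv_const brv_powr) auto
  fix w
  have "\<bar>ctr (lo L) i w\<bar> powr (2 * a) <= (2 * B + \<bar>ctr (lo L) i w - ctr (lo B) i w\<bar>) powr (2 * a)"
   using ts(2)[of i w] a by (intro powr_mono2) auto
  also have "... <= 2 powr (2 * a) * ((2 * B) powr (2 * a) + \<bar>ctr (lo L) i w - ctr (lo B) i w\<bar> powr (2 * a))"
   using B a by (intro powr_add_le) auto
  finally show "\<bar>ctr (lo L) i w\<bar> powr (2 * a) <= 2 powr (2 * a) * ((2 * B) powr (2 * a) + \<bar>ctr (lo L) i w - ctr (lo B) i w\<bar> powr (2 * a))" .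
 qed
 also have "... = 2 powr (2 * a) * ((2 * B) powr (2 * a) + (\<E> w. \<bar>ctr (lo L) i w - ctr (lo B) i w\<bar> powr (2 * a)))"
 proof -
  have "integrable M (\<lambda>w. \<bar>ctr (lo L) i w - ctr (lo B) i w\<bar> powr (2 * a))" using bM a by (intro brv_integrable brv_powr) auto
  then show ?thesis by (simp add: prob_space)
 qed
 also have "... <= 2 powr (2 * a) * (2 powr (2 * a) * (2 * I) + 2 powr (2 * a + 1) * I)"
 proof (intro mult_left_mono add_mono)
  show "(2 * B) powr (2 * a) <= 2 powr (2 * a) * (2 * I)"
   using l1[of "2 * a"] a B al_0 by (simp add: powr_mult I_def)
  show "(\<E> w. \<bar>ctr (lo L) i w - ctr (lo B) i w\<bar> powr (2 * a)) <= 2 powr (2 * a + 1) * I"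
  proof (rule order_trans[OF ts(4)])
   show "2 powr (2 * a + 1) * (\<integral>u. max 0 (min (quant H u) L - B) powr (2 * a) \<partial>unif01) <= 2 powr (2 * a + 1) * I"
    unfolding I_def using l2[of "2 * a"] a by (intro mult_left_mono) auto
  qed (use a in auto)
 qed auto
 also have "... = 4 * (2 powr (2 * a) * 2 powr (2 * a)) * I" by (simp add: powr_add algebra_simps)
 also have "2 powr (2 * a) * 2 powr (2 * a) = (16::real) powr a"
 proof -
  have "(16::real) = 2 powr 4" by (simp add: powr_numeral)
  then have "(16::real) powr a = 2 powr (4 * a)" by (simp only: powr_powr)
  then show ?thesis by (simp add: powr_add[symmetric])
 qed
 also have "4 * 16 powr a * I <= 16 powr (a + 1) * I"
  using lev_nonneg[of H L 0 "2 * a"] by (intro mult_right_mono) (auto simp: powr_add I_def)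
 finally show ?thesis by (simp add: I_def)
qed

lemma four_sum_powr_le:
 fixes p q r s a :: real
 assumes "1 <= a"
 shows "\<bar>(p + q) * (r + s)\<bar> powr a <= 4 powr a * (\<bar>p * r\<bar> powr a + \<bar>q * r\<bar> powr a + \<bar>p * s\<bar> powr a + \<bar>q * s\<bar> powr a)"
proof -
 have 1: "\<bar>x + y\<bar> powr a <= 2 powr a * (\<bar>x\<bar> powr a + \<bar>y\<bar> powr a)" for x y :: real
 proof -
  have "\<bar>x + y\<bar> powr a <= (\<bar>x\<bar> + \<bar>y\<bar>) powr a" using assms by (intro powr_mono2) auto
  also have "... <= 2 powr a * (\<bar>x\<bar> powr a + \<bar>y\<bar> powr a)" using assms by (intro powr_add_le) auto
  finally show ?thesis .
 qed
 have "\<bar>(p + q) * (r + s)\<bar> powr a = \<bar>(p * r + q * r) + (p * s + q * s)\<bar> powr a" by (simp add: algebra_simps)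
 also have "... <= 2 powr a * (\<bar>p * r + q * r\<bar> powr a + \<bar>p * s + q * s\<bar> powr a)" by (rule 1)
 also have "... <= 2 powr a * (2 powr a * (\<bar>p * r\<bar> powr a + \<bar>q * r\<bar> powr a) + 2 powr a * (\<bar>p * s\<bar> powr a + \<bar>q * s\<bar> powr a))"
  by (intro mult_left_mono add_mono 1) auto
 also have "... = (2 powr a * 2 powr a) * (\<bar>p * r\<bar> powr a + \<bar>q * r\<bar> powr a + \<bar>p * s\<bar> powr a + \<bar>q * s\<bar> powr a)"
  by (simp add: algebra_simps)
 also have "2 powr a * 2 powr a = (4::real) powr a" by (simp add: powr_mult[symmetric])
 finally show ?thesis .
qed

text \<open>Both factors are split at the level \<open>B\<close> of \<open>split_level\<close>. The bounded part of \<open>x j\<close> has, by duality, a projection with small \<open>L\<^sup>1\<close> norm, namely \<open>B\<close> times the mixing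
coefficient; the excess parts are estimated by their own moments. Each of the four products is then at most the same integral.\<close>

lemma truncated_projection_moment:
 assumes H: "tail_function H" and tf: "truncation_family H \<mu> h lo" and L: "0 <= L" and a: "1 <= a"
  and m: "1 <= m" "i + int m <= j"
 shows "\<exists>W. is_cexp M (F i) (ctr (lo L) j) W \<and> (\<E> w. \<bar>ctr (lo L) i w * W w\<bar> powr a) <= 16 powr (a + 1) * lev H L m (2 * a)"
proof -
 obtain B where B: "0 <= B" "B <= L" and l: "\<forall>s\<ge>0. B powr s * al m <= lev H L m s"
  "\<forall>s\<ge>1. (\<integral>u. max 0 (min (quant H u) L - B) powr s \<partial>unif01) <= lev H L m s"
  "\<forall>s\<ge>1. \<forall>t\<ge>0. B powr t * (\<integral>u. max 0 (min (quant H u) L - B) powr s \<partial>unif01) <= lev H L m (t + s)"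
  by (rule split_level[OF H L, of m])
 note l1 = l(1)[rule_format] and l2 = l(2)[rule_format] and l3 = l(3)[rule_format]
 note ts = truncated_split[OF tf B]
 define I where "I = lev H L m (2 * a)"
 define x' where "x' k w = ctr (lo B) k w" for k w
 define x'' where "x'' k w = ctr (lo L) k w - ctr (lo B) k w" for k w
 have xF: "brv (F k) (x' k)" "brv (F k) (x'' k)" for k unfolding x'_def x''_def using ts(1,3) by auto
 have xM: "brv M (x' k)" "brv M (x'' k)" for k using F_brv_M xF by blast+
 have x'b: "\<bar>x' k w\<bar> <= 2 * B" for k w unfolding x'_def by (rule ts(2))
 obtain W' where W': "is_cexp M (F i) (x' j) W'" "\<And>w. - (2 * B) <= W' w" "\<And>w. W' w <= 2 * B"
  by (rule is_cexp_exists[OF F_sub xM(1)[of j], of "- (2 * B)" "2 * B" i]) (use x'b in \<open>auto simp: abs_le_iff minus_le_iff\<close>)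
 have W'b: "\<bar>W' w\<bar> <= 2 * B" for w using W'(2,3)[of w] by linarith
 obtain C where C: "\<And>w. \<bar>x'' j w\<bar> <= C" using brvE[OF xM(2)[of j]] by metis
 obtain W'' where W'': "is_cexp M (F i) (x'' j) W''"
  by (rule is_cexp_exists[OF F_sub xM(2)[of j], of "- C" C i]) (use C in \<open>auto simp: abs_le_iff minus_le_iff\<close>)
 define W where "W w = W' w + W'' w" for w
 have "is_cexp M (F i) (\<lambda>w. x' j w + x'' j w) W" unfolding W_def
  by (rule is_cexp_add[OF F_sub W'(1) W'' xM])
 moreover have "(\<lambda>w. x' j w + x'' j w) = ctr (lo L) j" by (simp add: x'_def x''_def fun_eq_iff)
 ultimately have Wc: "is_cexp M (F i) (ctr (lo L) j) W" by simp
 have WM: "brv M W'" "brv M W''" using F_brv_M is_cexp_brv W'(1) W'' by blast+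
 have lob: "bv_bounded (4 * B) (lo B)" "\<And>y. \<bar>lo B y\<bar> <= B" using tf B unfolding truncation_family_def by auto
 have L1: "(\<E> w. \<bar>W' w\<bar>) <= 16 * B * al m"
 proof (rule is_cexp_L1_dual[OF F_sub W'(1) xM(1)])
  fix \<xi> assume "brv (F i) \<xi>" "\<And>w. \<bar>\<xi> w\<bar> <= 1"
  from mix_bv1[OF m lob this] show "(\<E> w. \<xi> w * x' j w) <= 16 * B * al m" by (simp add: x'_def)
 qed
 have x''m: "(\<E> w. \<bar>x'' k w\<bar> powr s) <= 2 powr (s + 1) * (\<integral>u. max 0 (min (quant H u) L - B) powr s \<partial>unif01)" if "1 <= s" for k s
  unfolding x''_def by (rule ts(4)[OF that])
 have W''m: "(\<E> w. \<bar>W'' w\<bar> powr s) <= 2 powr (s + 1) * (\<integral>u. max 0 (min (quant H u) L - B) powr s \<partial>unif01)" if "1 <= s" for s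
  using is_cexp_moment_le[OF F_sub W'' xM(2) that] x''m[OF that, of j] by linarith
 have two: "2 powr (2 * a) = (2 * 2::real) powr a" by (simp only: powr_powr[symmetric]) simp
 have t1: "(\<E> w. \<bar>x' i w * W' w\<bar> powr a) <= 8 * 2 powr (2 * a) * I"
 proof -
  have "(\<E> w. \<bar>x' i w * W' w\<bar> powr a) <= (\<E> w. (2 * B) powr (2 * a - 1) * \<bar>W' w\<bar>)"
  proof (rule integral_mono)
   show "integrable M (\<lambda>w. \<bar>x' i w * W' w\<bar> powr a)" using xM WM a by (intro brv_integrable brv_powr brv_mult) auto
   show "integrable M (\<lambda>w. (2 * B) powr (2 * a - 1) * \<bar>W' w\<bar>)" using WM by (intro brv_integrable brv_cmult brv_abs)
   fix w
   have "\<bar>x' i w * W' w\<bar> powr a = \<bar>x' i w\<bar> powr a * \<bar>W' w\<bar> powr a" by (simp add: abs_mult powr_mult)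
   also have "... <= (2 * B) powr a * ((2 * B) powr (a - 1) * \<bar>W' w\<bar>)"
   proof (intro mult_mono powr_mono2 x'b)
    show "\<bar>W' w\<bar> powr a <= (2 * B) powr (a - 1) * \<bar>W' w\<bar>"
    proof (cases "W' w = 0")
     case False
     then have "\<bar>W' w\<bar> powr a = \<bar>W' w\<bar> powr (a - 1) * \<bar>W' w\<bar>" using powr_add[of "\<bar>W' w\<bar>" "a - 1" 1] by simp
     also have "... <= (2 * B) powr (a - 1) * \<bar>W' w\<bar>" using W'b a by (intro mult_right_mono powr_mono2) auto
     finally show ?thesis .
    qed simp
   qed (use a in auto)
   also have "... = (2 * B) powr (2 * a - 1) * \<bar>W' w\<bar>" by (simp add: powr_add[symmetric])
   finally show "\<bar>x' i w * W' w\<bar> powr a <= (2 * B) powr (2 * a - 1) * \<bar>W' w\<bar>" .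
  qed
  also have "... = (2 * B) powr (2 * a - 1) * (\<E> w. \<bar>W' w\<bar>)" by simp
  also have "... <= (2 * B) powr (2 * a - 1) * (8 * ((2 * B) * al m))" using L1 by (intro mult_left_mono) auto
  also have "... = 8 * ((2 * B) powr (2 * a) * al m)"
   using powr_add[of "2 * B" "2 * a - 1" 1] B by (cases "B = 0") auto
  also have "... = 8 * 2 powr (2 * a) * (B powr (2 * a) * al m)" using B by (simp add: powr_mult)
  also have "... <= 8 * 2 powr (2 * a) * I" using l1[of "2 * a"] a by (intro mult_left_mono) (auto simp: I_def)
  finally show ?thesis .
 qed
 have cross: "(\<E> w. \<bar>f w * g w\<bar> powr a) <= 2 * 2 powr (2 * a) * I"
  if fb: "\<And>w. \<bar>f w\<bar> <= 2 * B" and bM: "brv M f" "brv M g"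
   and gm: "(\<E> w. \<bar>g w\<bar> powr a) <= 2 powr (a + 1) * (\<integral>u. max 0 (min (quant H u) L - B) powr a \<partial>unif01)" for f g
 proof -
  have "(\<E> w. \<bar>f w * g w\<bar> powr a) <= (\<E> w. (2 * B) powr a * \<bar>g w\<bar> powr a)"
  proof (rule integral_mono)
   show "\<bar>f w * g w\<bar> powr a <= (2 * B) powr a * \<bar>g w\<bar> powr a" for w
    unfolding abs_mult using fb a by (subst powr_mult) (auto intro!: mult_right_mono powr_mono2)
  qed (use bM a in \<open>auto intro!: brv_integrable brv_powr brv_mult brv_cmult\<close>)
  also have "... = (2 * B) powr a * (\<E> w. \<bar>g w\<bar> powr a)" by simp
  also have "... <= (2 * B) powr a * (2 powr (a + 1) * (\<integral>u. max 0 (min (quant H u) L - B) powr a \<partial>unif01))"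
   using gm by (intro mult_left_mono) auto
  also have "... = (2 powr a * 2 powr (a + 1)) * (B powr a * (\<integral>u. max 0 (min (quant H u) L - B) powr a \<partial>unif01))"
   using B by (simp add: powr_mult)
  also have "... <= (2 powr a * 2 powr (a + 1)) * I"
   using l3[of a a] a by (intro mult_left_mono) (auto simp: I_def)
  also have "(2::real) powr a * 2 powr (a + 1) = 2 * 2 powr (2 * a)" unfolding two by (simp add: powr_add powr_mult[symmetric])
  finally show ?thesis .
 qed
 have t2: "(\<E> w. \<bar>x'' i w * W' w\<bar> powr a) <= 2 * 2 powr (2 * a) * I"
  using cross[OF W'b WM(1) xM(2) x''m[OF a]] by (simp add: mult.commute)
 have t3: "(\<E> w. \<bar>x' i w * W'' w\<bar> powr a) <= 2 * 2 powr (2 * a) * I"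
  using cross[OF x'b xM(1) WM(2) W''m[OF a]] .
 have t4: "(\<E> w. \<bar>x'' i w * W'' w\<bar> powr a) <= 4 * 2 powr (2 * a) * I"
 proof -
  have "(\<E> w. \<bar>x'' i w * W'' w\<bar> powr a) <= (\<E> w. \<bar>x'' i w\<bar> powr (2 * a) + \<bar>W'' w\<bar> powr (2 * a))"
  proof (rule integral_mono)
   show "\<bar>x'' i w * W'' w\<bar> powr a <= \<bar>x'' i w\<bar> powr (2 * a) + \<bar>W'' w\<bar> powr (2 * a)" for w
   proof -
    define M where "M = max \<bar>x'' i w\<bar> \<bar>W'' w\<bar>"
    have "\<bar>x'' i w * W'' w\<bar> powr a <= (M * M) powr a" unfolding abs_mult M_def using a by (intro powr_mono2 mult_mono) auto
    also have "... = M powr (2 * a)"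
    proof -
     have "0 <= M" by (simp add: M_def)
     then show ?thesis by (simp add: powr_mult powr_add[symmetric])
    qed
    also have "... <= \<bar>x'' i w\<bar> powr (2 * a) + \<bar>W'' w\<bar> powr (2 * a)" by (simp add: M_def max_def)
    finally show ?thesis .
   qed
  qed (use xM WM a in \<open>auto intro!: brv_integrable brv_powr brv_mult brv_add\<close>)
  also have "... = (\<E> w. \<bar>x'' i w\<bar> powr (2 * a)) + (\<E> w. \<bar>W'' w\<bar> powr (2 * a))"
   using xM WM a by (intro Bochner_Integration.integral_add brv_integrable brv_powr) auto
  also have "... <= 2 powr (2 * a + 1) * I + 2 powr (2 * a + 1) * I"
  proof (intro add_mono)
   have "2 powr (2 * a + 1) * (\<integral>u. max 0 (min (quant H u) L - B) powr (2 * a) \<partial>unif01) <= 2 powr (2 * a + 1) * I"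
    unfolding I_def using l2[of "2 * a"] a by (intro mult_left_mono) auto
   then show "(\<E> w. \<bar>x'' i w\<bar> powr (2 * a)) <= 2 powr (2 * a + 1) * I" "(\<E> w. \<bar>W'' w\<bar> powr (2 * a)) <= 2 powr (2 * a + 1) * I"
    using x''m[of "2 * a" i] W''m[of "2 * a"] a by linarith+
  qed
  also have "... = 4 * 2 powr (2 * a) * I" by (simp add: powr_add)
  finally show ?thesis .
 qed
 have "(\<E> w. \<bar>ctr (lo L) i w * W w\<bar> powr a) <= (\<E> w. 4 powr a * (\<bar>x' i w * W' w\<bar> powr a + \<bar>x'' i w * W' w\<bar> powr a + \<bar>x' i w * W'' w\<bar> powr a + \<bar>x'' i w * W'' w\<bar> powr a))"
 proof (rule integral_mono)
  have "brv M (\<lambda>w. (x' i w + x'' i w) * (W' w + W'' w))" using xM WM by (intro brv_mult brv_add)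
  then show "integrable M (\<lambda>w. \<bar>ctr (lo L) i w * W w\<bar> powr a)"
   using a by (intro brv_integrable brv_powr) (auto simp: x'_def x''_def W_def)
  show "integrable M (\<lambda>w. 4 powr a * (\<bar>x' i w * W' w\<bar> powr a + \<bar>x'' i w * W' w\<bar> powr a + \<bar>x' i w * W'' w\<bar> powr a + \<bar>x'' i w * W'' w\<bar> powr a))"
   using xM WM a by (intro brv_integrable brv_cmult brv_add brv_powr brv_mult) auto
  show "\<bar>ctr (lo L) i w * W w\<bar> powr a <= 4 powr a * (\<bar>x' i w * W' w\<bar> powr a + \<bar>x'' i w * W' w\<bar> powr a + \<bar>x' i w * W'' w\<bar> powr a + \<bar>x'' i w * W'' w\<bar> powr a)" for w
   using four_sum_powr_le[OF a, of "x' i w" "x'' i w" "W' w" "W'' w"] by (simp add: x'_def x''_def W_def)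
 qed
 also have "... = 4 powr a * ((\<E> w. \<bar>x' i w * W' w\<bar> powr a) + (\<E> w. \<bar>x'' i w * W' w\<bar> powr a)
   + (\<E> w. \<bar>x' i w * W'' w\<bar> powr a) + (\<E> w. \<bar>x'' i w * W'' w\<bar> powr a))"
 proof -
  have "integrable M (\<lambda>w. \<bar>x' i w * W' w\<bar> powr a)" "integrable M (\<lambda>w. \<bar>x'' i w * W' w\<bar> powr a)"
   "integrable M (\<lambda>w. \<bar>x' i w * W'' w\<bar> powr a)" "integrable M (\<lambda>w. \<bar>x'' i w * W'' w\<bar> powr a)"
   using xM WM a by (auto intro!: brv_integrable brv_powr brv_mult)
  then show ?thesis by simp
 qed
 also have "... <= 4 powr a * (8 * 2 powr (2 * a) * I + 2 * 2 powr (2 * a) * I + 2 * 2 powr (2 * a) * I + 4 * 2 powr (2 * a) * I)"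
  by (intro mult_left_mono add_mono t1 t2 t3 t4) auto
 also have "... = 16 * (4 powr a * 2 powr (2 * a)) * I" by (simp add: algebra_simps)
 also have "(4::real) powr a * 2 powr (2 * a) = 16 powr a" unfolding two by (simp add: powr_mult[symmetric])
 finally show ?thesis using Wc by (auto simp: I_def powr_add)
qed

end

section \<open>Blocks\<close>

lemma (in prob_space) is_cexp_ex:
 assumes "subalgebra M F" "brv M Z" "\<And>w. lo <= Z w" "\<And>w. Z w <= hi"
 shows "\<exists>W. is_cexp M F Z W \<and> (\<forall>w. lo <= W w \<and> W w <= hi)"
proof -
 obtain W where W: "is_cexp M F Z W" "\<And>w. lo <= W w" "\<And>w. W w <= hi"
  by (rule is_cexp_exists[of F Z lo hi]) (rule assms | rule that; assumption)+
 then show ?thesis by (intro exI[of _ W]) simp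
qed

text \<open>Blocks of \<open>q\<close> consecutive variables, truncated at height \<open>L\<close>; block \<open>i\<close> covers the times from \<open>(i - 1) q + 1\<close> to \<open>i q\<close>.\<close>

locale truncated_blocks = alpha_dependent +
 fixes H h :: "real \<Rightarrow> real" and lo :: "real \<Rightarrow> real \<Rightarrow> real" and L :: real and q :: nat
 assumes H: "tail_function H" and tf: "truncation_family H \<mu> h lo" and L: "0 <= L" and q: "1 <= q"
begin

definition x :: "int \<Rightarrow> 'a \<Rightarrow> real" where "x j = ctr (lo L) j"

definition U :: "nat \<Rightarrow> 'a \<Rightarrow> real" where
 "U i w = (\<Sum>j=1..q. x (int ((i - 1) * q + j)) w)"

definition V2 :: real where "V2 = 512 * real q * (\<Sum>m<q. lev H L m 2)"

lemma V2_nonneg: "0 <= V2"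
 unfolding V2_def by (intro mult_nonneg_nonneg sum_nonneg lev_nonneg) auto

lemma lo_bv: "bv_bounded (4 * L) (lo L)" "\<bar>lo L y\<bar> <= L"
 using tf L unfolding truncation_family_def by auto

lemma x_brv: "j <= k ==> brv (F k) (x j)"
 unfolding x_def by (rule brv_ctr[OF bv_bounded_borel[OF lo_bv(1)] lo_bv(2)])

lemma x_brvM: "brv M (x j)" using F_brv_M[OF x_brv[OF order_refl]] .

lemma x_bound: "\<bar>x j w\<bar> <= 2 * L"
 unfolding x_def by (rule ctr_abs_le[OF bv_bounded_borel[OF lo_bv(1)] lo_bv(2)])

lemma U_brv: "1 <= i ==> int (i * q) <= k ==> brv (F k) (U i)"
proof -
 assume i: "1 <= i" "int (i * q) <= k"
 show "brv (F k) (U i)" unfolding U_def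
 proof (intro brv_sum x_brv)
  fix j assume "j \<in> {1..q}"
  then have "(i - 1) * q + j <= (i - 1) * q + q" by simp
  also have "... = i * q" using i by (cases i) auto
  finally show "int ((i - 1) * q + j) <= k" using i by linarith
 qed
qed

lemma U_brvM: "brv M (U i)" unfolding U_def by (intro brv_sum x_brvM)

lemma U_bound: "\<bar>U i w\<bar> <= 2 * (real q * L)"
proof -
 have "\<bar>U i w\<bar> <= (\<Sum>j=1..q. \<bar>x (int ((i - 1) * q + j)) w\<bar>)" unfolding U_def by (rule sum_abs)
 also have "... <= (\<Sum>j=1..q. 2 * L)" by (intro sum_mono x_bound)
 finally show ?thesis by simp
qed

lemma U_moment:
 assumes a: "1 < a" and e: "0 < e" "e < a - 1"
 shows "(\<E> w. \<bar>U i w\<bar> powr (2 * a)) <=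
  dd_const a e * real q powr (a + e) * (\<Sum>m<q. real (Suc m) powr (a - 1 - e) * (16 powr (a + 1) * lev H L m (2 * a)))"
 unfolding U_def
proof (rule projective_moment_bound[OF a e, where F="\<lambda>k. F (int ((i - 1) * q + k))"])
 show "filtration_on M (\<lambda>k. F (int ((i - 1) * q + k)))"
  unfolding filtration_on_def using F_sub by (intro conjI allI impI F_mono) auto
 show "brv (F (int ((i - 1) * q + k))) (x (int ((i - 1) * q + k)))" for k by (rule x_brv) simp
 show "0 <= 16 powr (a + 1) * lev H L m (2 * a)" for m by (intro mult_nonneg_nonneg lev_nonneg) auto
 show "(\<E> w. \<bar>x (int ((i - 1) * q + k)) w\<bar> powr (2 * a)) <= 16 powr (a + 1) * lev H L 0 (2 * a)" for k
  unfolding x_def using a by (intro truncated_moment_le[OF H tf L]) auto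
 show "\<exists>W. is_cexp M (F (int ((i - 1) * q + j))) (x (int ((i - 1) * q + k))) W \<and>
   (\<E> w. \<bar>x (int ((i - 1) * q + j)) w * W w\<bar> powr a) <= 16 powr (a + 1) * lev H L (k - j) (2 * a)"
  if "1 <= j" "j < k" "k <= q" for j k
  unfolding x_def using that a by (intro truncated_projection_moment[OF H tf L]) auto
qed (use q in auto)

text \<open>The case \<open>a = 1\<close> of the two moment bounds.\<close>

lemma x_cov_le:
 assumes "j <= k" shows "\<bar>(\<E> w. x j w * x k w)\<bar> <= 256 * lev H L (nat (k - j)) 2"
proof (cases "j = k")
 case True
 have "(\<E> w. x j w * x k w) = (\<E> w. \<bar>x j w\<bar> powr (2 * 1))"
  using True by (intro expect_cong) (auto simp: powr_numeral power2_eq_square)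
 also have "... <= 16 powr (1 + 1) * lev H L 0 (2 * 1)" unfolding x_def by (rule truncated_moment_le[OF H tf L]) simp
 finally have "(\<E> w. x j w * x k w) <= 256 * lev H L (nat (k - j)) 2" using True by (simp add: powr_numeral)
 moreover have "0 <= (\<E> w. x j w * x k w)" using True by (intro integral_ge_0) auto
 ultimately show ?thesis by simp
next
 case False
 then have m: "1 <= nat (k - j)" "j + int (nat (k - j)) <= k" using assms by auto
 obtain W where W: "is_cexp M (F j) (x k) W" "(\<E> w. \<bar>x j w * W w\<bar> powr 1) <= 16 powr (1 + 1) * lev H L (nat (k - j)) (2 * 1)"
  using truncated_projection_moment[OF H tf L _ m, of 1] unfolding x_def by auto
 have "(\<E> w. x j w * x k w) = (\<E> w. x j w * W w)" by (rule is_cexpD[OF W(1) x_brv[OF order_refl]])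
 then have "\<bar>(\<E> w. x j w * x k w)\<bar> <= (\<E> w. \<bar>x j w * W w\<bar>)" using integral_abs_bound[of M "\<lambda>w. x j w * W w"] by simp
 then show ?thesis using W(2) by (simp add: powr_numeral)
qed

lemma U_square: "(U i w)\<^sup>2 = (\<Sum>p\<in>{1..q} \<times> {1..q}. x (int ((i - 1) * q + fst p)) w * x (int ((i - 1) * q + snd p)) w)"
 unfolding U_def power2_eq_square sum_product sum.cartesian_product case_prod_beta ..

lemma U_var: "(\<E> w. (U i w)\<^sup>2) <= V2"
proof -
 let ?y = "\<lambda>j. x (int ((i - 1) * q + j))"
 define d :: "nat \<Rightarrow> nat \<Rightarrow> nat" where "d j k = (if j <= k then k - j else j - k)" for j k
 have cov: "(\<E> w. ?y j w * ?y k w) <= 256 * lev H L (d j k) 2" for j k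
 proof (cases "j <= k")
  case True
  then have "nat (int ((i - 1) * q + k) - int ((i - 1) * q + j)) = k - j" by auto
  then show ?thesis using x_cov_le[of "int ((i - 1) * q + j)" "int ((i - 1) * q + k)"] True by (simp add: d_def)
 next
  case False
  then have "nat (int ((i - 1) * q + j) - int ((i - 1) * q + k)) = j - k" by auto
  then show ?thesis using x_cov_le[of "int ((i - 1) * q + k)" "int ((i - 1) * q + j)"] False by (simp add: d_def mult.commute)
 qed
 have "(\<E> w. (U i w)\<^sup>2) = (\<Sum>p\<in>{1..q} \<times> {1..q}. (\<E> w. ?y (fst p) w * ?y (snd p) w))"
  unfolding U_square by (intro expect_sum brv_integrable brv_mult x_brvM)
 also have "... = (\<Sum>j=1..q. \<Sum>k=1..q. (\<E> w. ?y j w * ?y k w))"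
  unfolding sum.cartesian_product case_prod_beta ..
 also have "... <= (\<Sum>j=1..q. 2 * (256 * (\<Sum>m<q. lev H L m 2)))"
 proof (rule sum_mono)
  fix j assume j: "j \<in> {1..q}"
  have "(\<Sum>k=1..q. (\<E> w. ?y j w * ?y k w)) <= (\<Sum>k=1..q. 256 * lev H L (d j k) 2)" by (intro sum_mono cov)
  also have "... <= (\<Sum>k\<in>{1..<j}. 256 * lev H L (d j k) 2) + (\<Sum>k\<in>{j..q}. 256 * lev H L (d j k) 2)"
  proof -
   have "{1..q} = {1..<j} \<union> {j..q}" using j by auto
   then show ?thesis by (simp add: sum.union_disjoint ivl_disj_int)
  qed
  also have "(\<Sum>k\<in>{1..<j}. 256 * lev H L (d j k) 2) = (\<Sum>m\<in>{1..<j}. 256 * lev H L m 2)"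
   by (rule sum.reindex_bij_witness[where i="\<lambda>m. j - m" and j="\<lambda>k. j - k"]) (auto simp: d_def)
  also have "... <= (\<Sum>m<q. 256 * lev H L m 2)"
   using j by (intro sum_mono2) (auto intro!: mult_nonneg_nonneg lev_nonneg)
  also have "(\<Sum>k\<in>{j..q}. 256 * lev H L (d j k) 2) = (\<Sum>m\<in>{..q - j}. 256 * lev H L m 2)"
   using j by (intro sum.reindex_bij_witness[where i="\<lambda>m. j + m" and j="\<lambda>k. k - j"]) (auto simp: d_def)
  also have "... <= (\<Sum>m<q. 256 * lev H L m 2)"
   using j by (intro sum_mono2) (auto intro!: mult_nonneg_nonneg lev_nonneg)
  finally show "(\<Sum>k=1..q. (\<E> w. ?y j w * ?y k w)) <= 2 * (256 * (\<Sum>m<q. lev H L m 2))"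
   by (simp add: sum_distrib_left)
 qed
 also have "... = V2" by (simp add: V2_def)
 finally show ?thesis .
qed

text \<open>The mean of a squared block is at most \<open>V2\<close>. The deviation from it, over the past of a block \<open>m\<close> blocks earlier, is controlled by the pair coefficients, summed over the \<open>q\<^sup>2\<close> pairs.\<close>

lemma U_mix2:
 assumes m: "1 <= m" "s + int (m * q) <= int ((i - 1) * q)" and z: "brv (F s) z" "\<And>w. 0 <= z w" "\<And>w. z w <= \<Gamma>"
 shows "(\<E> w. z w * (U i w)\<^sup>2) <= V2 * expectation z + \<Gamma> * (64 * (real q * L)\<^sup>2 * al (m * q))"
proof (cases "\<Gamma> = 0")
 case True
 then have "z = (\<lambda>w. 0)" using z(2,3) by (intro ext antisym) auto
 then show ?thesis using True by simp
next
 case False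
 have \<Gamma>: "0 < \<Gamma>" using False order_trans[OF z(2,3)] by fastforce
 let ?y = "\<lambda>j. x (int ((i - 1) * q + j))"
 define \<xi> where "\<xi> w = z w / \<Gamma>" for w
 have \<xi>: "brv (F s) \<xi>" "\<bar>\<xi> w\<bar> <= 1" for w
  unfolding \<xi>_def using z \<Gamma> by (auto intro: brv_divide)
 have \<xi>M: "brv M \<xi>" "brv M z" using F_brv_M \<xi> z by blast+
 have mq: "1 <= m * q" using m q by simp
 have one: "\<bar>assoc \<xi> (\<lambda>w. ?y (fst p) w * ?y (snd p) w)\<bar> <= 64 * L\<^sup>2 * al (m * q)" if p: "p \<in> {1..q} \<times> {1..q}" for p
 proof -
  have *: "\<bar>assoc \<xi> (\<lambda>w. ?y j w * ?y k w)\<bar> <= 64 * L\<^sup>2 * al (m * q)" if "1 <= j" "j <= k" for j k :: nat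
  proof -
   have "\<bar>assoc \<xi> (\<lambda>w. ?y j w * ?y k w)\<bar> <= 4 * (4 * L)\<^sup>2 * al (m * q)"
    unfolding x_def by (rule mix_bv2[OF mq _ _ lo_bv \<xi>]) (use m(2) that in auto)
   then show ?thesis by (simp add: power_mult_distrib)
  qed
  show ?thesis
  proof (cases "fst p <= snd p")
   case True
   then show ?thesis using *[of "fst p" "snd p"] p by auto
  next
   case False
   then show ?thesis using *[of "snd p" "fst p"] p by (auto simp: mult.commute)
  qed
 qed
 have "assoc \<xi> (\<lambda>w. (U i w)\<^sup>2) = assoc \<xi> (\<lambda>w. \<Sum>p\<in>{1..q} \<times> {1..q}. 1 * (?y (fst p) w * ?y (snd p) w))" unfolding U_square by simp
 also have "... = (\<Sum>p\<in>{1..q} \<times> {1..q}. 1 * assoc \<xi> (\<lambda>w. ?y (fst p) w * ?y (snd p) w))"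
  by (intro assoc_sum \<xi>M brv_mult x_brvM)
 also have "... <= (\<Sum>p\<in>{1..q} \<times> {1..q}. 64 * L\<^sup>2 * al (m * q))"
  using one by (intro sum_mono) (simp add: abs_le_iff)
 also have "... = 64 * (real q * L)\<^sup>2 * al (m * q)" by (simp add: power2_eq_square)
 finally have A: "assoc \<xi> (\<lambda>w. (U i w)\<^sup>2) <= 64 * (real q * L)\<^sup>2 * al (m * q)" .
 have e0: "0 <= expectation \<xi>" using z(2) \<Gamma> by (intro integral_ge_0) (auto simp: \<xi>_def)
 have "(\<E> w. \<xi> w * (U i w)\<^sup>2) = assoc \<xi> (\<lambda>w. (U i w)\<^sup>2) + expectation \<xi> * (\<E> w. (U i w)\<^sup>2)"
  by (simp add: assoc_def)
 also have "... <= 64 * (real q * L)\<^sup>2 * al (m * q) + expectation \<xi> * V2"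
  using A U_var e0 by (intro add_mono mult_left_mono)
 finally have "\<Gamma> * (\<E> w. \<xi> w * (U i w)\<^sup>2) <= \<Gamma> * (64 * (real q * L)\<^sup>2 * al (m * q) + expectation \<xi> * V2)"
  using \<Gamma> by (intro mult_left_mono) auto
 moreover have "\<Gamma> * (\<E> w. \<xi> w * (U i w)\<^sup>2) = (\<E> w. z w * (U i w)\<^sup>2)"
  using \<Gamma> by (simp add: \<xi>_def)
 moreover have "expectation z = (\<E> w. \<Gamma> * \<xi> w)" using \<Gamma> by (simp add: \<xi>_def)
 then have "\<Gamma> * (expectation \<xi> * V2) = V2 * expectation z" by simp
 ultimately show ?thesis by (simp only: distrib_left)
qed

lemma U_mix1:
 assumes m: "s + int q <= int ((i - 1) * q)" and \<xi>: "brv (F s) \<xi>" "\<And>w. \<bar>\<xi> w\<bar> <= 1"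
 shows "(\<E> w. \<xi> w * U i w) <= 16 * (real q * L) * al q"
proof -
 have "(\<E> w. \<xi> w * U i w) = (\<Sum>j=1..q. (\<E> w. \<xi> w * x (int ((i - 1) * q + j)) w))"
  unfolding U_def sum_distrib_left
  by (intro expect_sum brv_integrable brv_mult x_brvM F_brv_M[OF \<xi>(1)])
 also have "... <= (\<Sum>j=1..q. 16 * L * al q)"
 proof (rule sum_mono)
  fix j assume j: "j \<in> {1..q}"
  have "\<bar>(\<E> w. \<xi> w * x (int ((i - 1) * q + j)) w)\<bar> <= 4 * (4 * L) * al q"
   unfolding x_def by (rule mix_bv1[OF q _ lo_bv \<xi>]) (use m in auto)
  then show "(\<E> w. \<xi> w * x (int ((i - 1) * q + j)) w) <= 16 * L * al q" by simp
 qed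
 finally show ?thesis by simp
qed

end
definition parity_const :: "real \<Rightarrow> real \<Rightarrow> real" where
 "parity_const a C = 2 * taylor_const (2 * a) * ((2 * taylor_const (2 * a)) powr (a - 1) * C * 16 + 2 powr (2 * a + 1))"

context truncated_blocks begin

text \<open>Along blocks of one parity, the conditional expectation two blocks back is that of the preceding block of the same parity, so the differences form a martingale. Blocks of the other parity
are replaced by 0, which keeps the index set \<open>{1..N}\<close>. Its conditional variances are majorised by the conditional second moments \<open>X\<close> of the blocks, to which the bound for predictable sums applies.\<close>

lemma parity_martingale_tail:
 fixes W :: "nat \<Rightarrow> 'a \<Rightarrow> real" and par :: nat
 assumes W: "\<And>i. is_cexp M (F (int i * int q - 2 * int q)) (U i) (W i)"
  and a: "3 / 2 < a" and \<delta>: "0 < \<delta>" and C: "predictable_bound a \<delta> C"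
  and K1: "\<And>i. (\<E> w. \<bar>U i w\<bar> powr (2 * a)) <= K1" and NK: "2 ^ K <= N" "N < 2 ^ Suc K" and l: "0 < l"
  and par: "par < 2"
 shows "prob {w \<in> space M. \<exists>k\<in>{1..N}. l <= \<bar>\<Sum>i=1..k. if i mod 2 = par then U i w - W i w else 0\<bar>} <=
   parity_const a C * ((real N * V2) powr a + real N * K1
    + real N * (2 * (real q * L)) powr (2 * a) * (\<Sum>k\<le>K. 2 powr (real k * (a - 1 + \<delta>)) * al (2 ^ k * q))) / l powr (2 * a)"
proof -
 define D where "D i w = (if i mod 2 = par then U i w - W i w else 0)" for i w
 \<comment> \<open>The filtration advances only at blocks of the parity under consideration.\<close>
 define b where "b k = (if k mod 2 = par then int k else int k - 1)" for k :: nat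
 define G where "G k = F (b k * int q)" for k
 have bmono: "b j <= b k" if "j <= k" for j k
 proof (cases "j = k")
  case False
  then have "int j <= int k - 1" using that by simp
  then show ?thesis by (auto simp: b_def)
 qed simp
 have G: "filtration_on M G"
  unfolding filtration_on_def G_def using F_sub bmono by (intro conjI allI impI F_mono mult_right_mono) auto
 have b1: "b k = int k" if "k mod 2 = par" for k using that by (simp add: b_def)
 have b2: "b (k - 1) = int k - 2" if "k mod 2 = par" "1 <= k" for k
 proof -
  obtain j where j: "k = Suc j" using \<open>1 <= k\<close> by (cases k) auto
  have "j mod 2 \<noteq> Suc j mod 2" by presburger
  then have "(k - 1) mod 2 \<noteq> par" using that(1) j by simp
  then show ?thesis using that by (auto simp: b_def of_nat_diff)
 qed
 have Geq: "G (k - 1) = F (int k * int q - 2 * int q)" if "k mod 2 = par" "1 <= k" for k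
  unfolding G_def b2[OF that] by (simp add: algebra_simps)
 have WG: "brv (G (k - 1)) (W k)" if "k mod 2 = par" "1 <= k" for k
  unfolding Geq[OF that] by (rule is_cexp_brv[OF W])
 have WM: "brv M (W k)" for k using F_brv_M[OF is_cexp_brv[OF W]] .
 have UG: "brv (G k) (U k)" if "k mod 2 = par" "1 <= k" for k
  unfolding G_def b1[OF that(1)] by (rule U_brv) (use that in auto)
 have DG: "brv (G k) (D k)" if "k \<in> {1..N}" for k
 proof (cases "k mod 2 = par")
  case True
  then have "D k = (\<lambda>w. U k w - W k w)" by (simp add: D_def fun_eq_iff)
  moreover have "brv (G k) (W k)" using filtration_brv_mono[OF G _ WG[OF True], of k] that by auto
  ultimately show ?thesis using UG[OF True] that by (auto intro: brv_diff)
 next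
  case False
  then have "D k = (\<lambda>w. 0)" by (simp add: D_def fun_eq_iff)
  then show ?thesis by (simp add: brv_const)
 qed
 have ec: "(\<E> w. \<zeta> w * U k w) = (\<E> w. \<zeta> w * W k w)" if "k mod 2 = par" "1 <= k" "brv (G (k - 1)) \<zeta>" for k \<zeta>
  by (rule is_cexpD[OF W]) (use that Geq in simp)
 have mart: "(\<E> w. \<zeta> w * D k w) = 0" if k: "k \<in> {1..N}" and z: "brv (G (k - 1)) \<zeta>" for k \<zeta>
 proof (cases "k mod 2 = par")
  case True
  have zM: "brv M \<zeta>" using filtration_brv_M[OF G z] .
  have "(\<E> w. \<zeta> w * D k w) = (\<E> w. \<zeta> w * U k w - \<zeta> w * W k w)"
   using True by (simp add: D_def right_diff_distrib)
  also have "... = (\<E> w. \<zeta> w * U k w) - (\<E> w. \<zeta> w * W k w)"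
   by (intro Bochner_Integration.integral_diff brv_integrable brv_mult zM U_brvM WM)
  finally show ?thesis using ec[OF True _ z] k by simp
 next
  case False
  then show ?thesis by (simp add: D_def)
 qed
 define \<Lambda> where "\<Lambda> = (2 * (real q * L))\<^sup>2"
 have \<Lambda>0: "0 <= \<Lambda>" by (simp add: \<Lambda>_def)
 have U2: "(U k w)\<^sup>2 <= \<Lambda>" for k w unfolding \<Lambda>_def using U_bound[of k w] by (rule abs_le_square_iff[THEN iffD1, OF order_trans]) auto
 have "\<forall>k. \<exists>X. is_cexp M (F (int k * int q - 2 * int q)) (\<lambda>w. (U k w)\<^sup>2) X \<and> (\<forall>w. 0 <= X w \<and> X w <= \<Lambda>)"
  using is_cexp_ex[OF F_sub brv_power2[OF U_brvM], of 0 _ \<Lambda>] U2 by simp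
 then obtain X where X': "\<forall>k. is_cexp M (F (int k * int q - 2 * int q)) (\<lambda>w. (U k w)\<^sup>2) (X k) \<and> (\<forall>w. 0 <= X k w \<and> X k w <= \<Lambda>)"
  by (rule choice[THEN exE])
 have X: "is_cexp M (F (int k * int q - 2 * int q)) (\<lambda>w. (U k w)\<^sup>2) (X k)"
   and X0: "0 <= X k w" and X1: "X k w <= \<Lambda>" for k w using X' by simp_all
 define \<xi> where "\<xi> k w = (if k mod 2 = par then X k w else 0)" for k w
 have \<xi>G: "brv (G (k - 1)) (\<xi> k)" if "k \<in> {1..N}" for k
 proof (cases "k mod 2 = par")
  case True
  then have "\<xi> k = X k" by (simp add: \<xi>_def fun_eq_iff)
  then show ?thesis using is_cexp_brv[OF X[of k]] Geq[OF True] that by simp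
 next
  case False
  then have "\<xi> k = (\<lambda>w. 0)" by (simp add: \<xi>_def fun_eq_iff)
  then show ?thesis by (simp add: brv_const)
 qed
 have \<xi>0: "0 <= \<xi> k w" for k w using X0 by (simp add: \<xi>_def)
 have \<xi>1: "\<xi> k w <= \<Lambda>" for k w using X1 \<Lambda>0 by (simp add: \<xi>_def)
 have ec2: "(\<E> w. \<zeta> w * (U k w)\<^sup>2) = (\<E> w. \<zeta> w * X k w)" if "k mod 2 = par" "1 <= k" "brv (G (k - 1)) \<zeta>" for k \<zeta>
  by (rule is_cexpD[OF X]) (use that Geq in simp)
 have var: "(\<E> w. \<zeta> w * (D k w)\<^sup>2) <= (\<E> w. \<zeta> w * \<xi> k w)"
  if k: "k \<in> {1..N}" and z: "brv (G (k - 1)) \<zeta>" "\<And>w. 0 <= \<zeta> w" for k \<zeta>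
 proof (cases "k mod 2 = par")
  case True
  have zM: "brv M \<zeta>" using filtration_brv_M[OF G z(1)] .
  have zW: "brv (G (k - 1)) (\<lambda>w. \<zeta> w * W k w)" using z(1) WG[OF True] k by (intro brv_mult) auto
  have "(\<E> w. \<zeta> w * (D k w)\<^sup>2) = (\<E> w. \<zeta> w * (U k w)\<^sup>2 - 2 * ((\<zeta> w * W k w) * U k w) + (\<zeta> w * W k w) * W k w)"
   using True by (intro expect_cong) (auto simp: D_def power2_eq_square algebra_simps)
  also have "... = (\<E> w. \<zeta> w * (U k w)\<^sup>2) - 2 * (\<E> w. (\<zeta> w * W k w) * U k w) + (\<E> w. (\<zeta> w * W k w) * W k w)"
  proof -
   have "integrable M (\<lambda>w. \<zeta> w * (U k w)\<^sup>2)" "integrable M (\<lambda>w. (\<zeta> w * W k w) * U k w)" "integrable M (\<lambda>w. (\<zeta> w * W k w) * W k w)"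
    by (intro brv_integrable brv_mult brv_power2 zM U_brvM WM)+
   then show ?thesis by simp
  qed
  also have "(\<E> w. (\<zeta> w * W k w) * U k w) = (\<E> w. (\<zeta> w * W k w) * W k w)"
   using ec[OF True _ zW] k by simp
  also have "(\<E> w. \<zeta> w * (U k w)\<^sup>2) - 2 * (\<E> w. (\<zeta> w * W k w) * W k w) + (\<E> w. (\<zeta> w * W k w) * W k w)
    <= (\<E> w. \<zeta> w * (U k w)\<^sup>2)"
  proof -
   have "0 <= (\<E> w. (\<zeta> w * W k w) * W k w)"
    using z(2) by (intro integral_ge_0) (simp add: mult.assoc)
   then show ?thesis by simp
  qed
  also have "... = (\<E> w. \<zeta> w * \<xi> k w)" using ec2[OF True _ z(1)] k True by (simp add: \<xi>_def)
  finally show ?thesis .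
 next
  case False
  then show ?thesis by (simp add: D_def \<xi>_def)
 qed
 define tc where "tc = taylor_const (2 * a)"
 have tc: "1 <= tc" unfolding tc_def using a by (intro taylor_const_ge_1) auto
 have C0: "0 < C" using C by (simp add: predictable_bound_def)
 have K10: "0 <= K1" using K1[of 0] by (meson integral_ge_0 order_trans powr_ge_zero)
 define Z where "Z = (\<Sum>k\<le>K. 2 powr (real k * (a - 1 + \<delta>)) * al (2 ^ k * q))"
 have Z0: "0 <= Z" unfolding Z_def by (intro sum_nonneg mult_nonneg_nonneg al_nonneg) auto
 define \<rho> where "\<rho> m = 64 * (real q * L)\<^sup>2 * al (m * q)" for m
 have \<rho>0: "0 <= \<rho> m" for m unfolding \<rho>_def using al_nonneg by simp
 have pm: "(\<E> w. \<zeta> w * \<xi> i w) <= V2 * expectation \<zeta> + \<Gamma> * \<rho> (i - j)"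
  if i: "i \<in> {1..N}" and j: "1 <= j" "j < i" and z: "brv (G (j - 1)) \<zeta>" "\<forall>w. 0 <= \<zeta> w \<and> \<zeta> w <= \<Gamma>" for i j \<zeta> \<Gamma>
 proof (cases "i mod 2 = par")
  case True
  have "brv (G (i - 1)) \<zeta>" by (rule filtration_brv_mono[OF G _ z(1)]) (use j in auto)
  then have "(\<E> w. \<zeta> w * \<xi> i w) = (\<E> w. \<zeta> w * (U i w)\<^sup>2)"
   using ec2[OF True, of \<zeta>] i True by (simp add: \<xi>_def)
  also have "... <= V2 * expectation \<zeta> + \<Gamma> * (64 * (real q * L)\<^sup>2 * al ((i - j) * q))"
  proof (rule U_mix2[where s="int (j - 1) * int q"])
   show "int (j - 1) * int q + int ((i - j) * q) <= int ((i - 1) * q)"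
    using j by (simp add: of_nat_diff algebra_simps)
   have "b (j - 1) * int q <= int (j - 1) * int q" by (intro mult_right_mono) (auto simp: b_def)
   then show "brv (F (int (j - 1) * int q)) \<zeta>" using z(1) unfolding G_def by (rule F_brv_mono)
  qed (use j z in auto)
  finally show ?thesis by (simp add: \<rho>_def)
 next
  case False
  have "0 <= \<Gamma>" using z(2) order_trans by blast
  then have "0 <= V2 * expectation \<zeta> + \<Gamma> * \<rho> (i - j)"
   using z(2) \<rho>0 V2_nonneg by (intro add_nonneg_nonneg mult_nonneg_nonneg integral_ge_0) auto
  then show ?thesis using False by (simp add: \<xi>_def)
 qed
 have T: "(\<E> w. (\<Sum>i=1..N. \<xi> i w) powr a) <= C * 16 * ((real N * V2) powr a + real N * K1 + real N * (2 * (real q * L)) powr (2 * a) * Z)"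
 proof -
  have "(\<E> w. (\<Sum>i=1..N. \<xi> i w) powr a) <=
    C * ((real N * V2) powr a + (\<Sum>i=1..N. (\<E> w. \<xi> i w powr a))
     + real N * \<Lambda> powr (a - 1) * (\<Sum>k\<le>K. 2 powr (real k * (a - 1 + \<delta>)) * \<rho> (2 ^ k)))"
  proof (rule C[unfolded predictable_bound_def, THEN conjunct2, rule_format])
   show "filtration_on M G" "2 ^ K <= N" "N < 2 ^ Suc K" "0 <= \<Lambda>" "0 <= V2" by (fact G NK \<Lambda>0 V2_nonneg)+
   show "brv (G (i - 1)) (\<xi> i) \<and> (\<forall>w. 0 <= \<xi> i w \<and> \<xi> i w <= \<Lambda>)" if "i \<in> {1..N}" for i
    using \<xi>G[OF that] \<xi>0 \<xi>1 by simp
   show "0 <= \<rho> m" for m by (rule \<rho>0)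
   fix i j \<zeta> \<Gamma> assume *: "i \<in> {1..N}" "1 <= j" "j < i" "brv (G (j - 1)) \<zeta>" "\<And>w. 0 <= \<zeta> w \<and> \<zeta> w <= \<Gamma>"
   show "(\<E> w. \<zeta> w * \<xi> i w) <= V2 * expectation \<zeta> + \<Gamma> * \<rho> (i - j)"
    by (rule pm[OF *(1-4)]) (simp add: *(5))
  qed
  also have "... <= C * ((real N * V2) powr a + real N * K1 + 16 * (real N * (2 * (real q * L)) powr (2 * a) * Z))"
  proof (intro mult_left_mono add_mono order_refl)
   have "(\<E> w. \<xi> i w powr a) <= K1" for i
   proof (cases "i mod 2 = par")
    case True
    have "(\<E> w. \<xi> i w powr a) = (\<E> w. \<bar>X i w\<bar> powr a)" using True X0 by (simp add: \<xi>_def)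
    also have "... <= (\<E> w. \<bar>(U i w)\<^sup>2\<bar> powr a)"
     by (rule is_cexp_moment_le[OF F_sub X brv_power2[OF U_brvM]]) (use a in auto)
    also have "... <= K1" using K1[of i] by (simp add: powr_abs_square)
    finally show ?thesis .
   next
    case False
    then show ?thesis using K10 by (simp add: \<xi>_def)
   qed
   then have "(\<Sum>i=1..N. (\<E> w. \<xi> i w powr a)) <= (\<Sum>i=1..N. K1)" by (intro sum_mono)
   then show "(\<Sum>i=1..N. (\<E> w. \<xi> i w powr a)) <= real N * K1" by simp
   have "\<Lambda> powr (a - 1) * \<Lambda> = (2 * (real q * L)) powr (2 * a)"
   proof -
    have "\<Lambda> powr (a - 1) * \<Lambda> = \<Lambda> powr a" using powr_add[of \<Lambda> "a - 1" 1] \<Lambda>0 by (cases "\<Lambda> = 0") auto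
    also have "... = \<bar>2 * (real q * L)\<bar> powr (2 * a)" unfolding \<Lambda>_def by (rule powr_abs_square(2)[symmetric])
    finally show ?thesis using L by simp
   qed
   moreover have "64 * (real q * L)\<^sup>2 = 16 * \<Lambda>" by (simp add: \<Lambda>_def power2_eq_square)
   moreover have "\<Lambda> powr (a - 1) * (16 * \<Lambda>) = 16 * (\<Lambda> powr (a - 1) * \<Lambda>)" by simp
   ultimately have "\<Lambda> powr (a - 1) * (64 * (real q * L)\<^sup>2) = 16 * (2 * (real q * L)) powr (2 * a)" by (simp only:)
   moreover have "(\<Sum>k\<le>K. 2 powr (real k * (a - 1 + \<delta>)) * \<rho> (2 ^ k)) = (64 * (real q * L)\<^sup>2) * Z"
    unfolding Z_def \<rho>_def sum_distrib_left by (intro sum.cong) (auto simp: mult_ac)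
   ultimately have "real N * \<Lambda> powr (a - 1) * (\<Sum>k\<le>K. 2 powr (real k * (a - 1 + \<delta>)) * \<rho> (2 ^ k)) = 16 * (real N * (2 * (real q * L)) powr (2 * a) * Z)"
    by (simp add: mult_ac)
   then show "real N * \<Lambda> powr (a - 1) * (\<Sum>k\<le>K. 2 powr (real k * (a - 1 + \<delta>)) * \<rho> (2 ^ k)) <= 16 * (real N * (2 * (real q * L)) powr (2 * a) * Z)" by (simp only: order_refl)
  qed (use C0 in auto)
  also have "... <= C * (16 * ((real N * V2) powr a + real N * K1 + real N * (2 * (real q * L)) powr (2 * a) * Z))"
   using C0 K10 by (intro mult_left_mono) auto
  finally show ?thesis by (simp only: mult.assoc)
 qed
 have Dm: "(\<E> w. \<bar>D i w\<bar> powr (2 * a)) <= 2 powr (2 * a + 1) * K1" for i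
 proof (cases "i mod 2 = par")
  case True
  have "(\<E> w. \<bar>D i w\<bar> powr (2 * a)) <= (\<E> w. 2 powr (2 * a) * (\<bar>U i w\<bar> powr (2 * a) + \<bar>W i w\<bar> powr (2 * a)))"
  proof (rule integral_mono)
   have "D i = (\<lambda>w. U i w - W i w)" using True by (simp add: D_def fun_eq_iff)
   then have "brv M (D i)" using U_brvM WM by (simp add: brv_diff)
   then show "integrable M (\<lambda>w. \<bar>D i w\<bar> powr (2 * a))" using a by (intro brv_integrable brv_powr) auto
   show "integrable M (\<lambda>w. 2 powr (2 * a) * (\<bar>U i w\<bar> powr (2 * a) + \<bar>W i w\<bar> powr (2 * a)))"
    using a U_brvM WM by (intro brv_integrable brv_cmult brv_add brv_powr) auto
   fix w
   have "\<bar>D i w\<bar> powr (2 * a) <= (\<bar>U i w\<bar> + \<bar>W i w\<bar>) powr (2 * a)"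
    using True a by (intro powr_mono2) (auto simp: D_def)
   also have "... <= 2 powr (2 * a) * (\<bar>U i w\<bar> powr (2 * a) + \<bar>W i w\<bar> powr (2 * a))"
    using a by (intro powr_add_le) auto
   finally show "\<bar>D i w\<bar> powr (2 * a) <= 2 powr (2 * a) * (\<bar>U i w\<bar> powr (2 * a) + \<bar>W i w\<bar> powr (2 * a))" .
  qed
  also have "... = 2 powr (2 * a) * ((\<E> w. \<bar>U i w\<bar> powr (2 * a)) + (\<E> w. \<bar>W i w\<bar> powr (2 * a)))"
  proof -
   have "integrable M (\<lambda>w. \<bar>U i w\<bar> powr (2 * a))" "integrable M (\<lambda>w. \<bar>W i w\<bar> powr (2 * a))"
    using a U_brvM WM by (auto intro!: brv_integrable brv_powr)
   then show ?thesis by simp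
  qed
  also have "... <= 2 powr (2 * a) * (K1 + K1)"
  proof (intro mult_left_mono add_mono K1)
   have "(\<E> w. \<bar>W i w\<bar> powr (2 * a)) <= (\<E> w. \<bar>U i w\<bar> powr (2 * a))"
    by (rule is_cexp_moment_le[OF F_sub W U_brvM]) (use a in auto)
   then show "(\<E> w. \<bar>W i w\<bar> powr (2 * a)) <= K1" using K1[of i] by linarith
  qed simp
  finally show ?thesis by (simp add: powr_add)
 next
  case False
  then show ?thesis using K10 by (simp add: D_def)
 qed
 define E where "E = (real N * V2) powr a + real N * K1 + real N * (2 * (real q * L)) powr (2 * a) * Z"
 have "(\<E> w. \<bar>\<Sum>i=1..N. D i w\<bar> powr (2 * a)) <=
  2 * tc * ((2 * tc) powr (a - 1) * (\<E> w. (\<Sum>i=1..N. \<xi> i w) powr a) + (\<Sum>i=1..N. (\<E> w. \<bar>D i w\<bar> powr (2 * a))))"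
  unfolding tc_def by (rule martingale_rosenthal[OF G DG mart a \<xi>G \<xi>0 var])
 also have "... <= 2 * tc * ((2 * tc) powr (a - 1) * (C * 16 * E) + 2 powr (2 * a + 1) * E)"
 proof (intro mult_left_mono add_mono)
  show "(\<E> w. (\<Sum>i=1..N. \<xi> i w) powr a) <= C * 16 * E" using T by (simp add: E_def)
  have "(\<Sum>i=1..N. (\<E> w. \<bar>D i w\<bar> powr (2 * a))) <= (\<Sum>i=1..N. 2 powr (2 * a + 1) * K1)" by (intro sum_mono Dm)
  also have "... = 2 powr (2 * a + 1) * (real N * K1)" by simp
  also have "... <= 2 powr (2 * a + 1) * E" unfolding E_def using Z0 by (intro mult_left_mono) auto
  finally show "(\<Sum>i=1..N. (\<E> w. \<bar>D i w\<bar> powr (2 * a))) <= 2 powr (2 * a + 1) * E" .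
 qed (use tc in auto)
 also have "... = parity_const a C * E" by (simp add: parity_const_def tc_def algebra_simps)
 finally have fin: "(\<E> w. \<bar>\<Sum>i=1..N. D i w\<bar> powr (2 * a)) <= parity_const a C * E" .
 have "prob {w \<in> space M. \<exists>k\<in>{1..N}. l <= \<bar>\<Sum>i=1..k. D i w\<bar>} <= (\<E> w. \<bar>\<Sum>i=1..N. D i w\<bar> powr (2 * a)) / l powr (2 * a)"
  by (rule martingale_maximal[OF G DG mart _ l]) (use a in auto)
 also have "... <= parity_const a C * E / l powr (2 * a)" using fin by (intro divide_right_mono) auto
 finally show ?thesis unfolding D_def E_def Z_def .
qed

end

section \<open>Deviation of truncated sums\<close>

context truncated_blocks begin

text \<open>Up to an incomplete block, of size at most \<open>l / 8\<close> by the choice of \<open>q L\<close>, the partial sums are those of blocks. These are split into the even and the odd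
martingale and the projections, whose \<open>L\<^sup>1\<close> norms \<open>16 q L al q\<close> are added up by the Markov inequality.\<close>

lemma block_deviation:
 assumes a: "3 / 2 < a" and e: "0 < e" "e < a - 1" and \<delta>: "0 < \<delta>" and C: "predictable_bound a \<delta> C"
  and l: "0 < l" and ql: "16 * (real q * L) <= l" and n: "1 <= n" and NK: "2 ^ K <= max 1 (n div q)" "max 1 (n div q) < 2 ^ Suc K"
 shows "prob {w \<in> space M. \<exists>k\<in>{1..n}. l / 2 <= \<bar>\<Sum>j=1..k. x (int j) w\<bar>} <=
   (2 * parity_const a C * 8 powr (2 * a)) * ((real (n div q) * V2) powr a + real (n div q) * (dd_const a e * real q powr (a + e) * (\<Sum>m<q. real (Suc m) powr (a - 1 - e) * (16 powr (a + 1) * lev H L m (2 * a))))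
    + real (n div q) * (2 * (real q * L)) powr (2 * a) * (\<Sum>k\<le>K. 2 powr (real k * (a - 1 + \<delta>)) * al (2 ^ k * q))) / l powr (2 * a)
   + 128 * (real (n div q) * real q) * L * al q / l"
proof -
 define N where "N = n div q"
 define S where "S k w = (\<Sum>j=1..k. x (int j) w)" for k w
 have "\<forall>i. \<exists>W. is_cexp M (F (int i * int q - 2 * int q)) (U i) W \<and> (\<forall>w. - (2 * (real q * L)) <= W w \<and> W w <= 2 * (real q * L))"
 proof
  fix i
  have "- (2 * (real q * L)) <= U i w" "U i w <= 2 * (real q * L)" for w using U_bound[of i w] by linarith+
  then show "\<exists>W. is_cexp M (F (int i * int q - 2 * int q)) (U i) W \<and> (\<forall>w. - (2 * (real q * L)) <= W w \<and> W w <= 2 * (real q * L))"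
   by (rule is_cexp_ex[OF F_sub U_brvM])
 qed
 then obtain W where W': "\<forall>i. is_cexp M (F (int i * int q - 2 * int q)) (U i) (W i) \<and> (\<forall>w. - (2 * (real q * L)) <= W i w \<and> W i w <= 2 * (real q * L))"
  by (rule choice[THEN exE])
 have W: "is_cexp M (F (int i * int q - 2 * int q)) (U i) (W i)" for i using W' by simp
 have WM: "brv M (W i)" for i using F_brv_M[OF is_cexp_brv[OF W]] .
 define D where "D par i w = (if i mod 2 = par then U i w - W i w else 0)" for par i :: nat and w
 define X where "X = (real N * V2) powr a + real N * (dd_const a e * real q powr (a + e) * (\<Sum>m<q. real (Suc m) powr (a - 1 - e) * (16 powr (a + 1) * lev H L m (2 * a))))
    + real N * (2 * (real q * L)) powr (2 * a) * (\<Sum>k\<le>K. 2 powr (real k * (a - 1 + \<delta>)) * al (2 ^ k * q))"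
 have C0: "0 < C" using C by (simp add: predictable_bound_def)
 have pc: "0 <= parity_const a C" unfolding parity_const_def using a C0 taylor_const_ge_1[of "2 * a"] by simp
 define A where "A par = {w \<in> space M. \<exists>k\<in>{1..N}. l / 8 <= \<bar>\<Sum>i=1..k. D par i w\<bar>}" for par
 define B where "B = {w \<in> space M. l / 8 <= (\<Sum>i=1..N. \<bar>W i w\<bar>)}"
 have DM: "brv M (D par i)" for par i
 proof (cases "i mod 2 = par")
  case True
  then have "D par i = (\<lambda>w. U i w - W i w)" by (simp add: D_def fun_eq_iff)
  then show ?thesis using U_brvM WM by (simp add: brv_diff)
 next
  case False
  then have "D par i = (\<lambda>w. 0)" by (simp add: D_def fun_eq_iff)
  then show ?thesis by (simp add: brv_const)
 qed
 have Am: "A par \<in> events" for par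
 proof -
  have [measurable]: "D par i \<in> borel_measurable M" for i using brv_meas[OF DM] .
  show ?thesis unfolding A_def by measurable
 qed
 have Bm: "B \<in> events"
 proof -
  have [measurable]: "W i \<in> borel_measurable M" for i using brv_meas[OF WM] .
  show ?thesis unfolding B_def by measurable
 qed
 have dd0: "0 <= dd_const a e" unfolding dd_const_def using a taylor_const_ge_1[of "2 * a"] by simp
 have X0: "0 <= (real N * (dd_const a e * real q powr (a + e) * (\<Sum>m<q. real (Suc m) powr (a - 1 - e) * (16 powr (a + 1) * lev H L m (2 * a)))))"
  using dd0 by (intro mult_nonneg_nonneg sum_nonneg lev_nonneg) auto
 have X1: "0 <= X"
  unfolding X_def using dd0 by (intro add_nonneg_nonneg mult_nonneg_nonneg sum_nonneg al_nonneg lev_nonneg) auto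
 have PA: "prob (A par) <= parity_const a C * X * 8 powr (2 * a) / l powr (2 * a)" if par: "par < 2" for par
 proof (cases "N = 0")
  case True
  then have "A par = {}" by (simp add: A_def)
  then show ?thesis using X1 pc by simp
 next
  case False
  then have N: "max 1 (n div q) = N" by (simp add: N_def)
  have "prob (A par) <= parity_const a C * X / (l / 8) powr (2 * a)"
   unfolding A_def X_def D_def
   by (rule parity_martingale_tail[OF W a \<delta> C U_moment NK[unfolded N] _ par]) (use a e l in auto)
  also have "... = parity_const a C * X * 8 powr (2 * a) / l powr (2 * a)" using l by (simp add: powr_divide)
  finally show ?thesis .
 qed
 have PB: "prob B <= 128 * (real N * real q) * L * al q / l"
 proof -
  have WE: "(\<E> w. \<bar>W i w\<bar>) <= 16 * (real q * L) * al q" if "1 <= i" for i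
  proof (rule is_cexp_L1_dual[OF F_sub W U_brvM])
   fix \<xi> assume \<xi>: "brv (F (int i * int q - 2 * int q)) \<xi>" "\<And>w. \<bar>\<xi> w\<bar> <= 1"
   show "(\<E> w. \<xi> w * U i w) <= 16 * (real q * L) * al q"
    by (rule U_mix1[OF _ \<xi>]) (use that in \<open>auto simp: of_nat_diff algebra_simps\<close>)
  qed
  have i: "integrable M (\<lambda>w. \<Sum>i=1..N. \<bar>W i w\<bar>)" by (intro brv_integrable brv_sum brv_abs WM)
  have "prob B <= (\<E> w. \<Sum>i=1..N. \<bar>W i w\<bar>) / (l / 8)"
   unfolding B_def using l by (intro integral_Markov_inequality_measure[OF i, where A="{}"]) (auto intro!: sum_nonneg)
  also have "(\<E> w. \<Sum>i=1..N. \<bar>W i w\<bar>) = (\<Sum>i=1..N. (\<E> w. \<bar>W i w\<bar>))"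
   by (intro expect_sum brv_integrable brv_abs WM)
  also have "(\<Sum>i=1..N. (\<E> w. \<bar>W i w\<bar>)) / (l / 8) <= (\<Sum>i=1..N. 16 * (real q * L) * al q) / (l / 8)"
   using l WE by (intro divide_right_mono sum_mono) auto
  also have "... = 128 * (real N * real q) * L * al q / l" using l by (simp add: field_simps)
  finally show ?thesis .
 qed
 have sub: "{w \<in> space M. \<exists>k\<in>{1..n}. l / 2 <= \<bar>S k w\<bar>} \<subseteq> A 0 \<union> A 1 \<union> B"
 proof (intro subsetI, rule ccontr)
  fix w assume wt: "w \<in> {w \<in> space M. \<exists>k\<in>{1..n}. l / 2 <= \<bar>S k w\<bar>}" and no: "w \<notin> A 0 \<union> A 1 \<union> B"
  then obtain k where k: "k \<in> {1..n}" "l / 2 <= \<bar>S k w\<bar>" by blast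
  define k' where "k' = k div q"
  have k'N: "k' <= N" unfolding k'_def N_def using k by (intro div_le_mono) auto
  have Sblock: "S (j * q) w = (\<Sum>i=1..j. U i w)" for j
  proof (induction j)
   case 0
   then show ?case by (simp add: S_def)
  next
   case (Suc j)
   have "S (Suc j * q) w = S (j * q + q) w" by (simp add: add.commute)
   also have "... = S (j * q) w + (\<Sum>i=j * q + 1..j * q + q. x (int i) w)"
    unfolding S_def by (rule sum.ub_add_nat) simp
   also have "(\<Sum>i=j * q + 1..j * q + q. x (int i) w) = U (Suc j) w"
    unfolding U_def using sum.shift_bounds_cl_nat_ivl[of "\<lambda>i. x (int i) w" 1 "j * q" q] by (simp add: add.commute)
   finally show ?case using Suc by simp
  qed
  have rest: "\<bar>S k w - S (k' * q) w\<bar> <= l / 8"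
  proof -
   have kd: "k = k' * q + k mod q" by (simp add: k'_def)
   have "S k w = S (k' * q) w + (\<Sum>i=k' * q + 1..k' * q + k mod q. x (int i) w)"
    using sum.ub_add_nat[of 1 "k' * q" "\<lambda>i. x (int i) w" "k mod q"] kd unfolding S_def by simp
   then have "\<bar>S k w - S (k' * q) w\<bar> <= (\<Sum>i=k' * q + 1..k' * q + k mod q. \<bar>x (int i) w\<bar>)" by simp
   also have "... <= (\<Sum>i=k' * q + 1..k' * q + k mod q. 2 * L)" by (intro sum_mono x_bound)
   also have "... = real (k mod q) * (2 * L)" by simp
   also have "... <= real q * (2 * L)" using L q by (intro mult_right_mono) (auto intro: less_imp_le)
   also have "... <= l / 8" using ql by simp
   finally show ?thesis .
  qed
  have dec: "(\<Sum>i=1..k'. U i w) = (\<Sum>i=1..k'. D 0 i w) + (\<Sum>i=1..k'. D 1 i w) + (\<Sum>i=1..k'. W i w)"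
   unfolding sum.distrib[symmetric]
  proof (rule sum.cong)
   fix i :: nat
   have "i mod 2 = 0 \<or> i mod 2 = 1" by presburger
   then show "U i w = D 0 i w + D 1 i w + W i w" by (auto simp: D_def)
  qed simp
  have DA: "\<bar>\<Sum>i=1..k'. D par i w\<bar> < l / 8" if "par \<in> {0, 1}" for par
  proof (cases "k' = 0")
   case True
   then show ?thesis using l by simp
  next
   case False
   have "w \<notin> A par" using no that by auto
   then show ?thesis using wt False k'N unfolding A_def by (auto simp: not_le)
  qed
  have "\<bar>\<Sum>i=1..k'. W i w\<bar> <= (\<Sum>i=1..k'. \<bar>W i w\<bar>)" by (rule sum_abs)
  also have "... <= (\<Sum>i=1..N. \<bar>W i w\<bar>)" using k'N by (intro sum_mono2) auto
  also have "... < l / 8" using no wt unfolding B_def by auto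
  finally have "\<bar>\<Sum>i=1..k'. W i w\<bar> < l / 8" .
  moreover have "\<bar>\<Sum>i=1..k'. D 0 i w\<bar> < l / 8" "\<bar>\<Sum>i=1..k'. D 1 i w\<bar> < l / 8" by (rule DA; simp)+
  ultimately have "\<bar>S (k' * q) w\<bar> < 3 * (l / 8)" unfolding Sblock dec by linarith
  then show False using rest k(2) by linarith
 qed
 have "prob {w \<in> space M. \<exists>k\<in>{1..n}. l / 2 <= \<bar>S k w\<bar>} <= prob (A 0 \<union> A 1 \<union> B)"
  using sub Am Bm by (intro finite_measure_mono) auto
 also have "... <= prob (A 0) + prob (A 1) + prob B"
  using measure_Un_le[of "A 0 \<union> A 1" M B] measure_Un_le[of "A 0" M "A 1"] Am Bm by auto
 also have "... <= parity_const a C * X * 8 powr (2 * a) / l powr (2 * a) + parity_const a C * X * 8 powr (2 * a) / l powr (2 * a) + 128 * (real N * real q) * L * al q / l"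
  by (intro add_mono PA PB) auto
 also have "... = (2 * parity_const a C * 8 powr (2 * a)) * X / l powr (2 * a) + 128 * (real N * real q) * L * al q / l"
  by (simp add: field_simps)
 finally show ?thesis unfolding S_def X_def N_def .
qed

end

section \<open>The integrals of the rate function\<close>

definition Phi :: "real \<Rightarrow> real \<Rightarrow> real \<Rightarrow> real" where
 "Phi b1 b2 t = min (t powr b1) (t powr b2)"

lemma Phi_nonneg [simp]: "0 <= Phi b1 b2 t" by (simp add: Phi_def)

lemma Phi_mono: "0 < b1 ==> 0 < b2 ==> 0 <= s ==> s <= t ==> Phi b1 b2 s <= Phi b1 b2 t"
 unfolding Phi_def by (intro min.mono powr_mono2) auto

lemma Phi_eq_large: "b2 <= b1 ==> 1 <= t ==> Phi b1 b2 t = t powr b2"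
 unfolding Phi_def using powr_mono[of b2 b1 t] by (simp add: min_def)

lemma Phi_eq_small: "b2 <= b1 ==> 0 <= t ==> t <= 1 ==> Phi b1 b2 t = t powr b1"
 unfolding Phi_def using powr_mono'[of b2 b1 t] by (simp add: min_def)

lemma Phi_scale:
 assumes "0 < b2" "b2 <= b1" "1 <= \<kappa>" "0 <= t"
 shows "Phi b1 b2 (\<kappa> * t) <= \<kappa> powr b1 * Phi b1 b2 t"
proof -
 have "(\<kappa> * t) powr b2 <= \<kappa> powr b1 * t powr b2"
  using assms by (auto simp: powr_mult intro!: mult_right_mono powr_mono)
 moreover have "(\<kappa> * t) powr b1 = \<kappa> powr b1 * t powr b1" using assms by (simp add: powr_mult)
 ultimately show ?thesis unfolding Phi_def using powr_ge_zero[of \<kappa> b1] by (simp add: min_mult_distrib_left)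
qed

text \<open>Coefficients decrease, hence the lags \<open>m\<close> with \<open>u < al m\<close> form an initial segment.\<close>

lemma indicator_sum_initial:
 fixes al :: "nat \<Rightarrow> real"
 assumes anti: "\<And>m n. m <= n ==> al n <= al m"
 obtains A where "A <= q" "\<forall>m<q. u < al m \<longleftrightarrow> m < A"
proof (cases "\<forall>m<q. u < al m")
 case True
 then show ?thesis by (intro that[of q]) auto
next
 case False
 then obtain m0 where m0: "m0 < q" "\<not> u < al m0" by auto
 define A where "A = (LEAST m. \<not> u < al m)"
 have 1: "\<not> u < al A" unfolding A_def by (rule LeastI) (rule m0)
 have 2: "u < al m" if "m < A" for m using not_less_Least[of m "\<lambda>m. \<not> u < al m"] that unfolding A_def by blast
 have "A <= m0" unfolding A_def by (rule Least_le) (rule m0)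
 moreover have "u < al m \<longleftrightarrow> m < A" for m using 1 2 anti[of A m] by (cases "m < A") auto
 ultimately show ?thesis using m0 by (intro that[of A]) auto
qed

text \<open>The function \<open>\<rho>\<close> plays the role of \<open>\<alpha>\<inverse> Q\<close>. The lower and the upper bound are the only two ways in which the inverse of \<open>al\<close> enters, and unlike an equation they tolerate
the factor between \<open>al\<close> and the coefficients.\<close>

locale alpha_rate = alpha_dependent +
 fixes H \<rho> :: "real \<Rightarrow> real"
 assumes H: "tail_function H"
  and \<rho>_lower: "\<And>u m. 0 < u ==> u < 1 ==> u < al m ==> real (Suc m) * quant H u <= \<rho> u"
  and \<rho>_upper: "\<And>u. 0 < u ==> u < 1 ==> 0 < quant H u ==> \<exists>m. al m <= u \<and> real m * quant H u <= \<rho> u"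
  and \<rho>_antimono: "\<And>u v. 0 < u ==> u <= v ==> v < 1 ==> \<rho> v <= \<rho> u"
  and \<rho>_nonneg: "\<And>u. 0 <= \<rho> u"
  and Q_integrable: "integrable unif01 (quant H)"
begin

lemma \<rho>_measurable [measurable]: "\<rho> \<in> borel_measurable unif01"
 by (rule antimono_measurable_unif01) (rule \<rho>_antimono)

lemmas Q_measurable [measurable] = quant_measurable[OF H]

definition VV :: "real \<Rightarrow> real" where "VV l = (\<integral>u. quant H u * min (\<rho> u) l \<partial>unif01)"

definition JJ :: "real \<Rightarrow> real \<Rightarrow> real \<Rightarrow> real" where
 "JJ b1 b2 l = (\<integral>u. quant H u * Phi b1 b2 (\<rho> u / l) \<partial>unif01)"

lemma sum_lev:
 assumes "0 <= L" "0 <= s"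
 shows "(\<Sum>m<q. w m * lev H L m s) = (\<integral>u. (\<Sum>m<q. w m * indicator {..<al m} u) * min (quant H u) L powr s \<partial>unif01)"
  "integrable unif01 (\<lambda>u. (\<Sum>m<q. w m * indicator {..<al m} u) * min (quant H u) L powr s)"
proof -
 have i: "integrable unif01 (\<lambda>u. w m * (indicator {..<al m} u * min (quant H u) L powr s))" for m
  using lev_integrable[OF H assms, of "al m"] by simp
 have eq: "(\<Sum>m<q. w m * indicator {..<al m} u) * min (quant H u) L powr s = (\<Sum>m<q. w m * (indicator {..<al m} u * min (quant H u) L powr s))" for u
  by (simp only: sum_distrib_right mult.assoc)
 show "integrable unif01 (\<lambda>u. (\<Sum>m<q. w m * indicator {..<al m} u) * min (quant H u) L powr s)"
  unfolding eq using i by (intro integrable_setsum)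
 show "(\<Sum>m<q. w m * lev H L m s) = (\<integral>u. (\<Sum>m<q. w m * indicator {..<al m} u) * min (quant H u) L powr s \<partial>unif01)"
  unfolding eq using i by (subst expect_sum) (auto simp: lev_def)
qed

lemma VV_integrable: "0 <= l ==> integrable unif01 (\<lambda>u. quant H u * min (\<rho> u) l)"
proof (rule integrable_dominated[where f="\<lambda>u. quant H u * l"])
 assume l: "0 <= l"
 show "integrable unif01 (\<lambda>u. quant H u * l)" using Q_integrable by simp
 show "(\<lambda>u. quant H u * min (\<rho> u) l) \<in> borel_measurable unif01" by measurable
 show "AE u in unif01. norm (quant H u * min (\<rho> u) l) <= norm (quant H u * l)"
  using l \<rho>_nonneg by (auto simp: abs_mult intro!: mult_left_mono)
qed

text \<open>For fixed \<open>u\<close> the number of lags with \<open>u < al m\<close>, times the quantile, is at most \<open>\<rho> u\<close>.\<close>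

lemma variance_integral:
 assumes L: "0 <= L" and ql: "real q * L <= l"
 shows "(\<Sum>m<q. lev H L m 2) <= VV l"
proof -
 have l: "0 <= l" using L ql by (meson mult_nonneg_nonneg of_nat_0_le_iff order_trans)
 have "(\<Sum>m<q. lev H L m 2) = (\<Sum>m<q. 1 * lev H L m 2)" by simp
 also have "... = (\<integral>u. (\<Sum>m<q. 1 * indicator {..<al m} u) * min (quant H u) L powr 2 \<partial>unif01)" using L by (intro sum_lev) auto
 also have "... <= VV l" unfolding VV_def
 proof (rule integral_mono)
  show "integrable unif01 (\<lambda>u. (\<Sum>m<q. 1 * indicator {..<al m} u) * min (quant H u) L powr 2)" using L by (intro sum_lev) auto
  show "integrable unif01 (\<lambda>u. quant H u * min (\<rho> u) l)" by (rule VV_integrable[OF l])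
  fix u assume "u \<in> space unif01"
  then have u: "0 < u" "u < 1" by auto
  obtain A where A': "A <= q" "\<forall>m<q. u < al m \<longleftrightarrow> m < A" by (rule indicator_sum_initial[where al=al and q=q and u=u, OF al_antimono])
  note A = A'(1) A'(2)[rule_format]
  have "(\<Sum>m<q. 1 * indicator {..<al m} u) = (\<Sum>m<q. if m \<in> {..<A} then 1 else (0::real))"
   using A(2) by (intro sum.cong) (auto simp: indicator_def)
  also have "... = (\<Sum>m\<in>{..<q} \<inter> {..<A}. 1)" by (rule sum.inter_restrict[symmetric]) simp
  also have "{..<q} \<inter> {..<A} = {..<A}" using A(1) by auto
  finally have s: "(\<Sum>m<q. 1 * indicator {..<al m} u) = real A" by simp
  define y where "y = min (quant H u) L"
  have y: "0 <= y" "y <= quant H u" "y <= L" using L by (auto simp: y_def)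
  have "real A * y <= min (\<rho> u) l"
  proof (cases "A = 0")
   case True
   then show ?thesis using \<rho>_nonneg l by simp
  next
   case False
   then have "u < al (A - 1)" using A by auto
   then have "real (Suc (A - 1)) * quant H u <= \<rho> u" by (rule \<rho>_lower[OF u])
   then have "real A * quant H u <= \<rho> u" using False by simp
   moreover have "real A * y <= real A * quant H u" using y by (intro mult_left_mono) auto
   moreover have "real A * y <= real q * L" using y A(1) by (intro mult_mono) auto
   ultimately show ?thesis using ql by simp
  qed
  then have "(real A * y) * y <= min (\<rho> u) l * quant H u" using y \<rho>_nonneg l by (intro mult_mono) auto
  then show "(\<Sum>m<q. 1 * indicator {..<al m} u) * min (quant H u) L powr 2 <= quant H u * min (\<rho> u) l"
   unfolding s y_def[symmetric] using y by (cases "y = 0") (auto simp: powr_numeral power2_eq_square mult_ac)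
 qed
 finally show ?thesis .
qed

text \<open>Pointwise in \<open>u\<close>: if \<open>A\<close> lags satisfy \<open>u < al m\<close> and \<open>y\<close> is the truncated quantile, then \<open>A y \<le> min (\<rho> u) l\<close> and \<open>q y \<le> l\<close>. The power sum over the lags contributes \<open>A powr (a - e)\<close>.\<close>

lemma block_moment_integral:
 assumes L: "0 <= L" and ql: "real q * L <= l" and l: "0 < l" and q: "1 <= q"
  and a: "1 < a" and e: "0 < e" "e < a" and b2: "0 < b2" "b2 <= a - e"
  and Ji: "integrable unif01 (\<lambda>u. quant H u * Phi (a - e) b2 (\<rho> u / l))"
 shows "real q powr (a - 1 + e) * (\<Sum>m<q. real (Suc m) powr (a - 1 - e) * lev H L m (2 * a)) <= (1 + 1 / (a - e)) * (l powr (2 * a - 1) * JJ (a - e) b2 l)"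
proof -
 have "real q powr (a - 1 + e) * (\<Sum>m<q. real (Suc m) powr (a - 1 - e) * lev H L m (2 * a))
  = (\<integral>u. real q powr (a - 1 + e) * ((\<Sum>m<q. real (Suc m) powr (a - 1 - e) * indicator {..<al m} u) * min (quant H u) L powr (2 * a)) \<partial>unif01)"
  using L a by (subst sum_lev(1)) auto
 also have "... <= (\<integral>u. ((1 + 1 / (a - e)) * l powr (2 * a - 1)) * (quant H u * Phi (a - e) b2 (\<rho> u / l)) \<partial>unif01)"
 proof (rule integral_mono)
  show "integrable unif01 (\<lambda>u. real q powr (a - 1 + e) * ((\<Sum>m<q. real (Suc m) powr (a - 1 - e) * indicator {..<al m} u) * min (quant H u) L powr (2 * a)))"
   using L a by (intro integrable_cmult sum_lev) auto
  show "integrable unif01 (\<lambda>u. ((1 + 1 / (a - e)) * l powr (2 * a - 1)) * (quant H u * Phi (a - e) b2 (\<rho> u / l)))"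
   using Ji by (rule integrable_cmult)
  fix u assume "u \<in> space unif01"
  then have u: "0 < u" "u < 1" by auto
  obtain A where A': "A <= q" "\<forall>m<q. u < al m \<longleftrightarrow> m < A" by (rule indicator_sum_initial[where al=al and q=q and u=u, OF al_antimono])
  note A = A'(1) A'(2)[rule_format]
  have "(\<Sum>m<q. real (Suc m) powr (a - 1 - e) * indicator {..<al m} u) = (\<Sum>m<q. if m \<in> {..<A} then real (Suc m) powr (a - 1 - e) else (0::real))"
   using A(2) by (intro sum.cong) (auto simp: indicator_def)
  also have "... = (\<Sum>m\<in>{..<q} \<inter> {..<A}. real (Suc m) powr (a - 1 - e))" by (rule sum.inter_restrict[symmetric]) simp
  also have "{..<q} \<inter> {..<A} = {..<A}" using A(1) by auto
  also have "(\<Sum>m<A. real (Suc m) powr (a - 1 - e)) <= (1 + 1 / (a - e)) * real A powr (a - e)"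
   using sum_powr_le[of "a - e" A] e by (simp add: algebra_simps)
  finally have s: "(\<Sum>m<q. real (Suc m) powr (a - 1 - e) * indicator {..<al m} u) <= (1 + 1 / (a - e)) * real A powr (a - e)" .
  define y where "y = min (quant H u) L"
  have y: "0 <= y" "y <= quant H u" "y <= L" using L by (auto simp: y_def)
  define t where "t = real A * y / l"
  have t0: "0 <= t" using y l by (simp add: t_def)
  have t1: "t <= 1"
  proof -
   have "real A * y <= real q * L" using y A(1) by (intro mult_mono) auto
   then show ?thesis using ql l by (simp add: t_def)
  qed
  have t2: "t <= \<rho> u / l"
  proof (cases "A = 0")
   case True
   then show ?thesis using \<rho>_nonneg l by (simp add: t_def)
  next
   case False
   then have "u < al (A - 1)" using A by auto
   then have "real (Suc (A - 1)) * quant H u <= \<rho> u" by (rule \<rho>_lower[OF u])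
   then have "real A * quant H u <= \<rho> u" using False by simp
   moreover have "real A * y <= real A * quant H u" using y by (intro mult_left_mono) auto
   ultimately show ?thesis using l by (simp add: t_def divide_right_mono)
  qed
  have key: "real q powr (a - 1 + e) * (real A powr (a - e) * y powr (2 * a)) <= l powr (2 * a - 1) * (quant H u * Phi (a - e) b2 (\<rho> u / l))"
  proof (cases "y = 0")
   case True
   then show ?thesis using a by simp
  next
   case False
   then have yp: "0 < y" using y by simp
   have "y powr (2 * a) = y * (y powr (a - e) * y powr (a - 1 + e))"
    using yp powr_add[of y "a - e" "a - 1 + e"] powr_add[of y 1 "2 * a - 1"] by simp
   then have "real q powr (a - 1 + e) * (real A powr (a - e) * y powr (2 * a)) = y * ((real A * y) powr (a - e) * (real q * y) powr (a - 1 + e))"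
    using yp by (simp add: powr_mult mult_ac)
   also have "... <= quant H u * ((l powr (a - e) * Phi (a - e) b2 (\<rho> u / l)) * l powr (a - 1 + e))"
   proof (intro mult_mono)
    have "(real A * y) powr (a - e) = (t * l) powr (a - e)" using l by (simp add: t_def)
    also have "... = l powr (a - e) * t powr (a - e)" using l t0 by (simp add: powr_mult mult.commute)
    also have "t powr (a - e) = Phi (a - e) b2 t" using Phi_eq_small[OF b2(2) t0 t1] by simp
    also have "Phi (a - e) b2 t <= Phi (a - e) b2 (\<rho> u / l)" using e b2 t0 t2 by (intro Phi_mono) auto
    finally show "(real A * y) powr (a - e) <= l powr (a - e) * Phi (a - e) b2 (\<rho> u / l)" by (simp add: mult_left_mono)
    have "real q * y <= l" using y ql mult_left_mono[of y L "real q"] by simp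
    then show "(real q * y) powr (a - 1 + e) <= l powr (a - 1 + e)" using y e a by (intro powr_mono2) auto
   qed (use y in auto)
   also have "... = (l powr (a - e) * l powr (a - 1 + e)) * (quant H u * Phi (a - e) b2 (\<rho> u / l))" by simp
   also have "l powr (a - e) * l powr (a - 1 + e) = l powr (2 * a - 1)" by (simp add: powr_add[symmetric])
   finally show ?thesis .
  qed
  have c0: "0 <= 1 + 1 / (a - e)" using e by (simp add: add_nonneg_nonneg)
  have "real q powr (a - 1 + e) * ((\<Sum>m<q. real (Suc m) powr (a - 1 - e) * indicator {..<al m} u) * y powr (2 * a))
   <= real q powr (a - 1 + e) * (((1 + 1 / (a - e)) * real A powr (a - e)) * y powr (2 * a))"
   using s by (intro mult_left_mono mult_right_mono) auto
  also have "... = (1 + 1 / (a - e)) * (real q powr (a - 1 + e) * (real A powr (a - e) * y powr (2 * a)))" by simp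
  also have "... <= (1 + 1 / (a - e)) * (l powr (2 * a - 1) * (quant H u * Phi (a - e) b2 (\<rho> u / l)))"
   using key c0 by (rule mult_left_mono)
  finally show "real q powr (a - 1 + e) * ((\<Sum>m<q. real (Suc m) powr (a - 1 - e) * indicator {..<al m} u) * min (quant H u) L powr (2 * a))
   <= ((1 + 1 / (a - e)) * l powr (2 * a - 1)) * (quant H u * Phi (a - e) b2 (\<rho> u / l))"
   by (simp add: y_def mult.assoc)
 qed
 also have "... = (1 + 1 / (a - e)) * (l powr (2 * a - 1) * JJ (a - e) b2 l)" by (simp add: JJ_def)
 finally show ?thesis .
qed

text \<open>Pointwise in \<open>u\<close>: the geometric sum is of the order of its last term, the largest \<open>2 ^ k\<close> with \<open>u < al (2 ^ k q)\<close>, and then \<open>2 ^ k l \<le> 32 \<rho> u\<close>.\<close>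

lemma long_range_integral:
 assumes v: "0 < v" "v < 1" and Lv: "0 < quant H v" and q: "1 <= q" "al q <= v" and l: "0 < l" "l <= 32 * (real q * quant H v)"
  and b: "0 < b2" "b2 <= b1"
  and Ji: "integrable unif01 (\<lambda>u. quant H u * Phi b1 b2 (\<rho> u / l))"
 shows "(\<Sum>k\<le>K. 2 powr (real k * b2) * al (2 ^ k * q)) / real q <= (32 * 32 powr b1 / (1 - 2 powr (- b2))) * JJ b1 b2 l / l"
proof -
 interpret U: prob_space unif01 by (rule prob_space_unif01)
 define g where "g = 1 / (1 - 2 powr (- b2))"
 have g: "0 < g" using b by (simp add: g_def powr_less_one)
 have qp: "0 < real q" using q by simp
 have i: "integrable unif01 (indicat_real {..<c})" for c
 proof (rule U.integrable_const_bound[where B=1])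
  show "indicat_real {..<c} \<in> borel_measurable unif01" by (rule indicator_unif01_measurable)
 qed (auto simp: indicator_def)
 have "(\<Sum>k\<le>K. 2 powr (real k * b2) * al (2 ^ k * q)) = (\<Sum>k\<le>K. \<integral>u. 2 powr (real k * b2) * indicat_real {..<al (2 ^ k * q)} u \<partial>unif01)"
 proof (rule sum.cong)
  fix k
  have "al (2 ^ k * q) = (\<integral>u. indicat_real {..<al (2 ^ k * q)} u \<partial>unif01)"
   by (rule integral_indicator_unif01[symmetric]) (use al_nonneg[of "2 ^ k * q"] al_le_half[of "2 ^ k * q"] in linarith)+
  then show "2 powr (real k * b2) * al (2 ^ k * q) = (\<integral>u. 2 powr (real k * b2) * indicat_real {..<al (2 ^ k * q)} u \<partial>unif01)"
   by (simp only: Bochner_Integration.integral_mult_right_zero)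
 qed simp
 also have "... = (\<integral>u. (\<Sum>k\<le>K. 2 powr (real k * b2) * indicat_real {..<al (2 ^ k * q)} u) \<partial>unif01)"
  using i by (intro expect_sum[symmetric]) auto
 finally have "(\<Sum>k\<le>K. 2 powr (real k * b2) * al (2 ^ k * q)) / real q = (\<integral>u. (\<Sum>k\<le>K. 2 powr (real k * b2) * indicat_real {..<al (2 ^ k * q)} u) / real q \<partial>unif01)"
  by simp
 also have "... <= (\<integral>u. (32 * 32 powr b1 * g / l) * (quant H u * Phi b1 b2 (\<rho> u / l)) \<partial>unif01)"
 proof (rule integral_mono)
  show "integrable unif01 (\<lambda>u. (\<Sum>k\<le>K. 2 powr (real k * b2) * indicat_real {..<al (2 ^ k * q)} u) / real q)"
   using i by (intro Bochner_Integration.integrable_divide integrable_setsum) auto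
  show "integrable unif01 (\<lambda>u. (32 * 32 powr b1 * g / l) * (quant H u * Phi b1 b2 (\<rho> u / l)))"
   using Ji by (rule integrable_cmult)
  fix u assume "u \<in> space unif01"
  then have u: "0 < u" "u < 1" by auto
  obtain A where A': "A <= Suc K" "\<forall>m<Suc K. u < al (2 ^ m * q) \<longleftrightarrow> m < A"
  proof (rule indicator_sum_initial[where al="\<lambda>m. al (2 ^ m * q)" and q="Suc K" and u=u])
   show "al (2 ^ n * q) <= al (2 ^ m * q)" if "m <= n" for m n
    using that by (intro al_antimono mult_right_mono power_increasing) auto
  qed
  note A = A'(1) A'(2)[rule_format]
  have "(\<Sum>k\<le>K. 2 powr (real k * b2) * indicat_real {..<al (2 ^ k * q)} u) = (\<Sum>k<Suc K. if k \<in> {..<A} then 2 powr (real k * b2) else 0)"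
   using A(2) by (intro sum.cong) (auto simp: indicator_def)
  also have "... = (\<Sum>k\<in>{..<Suc K} \<inter> {..<A}. 2 powr (real k * b2))" by (rule sum.inter_restrict[symmetric]) simp
  also have "{..<Suc K} \<inter> {..<A} = {..<A}" using A(1) by auto
  finally have s: "(\<Sum>k\<le>K. 2 powr (real k * b2) * indicat_real {..<al (2 ^ k * q)} u) = (\<Sum>k<A. 2 powr (real k * b2))" .
  show "(\<Sum>k\<le>K. 2 powr (real k * b2) * indicat_real {..<al (2 ^ k * q)} u) / real q <= (32 * 32 powr b1 * g / l) * (quant H u * Phi b1 b2 (\<rho> u / l))"
  proof (cases "A = 0")
   case True
   then show ?thesis unfolding s using g l by simp
  next
   case False
   define k where "k = A - 1"
   have Ak: "A = Suc k" using False by (simp add: k_def)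
   have uk: "u < al (2 ^ k * q)" using A Ak by auto
   have "q <= 2 ^ k * q" by simp
   then have "u < al q" using uk al_antimono by (meson less_le_trans)
   then have "u <= v" using q by simp
   then have QL: "quant H v <= quant H u" using quant_antimono[OF H u(1)] by simp
   have "real (Suc (2 ^ k * q)) * quant H u <= \<rho> u" by (rule \<rho>_lower[OF u uk])
   moreover have "2 ^ k * (real q * quant H u) <= real (Suc (2 ^ k * q)) * quant H u"
    by (simp add: algebra_simps)
   ultimately have r1: "2 ^ k * (real q * quant H u) <= \<rho> u" by linarith
   have lq: "l <= 32 * (real q * quant H u)" using l(2) QL mult_left_mono[OF QL, of "real q"] by simp
   have "2 ^ k * l <= 2 ^ k * (32 * (real q * quant H u))" using lq by (intro mult_left_mono) auto
   also have "... = 32 * (2 ^ k * (real q * quant H u))" by simp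
   also have "... <= 32 * \<rho> u" using r1 by (intro mult_left_mono) auto
   finally have "2 ^ k * l <= 32 * \<rho> u" .
   then have r2: "2 ^ k <= 32 * (\<rho> u / l)" using l by (simp add: field_simps)
   have geo: "(\<Sum>k<A. 2 powr (real k * b2)) <= g * 2 powr (real k * b2)"
   proof -
    have "(\<Sum>j<A. 2 powr (real j * b2)) = (\<Sum>j\<le>k. 2 powr (real (k - j) * b2))"
     unfolding Ak lessThan_Suc_atMost by (rule sum_reverse_atMost[symmetric])
    also have "... = (\<Sum>j\<le>k. 2 powr (real k * b2) * 2 powr (- b2 * real j))"
     by (intro sum.cong refl) (simp add: powr_add[symmetric] of_nat_diff algebra_simps)
    also have "... = 2 powr (real k * b2) * (\<Sum>j\<le>k. 2 powr (- b2 * real j))" by (simp add: sum_distrib_left)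
    also have "... <= 2 powr (real k * b2) * g" unfolding g_def using b by (intro mult_left_mono geometric_powr_sum_le) auto
    finally show ?thesis by (simp add: mult.commute)
   qed
   have "2 powr (real k * b2) = (2 ^ k) powr b2" by (simp add: powr_realpow[symmetric] powr_powr)
   also have "... <= (32 * (\<rho> u / l)) powr b2" using r2 b by (intro powr_mono2) auto
   also have "... = Phi b1 b2 (32 * (\<rho> u / l))"
   proof (rule Phi_eq_large[symmetric, OF b(2)])
    have "(1::real) <= 2 ^ k" by simp
    then show "1 <= 32 * (\<rho> u / l)" using r2 by linarith
   qed
   also have "... <= 32 powr b1 * Phi b1 b2 (\<rho> u / l)" using b l \<rho>_nonneg by (intro Phi_scale) auto
   finally have p2: "2 powr (real k * b2) <= 32 powr b1 * Phi b1 b2 (\<rho> u / l)" .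
   have iq: "1 / real q <= 32 * quant H u / l" using lq l qp by (simp add: field_simps)
   have "(\<Sum>k<A. 2 powr (real k * b2)) / real q = (\<Sum>k<A. 2 powr (real k * b2)) * (1 / real q)" by simp
   also have "... <= (g * (32 powr b1 * Phi b1 b2 (\<rho> u / l))) * (32 * quant H u / l)"
   proof (intro mult_mono iq)
    show "(\<Sum>k<A. 2 powr (real k * b2)) <= g * (32 powr b1 * Phi b1 b2 (\<rho> u / l))"
     using geo mult_left_mono[OF p2, of g] g by linarith
   qed (use g in auto)
   also have "... = (32 * 32 powr b1 * g / l) * (quant H u * Phi b1 b2 (\<rho> u / l))" by simp
   finally show ?thesis unfolding s .
  qed
 qed
 also have "... = (32 * 32 powr b1 / (1 - 2 powr (- b2))) * JJ b1 b2 l / l" by (simp add: JJ_def g_def)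
 finally show ?thesis .
qed

end

section \<open>The deviation inequality\<close>

context alpha_rate begin

definition small_Q :: "real \<Rightarrow> real" where "small_Q v = (\<integral>u. indicator {..<v} u * quant H u \<partial>unif01)"

lemma small_Q_integrable: "integrable unif01 (\<lambda>u. indicat_real {..<v} u * quant H u)"
proof (rule integrable_dominated[OF Q_integrable])
 note [measurable] = indicator_unif01_measurable
 show "(\<lambda>u. indicat_real {..<v} u * quant H u) \<in> borel_measurable unif01" by measurable
qed (auto simp: indicator_def)

lemma small_Q_nonneg: "0 <= small_Q v"
 unfolding small_Q_def by (intro integral_ge_0) auto

lemma small_Q_ge:
 assumes v: "0 < v" "v < 1" shows "quant H v * v <= small_Q v"
proof -
 interpret U: prob_space unif01 by (rule prob_space_unif01)
 have "quant H v * v = (\<integral>u. indicat_real {..<v} u * quant H v \<partial>unif01)"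
  using integral_indicator_unif01[of v] v by simp
 also have "... <= small_Q v" unfolding small_Q_def
 proof (rule integral_mono[OF _ small_Q_integrable])
  show "integrable unif01 (\<lambda>u. indicat_real {..<v} u * quant H v)"
  proof (rule U.integrable_const_bound[where B="quant H v"])
   note [measurable] = indicator_unif01_measurable
   show "(\<lambda>u. indicat_real {..<v} u * quant H v) \<in> borel_measurable unif01" by measurable
  qed (auto simp: indicator_def)
  show "indicat_real {..<v} u * quant H v <= indicat_real {..<v} u * quant H u" if "u \<in> space unif01" for u
   using quant_antimono[OF H, of u v] that by (auto simp: indicator_def)
 qed
 finally show ?thesis .
qed

lemma small_Q_double:
 assumes v: "0 < v" "2 * v <= 1" shows "small_Q (2 * v) <= 2 * small_Q v"
proof -
 interpret U: prob_space unif01 by (rule prob_space_unif01)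
 note [measurable] = indicator_unif01_measurable
 have i: "integrable unif01 (indicat_real {..<c})" for c
 proof (rule U.integrable_const_bound[where B=1])
  show "indicat_real {..<c} \<in> borel_measurable unif01" by (rule indicator_unif01_measurable)
 qed (auto simp: indicator_def)
 have "small_Q (2 * v) <= (\<integral>u. indicat_real {..<v} u * quant H u + (indicat_real {..<2 * v} u - indicat_real {..<v} u) * quant H v \<partial>unif01)"
  unfolding small_Q_def
 proof (rule integral_mono[OF small_Q_integrable])
  show "integrable unif01 (\<lambda>u. indicat_real {..<v} u * quant H u + (indicat_real {..<2 * v} u - indicat_real {..<v} u) * quant H v)"
   using i small_Q_integrable by (intro Bochner_Integration.integrable_add Bochner_Integration.integrable_mult_left Bochner_Integration.integrable_diff) auto
  show "indicat_real {..<2 * v} u * quant H u <= indicat_real {..<v} u * quant H u + (indicat_real {..<2 * v} u - indicat_real {..<v} u) * quant H v"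
   if "u \<in> space unif01" for u
   using quant_antimono[OF H v(1), of u] v by (auto simp: indicator_def)
 qed
 also have "... = small_Q v + (\<integral>u. (indicat_real {..<2 * v} u - indicat_real {..<v} u) \<partial>unif01) * quant H v"
  using i small_Q_integrable by (simp add: small_Q_def)
 also have "(\<integral>u. (indicat_real {..<2 * v} u - indicat_real {..<v} u) \<partial>unif01) = 2 * v - v"
  using i integral_indicator_unif01[of "2 * v"] integral_indicator_unif01[of v] v by (subst Bochner_Integration.integral_diff) auto
 finally show ?thesis using small_Q_ge[of v] v by (simp add: mult.commute)
qed

text \<open>On \<open>(0, w)\<close> the rate exceeds \<open>l / 16\<close>, hence \<open>\<Phi> (\<rho> / l)\<close> is bounded below.\<close>

lemma small_Q_le_JJ:
 assumes w: "0 < w" "w < 1" "l / 16 < \<rho> w" and l: "0 < l" and b: "0 < b2" "b2 <= b1"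
  and Ji: "integrable unif01 (\<lambda>u. quant H u * Phi b1 b2 (\<rho> u / l))"
 shows "small_Q w <= 16 powr b1 * JJ b1 b2 l"
proof -
 have "small_Q w <= (\<integral>u. 16 powr b1 * (quant H u * Phi b1 b2 (\<rho> u / l)) \<partial>unif01)"
  unfolding small_Q_def
 proof (rule integral_mono[OF small_Q_integrable])
  show "integrable unif01 (\<lambda>u. 16 powr b1 * (quant H u * Phi b1 b2 (\<rho> u / l)))"
   using Ji by (rule integrable_cmult)
  fix u assume "u \<in> space unif01"
  then have u: "0 < u" "u < 1" by auto
  show "indicat_real {..<w} u * quant H u <= 16 powr b1 * (quant H u * Phi b1 b2 (\<rho> u / l))"
  proof (cases "u < w")
   case True
   then have "l / 16 < \<rho> u" using \<rho>_antimono[OF u(1), of w] w by simp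
   then have "1 <= 16 * (\<rho> u / l)" using l by (simp add: field_simps)
   then have "1 <= Phi b1 b2 (16 * (\<rho> u / l))" using b by (simp add: Phi_eq_large ge_one_powr_ge_zero)
   also have "... <= 16 powr b1 * Phi b1 b2 (\<rho> u / l)" using b l \<rho>_nonneg by (intro Phi_scale) auto
   finally show ?thesis using True mult_left_mono[of 1 "16 powr b1 * Phi b1 b2 (\<rho> u / l)" "quant H u"] by (simp add: mult.left_commute)
  qed simp
 qed
 then show ?thesis by (simp add: JJ_def)
qed

lemma small_Q_tendsto: "(\<lambda>j. small_Q ((1/2) ^ j)) \<longlonglongrightarrow> 0"
proof -
 have "(\<lambda>j. small_Q ((1/2) ^ j)) \<longlonglongrightarrow> (\<integral>u. 0 \<partial>unif01)"
  unfolding small_Q_def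
 proof (rule integral_dominated_convergence[where w="quant H"])
  show "integrable unif01 (quant H)" by (rule Q_integrable)
  show "(\<lambda>u. indicat_real {..<(1/2) ^ j} u * quant H u) \<in> borel_measurable unif01" for j
   using small_Q_integrable by (rule borel_measurable_integrable)
  show "AE u in unif01. (\<lambda>j. indicat_real {..<(1/2) ^ j} u * quant H u) \<longlonglongrightarrow> 0"
  proof (rule AE_I2)
   fix u assume "u \<in> space unif01"
   then have u: "0 < u" by simp
   have "(\<lambda>j. (1/2::real) ^ j) \<longlonglongrightarrow> 0" by (rule LIMSEQ_power_zero) simp
   then have "eventually (\<lambda>j. (1/2) ^ j < u) sequentially" using u by (rule order_tendstoD)
   then have "eventually (\<lambda>j. indicat_real {..<(1/2) ^ j} u * quant H u = 0) sequentially"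
    by eventually_elim (auto simp: indicator_def)
   then show "(\<lambda>j. indicat_real {..<(1/2) ^ j} u * quant H u) \<longlonglongrightarrow> 0" by (rule tendsto_eventually)
  qed
 qed (auto simp: indicator_def)
 then show ?thesis by simp
qed

lemma maximal_split:
 fixes A B :: "nat \<Rightarrow> 'a \<Rightarrow> real" and l :: real
 assumes [measurable]: "\<And>j. A j \<in> borel_measurable M" "\<And>j. B j \<in> borel_measurable M"
 shows "prob {w \<in> space M. \<exists>k\<in>{1..n}. l <= \<bar>\<Sum>j=1..k. A j w\<bar>} <=
  prob {w \<in> space M. \<exists>k\<in>{1..n}. l / 2 <= \<bar>\<Sum>j=1..k. B j w\<bar>}
  + prob {w \<in> space M. \<exists>k\<in>{1..n}. l / 2 <= \<bar>\<Sum>j=1..k. (A j w - B j w)\<bar>}" (is "prob ?E <= prob ?E1 + prob ?E2")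
proof -
 have E: "?E1 \<in> events" "?E2 \<in> events" by measurable
 have "prob ?E <= prob (?E1 \<union> ?E2)"
 proof (rule finite_measure_mono)
  show "?E \<subseteq> ?E1 \<union> ?E2"
  proof
   fix w assume "w \<in> ?E"
   then obtain k where k: "w \<in> space M" "k \<in> {1..n}" "l <= \<bar>\<Sum>j=1..k. A j w\<bar>" by blast
   then have "l / 2 <= \<bar>\<Sum>j=1..k. B j w\<bar> \<or> l / 2 <= \<bar>\<Sum>j=1..k. (A j w - B j w)\<bar>"
    unfolding sum_subtractf by linarith
   then show "w \<in> ?E1 \<union> ?E2" using k by blast
  qed
 qed (use E in auto)
 also have "... <= prob ?E1 + prob ?E2" using E by (intro measure_Un_le)
 finally show ?thesis .
qed

text \<open>The maximum is at most the sum of all absolute values, to which the Markov inequality applies.\<close>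

lemma ctr_difference_tail:
 assumes f: "integrable \<mu> f" and g: "integrable \<mu> g" and t: "0 < t"
 shows "prob {w \<in> space M. \<exists>k\<in>{1..n}. t <= \<bar>\<Sum>j=1..k. (ctr f (int j) w - ctr g (int j) w)\<bar>}
   <= 2 * real n * (\<integral>y. \<bar>f y - g y\<bar> \<partial>\<mu>) / t"
proof -
 define d where "d y = f y - g y" for y
 define I where "I = (\<integral>y. \<bar>d y\<bar> \<partial>\<mu>)"
 have di: "integrable \<mu> d" unfolding d_def using f g by simp
 have dm: "d \<in> borel_measurable borel" using borel_measurable_integrable[OF di] \<mu>_sets by (simp cong: measurable_cong_sets)
 define Z where "Z j w = \<bar>d (Y j w)\<bar> + I" for j w
 have Yi: "integrable M (\<lambda>w. \<bar>d (Y j w)\<bar>)" for j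
  using di law[of j] integrable_distr[OF Y_measM[of j], of d] by simp
 have EZ: "expectation (Z j) <= 2 * I" for j
 proof -
  have "expectation (Z j) = (\<E> w. \<bar>d (Y j w)\<bar>) + I" unfolding Z_def using Yi by (simp add: prob_space)
  also have "(\<E> w. \<bar>d (Y j w)\<bar>) = I" unfolding I_def by (rule integral_Y[of "\<lambda>x. \<bar>d x\<bar>"]) (use dm in measurable)
  finally show ?thesis by simp
 qed
 have Zi: "integrable M (Z j)" for j unfolding Z_def using Yi by simp
 have Z0: "0 <= Z j w" for j w unfolding Z_def I_def by (intro add_nonneg_nonneg integral_ge_0) auto
 have le: "\<bar>ctr f j w - ctr g j w\<bar> <= Z j w" for j w
 proof -
  have "ctr f j w - ctr g j w = d (Y j w) - (\<integral>y. d y \<partial>\<mu>)" unfolding ctr_def d_def using f g by simp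
  moreover have "\<bar>\<integral>y. d y \<partial>\<mu>\<bar> <= I" unfolding I_def by (rule integral_abs_bound)
  ultimately show ?thesis unfolding Z_def by linarith
 qed
 have Si: "integrable M (\<lambda>w. \<Sum>j=1..n. Z (int j) w)" using Zi by (intro integrable_setsum)
 have "prob {w \<in> space M. \<exists>k\<in>{1..n}. t <= \<bar>\<Sum>j=1..k. (ctr f (int j) w - ctr g (int j) w)\<bar>} <= prob {w \<in> space M. t <= (\<Sum>j=1..n. Z (int j) w)}"
 proof (rule finite_measure_mono)
  have [measurable]: "Z j \<in> borel_measurable M" for j using Zi by auto
  show "{w \<in> space M. t <= (\<Sum>j=1..n. Z (int j) w)} \<in> events" by measurable
  show "{w \<in> space M. \<exists>k\<in>{1..n}. t <= \<bar>\<Sum>j=1..k. (ctr f (int j) w - ctr g (int j) w)\<bar>} \<subseteq> {w \<in> space M. t <= (\<Sum>j=1..n. Z (int j) w)}"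
  proof
   fix w assume "w \<in> {w \<in> space M. \<exists>k\<in>{1..n}. t <= \<bar>\<Sum>j=1..k. (ctr f (int j) w - ctr g (int j) w)\<bar>}"
   then obtain k where k: "w \<in> space M" "k \<in> {1..n}" "t <= \<bar>\<Sum>j=1..k. (ctr f (int j) w - ctr g (int j) w)\<bar>" by blast
   note k(3)
   also have "\<bar>\<Sum>j=1..k. (ctr f (int j) w - ctr g (int j) w)\<bar> <= (\<Sum>j=1..k. \<bar>ctr f (int j) w - ctr g (int j) w\<bar>)" by (rule sum_abs)
   also have "... <= (\<Sum>j=1..k. Z (int j) w)" by (intro sum_mono le)
   also have "... <= (\<Sum>j=1..n. Z (int j) w)" using k Z0 by (intro sum_mono2) auto
   finally show "w \<in> {w \<in> space M. t <= (\<Sum>j=1..n. Z (int j) w)}" using k by simp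
  qed
 qed
 also have "... <= (\<E> w. \<Sum>j=1..n. Z (int j) w) / t"
  using t Z0 by (intro integral_Markov_inequality_measure[OF Si, where A="{}"]) (auto intro!: sum_nonneg)
 also have "(\<E> w. \<Sum>j=1..n. Z (int j) w) = (\<Sum>j=1..n. expectation (Z (int j)))" using Zi by (intro expect_sum)
 also have "(\<Sum>j=1..n. expectation (Z (int j))) / t <= (\<Sum>j=1..n. 2 * I) / t" using t EZ by (intro divide_right_mono sum_mono) auto
 also have "(\<Sum>j=1..n. 2 * I) / t = 2 * real n * I / t" by simp
 finally show ?thesis by (simp add: I_def d_def)
qed

lemma truncation_integrable:
 assumes tf: "truncation_family H \<mu> h lo" and B: "0 <= B"
 shows "integrable \<mu> h" "integrable \<mu> (lo B)" "(\<integral>y. \<bar>h y - lo B y\<bar> \<partial>\<mu>) <= (\<integral>u. max 0 (quant H u - B) \<partial>unif01)"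
proof -
 interpret \<mu>: prob_space \<mu> by (rule \<mu>_prob)
 have hm: "h \<in> borel_measurable borel" using tf by (simp add: truncation_family_def)
 have lo: "bv_bounded (4 * B) (lo B)" "\<And>y. \<bar>lo B y\<bar> <= B" 
  and nn: "(\<integral>\<^sup>+x. ennreal \<bar>h x - lo B x\<bar> \<partial>\<mu>) <= (\<integral>\<^sup>+u. ennreal (max 0 (quant H u - B)) \<partial>unif01)"
  using tf B unfolding truncation_family_def by auto
 have lm: "lo B \<in> borel_measurable borel" using bv_bounded_borel[OF lo(1)] .
 define d where "d y = h y - lo B y" for y
 have dm: "d \<in> borel_measurable borel" unfolding d_def using hm lm by measurable
 have dm\<mu>: "d \<in> borel_measurable \<mu>" "lo B \<in> borel_measurable \<mu>" using dm lm \<mu>_sets by (simp_all cong: measurable_cong_sets)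
 have Bi: "integrable unif01 (\<lambda>u. max 0 (quant H u - B))"
  by (rule integrable_dominated[OF Q_integrable]) (use B in auto)
 define I where "I = (\<integral>u. max 0 (quant H u - B) \<partial>unif01)"
 have eqI: "(\<integral>\<^sup>+u. ennreal (max 0 (quant H u - B)) \<partial>unif01) = ennreal I"
  unfolding I_def using Bi by (intro nn_integral_eq_integral) auto
 have di: "integrable \<mu> d"
 proof (rule integrableI_bounded[OF dm\<mu>(1)])
  have "(\<integral>\<^sup>+x. ennreal (norm (d x)) \<partial>\<mu>) <= ennreal I" using nn eqI by (simp add: d_def)
  then show "(\<integral>\<^sup>+x. ennreal (norm (d x)) \<partial>\<mu>) < \<infinity>" by (simp add: le_less_trans)
 qed
 show li: "integrable \<mu> (lo B)" by (rule \<mu>.integrable_const_bound[where B=B]) (use lo dm\<mu> in auto)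
 have "h = (\<lambda>y. d y + lo B y)" by (simp add: d_def)
 then show "integrable \<mu> h" using di li by (metis Bochner_Integration.integrable_add)
 have "ennreal (\<integral>x. \<bar>d x\<bar> \<partial>\<mu>) = (\<integral>\<^sup>+x. ennreal \<bar>d x\<bar> \<partial>\<mu>)" using di by (intro nn_integral_eq_integral[symmetric]) auto
 also have "... <= ennreal I" using nn eqI by (simp add: d_def)
 finally show "(\<integral>y. \<bar>h y - lo B y\<bar> \<partial>\<mu>) <= (\<integral>u. max 0 (quant H u - B) \<partial>unif01)"
  unfolding I_def d_def by (simp add: ennreal_le_iff)
qed

lemma truncation_rest:
 assumes tf: "truncation_family H \<mu> h lo" and B: "0 <= B" and t: "0 < t"
 shows "prob {w \<in> space M. \<exists>k\<in>{1..n}. t <= \<bar>\<Sum>j=1..k. (ctr h (int j) w - ctr (lo B) (int j) w)\<bar>}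
   <= 2 * real n * (\<integral>u. max 0 (quant H u - B) \<partial>unif01) / t"
proof (rule order_trans[OF ctr_difference_tail[OF truncation_integrable(1,2)[OF tf B] t]])
 show "2 * real n * (\<integral>y. \<bar>h y - lo B y\<bar> \<partial>\<mu>) / t <= 2 * real n * (\<integral>u. max 0 (quant H u - B) \<partial>unif01) / t"
  using t truncation_integrable(3)[OF tf B] by (intro divide_right_mono mult_left_mono) auto
qed

lemma ctr_measurable: "integrable \<mu> f ==> ctr f i \<in> borel_measurable M"
proof -
 assume "integrable \<mu> f"
 then have [measurable]: "f \<in> borel_measurable borel" using \<mu>_sets borel_measurable_integrable[of \<mu> f] by (simp cong: measurable_cong_sets)
 show "ctr f i \<in> borel_measurable M" unfolding ctr_def by measurable
qed

lemma excess_le_small_Q: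
 assumes v: "0 < v" "v < 1" shows "(\<integral>u. max 0 (quant H u - quant H v) \<partial>unif01) <= small_Q v"
 unfolding small_Q_def
proof (rule integral_mono[OF _ small_Q_integrable])
 show "integrable unif01 (\<lambda>u. max 0 (quant H u - quant H v))"
  by (rule integrable_dominated[OF Q_integrable]) auto
 show "max 0 (quant H u - quant H v) <= indicat_real {..<v} u * quant H u" if "u \<in> space unif01" for u
  using quant_antimono[OF H v(1), of u] that by (auto simp: indicator_def)
qed

text \<open>The block length is \<open>l / (16 L)\<close>, rounded down. It is at least the lag \<open>m\<close> of the upper bound on \<open>\<rho> v\<close>, so that \<open>al q \<le> v\<close>; this is how \<open>\<rho> v \<le> l / 16\<close> is used.\<close>

lemma truncated_deviation:
 assumes a: "3 / 2 < a" and e: "0 < e" "e < a - 1" and \<delta>: "0 < \<delta>" and b: "a - 1 + \<delta> <= a - e" and C: "predictable_bound a \<delta> C"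
  and Ji: "integrable unif01 (\<lambda>u. quant H u * Phi (a - e) (a - 1 + \<delta>) (\<rho> u / l))"
  and tf: "truncation_family H \<mu> h lo" and v: "0 < v" "v <= 1 / 4" and \<rho>v: "\<rho> v <= l / 16" and l: "0 < l" and n: "1 <= n" and Qv: "0 < quant H v"
 shows "prob {w \<in> space M. \<exists>k\<in>{1..n}. l / 2 <= \<bar>\<Sum>j=1..k. ctr (lo (quant H v)) (int j) w\<bar>} <=
  (2 * parity_const a C * 8 powr (2 * a)) * (512 powr a + dd_const a e * 16 powr (a + 1) * (1 + 1 / (a - e)) + 32 * 32 powr (a - e) / (1 - 2 powr (- (a - 1 + \<delta>))))
   * ((real n * VV l) powr a / l powr (2 * a) + real n / l * JJ (a - e) (a - 1 + \<delta>) l) + 128 * (real n / l * small_Q v)"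
proof -
 define L where "L = quant H v"
 have L: "0 < L" using Qv by (simp add: L_def)
 obtain m where m: "al m <= v" "real m * L <= \<rho> v" using \<rho>_upper[of v] v Qv by (auto simp: L_def)
 have m1: "1 <= m" using m(1) v al_0 by (cases m) auto
 define q where "q = nat \<lfloor>l / 16 / L\<rfloor>"
 have mq: "m <= q"
 proof -
  have "real m <= l / 16 / L" using m(2) \<rho>v L by (simp add: field_simps)
  then show ?thesis unfolding q_def by (simp add: le_nat_iff le_floor_iff)
 qed
 have q: "1 <= q" using m1 mq by simp
 have qf: "real q <= l / 16 / L" "l / 16 / L < real q + 1" unfolding q_def using l L by (auto simp: floor_le_iff)
 have ql: "16 * (real q * L) <= l" using qf(1) L by (simp add: field_simps)
 have lq: "l <= 32 * (real q * L)"
 proof -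
  have "l / 16 < (real q + 1) * L" using qf(2) L by (simp add: field_simps)
  also have "... <= (2 * real q) * L" using q L by (intro mult_right_mono) auto
  finally show ?thesis by simp
 qed
 have alq: "al q <= v" using al_antimono[OF mq] m(1) by simp
 have "0 <= real q * L" using L by simp
 then have qlL: "real q * L <= l" "2 * (real q * L) <= l" using ql by linarith+
 interpret B: truncated_blocks M F Y al \<mu> H h lo L q
  by unfold_locales (use H tf L q in auto)
 obtain K where K: "2 ^ K <= max 1 (n div q)" "max 1 (n div q) < 2 ^ Suc K"
  using ex_power_ivl1[of 2 "max 1 (n div q)"] by auto
 define N where "N = n div q"
 have Nq: "real N * real q <= real n" unfolding N_def by (metis of_nat_le_iff of_nat_mult div_times_less_eq_dividend)
 define P where "P = 2 * parity_const a C * 8 powr (2 * a)"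
 have C0: "0 < C" using C by (simp add: predictable_bound_def)
 have P0: "0 <= P" unfolding P_def parity_const_def using a C0 taylor_const_ge_1[of "2 * a"] by simp
 have dd0: "0 <= dd_const a e" unfolding dd_const_def using a taylor_const_ge_1[of "2 * a"] by simp
 define J where "J = JJ (a - e) (a - 1 + \<delta>) l"
 have J0: "0 <= J" unfolding J_def JJ_def by (intro integral_ge_0) auto
 have VV0: "0 <= VV l" unfolding VV_def using \<rho>_nonneg l by (intro integral_ge_0 mult_nonneg_nonneg) auto
 define c3 where "c3 = 32 * 32 powr (a - e) / (1 - 2 powr (- (a - 1 + \<delta>)))"
 have "(2::real) powr (- (a - 1 + \<delta>)) < 1" using a \<delta> by (intro powr_less_one) auto
 then have c30: "0 <= c3" unfolding c3_def by (intro divide_nonneg_nonneg) auto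
 have T1: "(real N * B.V2) powr a / l powr (2 * a) <= 512 powr a * ((real n * VV l) powr a / l powr (2 * a))"
 proof -
  have "real N * B.V2 = 512 * ((real N * real q) * (\<Sum>m<q. lev H L m 2))" by (simp add: B.V2_def)
  also have "... <= 512 * (real n * VV l)"
   using variance_integral[OF less_imp_le[OF L] qlL(1)] Nq lev_nonneg by (intro mult_left_mono mult_mono sum_nonneg) auto
  finally have "(real N * B.V2) powr a <= (512 * (real n * VV l)) powr a" using a B.V2_nonneg by (intro powr_mono2) auto
  also have "... = 512 powr a * (real n * VV l) powr a" using VV0 by (simp add: powr_mult)
  finally show ?thesis by (simp add: divide_right_mono)
 qed
 have T2: "real N * (dd_const a e * real q powr (a + e) * (\<Sum>m<q. real (Suc m) powr (a - 1 - e) * (16 powr (a + 1) * lev H L m (2 * a)))) / l powr (2 * a)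
   <= dd_const a e * 16 powr (a + 1) * (1 + 1 / (a - e)) * (real n / l * J)"
 proof -
  define S where "S = (\<Sum>m<q. real (Suc m) powr (a - 1 - e) * lev H L m (2 * a))"
  have S0: "0 <= S" unfolding S_def by (intro sum_nonneg mult_nonneg_nonneg lev_nonneg) auto
  have qq: "real q powr (a + e) = real q * real q powr (a - 1 + e)" using q powr_add[of "real q" 1 "a - 1 + e"] by simp
  have "(\<Sum>m<q. real (Suc m) powr (a - 1 - e) * (16 powr (a + 1) * lev H L m (2 * a))) = 16 powr (a + 1) * S"
   unfolding S_def sum_distrib_left by (intro sum.cong) auto
  then have "real N * (dd_const a e * real q powr (a + e) * (\<Sum>m<q. real (Suc m) powr (a - 1 - e) * (16 powr (a + 1) * lev H L m (2 * a))))
    = dd_const a e * 16 powr (a + 1) * ((real N * real q) * (real q powr (a - 1 + e) * S))"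
   unfolding qq by simp
  also have "... <= dd_const a e * 16 powr (a + 1) * (real n * ((1 + 1 / (a - e)) * (l powr (2 * a - 1) * J)))"
  proof (rule mult_left_mono[OF mult_mono[OF Nq]])
   show "real q powr (a - 1 + e) * S <= (1 + 1 / (a - e)) * (l powr (2 * a - 1) * J)"
    unfolding S_def J_def using a e b \<delta> by (intro block_moment_integral[OF less_imp_le[OF L] qlL(1) l q _ _ _ _ _ Ji]) auto
  qed (use S0 dd0 in auto)
  finally have "real N * (dd_const a e * real q powr (a + e) * (\<Sum>m<q. real (Suc m) powr (a - 1 - e) * (16 powr (a + 1) * lev H L m (2 * a)))) / l powr (2 * a)
    <= dd_const a e * 16 powr (a + 1) * (real n * ((1 + 1 / (a - e)) * (l powr (2 * a - 1) * J))) / l powr (2 * a)" by (rule divide_right_mono) auto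
  also have "... = dd_const a e * 16 powr (a + 1) * (1 + 1 / (a - e)) * (real n * J) * (l powr (2 * a - 1) / l powr (2 * a))" by simp
  also have "l powr (2 * a - 1) / l powr (2 * a) = 1 / l" using l by (simp add: powr_diff)
  finally show ?thesis by (simp add: mult_ac)
 qed
 define Z where "Z = (\<Sum>k\<le>K. 2 powr (real k * (a - 1 + \<delta>)) * al (2 ^ k * q))"
 have Z0: "0 <= Z" unfolding Z_def by (intro sum_nonneg mult_nonneg_nonneg al_nonneg) auto
 have T3: "real N * (2 * (real q * L)) powr (2 * a) * Z / l powr (2 * a) <= c3 * (real n / l * J)"
 proof -
  have "(2 * (real q * L)) powr (2 * a) <= l powr (2 * a)" using qlL L a by (intro powr_mono2) auto
  then have "real N * (2 * (real q * L)) powr (2 * a) * Z / l powr (2 * a) <= real N * l powr (2 * a) * Z / l powr (2 * a)"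
   using Z0 by (intro divide_right_mono mult_right_mono mult_left_mono) auto
  also have "... = real N * Z" using l by simp
  also have "... = (real N * real q) * (Z / real q)" using q by simp
  also have "... <= real n * (c3 * J / l)"
  proof (intro mult_mono Nq)
   show "Z / real q <= c3 * J / l"
    unfolding Z_def c3_def J_def
    by (rule long_range_integral[OF v(1) _ Qv q alq l _ _ b Ji]) (use v lq a \<delta> in \<open>auto simp: L_def\<close>)
  qed (use Z0 in auto)
  finally show ?thesis by (simp add: mult_ac)
 qed
 have T4: "128 * (real N * real q) * L * al q / l <= 128 * (real n / l * small_Q v)"
 proof -
  have "L * al q <= L * v" using alq L by (intro mult_left_mono) auto
  also have "... <= small_Q v" unfolding L_def by (rule small_Q_ge) (use v in auto)
  finally have "(real N * real q) * (L * al q) <= real n * small_Q v" using Nq L al_nonneg by (intro mult_mono) auto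
  then have "128 * ((real N * real q) * (L * al q)) / l <= 128 * (real n * small_Q v) / l" using l by (intro divide_right_mono mult_left_mono) auto
  then show ?thesis by (simp add: mult.assoc)
 qed
 have "prob {w \<in> space M. \<exists>k\<in>{1..n}. l / 2 <= \<bar>\<Sum>j=1..k. B.x (int j) w\<bar>} <=
   P * ((real N * B.V2) powr a + real N * (dd_const a e * real q powr (a + e) * (\<Sum>m<q. real (Suc m) powr (a - 1 - e) * (16 powr (a + 1) * lev H L m (2 * a))))
    + real N * (2 * (real q * L)) powr (2 * a) * Z) / l powr (2 * a)
   + 128 * (real N * real q) * L * al q / l"
  unfolding P_def N_def Z_def by (rule B.block_deviation[OF a e \<delta> C l ql n K])
 also have "... = P * ((real N * B.V2) powr a / l powr (2 * a) + real N * (dd_const a e * real q powr (a + e) * (\<Sum>m<q. real (Suc m) powr (a - 1 - e) * (16 powr (a + 1) * lev H L m (2 * a)))) / l powr (2 * a)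
    + real N * (2 * (real q * L)) powr (2 * a) * Z / l powr (2 * a)) + 128 * (real N * real q) * L * al q / l"
  by (simp only: add_divide_distrib times_divide_eq_right[symmetric])
 also have "... <= P * (512 powr a * ((real n * VV l) powr a / l powr (2 * a)) + dd_const a e * 16 powr (a + 1) * (1 + 1 / (a - e)) * (real n / l * J) + c3 * (real n / l * J))
   + 128 * (real n / l * small_Q v)"
  by (intro add_mono mult_left_mono T1 T2 T3 T4 P0)
 also have "... <= P * ((512 powr a + dd_const a e * 16 powr (a + 1) * (1 + 1 / (a - e)) + c3) * ((real n * VV l) powr a / l powr (2 * a) + real n / l * J)) + 128 * (real n / l * small_Q v)"
 proof (intro add_right_mono mult_left_mono P0)
  define s t c1 c2 where "s = (real n * VV l) powr a / l powr (2 * a)" and "t = real n / l * J" and "c1 = (512::real) powr a" and "c2 = dd_const a e * 16 powr (a + 1) * (1 + 1 / (a - e))"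
  have nn: "0 <= s" "0 <= t" "0 <= c1" "0 <= c2" using J0 l dd0 e by (auto simp: s_def t_def c1_def c2_def intro!: mult_nonneg_nonneg add_nonneg_nonneg)
  then have "0 <= (c2 + c3) * s" "0 <= c1 * t" using c30 by simp_all
  then have "c1 * s + c2 * t + c3 * t <= (c1 + c2 + c3) * (s + t)" by (simp add: algebra_simps)
  then show "512 powr a * ((real n * VV l) powr a / l powr (2 * a)) + dd_const a e * 16 powr (a + 1) * (1 + 1 / (a - e)) * (real n / l * J) + c3 * (real n / l * J)
   <= (512 powr a + dd_const a e * 16 powr (a + 1) * (1 + 1 / (a - e)) + c3) * ((real n * VV l) powr a / l powr (2 * a) + real n / l * J)"
   unfolding s_def t_def c1_def c2_def .
 qed
 finally show ?thesis unfolding B.x_def unfolding L_def P_def c3_def J_def by (simp only: mult.assoc)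
qed

text \<open>The level \<open>v = 2 ^ - (j + 2)\<close> is the smallest for which \<open>\<rho> v \<le> l / 16\<close>. Then \<open>\<rho>\<close> exceeds \<open>l / 16\<close> on \<open>(0, v / 2)\<close>, so that the integral of \<open>Q\<close> over \<open>(0, v)\<close> is dominated by
\<open>\<integral> Q \<Phi> (\<rho> / l)\<close>. If already \<open>\<rho> (1/4)\<close> is too large, the truncation at height 0 suffices. If every level qualifies, the integral of \<open>Q\<close> tends to 0 along them.\<close>

theorem deviation_inequality:
 assumes a: "3 / 2 < a" and e: "0 < e" "e < a - 1" and \<delta>: "0 < \<delta>" and b: "a - 1 + \<delta> <= a - e"
  and Ji: "\<And>l. 0 < l ==> integrable unif01 (\<lambda>u. quant H u * Phi (a - e) (a - 1 + \<delta>) (\<rho> u / l))"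
 shows "\<exists>C>0. \<forall>h lo n l. truncation_family H \<mu> h lo --> 1 <= n --> 0 < l -->
   prob {w \<in> space M. \<exists>k\<in>{1..n}. l <= \<bar>\<Sum>j=1..k. ctr h (int j) w\<bar>} <=
    C * ((real n * VV l) powr a / l powr (2 * a) + real n / l * JJ (a - e) (a - 1 + \<delta>) l)"
proof -
 obtain CT where CT: "predictable_bound a \<delta> CT"
  using predictable_sum_moment[of a \<delta>] a \<delta> by auto
 define C1 where "C1 = (2 * parity_const a CT * 8 powr (2 * a)) * (512 powr a + dd_const a e * 16 powr (a + 1) * (1 + 1 / (a - e)) + 32 * 32 powr (a - e) / (1 - 2 powr (- (a - 1 + \<delta>))))"
 have C10: "0 <= C1"
 proof -
  have "0 < CT" using CT by (simp add: predictable_bound_def)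
  then have "0 <= 2 * parity_const a CT * 8 powr (2 * a)" unfolding parity_const_def using a taylor_const_ge_1[of "2 * a"] by simp
  moreover have "0 <= dd_const a e" unfolding dd_const_def using a taylor_const_ge_1[of "2 * a"] by simp
  moreover have "(2::real) powr (- (a - 1 + \<delta>)) < 1" using a \<delta> by (intro powr_less_one) auto
  ultimately have "0 <= 512 powr a + dd_const a e * 16 powr (a + 1) * (1 + 1 / (a - e)) + 32 * 32 powr (a - e) / (1 - 2 powr (- (a - 1 + \<delta>)))"
   using e a by (intro mult_nonneg_nonneg add_nonneg_nonneg divide_nonneg_nonneg) auto
  with \<open>0 <= 2 * parity_const a CT * 8 powr (2 * a)\<close> show ?thesis unfolding C1_def by (rule mult_nonneg_nonneg)
 qed
 define b1 b2 where "b1 = a - e" and "b2 = a - 1 + \<delta>"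
 have bb: "0 < b2" "b2 <= b1" using a \<delta> b by (auto simp: b1_def b2_def)
 define C where "C = C1 + 132 * (2 * 16 powr b1) + 1"
 have C: "0 < C" unfolding C_def using C10 by (intro add_nonneg_pos add_nonneg_nonneg) auto
 show ?thesis
 proof (intro exI[of _ C] conjI allI impI C)
  fix h :: "real \<Rightarrow> real" and lo and n :: nat and l :: real
  assume tf: "truncation_family H \<mu> h lo" and n: "1 <= n" and l: "0 < l"
  define J where "J = JJ b1 b2 l"
  note Jil = Ji[OF l, folded b1_def b2_def]
  have J0: "0 <= J" unfolding J_def JJ_def by (intro integral_ge_0) auto
  define R where "R = (real n * VV l) powr a / l powr (2 * a) + real n / l * J"
  have nJR: "real n / l * J <= R" by (simp add: R_def)
  have nJ0: "0 <= real n / l * J" using J0 l by simp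
  define p where "p = prob {w \<in> space M. \<exists>k\<in>{1..n}. l <= \<bar>\<Sum>j=1..k. ctr h (int j) w\<bar>}"
  have R0: "0 <= R" using nJR nJ0 by linarith
  have hm [measurable]: "ctr h i \<in> borel_measurable M" for i by (rule ctr_measurable[OF truncation_integrable(1)[OF tf order_refl]])
  have lom [measurable]: "ctr (lo B) i \<in> borel_measurable M" if "0 <= B" for B i
   using brv_meas[OF F_brv_M[OF truncated_split(1)[OF tf that order_refl]]] .
  have at: "p <= C1 * R + 132 * (real n / l * small_Q v)" if v: "0 < v" "v <= 1 / 4" and \<rho>v: "\<rho> v <= l / 16" for v
  proof -
   define L where "L = quant H v"
   have L: "0 <= L" by (simp add: L_def)
   define E1 where "E1 = {w \<in> space M. \<exists>k\<in>{1..n}. l / 2 <= \<bar>\<Sum>j=1..k. ctr (lo L) (int j) w\<bar>}"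
   define E2 where "E2 = {w \<in> space M. \<exists>k\<in>{1..n}. l / 2 <= \<bar>\<Sum>j=1..k. (ctr h (int j) w - ctr (lo L) (int j) w)\<bar>}"
   have "p <= prob E1 + prob E2" unfolding p_def E1_def E2_def
   by (rule maximal_split) (use hm lom[OF L] in auto)
  also have "prob E2 <= 4 * (real n / l * small_Q v)"
   proof -
    have "prob E2 <= 2 * real n * (\<integral>u. max 0 (quant H u - L) \<partial>unif01) / (l / 2)"
     unfolding E2_def by (rule truncation_rest[OF tf L]) (use l in auto)
    also have "... <= 2 * real n * small_Q v / (l / 2)"
     using excess_le_small_Q[of v] v l by (intro divide_right_mono mult_left_mono) (auto simp: L_def)
    finally show ?thesis by simp
   qed
   also have "prob E1 <= C1 * R + 128 * (real n / l * small_Q v)"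
   proof (cases "L = 0")
    case True
    have "ctr (lo L) j w = 0" for j w
    proof -
     have "\<bar>ctr (lo L) j w\<bar> <= 2 * L" by (rule truncated_split(2)[OF tf L order_refl])
     then show ?thesis using True by simp
    qed
    then have "E1 = {}" unfolding E1_def using l by simp
    then show ?thesis using C10 R0 small_Q_nonneg[of v] l by simp
   next
    case False
    then have "0 < L" using L by linarith
    then have "0 < quant H v" unfolding L_def .
    from truncated_deviation[OF a e \<delta> b CT Ji[OF l] tf v \<rho>v l n this]
    show ?thesis unfolding E1_def L_def C1_def R_def J_def b1_def b2_def .
   qed
   finally show ?thesis by (simp add: algebra_simps)
  qed
  have fin: "p <= (C1 + 132 * (2 * 16 powr b1)) * R + \<epsilon>" if \<epsilon>: "0 < \<epsilon>" for \<epsilon>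
  proof (cases "l / 16 < \<rho> (1/4)")
   case True
   have "p <= 2 * real n * (\<integral>u. max 0 (quant H u - 0) \<partial>unif01) / l"
   proof -
    have "p = prob {w \<in> space M. \<exists>k\<in>{1..n}. l <= \<bar>\<Sum>j=1..k. (ctr h (int j) w - ctr (lo 0) (int j) w)\<bar>}"
    proof -
     have "ctr (lo 0) j w = 0" for j w using truncated_split(2)[OF tf order_refl order_refl, of j w] by simp
     then show ?thesis by (simp add: p_def)
    qed
    also have "... <= 2 * real n * (\<integral>u. max 0 (quant H u - 0) \<partial>unif01) / l" by (rule truncation_rest[OF tf order_refl l])
    finally show ?thesis .
   qed
   also have "(\<integral>u. max 0 (quant H u - 0) \<partial>unif01) = small_Q 1"
    unfolding small_Q_def by (intro expect_cong) (auto simp: indicator_def)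
   also have "small_Q 1 <= 4 * small_Q (1/4)" using small_Q_double[of "1/2"] small_Q_double[of "1/4"] by simp
   also have "small_Q (1/4) <= 16 powr b1 * J" unfolding J_def by (rule small_Q_le_JJ[OF _ _ True l bb Jil]) auto
   finally have "p <= 2 * real n * (4 * (16 powr b1 * J)) / l" using l by (simp add: divide_right_mono mult_left_mono)
   also have "... = (8 * 16 powr b1) * (real n / l * J)" by simp
   also have "... <= (C1 + 132 * (2 * 16 powr b1)) * R" using nJR nJ0 C10 by (intro mult_mono) auto
   finally show ?thesis using \<epsilon> by simp
  next
   case False
   \<comment> \<open>The exponents start at 2 to keep \<open>v \<le> 1/4 < al 0\<close>.\<close>
   define P where "P j \<longleftrightarrow> \<rho> ((1/2) ^ (j + 2)) <= l / 16" for j :: nat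
   have P0: "P 0" using False by (simp add: P_def power2_eq_square)
   have vj: "0 < (1/2::real) ^ (j + 2)" "(1/2::real) ^ (j + 2) <= 1 / 4" for j
   proof -
    have "(1/2::real) ^ (j + 2) <= (1/2) ^ 2" by (rule power_decreasing) auto
    then show "(1/2::real) ^ (j + 2) <= 1 / 4" by (simp add: power2_eq_square)
   qed simp
   have "\<exists>v. 0 < v \<and> v <= 1 / 4 \<and> \<rho> v <= l / 16 \<and> 132 * (real n / l * small_Q v) <= 132 * (2 * 16 powr b1) * (real n / l * J) + \<epsilon>"
   proof (cases "\<forall>j. P j")
    case True
    have "(\<lambda>j. 132 * (real n / l * small_Q ((1/2) ^ (j + 2)))) \<longlonglongrightarrow> 132 * (real n / l * 0)"
     by (intro tendsto_mult tendsto_const LIMSEQ_ignore_initial_segment[OF small_Q_tendsto])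
    then have "eventually (\<lambda>j. 132 * (real n / l * small_Q ((1/2) ^ (j + 2))) < \<epsilon>) sequentially"
     by (rule order_tendstoD) (use \<epsilon> in simp)
    then obtain j where "132 * (real n / l * small_Q ((1/2) ^ (j + 2))) < \<epsilon>" by (auto simp: eventually_sequentially)
    moreover have "0 <= 132 * (2 * 16 powr b1) * (real n / l * J)" by (rule mult_nonneg_nonneg[OF _ nJ0]) simp
    ultimately show ?thesis using True vj[of j] by (intro exI[of _ "(1/2) ^ (j + 2)"]) (auto simp: P_def)
   next
    case False
    then obtain j0 where "\<not> P j0" by blast
    define j where "j = (LEAST j. \<not> P j)"
    have j: "\<not> P j" unfolding j_def by (rule LeastI) fact
    then have "j \<noteq> 0" using P0 by metis
    then obtain i where i: "j = Suc i" by (cases j) auto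
    have Pi: "P i" using not_less_Least[of i "\<lambda>j. \<not> P j"] i unfolding j_def by auto
    define wt where "wt = (1/2::real) ^ (j + 2)"
    have wt: "0 < wt" "wt <= 1 / 4" "2 * wt = (1/2) ^ (i + 2)" using vj[of j] by (auto simp: wt_def i)
    have "small_Q (2 * wt) <= 2 * small_Q wt" by (rule small_Q_double) (use wt in auto)
    also have "small_Q wt <= 16 powr b1 * J"
     unfolding J_def by (rule small_Q_le_JJ[OF wt(1) _ _ l bb Jil]) (use wt j in \<open>auto simp: P_def wt_def\<close>)
    finally have "small_Q (2 * wt) <= 2 * (16 powr b1 * J)" by simp
    then have "real n / l * small_Q (2 * wt) <= real n / l * (2 * (16 powr b1 * J))" using l by (intro mult_left_mono) auto
    then have "132 * (real n / l * small_Q (2 * wt)) <= 132 * (real n / l * (2 * (16 powr b1 * J)))" by (rule mult_left_mono) simp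
    also have "... = 132 * (2 * 16 powr b1) * (real n / l * J)" by simp
    also have "... <= ... + \<epsilon>" using \<epsilon> by simp
    finally have "132 * (real n / l * small_Q (2 * wt)) <= 132 * (2 * 16 powr b1) * (real n / l * J) + \<epsilon>" .
    moreover have "0 < 2 * wt" "2 * wt <= 1 / 4" "\<rho> (2 * wt) <= l / 16"
     unfolding wt(3) by (fact vj)+ (use Pi in \<open>simp only: P_def\<close>)
    ultimately show ?thesis by (intro exI[of _ "2 * wt"] conjI)
   qed
   then obtain v where v: "0 < v" "v <= 1 / 4" "\<rho> v <= l / 16" "132 * (real n / l * small_Q v) <= 132 * (2 * 16 powr b1) * (real n / l * J) + \<epsilon>" by blast
   have "p <= C1 * R + 132 * (real n / l * small_Q v)" by (rule at[OF v(1-3)])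
   also have "... <= C1 * R + (132 * (2 * 16 powr b1) * (real n / l * J) + \<epsilon>)" using v(4) by simp
   also have "... <= C1 * R + (132 * (2 * 16 powr b1) * R + \<epsilon>)" using nJR by (intro add_left_mono add_right_mono mult_left_mono) auto
   finally show ?thesis by (simp add: algebra_simps)
  qed
  have "p <= (C1 + 132 * (2 * 16 powr b1)) * R" by (rule field_le_epsilon) (rule fin)
  also have "... <= C * R" unfolding C_def using R0 by (intro mult_right_mono) auto
  finally show "prob {w \<in> space M. \<exists>k\<in>{1..n}. l <= \<bar>\<Sum>j=1..k. ctr h (int j) w\<bar>} <=
    C * ((real n * VV l) powr a / l powr (2 * a) + real n / l * JJ (a - e) (a - 1 + \<delta>) l)"
   unfolding p_def R_def J_def b1_def b2_def .
 qed
qed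

end

section \<open>Closure, and the integrals under a tail condition\<close>

context alpha_rate begin

definition maxdev :: "(real \<Rightarrow> real) \<Rightarrow> nat \<Rightarrow> real \<Rightarrow> real" where
 "maxdev f n l = prob {w \<in> space M. \<exists>k\<in>{1..n}. l <= \<bar>\<Sum>j=1..k. ctr f (int j) w\<bar>}"

lemma VV_mono: "0 <= l ==> l <= l' ==> VV l <= VV l'"
 unfolding VV_def by (rule integral_mono[OF VV_integrable VV_integrable]) (auto intro!: mult_left_mono)

lemma VV_nonneg: "0 <= l ==> 0 <= VV l"
 unfolding VV_def using \<rho>_nonneg by (intro integral_ge_0 mult_nonneg_nonneg) auto

lemma JJ_nonneg: "0 <= JJ b1 b2 l"
 unfolding JJ_def by (intro integral_ge_0) auto

lemma JJ_half:
 assumes b: "0 < b2" "b2 <= b1" and l: "0 < l" and Ji: "\<And>l. 0 < l ==> integrable unif01 (\<lambda>u. quant H u * Phi b1 b2 (\<rho> u / l))"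
 shows "JJ b1 b2 (l / 2) <= 2 powr b1 * JJ b1 b2 l"
proof -
 have "JJ b1 b2 (l / 2) <= (\<integral>u. 2 powr b1 * (quant H u * Phi b1 b2 (\<rho> u / l)) \<partial>unif01)" unfolding JJ_def
 proof (rule integral_mono)
  show "integrable unif01 (\<lambda>u. quant H u * Phi b1 b2 (\<rho> u / (l / 2)))" using Ji[of "l / 2"] l by simp
  show "integrable unif01 (\<lambda>u. 2 powr b1 * (quant H u * Phi b1 b2 (\<rho> u / l)))" using Ji[OF l] by simp
  fix u
  have "Phi b1 b2 (2 * (\<rho> u / l)) <= 2 powr b1 * Phi b1 b2 (\<rho> u / l)" using b l \<rho>_nonneg by (intro Phi_scale) auto
  then have "quant H u * Phi b1 b2 (2 * (\<rho> u / l)) <= quant H u * (2 powr b1 * Phi b1 b2 (\<rho> u / l))" by (rule mult_left_mono) simp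
  then show "quant H u * Phi b1 b2 (\<rho> u / (l / 2)) <= 2 powr b1 * (quant H u * Phi b1 b2 (\<rho> u / l))" by (simp add: mult_ac)
 qed
 then show ?thesis by (simp add: JJ_def)
qed

text \<open>Both sides of the bound are stable under approximation in \<open>L\<^sup>1\<close>, \<open>n\<close> and \<open>l\<close> being fixed; half of \<open>l\<close> is spent on the error.\<close>

lemma closure_deviation:
 assumes f: "f \<in> F_class H \<mu>" and l: "0 < l" and bound: "\<And>h. h \<in> Mon_combinations H \<mu> ==> maxdev h n (l / 2) <= b"
 shows "maxdev f n l <= b"
proof (rule field_le_epsilon)
 fix \<epsilon> :: real assume \<epsilon>: "0 < \<epsilon>"
 \<comment> \<open>The denominator is that of the Markov inequality, with \<open>n + 1\<close> in place of \<open>n\<close> to allow \<open>n = 0\<close>.\<close>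
 define \<eta> where "\<eta> = \<epsilon> * l / (4 * (real n + 1))"
 have n1: "0 < real n + 1" by simp
 have \<eta>: "0 < \<eta>" unfolding \<eta>_def using \<epsilon> l by simp
 have fi: "integrable \<mu> f" using f by (simp add: F_class_def)
 obtain h where h: "h \<in> Mon_combinations H \<mu>" and nn: "(\<integral>\<^sup>+x. ennreal \<bar>f x - h x\<bar> \<partial>\<mu>) < ennreal \<eta>"
  using f \<eta> unfolding F_class_def by blast
 obtain lo where tf: "truncation_family H \<mu> h lo" using Mon_combination_truncation[OF H \<mu>_prob \<mu>_sets h] by blast
 have hi: "integrable \<mu> h" by (rule truncation_integrable(1)[OF tf order_refl])
 have d: "(\<integral>y. \<bar>f y - h y\<bar> \<partial>\<mu>) <= \<eta>"
 proof -
  have "ennreal (\<integral>x. \<bar>f x - h x\<bar> \<partial>\<mu>) = (\<integral>\<^sup>+x. ennreal \<bar>f x - h x\<bar> \<partial>\<mu>)" using fi hi by (intro nn_integral_eq_integral[symmetric]) auto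
  also have "... <= ennreal \<eta>" using nn by simp
  finally show ?thesis using \<eta> by (simp add: ennreal_le_iff)
 qed
 define E1 where "E1 = {w \<in> space M. \<exists>k\<in>{1..n}. l / 2 <= \<bar>\<Sum>j=1..k. ctr h (int j) w\<bar>}"
 define E2 where "E2 = {w \<in> space M. \<exists>k\<in>{1..n}. l / 2 <= \<bar>\<Sum>j=1..k. (ctr f (int j) w - ctr h (int j) w)\<bar>}"
 have "maxdev f n l <= prob E1 + prob E2" unfolding maxdev_def E1_def E2_def
  by (rule maximal_split) (intro ctr_measurable fi hi)+
 also have "prob E1 <= b" using bound[OF h] by (simp add: maxdev_def E1_def)
 also have "prob E2 <= 2 * real n * (\<integral>y. \<bar>f y - h y\<bar> \<partial>\<mu>) / (l / 2)"
  unfolding E2_def by (rule ctr_difference_tail[OF fi hi]) (use l in simp)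
 also have "... <= 2 * real n * \<eta> / (l / 2)" using d l by (intro divide_right_mono mult_left_mono) auto
 also have "... = \<epsilon> * (real n / (real n + 1))" unfolding \<eta>_def using l n1 by (simp add: divide_simps)
 also have "... <= \<epsilon> * 1" using \<epsilon> by (intro mult_left_mono) auto
 finally show "maxdev f n l <= b + \<epsilon>" by simp
qed

theorem F_class_deviation:
 assumes a: "3 / 2 < a" and e: "0 < e" "e < a - 1" and \<delta>: "0 < \<delta>" and b: "a - 1 + \<delta> <= a - e"
  and Ji: "\<And>l. 0 < l ==> integrable unif01 (\<lambda>u. quant H u * Phi (a - e) (a - 1 + \<delta>) (\<rho> u / l))"
 shows "\<exists>C>0. \<forall>f\<in>F_class H \<mu>. \<forall>n\<ge>1. \<forall>l>0. maxdev f n l <= C * ((real n * VV l) powr a / l powr (2 * a) + real n / l * JJ (a - e) (a - 1 + \<delta>) l)"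
proof -
 obtain C where C: "0 < C" and dev: "\<forall>h lo n l. truncation_family H \<mu> h lo --> 1 <= n --> 0 < l -->
   prob {w \<in> space M. \<exists>k\<in>{1..n}. l <= \<bar>\<Sum>j=1..k. ctr h (int j) w\<bar>} <=
    C * ((real n * VV l) powr a / l powr (2 * a) + real n / l * JJ (a - e) (a - 1 + \<delta>) l)"
  using deviation_inequality[OF a e \<delta> b Ji] by blast
 define c where "c = 2 powr (2 * a) + 2 * 2 powr (a - e)"
 have c: "0 < c" unfolding c_def by (intro add_pos_pos) auto
 show ?thesis
 proof (intro exI[of _ "C * c"] conjI ballI allI impI)
  show "0 < C * c" using C c by simp
  fix f and n :: nat and l :: real assume f: "f \<in> F_class H \<mu>" and n: "1 <= n" and l: "0 < l"
  show "maxdev f n l <= C * c * ((real n * VV l) powr a / l powr (2 * a) + real n / l * JJ (a - e) (a - 1 + \<delta>) l)"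
  proof (rule closure_deviation[OF f l])
   fix h assume h: "h \<in> Mon_combinations H \<mu>"
   obtain lo where tf: "truncation_family H \<mu> h lo" using Mon_combination_truncation[OF H \<mu>_prob \<mu>_sets h] by blast
   have "maxdev h n (l / 2) <= C * ((real n * VV (l / 2)) powr a / (l / 2) powr (2 * a) + real n / (l / 2) * JJ (a - e) (a - 1 + \<delta>) (l / 2))"
    unfolding maxdev_def by (rule dev[rule_format, OF tf n]) (use l in simp)
   also have "... <= C * (c * ((real n * VV l) powr a / l powr (2 * a)) + c * (real n / l * JJ (a - e) (a - 1 + \<delta>) l))"
   proof (intro mult_left_mono add_mono)
    have "(real n * VV (l / 2)) powr a / (l / 2) powr (2 * a) <= (real n * VV l) powr a / (l / 2) powr (2 * a)"
     using VV_mono[of "l / 2" l] VV_nonneg[of "l / 2"] l a by (intro divide_right_mono powr_mono2 mult_left_mono) auto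
    also have "... = 2 powr (2 * a) * ((real n * VV l) powr a / l powr (2 * a))" using l by (simp add: powr_divide)
    also have "... <= c * ((real n * VV l) powr a / l powr (2 * a))" by (intro mult_right_mono) (auto simp: c_def)
    finally show "(real n * VV (l / 2)) powr a / (l / 2) powr (2 * a) <= c * ((real n * VV l) powr a / l powr (2 * a))" .
    have "real n / (l / 2) * JJ (a - e) (a - 1 + \<delta>) (l / 2) <= real n / (l / 2) * (2 powr (a - e) * JJ (a - e) (a - 1 + \<delta>) l)"
     using JJ_half[OF _ b l Ji] a \<delta> l by (intro mult_left_mono) auto
    also have "... = (2 * 2 powr (a - e)) * (real n / l * JJ (a - e) (a - 1 + \<delta>) l)" by simp
    also have "... <= c * (real n / l * JJ (a - e) (a - 1 + \<delta>) l)"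
     using l JJ_nonneg by (intro mult_right_mono mult_nonneg_nonneg) (auto simp: c_def)
    finally show "real n / (l / 2) * JJ (a - e) (a - 1 + \<delta>) (l / 2) <= c * (real n / l * JJ (a - e) (a - 1 + \<delta>) l)" .
   qed (use C in auto)
   finally show "maxdev h n (l / 2) <= C * c * ((real n * VV l) powr a / l powr (2 * a) + real n / l * JJ (a - e) (a - 1 + \<delta>) l)"
    by (simp add: algebra_simps)
  qed
 qed
qed

definition tailQ :: "real \<Rightarrow> real" where "tailQ y = (\<integral>u. quant H u * indicator {u. y < \<rho> u} u \<partial>unif01)"

lemma tailQ_integrable: "integrable unif01 (\<lambda>u. quant H u * indicator {u. y < \<rho> u} u)"
proof (rule integrable_dominated[OF Q_integrable])
 have "(\<lambda>u. quant H u * indicator {u. y < \<rho> u} u) = (\<lambda>u. quant H u * (if y < \<rho> u then 1 else 0))" by (auto simp: indicator_def)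
 moreover have "(\<lambda>u. quant H u * (if y < \<rho> u then 1 else 0)) \<in> borel_measurable unif01" by measurable
 ultimately show "(\<lambda>u. quant H u * indicator {u. y < \<rho> u} u) \<in> borel_measurable unif01" by simp
qed (auto simp: indicator_def)

text \<open>Integrates a sum of layers of the form \<open>c j\<close> on \<open>{\<rho> / l > y j}\<close> against the tail bound.\<close>

lemma nn_integral_layers:
 assumes y: "\<And>j. 0 < y j" and tail: "\<And>t. 0 < t ==> t powr (p - 1) * tailQ t <= K" and K: "0 <= K" and l: "0 < l"
  and c: "\<And>j. 0 <= c j" and s: "(\<lambda>j. c j * y j powr (1 - p)) sums S"
 shows "(\<integral>\<^sup>+u. ennreal (quant H u) * (\<Sum>j. (if y j < \<rho> u / l then ennreal (c j) else 0)) \<partial>unif01) <= ennreal (K * l powr (1 - p) * S)"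
proof -
 have one: "(\<integral>\<^sup>+u. ennreal (quant H u) * (if y j < \<rho> u / l then ennreal (c j) else 0) \<partial>unif01) <= ennreal (K * l powr (1 - p) * (c j * y j powr (1 - p)))" for j
 proof -
  have yl: "0 < y j * l" using y l by simp
  have "(\<integral>\<^sup>+u. ennreal (quant H u) * (if y j < \<rho> u / l then ennreal (c j) else 0) \<partial>unif01)
   = (\<integral>\<^sup>+u. ennreal (c j * (quant H u * indicator {u. y j * l < \<rho> u} u)) \<partial>unif01)"
  proof (rule nn_integral_cong)
   fix u
   have "y j < \<rho> u / l \<longleftrightarrow> y j * l < \<rho> u" using l by (simp add: pos_less_divide_eq)
   then show "ennreal (quant H u) * (if y j < \<rho> u / l then ennreal (c j) else 0) = ennreal (c j * (quant H u * indicator {u. y j * l < \<rho> u} u))"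
    using c by (simp add: ennreal_mult mult.commute)
  qed
  also have "... = ennreal (c j * tailQ (y j * l))"
   using tailQ_integrable[of "y j * l"] c by (subst nn_integral_eq_integral) (auto simp: tailQ_def)
  also have "... <= ennreal (c j * (K * (y j * l) powr (1 - p)))"
  proof (intro ennreal_leI mult_left_mono c)
   have "(y j * l) powr (p - 1) * tailQ (y j * l) <= K" by (rule tail[OF yl])
   then have "(y j * l) powr (1 - p) * ((y j * l) powr (p - 1) * tailQ (y j * l)) <= (y j * l) powr (1 - p) * K" by (intro mult_left_mono) auto
   also have "(y j * l) powr (1 - p) * ((y j * l) powr (p - 1) * tailQ (y j * l)) = ((y j * l) powr (1 - p) * (y j * l) powr (p - 1)) * tailQ (y j * l)" by (simp only: mult.assoc)
   also have "(y j * l) powr (1 - p) * (y j * l) powr (p - 1) = 1" using y[of j] l by (simp add: powr_add[symmetric])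
   finally show "tailQ (y j * l) <= K * (y j * l) powr (1 - p)" by (simp add: mult.commute)
  qed
  also have "c j * (K * (y j * l) powr (1 - p)) = K * l powr (1 - p) * (c j * y j powr (1 - p))" using y[of j] l by (simp add: powr_mult)
  finally show ?thesis .
 qed
 have "(\<integral>\<^sup>+u. ennreal (quant H u) * (\<Sum>j. (if y j < \<rho> u / l then ennreal (c j) else 0)) \<partial>unif01)
  = (\<integral>\<^sup>+u. (\<Sum>j. ennreal (quant H u) * (if y j < \<rho> u / l then ennreal (c j) else 0)) \<partial>unif01)"
  by (intro nn_integral_cong) (simp add: ennreal_suminf_cmult)
 also have "... = (\<Sum>j. \<integral>\<^sup>+u. ennreal (quant H u) * (if y j < \<rho> u / l then ennreal (c j) else 0) \<partial>unif01)"
 proof (rule nn_integral_suminf)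
  fix j
  show "(\<lambda>u. ennreal (quant H u) * (if y j < \<rho> u / l then ennreal (c j) else 0)) \<in> borel_measurable unif01" by measurable
 qed
 also have "... <= (\<Sum>j. ennreal (K * l powr (1 - p) * (c j * y j powr (1 - p))))" by (intro suminf_le one) auto
 also have "... = ennreal (K * l powr (1 - p) * S)"
 proof (rule suminf_ennreal_eq)
  show "(\<lambda>j. K * l powr (1 - p) * (c j * y j powr (1 - p))) sums (K * l powr (1 - p) * S)" by (rule sums_mult[OF s])
 qed (use K c in auto)
 finally show ?thesis .
qed

lemma dyadic_up:
 assumes "0 < \<theta>" "1 < t"
 shows "ennreal (t powr \<theta>) <= (\<Sum>j. (if 2 ^ j < t then ennreal (2 powr (real (Suc j) * \<theta>)) else 0))"
proof -
 obtain N :: nat where N: "t < 2 ^ N" using real_arch_pow[of 2 t] by auto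
 define j where "j = (LEAST j. t <= 2 ^ Suc j)"
 have ex: "t <= 2 ^ Suc N" using N by (simp add: less_imp_le order_trans[of t "2 ^ N"])
 have j: "t <= 2 ^ Suc j" unfolding j_def by (rule LeastI[of "\<lambda>j. t <= 2 ^ Suc j", OF ex])
 have jl: "2 ^ j < t"
 proof (cases j)
  case 0
  then show ?thesis using assms by simp
 next
  case (Suc i)
  then show ?thesis using not_less_Least[of i "\<lambda>j. t <= 2 ^ Suc j"] unfolding j_def[symmetric] by auto
 qed
 have "t powr \<theta> <= (2 ^ Suc j) powr \<theta>" using j assms by (intro powr_mono2) auto
 also have "... = 2 powr (real (Suc j) * \<theta>)" by (simp only: powr_realpow[symmetric] powr_powr zero_less_numeral)
 finally have "ennreal (t powr \<theta>) <= (if 2 ^ j < t then ennreal (2 powr (real (Suc j) * \<theta>)) else 0)" using jl by (simp del: power_Suc of_nat_Suc add: ennreal_leI)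
 also have "... <= (\<Sum>j. (if 2 ^ j < t then ennreal (2 powr (real (Suc j) * \<theta>)) else 0))"
  by (rule order_trans[OF _ sum_le_suminf[of "\<lambda>j. (if 2 ^ j < t then ennreal (2 powr (real (Suc j) * \<theta>)) else 0)" "{j}"]]) (simp_all del: power_Suc of_nat_Suc)
 finally show ?thesis .
qed

lemma dyadic_down:
 assumes "0 < \<theta>" "0 < t" "t <= 1"
 shows "ennreal (t powr \<theta>) <= (\<Sum>j. (if (1/2) ^ Suc j < t then ennreal (2 powr (- (real j * \<theta>))) else 0))"
proof -
 obtain N :: nat where N: "(1/2) ^ N < t" using real_arch_pow_inv[of t "1/2"] assms by auto
 define j where "j = (LEAST j. (1/2) ^ Suc j < t)"
 have "(1/2) ^ Suc N <= (1/2::real) ^ N" by simp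
 then have ex: "(1/2) ^ Suc N < t" using N by linarith
 have j: "(1/2) ^ Suc j < t" unfolding j_def by (rule LeastI[of "\<lambda>j. (1/2) ^ Suc j < t", OF ex])
 have jl: "t <= (1/2) ^ j"
 proof (cases j)
  case 0
  then show ?thesis using assms by simp
 next
  case (Suc i)
  then show ?thesis using not_less_Least[of i "\<lambda>j. (1/2) ^ Suc j < t"] unfolding j_def[symmetric] by auto
 qed
 have "t powr \<theta> <= ((1/2) ^ j) powr \<theta>" using jl assms by (intro powr_mono2) auto
 also have "((1/2::real) ^ j) powr \<theta> = 2 powr (- (real j * \<theta>))"
 proof -
  have "(1/2::real) ^ j = 2 powr (- real j)" by (simp add: powr_minus powr_realpow power_one_over inverse_eq_divide)
  then show ?thesis by (simp add: powr_powr)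
 qed
 finally have "ennreal (t powr \<theta>) <= (if (1/2) ^ Suc j < t then ennreal (2 powr (- (real j * \<theta>))) else 0)" using j by (simp del: power_Suc of_nat_Suc add: ennreal_leI)
 also have "... <= (\<Sum>j. (if (1/2) ^ Suc j < t then ennreal (2 powr (- (real j * \<theta>))) else 0))"
  by (rule order_trans[OF _ sum_le_suminf[of "\<lambda>j. (if (1/2) ^ Suc j < t then ennreal (2 powr (- (real j * \<theta>))) else 0)" "{j}"]]) (simp_all del: power_Suc of_nat_Suc)
 finally show ?thesis .
qed

lemma geometric_powr_sums: "0 < \<delta> ==> (\<lambda>j. 2 powr (- (real j * \<delta>))) sums (1 / (1 - 2 powr (- \<delta>)))"
proof -
 assume \<delta>: "0 < (\<delta>::real)"
 have "2 powr (- (real j * \<delta>)) = (2 powr (- \<delta>)) ^ j" for j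
 proof -
  have "2 powr (- (real j * \<delta>)) = (2 powr (- \<delta>)) powr real j" by (simp add: powr_powr mult.commute)
  then show ?thesis by (simp add: powr_realpow)
 qed
 then show ?thesis using geometric_sums[of "2 powr (- \<delta>)"] \<delta> by (simp add: powr_less_one)
qed

lemma upper_powr_integral:
 assumes \<theta>: "0 < \<theta>" "\<theta> < p - 1" and tail: "\<And>t. 0 < t ==> t powr (p - 1) * tailQ t <= K" and K: "0 <= K" and l: "0 < l"
 shows "(\<integral>\<^sup>+u. ennreal (quant H u) * (if 1 < \<rho> u / l then ennreal ((\<rho> u / l) powr \<theta>) else 0) \<partial>unif01) <= ennreal (K * l powr (1 - p) * (2 powr \<theta> / (1 - 2 powr (- (p - 1 - \<theta>)))))"
proof -
 have "(\<integral>\<^sup>+u. ennreal (quant H u) * (if 1 < \<rho> u / l then ennreal ((\<rho> u / l) powr \<theta>) else 0) \<partial>unif01)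
  <= (\<integral>\<^sup>+u. ennreal (quant H u) * (\<Sum>j. (if 2 ^ j < \<rho> u / l then ennreal (2 powr (real (Suc j) * \<theta>)) else 0)) \<partial>unif01)"
  using dyadic_up[OF \<theta>(1)] by (intro nn_integral_mono mult_left_mono) (auto simp: indicator_def)
 also have "... <= ennreal (K * l powr (1 - p) * (2 powr \<theta> / (1 - 2 powr (- (p - 1 - \<theta>)))))"
 proof (rule nn_integral_layers[OF _ tail K l])
  have "(\<lambda>j. 2 powr \<theta> * 2 powr (- (real j * (p - 1 - \<theta>)))) sums (2 powr \<theta> * (1 / (1 - 2 powr (- (p - 1 - \<theta>)))))"
   using \<theta> by (intro sums_mult geometric_powr_sums) auto
  moreover have "2 powr (real (Suc j) * \<theta>) * (2 ^ j) powr (1 - p) = 2 powr \<theta> * 2 powr (- (real j * (p - 1 - \<theta>)))" for j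
  proof -
   have "(2 ^ j) powr (1 - p) = 2 powr (real j * (1 - p))" by (simp only: powr_realpow[symmetric] powr_powr zero_less_numeral)
   then show ?thesis by (simp add: powr_add[symmetric] algebra_simps)
  qed
  ultimately show "(\<lambda>j. 2 powr (real (Suc j) * \<theta>) * (2 ^ j) powr (1 - p)) sums (2 powr \<theta> / (1 - 2 powr (- (p - 1 - \<theta>))))" by simp
 qed auto
 finally show ?thesis .
qed

text \<open>Layers at the levels \<open>2 ^ j\<close> for \<open>\<rho> > l\<close> and at \<open>2 ^ - (j + 1)\<close> for \<open>\<rho> \<le> l\<close>.\<close>

lemma Phi_integral_weak:
 assumes b: "0 < b2" "b2 < p - 1" "p - 1 < b1" and tail: "\<And>t. 0 < t ==> t powr (p - 1) * tailQ t <= K" and K: "0 <= K"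
 shows "\<exists>C\<ge>0. \<forall>l>0. integrable unif01 (\<lambda>u. quant H u * Phi b1 b2 (\<rho> u / l)) \<and> JJ b1 b2 l <= C * l powr (1 - p)"
proof -
 define S1 where "S1 = 2 powr b2 / (1 - 2 powr (- (p - 1 - b2)))"
 define S2 where "S2 = 2 powr (p - 1) / (1 - 2 powr (- (b1 - (p - 1))))"
 have "(2::real) powr (- (p - 1 - b2)) < 1" "(2::real) powr (- (b1 - (p - 1))) < 1" using b by (intro powr_less_one; simp)+
 then have S: "0 <= S1" "0 <= S2" unfolding S1_def S2_def by (simp_all del: power_Suc of_nat_Suc)
 define C where "C = K * (S1 + S2)"
 have "integrable unif01 (\<lambda>u. quant H u * Phi b1 b2 (\<rho> u / l)) \<and> JJ b1 b2 l <= C * l powr (1 - p)" if l: "0 < l" for l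
 proof -
  have bnd: "(\<integral>\<^sup>+u. ennreal (quant H u * Phi b1 b2 (\<rho> u / l)) \<partial>unif01) <= ennreal (C * l powr (1 - p))"
  proof -
   have "(\<integral>\<^sup>+u. ennreal (quant H u * Phi b1 b2 (\<rho> u / l)) \<partial>unif01) <=
    (\<integral>\<^sup>+u. ennreal (quant H u) * (if 1 < \<rho> u / l then ennreal ((\<rho> u / l) powr b2) else 0)
     + ennreal (quant H u) * (\<Sum>j. (if (1/2) ^ Suc j < \<rho> u / l then ennreal (2 powr (- (real j * b1))) else 0)) \<partial>unif01)"
   proof (rule nn_integral_mono)
    fix u
    have "ennreal (Phi b1 b2 (\<rho> u / l)) <= (if 1 < \<rho> u / l then ennreal ((\<rho> u / l) powr b2) else 0) + (\<Sum>j. (if (1/2) ^ Suc j < \<rho> u / l then ennreal (2 powr (- (real j * b1))) else 0))"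
    proof (cases "1 < \<rho> u / l")
     case True
     then have "Phi b1 b2 (\<rho> u / l) <= (\<rho> u / l) powr b2" by (simp add: Phi_def)
     then show ?thesis using True by (simp add: add_increasing2 ennreal_leI)
    next
     case False
     show ?thesis
     proof (cases "\<rho> u / l = 0")
      case True
      then have "Phi b1 b2 (\<rho> u / l) = 0" using b by (simp only: Phi_def) simp
      then show ?thesis by simp
     next
      case F2: False
      have "0 <= \<rho> u / l" using \<rho>_nonneg l by simp
      then have t: "0 < \<rho> u / l" "\<rho> u / l <= 1" using False F2 by linarith+
      have "ennreal (Phi b1 b2 (\<rho> u / l)) <= ennreal ((\<rho> u / l) powr b1)" by (intro ennreal_leI) (simp add: Phi_def)
      also have "... <= (\<Sum>j. (if (1/2) ^ Suc j < \<rho> u / l then ennreal (2 powr (- (real j * b1))) else 0))"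
       by (rule dyadic_down) (use b t in auto)
      finally show ?thesis using False by (simp add: indicator_def)
     qed
    qed
    then have "ennreal (quant H u) * ennreal (Phi b1 b2 (\<rho> u / l)) <= ennreal (quant H u) * ((if 1 < \<rho> u / l then ennreal ((\<rho> u / l) powr b2) else 0) + (\<Sum>j. (if (1/2) ^ Suc j < \<rho> u / l then ennreal (2 powr (- (real j * b1))) else 0)))"
     by (rule mult_left_mono) simp
    then show "ennreal (quant H u * Phi b1 b2 (\<rho> u / l)) <= ennreal (quant H u) * (if 1 < \<rho> u / l then ennreal ((\<rho> u / l) powr b2) else 0)
     + ennreal (quant H u) * (\<Sum>j. (if (1/2) ^ Suc j < \<rho> u / l then ennreal (2 powr (- (real j * b1))) else 0))"
     by (simp add: ennreal_mult distrib_left)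
   qed
   also have "... = (\<integral>\<^sup>+u. ennreal (quant H u) * (if 1 < \<rho> u / l then ennreal ((\<rho> u / l) powr b2) else 0) \<partial>unif01)
     + (\<integral>\<^sup>+u. ennreal (quant H u) * (\<Sum>j. (if (1/2) ^ Suc j < \<rho> u / l then ennreal (2 powr (- (real j * b1))) else 0)) \<partial>unif01)"
   proof (rule nn_integral_add)
    show "(\<lambda>u. ennreal (quant H u) * (if 1 < \<rho> u / l then ennreal ((\<rho> u / l) powr b2) else 0)) \<in> borel_measurable unif01" by measurable
    show "(\<lambda>u. ennreal (quant H u) * (\<Sum>j. if (1/2) ^ Suc j < \<rho> u / l then ennreal (2 powr (- (real j * b1))) else 0)) \<in> borel_measurable unif01" by measurable
   qed
   also have "... <= ennreal (K * l powr (1 - p) * S1) + ennreal (K * l powr (1 - p) * S2)"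
   proof (rule add_mono)
    show "(\<integral>\<^sup>+u. ennreal (quant H u) * (if 1 < \<rho> u / l then ennreal ((\<rho> u / l) powr b2) else 0) \<partial>unif01) <= ennreal (K * l powr (1 - p) * S1)"
     unfolding S1_def by (rule upper_powr_integral[OF b(1,2) tail K l])
    show "(\<integral>\<^sup>+u. ennreal (quant H u) * (\<Sum>j. (if (1/2) ^ Suc j < \<rho> u / l then ennreal (2 powr (- (real j * b1))) else 0)) \<partial>unif01) <= ennreal (K * l powr (1 - p) * S2)"
    proof (rule nn_integral_layers[OF _ tail K l])
     have "(\<lambda>j. 2 powr (p - 1) * 2 powr (- (real j * (b1 - (p - 1))))) sums (2 powr (p - 1) * (1 / (1 - 2 powr (- (b1 - (p - 1))))))"
      using b by (intro sums_mult geometric_powr_sums) auto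
     moreover have "2 powr (- (real j * b1)) * ((1/2) ^ Suc j) powr (1 - p) = 2 powr (p - 1) * 2 powr (- (real j * (b1 - (p - 1))))" for j
     proof -
      have "(1/2::real) ^ Suc j = 2 powr (- real (Suc j))" by (simp add: powr_minus powr_realpow power_one_over inverse_eq_divide del: of_nat_Suc power_Suc)
      then have "((1/2::real) ^ Suc j) powr (1 - p) = 2 powr (- real (Suc j) * (1 - p))" by (simp only: powr_powr)
      then show ?thesis by (simp add: powr_add[symmetric] algebra_simps)
     qed
     ultimately show "(\<lambda>j. 2 powr (- (real j * b1)) * ((1/2) ^ Suc j) powr (1 - p)) sums S2" by (simp add: S2_def)
    qed auto
   qed
   also have "... = ennreal (C * l powr (1 - p))"
    using K S by (subst ennreal_plus[symmetric]) (auto simp: C_def algebra_simps)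
   finally show ?thesis .
  qed
  have meas: "(\<lambda>u. quant H u * Phi b1 b2 (\<rho> u / l)) \<in> borel_measurable unif01" unfolding Phi_def by measurable
  have int: "integrable unif01 (\<lambda>u. quant H u * Phi b1 b2 (\<rho> u / l))"
  proof (rule integrableI_bounded[OF meas])
   have "(\<integral>\<^sup>+u. ennreal (norm (quant H u * Phi b1 b2 (\<rho> u / l))) \<partial>unif01) <= ennreal (C * l powr (1 - p))" using bnd by (simp add: abs_mult)
   then show "(\<integral>\<^sup>+u. ennreal (norm (quant H u * Phi b1 b2 (\<rho> u / l))) \<partial>unif01) < \<infinity>" by (simp add: le_less_trans)
  qed
  moreover have "JJ b1 b2 l <= C * l powr (1 - p)"
  proof -
   have "ennreal (JJ b1 b2 l) <= ennreal (C * l powr (1 - p))" using bnd int by (subst (asm) nn_integral_eq_integral) (auto simp: JJ_def)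
   then show ?thesis using K S by (simp add: ennreal_le_iff C_def)
  qed
  ultimately show ?thesis by blast
 qed
 then show ?thesis using K S by (intro exI[of _ C]) (auto simp: C_def)
qed

lemma powr_integral_weak:
 assumes \<theta>: "0 < \<theta>" "\<theta> < p - 1" and tail: "\<And>t. 0 < t ==> t powr (p - 1) * tailQ t <= K" and K: "0 <= K"
 shows "integrable unif01 (\<lambda>u. quant H u * \<rho> u powr \<theta>)"
proof (rule integrableI_bounded)
 show "(\<lambda>u. quant H u * \<rho> u powr \<theta>) \<in> borel_measurable unif01" by measurable
 have "(\<integral>\<^sup>+u. ennreal (norm (quant H u * \<rho> u powr \<theta>)) \<partial>unif01) <=
   (\<integral>\<^sup>+u. ennreal (quant H u) + ennreal (quant H u) * (if 1 < \<rho> u / 1 then ennreal ((\<rho> u / 1) powr \<theta>) else 0) \<partial>unif01)"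
 proof (rule nn_integral_mono)
  fix u
  show "ennreal (norm (quant H u * \<rho> u powr \<theta>)) <= ennreal (quant H u) + ennreal (quant H u) * (if 1 < \<rho> u / 1 then ennreal ((\<rho> u / 1) powr \<theta>) else 0)"
  proof (cases "1 < \<rho> u")
   case True
   then show ?thesis by (simp add: abs_mult ennreal_mult add_increasing)
  next
   case False
   then have "\<rho> u powr \<theta> <= 1" using \<rho>_nonneg \<theta> by (simp add: powr_le1)
   then have "quant H u * \<rho> u powr \<theta> <= quant H u * 1" by (intro mult_left_mono) auto
   then show ?thesis using False by (simp add: abs_mult ennreal_leI)
  qed
 qed
 also have "... = (\<integral>\<^sup>+u. ennreal (quant H u) \<partial>unif01) + (\<integral>\<^sup>+u. ennreal (quant H u) * (if 1 < \<rho> u / 1 then ennreal ((\<rho> u / 1) powr \<theta>) else 0) \<partial>unif01)"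
  by (rule nn_integral_add) measurable
 also have "... < \<infinity>"
 proof -
  have "(\<integral>\<^sup>+u. ennreal (quant H u) \<partial>unif01) < \<infinity>" using Q_integrable by (subst nn_integral_eq_integral) auto
  moreover have "(\<integral>\<^sup>+u. ennreal (quant H u) * (if 1 < \<rho> u / 1 then ennreal ((\<rho> u / 1) powr \<theta>) else 0) \<partial>unif01) < \<infinity>"
   using upper_powr_integral[OF \<theta> tail K, of 1] by (rule le_less_trans) auto
  ultimately show ?thesis by simp
 qed
 finally show "(\<integral>\<^sup>+u. ennreal (norm (quant H u * \<rho> u powr \<theta>)) \<partial>unif01) < \<infinity>" .
qed

end

section \<open>The two conditions\<close>

lemma Phi_le_powr: "b2 <= r ==> r <= b1 ==> 0 <= t ==> Phi b1 b2 t <= t powr r"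
proof (cases "t <= 1")
 case True
 assume "b2 <= r" "r <= b1" "0 <= t"
 then show ?thesis using True powr_mono'[of r b1 t] by (simp add: Phi_def min_le_iff_disj)
next
 case False
 assume "b2 <= r" "r <= b1" "0 <= t"
 then show ?thesis using False powr_mono[of b2 r t] by (simp add: Phi_def min_le_iff_disj)
qed

text \<open>For \<open>n \<le> t\<close> the exponent \<open>b2 < r\<close> applies and the sum is carried by its last terms, for \<open>n > t\<close> the exponent \<open>b1 > r\<close> and it is carried by the first.\<close>

lemma sum_powr_Phi_le:
 assumes b: "0 < b2" "b2 < r" "r < b1" "b1 <= r + 1" and t: "0 <= t"
 shows "(\<Sum>n=1..N. real n powr (r - 1) * Phi b1 b2 (t / real n)) <= (2 + 1 / (r - b2) + 1 / (b1 - r)) * t powr r"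
proof (cases "t = 0")
 case True
 then show ?thesis using b by (simp add: Phi_def)
next
 case False
 then have t: "0 < t" using t by simp
 define g where "g n = real n powr (r - 1) * Phi b1 b2 (t / real n)" for n
 \<comment> \<open>The last index at which the argument of \<open>\<Phi>\<close> is at least 1.\<close>
 define q where "q = nat \<lfloor>t\<rfloor>"
 have q: "real q <= t" "t <= real (Suc q)" using t unfolding q_def by linarith+
 have g0: "0 <= g n" for n by (simp add: g_def)
 have low: "sum g {1..q} <= (1 + 1 / (r - b2)) * t powr r"
 proof -
  have "sum g {1..q} <= (\<Sum>n\<in>{1..q}. t powr b2 * real n powr (r - b2 - 1))"
  proof (rule sum_mono)
   fix n assume "n \<in> {1..q}"
   then have n: "0 < real n" by simp
   have "g n <= real n powr (r - 1) * (t / real n) powr b2" unfolding g_def by (intro mult_left_mono) (auto simp: Phi_def)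
   also have "... = t powr b2 * (real n powr (r - 1) / real n powr b2)" using n t by (simp add: powr_divide)
   also have "real n powr (r - 1) / real n powr b2 = real n powr (r - b2 - 1)" using n by (simp add: powr_diff[symmetric] algebra_simps)
   finally show "g n <= t powr b2 * real n powr (r - b2 - 1)" .
  qed
  also have "... = t powr b2 * (\<Sum>n\<in>{1..q}. real n powr (r - b2 - 1))" by (simp add: sum_distrib_left)
  also have "(\<Sum>n\<in>{1..q}. real n powr (r - b2 - 1)) = (\<Sum>m<q. real (Suc m) powr (r - b2 - 1))"
   by (simp add: sum.atLeast1_atMost_eq)
  also have "t powr b2 * ... <= t powr b2 * ((1 + 1 / (r - b2)) * real q powr (r - b2))"
   using b by (intro mult_left_mono sum_powr_le) auto
  also have "... <= t powr b2 * ((1 + 1 / (r - b2)) * t powr (r - b2))"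
   using b q by (intro mult_left_mono powr_mono2) auto
  also have "... = (1 + 1 / (r - b2)) * (t powr b2 * t powr (r - b2))" by simp
  also have "t powr b2 * t powr (r - b2) = t powr r" by (simp add: powr_add[symmetric])
  finally show ?thesis .
 qed
 have high: "sum g {Suc q..N} <= (1 + 1 / (b1 - r)) * t powr r"
 proof -
  have "sum g {Suc q..N} <= (\<Sum>n\<in>{Suc q..N}. t powr b1 * real n powr (- 1 - (b1 - r)))"
  proof (rule sum_mono)
   fix n assume "n \<in> {Suc q..N}"
   then have n: "0 < real n" by simp
   have "g n <= real n powr (r - 1) * (t / real n) powr b1" unfolding g_def by (intro mult_left_mono) (auto simp: Phi_def)
   also have "... = t powr b1 * (real n powr (r - 1) / real n powr b1)" using n t by (simp add: powr_divide)
   also have "real n powr (r - 1) / real n powr b1 = real n powr (- 1 - (b1 - r))" using n by (simp add: powr_diff[symmetric] algebra_simps)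
   finally show "g n <= t powr b1 * real n powr (- 1 - (b1 - r))" .
  qed
  also have "... = t powr b1 * (\<Sum>n\<in>{Suc q..N}. real n powr (- 1 - (b1 - r)))" by (simp add: sum_distrib_left)
  also have "... <= t powr b1 * ((1 + 1 / (b1 - r)) * real (Suc q) powr (- (b1 - r)))"
   using b by (intro mult_left_mono sum_powr_tail_le) auto
  also have "... <= t powr b1 * ((1 + 1 / (b1 - r)) * t powr (- (b1 - r)))"
   using b q t by (intro mult_left_mono powr_mono2') auto
  also have "... = (1 + 1 / (b1 - r)) * (t powr b1 * t powr (- (b1 - r)))" by simp
  also have "t powr b1 * t powr (- (b1 - r)) = t powr r" by (simp add: powr_add[symmetric])
  finally show ?thesis .
 qed
 have "sum g {1..N} <= sum g ({1..q} \<union> {Suc q..N})" by (rule sum_mono2) (auto intro: g0)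
 also have "... = sum g {1..q} + sum g {Suc q..N}" by (rule sum.union_disjoint) auto
 also have "... <= (1 + 1 / (r - b2)) * t powr r + (1 + 1 / (b1 - r)) * t powr r" using low high by (rule add_mono)
 also have "... = (2 + 1 / (r - b2) + 1 / (b1 - r)) * t powr r" by (simp add: algebra_simps)
 finally show ?thesis unfolding g_def .
qed

lemma factor_out: "C * (k * s + k * t) = (C * k) * (s + t)" for C k s t :: real
 by (simp add: algebra_simps)

context alpha_rate begin

lemma maxdev_le_1: "maxdev f n l <= 1" unfolding maxdev_def by (rule prob_le_1)

text \<open>The inequality is applied with an exponent \<open>a' \<ge> a\<close> above 3/2, close enough to \<open>p\<close>; 7/4 is one that is less than 2. Lowering it to \<open>a\<close> is harmless where \<open>B \<le> 1\<close>, and where \<open>B > 1\<close> the right-hand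
side exceeds 1. The exponents of \<open>\<Phi>\<close> then lie on both sides of \<open>p - 1\<close>.\<close>

lemma deviation_lower_exponent:
 assumes p: "2 <= p" and a: "p - 1 < a" "a < p"
  and Ji: "\<And>b1 b2 l. 0 < b2 ==> b2 < p - 1 ==> p - 1 < b1 ==> 0 < l ==> integrable unif01 (\<lambda>u. quant H u * Phi b1 b2 (\<rho> u / l))"
 shows "\<exists>b1 b2 C. 0 < b2 \<and> b2 < p - 1 \<and> p - 1 < b1 \<and> b1 <= p \<and> 0 < C \<and>
  (\<forall>f\<in>F_class H \<mu>. \<forall>n\<ge>1. \<forall>l>0. \<forall>B. real n * VV l / l\<^sup>2 <= B --> maxdev f n l <= C * (B powr a + real n / l * JJ b1 b2 l))"
proof -
 define a' where "a' = max a (7/4)"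
 \<comment> \<open>Margins that put \<open>a' - e\<close> above and \<open>a' - 1 + \<delta>\<close> below \<open>p - 1\<close>; the bound 1/4 also gives \<open>e + \<delta> \<le> 1\<close>.\<close>
 define e where "e = min ((a' - (p - 1)) / 2) (1/4)"
 define \<delta> where "\<delta> = min ((p - a') / 2) (1/4)"
 have a': "a <= a'" "7/4 <= a'" "a' < p" using a p by (auto simp: a'_def)
 have e: "0 < e" "e <= 1/4" "e <= (a' - (p - 1)) / 2" using a a' by (simp_all add: e_def min_def)
 have \<delta>: "0 < \<delta>" "\<delta> <= 1/4" "\<delta> <= (p - a') / 2" using a' by (simp_all add: \<delta>_def min_def)
 have b: "0 < a' - 1 + \<delta>" "a' - 1 + \<delta> < p - 1" "p - 1 < a' - e" "a' - e <= p"
  using a a' e \<delta> by (auto simp: field_simps)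
 have "\<exists>C>0. \<forall>f\<in>F_class H \<mu>. \<forall>n\<ge>1. \<forall>l>0. maxdev f n l <= C * ((real n * VV l) powr a' / l powr (2 * a') + real n / l * JJ (a' - e) (a' - 1 + \<delta>) l)"
  using a' e \<delta> b Ji by (intro F_class_deviation) auto
 then obtain C where C: "0 < C" and dev: "\<forall>f\<in>F_class H \<mu>. \<forall>n\<ge>1. \<forall>l>0. maxdev f n l <= C * ((real n * VV l) powr a' / l powr (2 * a') + real n / l * JJ (a' - e) (a' - 1 + \<delta>) l)"
  by blast
 have "maxdev f n l <= (C + 1) * (B powr a + real n / l * JJ (a' - e) (a' - 1 + \<delta>) l)"
  if f: "f \<in> F_class H \<mu>" and n: "1 <= n" and l: "0 < l" and B: "real n * VV l / l\<^sup>2 <= B" for f n l B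
 proof -
  define J where "J = real n / l * JJ (a' - e) (a' - 1 + \<delta>) l"
  have J: "0 <= J" unfolding J_def using l JJ_nonneg by (intro mult_nonneg_nonneg) auto
  have v0: "0 <= real n * VV l" using VV_nonneg[of l] l by simp
  show ?thesis unfolding J_def[symmetric]
  proof (cases "B <= 1")
   case True
   have B0: "0 <= B" using B v0 l by (meson divide_nonneg_nonneg order_trans zero_le_power2)
   have "(real n * VV l) powr a' / l powr (2 * a') = (real n * VV l / l\<^sup>2) powr a'"
    using l v0 by (simp add: powr_divide powr_powr[symmetric] powr_numeral)
   also have "... <= B powr a'" using B v0 l a' by (intro powr_mono2) auto
   also have "... <= B powr a" using B0 True a' by (intro powr_mono') auto
   finally have "C * ((real n * VV l) powr a' / l powr (2 * a') + J) <= C * (B powr a + J)" using C by (intro mult_left_mono) auto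
   also have "... <= (C + 1) * (B powr a + J)" using J by (intro mult_right_mono) auto
   finally show "maxdev f n l <= (C + 1) * (B powr a + J)" using dev[rule_format, OF f n l] by (simp add: J_def)
  next
   case False
   then have "1 <= B powr a" using a p by (intro ge_one_powr_ge_zero) auto
   then have "1 * 1 <= (C + 1) * (B powr a + J)" using C J by (intro mult_mono) auto
   then show "maxdev f n l <= (C + 1) * (B powr a + J)" using maxdev_le_1[of f n l] by simp
  qed
 qed
 then show ?thesis using b C by (intro exI[of _ "a' - e"] exI[of _ "a' - 1 + \<delta>"] exI[of _ "C + 1"]) auto
qed

lemma VV_le:
 assumes i: "integrable unif01 (\<lambda>u. quant H u * w u)" and l: "0 <= l" and w: "\<And>u. min (\<rho> u) l <= s * w u"
 shows "VV l <= s * (\<integral>u. quant H u * w u \<partial>unif01)"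
proof -
 have "VV l <= (\<integral>u. s * (quant H u * w u) \<partial>unif01)" unfolding VV_def
 proof (rule integral_mono[OF VV_integrable[OF l]])
  show "integrable unif01 (\<lambda>u. s * (quant H u * w u))" using i by (rule integrable_cmult)
  fix u show "quant H u * min (\<rho> u) l <= s * (quant H u * w u)" using mult_left_mono[OF w[of u], of "quant H u"] by (simp add: mult_ac)
 qed
 then show ?thesis by simp
qed

text \<open>The exponent \<open>c\<close> bounds \<open>min \<rho> l\<close> by \<open>l powr (1 - c) * \<rho> powr c\<close>, whose integral against \<open>Q\<close> is finite when \<open>c < p - 1\<close>. For \<open>p > 2\<close> it may be taken to be 1.\<close>

theorem weak_deviation:
 assumes p: "2 <= p" and a: "p - 1 < a" "a < p" and c: "0 < c" "c <= 1" "c < p - 1"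
  and tail: "\<And>t. 0 < t ==> t powr (p - 1) * tailQ t <= K" and K: "0 <= K" and f: "f \<in> F_class H \<mu>"
 shows "\<exists>C>0. \<forall>n\<ge>1. \<forall>x>0. maxdev f n (real n * x) <= C * (1 / (real n powr (a * c) * x powr (a * (1 + c))) + 1 / (real n powr (p - 1) * x powr p))"
proof -
 have Ji: "integrable unif01 (\<lambda>u. quant H u * Phi b1 b2 (\<rho> u / l))" if "0 < b2" "b2 < p - 1" "p - 1 < b1" "0 < l" for b1 b2 l
  using Phi_integral_weak[OF that(1-3) tail K] that(4) by blast
 obtain b1 b2 C where b: "0 < b2" "b2 < p - 1" "p - 1 < b1" and C: "0 < C"
  and dev: "\<forall>f\<in>F_class H \<mu>. \<forall>n\<ge>1. \<forall>l>0. \<forall>B. real n * VV l / l\<^sup>2 <= B --> maxdev f n l <= C * (B powr a + real n / l * JJ b1 b2 l)"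
  using deviation_lower_exponent[OF p a Ji] by auto
 obtain D where D: "0 <= D" and JD: "\<forall>l>0. integrable unif01 (\<lambda>u. quant H u * Phi b1 b2 (\<rho> u / l)) \<and> JJ b1 b2 l <= D * l powr (1 - p)"
  using Phi_integral_weak[OF b tail K] by blast
 define V where "V = (\<integral>u. quant H u * \<rho> u powr c \<partial>unif01)"
 have "integrable unif01 (\<lambda>u. quant H u * \<rho> u powr c)" by (rule powr_integral_weak[OF _ _ tail K]) (use c in auto)
 then have VV: "VV l <= l powr (1 - c) * V" if l: "0 < l" for l unfolding V_def
 proof (rule VV_le)
  show "0 <= l" using l by simp
  fix u
  have m: "0 <= min (\<rho> u) l" using \<rho>_nonneg l by simp
  have "min (\<rho> u) l = min (\<rho> u) l powr (1 - c) * min (\<rho> u) l powr c" using m by (simp add: powr_add[symmetric])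
  also have "... <= l powr (1 - c) * \<rho> u powr c" using m c by (intro mult_mono powr_mono2) auto
  finally show "min (\<rho> u) l <= l powr (1 - c) * \<rho> u powr c" .
 qed
 have V0: "0 <= V" using VV[of 1] VV_nonneg[of 1] by simp
 have "maxdev f n (real n * x) <= (C * (V powr a + D + 1)) * (1 / (real n powr (a * c) * x powr (a * (1 + c))) + 1 / (real n powr (p - 1) * x powr p))"
  if n: "1 <= n" and x: "0 < x" for n x
 proof -
  define l where "l = real n * x"
  have np: "0 < real n" using n by simp
  have l: "0 < l" using n x by (simp add: l_def)
  have "real n * VV l / l\<^sup>2 <= real n * (l powr (1 - c) * V) / l\<^sup>2" using VV[OF l] by (intro divide_right_mono mult_left_mono) auto
  also have "... = V / (real n powr c * x powr (1 + c))"
  proof -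
   have "l powr (1 - c) = l\<^sup>2 / l powr (1 + c)" using l powr_diff[of l 2 "1 + c"] by (simp add: powr_numeral)
   then have "real n * (l powr (1 - c) * V) / l\<^sup>2 = V * (real n / l powr (1 + c))" using l by simp
   also have "l powr (1 + c) = real n powr (1 + c) * x powr (1 + c)" using np x by (simp add: l_def powr_mult)
   also have "real n powr (1 + c) = real n * real n powr c" using np by (simp add: powr_add)
   finally show ?thesis using np by simp
  qed
  finally have "maxdev f n l <= C * ((V / (real n powr c * x powr (1 + c))) powr a + real n / l * JJ b1 b2 l)"
   by (rule dev[rule_format, OF f n l])
  also have "... <= C * (V powr a * (1 / (real n powr (a * c) * x powr (a * (1 + c)))) + D * (1 / (real n powr (p - 1) * x powr p)))"
  proof (intro mult_left_mono add_mono)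
   show "(V / (real n powr c * x powr (1 + c))) powr a <= V powr a * (1 / (real n powr (a * c) * x powr (a * (1 + c))))"
    using V0 np x by (simp add: powr_divide powr_mult powr_powr mult.commute)
   have "real n / l * JJ b1 b2 l <= real n / l * (D * l powr (1 - p))" using JD l by (intro mult_left_mono) auto
   also have "... = D * (l powr (1 - p) / x)" using np by (simp add: l_def)
   also have "l powr (1 - p) / x = 1 / (real n powr (p - 1) * x powr p)"
   proof -
    have "l powr (1 - p) = 1 / l powr (p - 1)" using powr_minus[of l "p - 1"] by (simp add: inverse_eq_divide)
    also have "... = 1 / (real n powr (p - 1) * x powr (p - 1))" using np x by (simp add: l_def powr_mult)
    finally have "l powr (1 - p) / x = 1 / (real n powr (p - 1) * (x powr (p - 1) * x))" by simp
    also have "x powr (p - 1) * x = x powr p" using x powr_add[of x "p - 1" 1] by simp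
    finally show ?thesis .
   qed
   finally show "real n / l * JJ b1 b2 l <= D * (1 / (real n powr (p - 1) * x powr p))" .
  qed (use C in auto)
  also have "... <= C * ((V powr a + D + 1) * (1 / (real n powr (a * c) * x powr (a * (1 + c)))) + (V powr a + D + 1) * (1 / (real n powr (p - 1) * x powr p)))"
   using C D by (intro mult_left_mono add_mono mult_right_mono) auto
  also have "... = (C * (V powr a + D + 1)) * (1 / (real n powr (a * c) * x powr (a * (1 + c))) + 1 / (real n powr (p - 1) * x powr p))"
   by (rule factor_out)
  finally show ?thesis unfolding l_def .
 qed
 moreover have "0 < C * (V powr a + D + 1)" using C D by (intro mult_pos_pos add_nonneg_pos) auto
 ultimately show ?thesis by blast
qed

text \<open>Summation of \<open>\<Phi> (\<rho> / (n x))\<close> under the integral gives \<open>(\<rho> / x) powr (p - 1)\<close>; the variance term sums because \<open>a > p - 1\<close>.\<close>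

theorem strong_deviation:
 assumes p: "2 <= p" and a: "p - 1 < a" "a < p" and Qi: "integrable unif01 (\<lambda>u. quant H u * \<rho> u powr (p - 1))"
  and f: "f \<in> F_class H \<mu>"
 shows "\<exists>C>0. \<forall>x>0. \<forall>N. (\<Sum>n=1..N. real n powr (p - 2) * maxdev f n (real n * x)) <= C * (1 / x powr (2 * a) + 1 / x powr p)"
proof -
 have Ji: "integrable unif01 (\<lambda>u. quant H u * Phi b1 b2 (\<rho> u / l))" if b: "0 < b2" "b2 < p - 1" "p - 1 < b1" and l: "0 < l" for b1 b2 l
 proof (rule integrable_dominated)
  show "integrable unif01 (\<lambda>u. (1 / l powr (p - 1)) * (quant H u * \<rho> u powr (p - 1)))" using Qi by (rule integrable_cmult)
  show "(\<lambda>u. quant H u * Phi b1 b2 (\<rho> u / l)) \<in> borel_measurable unif01" unfolding Phi_def by measurable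
  have "Phi b1 b2 (\<rho> u / l) <= \<rho> u powr (p - 1) / l powr (p - 1)" for u
   using Phi_le_powr[of b2 "p - 1" b1 "\<rho> u / l"] b l \<rho>_nonneg by (simp add: powr_divide)
  from mult_left_mono[OF this quant_nonneg]
  show "AE u in unif01. norm (quant H u * Phi b1 b2 (\<rho> u / l)) <= norm ((1 / l powr (p - 1)) * (quant H u * \<rho> u powr (p - 1)))"
   by (intro AE_I2) (simp add: abs_mult)
 qed
 obtain b1 b2 C where b: "0 < b2" "b2 < p - 1" "p - 1 < b1" "b1 <= p" and C: "0 < C"
  and dev: "\<forall>f\<in>F_class H \<mu>. \<forall>n\<ge>1. \<forall>l>0. \<forall>B. real n * VV l / l\<^sup>2 <= B --> maxdev f n l <= C * (B powr a + real n / l * JJ b1 b2 l)"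
  using deviation_lower_exponent[OF p a Ji] by auto
 define V where "V = (\<integral>u. quant H u * (1 + \<rho> u powr (p - 1)) \<partial>unif01)"
 have "integrable unif01 (\<lambda>u. quant H u + quant H u * \<rho> u powr (p - 1))" using Q_integrable Qi by (rule Bochner_Integration.integrable_add)
 then have Vi: "integrable unif01 (\<lambda>u. quant H u * (1 + \<rho> u powr (p - 1)))" by (simp add: distrib_left)
 have VV: "VV l <= V" if l: "0 <= l" for l
 proof -
  have "VV l <= 1 * V" unfolding V_def
  proof (rule VV_le[OF Vi l])
   fix u
   have "\<rho> u <= 1 + \<rho> u powr (p - 1)"
   proof (cases "\<rho> u <= 1")
    case False
    then have "\<rho> u powr 1 <= \<rho> u powr (p - 1)" using p by (intro powr_mono) auto
    then show ?thesis using False by simp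
   qed (simp add: add_increasing2)
   then show "min (\<rho> u) l <= 1 * (1 + \<rho> u powr (p - 1))" by simp
  qed
  then show ?thesis by simp
 qed
 have V0: "0 <= V" using VV[of 0] VV_nonneg[of 0] by simp
 define G where "G = 2 + 1 / (p - 1 - b2) + 1 / (b1 - (p - 1))"
 define W where "W = (\<integral>u. quant H u * \<rho> u powr (p - 1) \<partial>unif01)"
 have W0: "0 <= W" unfolding W_def by (intro integral_ge_0) auto
 have G0: "0 <= G" using b by (simp add: G_def)
 have Jsum: "(\<Sum>n=1..N. real n powr (p - 2) * JJ b1 b2 (real n * x)) <= G * W * x powr (1 - p)" if x: "0 < x" for N x
 proof -
  have "(\<Sum>n=1..N. real n powr (p - 2) * JJ b1 b2 (real n * x)) = (\<Sum>n=1..N. \<integral>u. real n powr (p - 2) * (quant H u * Phi b1 b2 (\<rho> u / (real n * x))) \<partial>unif01)"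
   unfolding JJ_def by simp
  also have "... = (\<integral>u. (\<Sum>n=1..N. real n powr (p - 2) * (quant H u * Phi b1 b2 (\<rho> u / (real n * x)))) \<partial>unif01)"
   using b x by (intro expect_sum[symmetric] integrable_cmult Ji) auto
  also have "... <= (\<integral>u. (G * x powr (1 - p)) * (quant H u * \<rho> u powr (p - 1)) \<partial>unif01)"
  proof (rule integral_mono)
   show "integrable unif01 (\<lambda>u. \<Sum>n=1..N. real n powr (p - 2) * (quant H u * Phi b1 b2 (\<rho> u / (real n * x))))"
    using b x by (intro integrable_setsum integrable_cmult Ji) auto
   show "integrable unif01 (\<lambda>u. (G * x powr (1 - p)) * (quant H u * \<rho> u powr (p - 1)))" using Qi by (rule integrable_cmult)
   fix u
   have "(\<Sum>n=1..N. real n powr (p - 1 - 1) * Phi b1 b2 (\<rho> u / x / real n)) <= G * (\<rho> u / x) powr (p - 1)"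
    unfolding G_def using b x \<rho>_nonneg by (intro sum_powr_Phi_le) auto
   also have "(\<rho> u / x) powr (p - 1) = x powr (1 - p) * \<rho> u powr (p - 1)"
    using x \<rho>_nonneg powr_minus[of x "p - 1"] by (simp add: powr_divide inverse_eq_divide)
   finally have s: "(\<Sum>n=1..N. real n powr (p - 1 - 1) * Phi b1 b2 (\<rho> u / x / real n)) <= G * (x powr (1 - p) * \<rho> u powr (p - 1))" .
   have "(\<Sum>n=1..N. real n powr (p - 2) * (quant H u * Phi b1 b2 (\<rho> u / (real n * x)))) = quant H u * (\<Sum>n=1..N. real n powr (p - 1 - 1) * Phi b1 b2 (\<rho> u / x / real n))"
    unfolding sum_distrib_left by (intro sum.cong refl) (simp add: mult_ac)
   also have "... <= quant H u * (G * (x powr (1 - p) * \<rho> u powr (p - 1)))" using s by (rule mult_left_mono) simp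
   also have "... = (G * x powr (1 - p)) * (quant H u * \<rho> u powr (p - 1))" by (simp only: mult_ac)
   finally show "(\<Sum>n=1..N. real n powr (p - 2) * (quant H u * Phi b1 b2 (\<rho> u / (real n * x)))) <= (G * x powr (1 - p)) * (quant H u * \<rho> u powr (p - 1))" .
  qed
  also have "... = G * W * x powr (1 - p)" by (simp add: W_def)
  finally show ?thesis .
 qed
 define A where "A = (1 + 1 / (a - (p - 1))) * V powr a"
 have A0: "0 <= A" using a by (simp add: A_def)
 have "(\<Sum>n=1..N. real n powr (p - 2) * maxdev f n (real n * x)) <= (C * (A + G * W + 1)) * (1 / x powr (2 * a) + 1 / x powr p)"
  if x: "0 < x" for x N
 proof -
  have summand: "real n powr (p - 2) * maxdev f n (real n * x) <= C * (V powr a / x powr (2 * a)) * real n powr (- 1 - (a - (p - 1))) + (C / x) * (real n powr (p - 2) * JJ b1 b2 (real n * x))"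
   if n: "n \<in> {1..N}" for n
  proof -
   have np: "0 < real n" "1 <= n" using n by auto
   define l where "l = real n * x"
   have l: "0 < l" using np x by (simp add: l_def)
   have "real n * VV l / l\<^sup>2 <= real n * V / l\<^sup>2" using VV l by (intro divide_right_mono mult_left_mono) auto
   also have "... = V / (real n * x\<^sup>2)" using np x by (simp add: l_def power2_eq_square)
   finally have "maxdev f n l <= C * ((V / (real n * x\<^sup>2)) powr a + real n / l * JJ b1 b2 l)"
    by (rule dev[rule_format, OF f np(2) l])
   also have "(V / (real n * x\<^sup>2)) powr a = (V powr a / x powr (2 * a)) / real n powr a"
    using V0 np x by (simp add: powr_divide powr_mult powr_powr[symmetric] powr_numeral)
   also have "real n / l = 1 / x" using np by (simp add: l_def)
   finally have "real n powr (p - 2) * maxdev f n l <= real n powr (p - 2) * (C * ((V powr a / x powr (2 * a)) / real n powr a + 1 / x * JJ b1 b2 l))"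
    by (intro mult_left_mono) auto
   also have "... = C * (V powr a / x powr (2 * a)) * (real n powr (p - 2) / real n powr a) + (C / x) * (real n powr (p - 2) * JJ b1 b2 l)"
    by (simp add: distrib_left mult_ac)
   also have "real n powr (p - 2) / real n powr a = real n powr (- 1 - (a - (p - 1)))" using np by (simp add: powr_diff[symmetric] algebra_simps)
   finally show ?thesis unfolding l_def .
  qed
  have "(\<Sum>n=1..N. real n powr (p - 2) * maxdev f n (real n * x)) <=
   C * (V powr a / x powr (2 * a)) * (\<Sum>n=1..N. real n powr (- 1 - (a - (p - 1)))) + (C / x) * (\<Sum>n=1..N. real n powr (p - 2) * JJ b1 b2 (real n * x))"
   unfolding sum_distrib_left sum.distrib[symmetric] by (rule sum_mono) (rule summand)
  also have "... <= C * (V powr a / x powr (2 * a)) * ((1 + 1 / (a - (p - 1))) * real 1 powr (- (a - (p - 1)))) + (C / x) * (G * W * x powr (1 - p))"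
   using a C x by (intro add_mono mult_left_mono sum_powr_tail_le Jsum) auto
  also have "... = C * (A * (1 / x powr (2 * a))) + C * (G * W * (x powr (1 - p) / x))" by (simp add: A_def)
  also have "x powr (1 - p) / x = 1 / x powr p" using x powr_diff[of x "1 - p" 1] by (simp add: powr_minus inverse_eq_divide)
  also have "C * (A * (1 / x powr (2 * a))) + C * (G * W * (1 / x powr p)) <= C * ((A + G * W + 1) * (1 / x powr (2 * a)) + (A + G * W + 1) * (1 / x powr p))"
   unfolding distrib_left[of C, symmetric] using C A0 G0 W0 by (intro add_mono mult_left_mono mult_right_mono) auto
  also have "... = (C * (A + G * W + 1)) * (1 / x powr (2 * a) + 1 / x powr p)" by (rule factor_out)
  finally show ?thesis .
 qed
 moreover have "0 < C * (A + G * W + 1)" using C A0 G0 W0 by (intro mult_pos_pos add_nonneg_pos add_nonneg_nonneg) auto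
 ultimately show ?thesis by blast
qed

end

section \<open>Stationary sequences\<close>

text \<open>The past of time \<open>i\<close> is the pullback of \<open>F0\<close> along the \<open>i\<close>-th iterate; it increases with \<open>i\<close> because \<open>F0\<close> is contained in its own pullback.\<close>

locale stationary_shift = prob_space M for M :: "'a measure" +
 fixes F0 :: "'a measure" and T :: "'a \<Rightarrow> 'a" and Y0 :: "'a \<Rightarrow> real"
 assumes mpt: "bimeasurable_mpt M T"
  and F0_sub: "subalgebra M F0"
  and F0_increasing: "sets F0 \<subseteq> {T -` A \<inter> space M | A. A \<in> sets F0}"
  and Y0_meas: "Y0 \<in> borel_measurable F0"
begin

abbreviation "Tinv \<equiv> inv_into (space M) T"
abbreviation "It \<equiv> int_iterate M T"

definition Y :: "int \<Rightarrow> 'a \<Rightarrow> real" where "Y = (\<lambda>i. Y0 \<circ> It i)"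

definition F :: "int \<Rightarrow> 'a measure" where "F i = vimage_algebra (space M) (It i) F0"

definition al :: "nat \<Rightarrow> real" where
 "al m = (if m = 0 then 1 / 2 else enn2real (alpha_coeff M F0 2 Y m) / 4)"

lemma bij: "bij_betw T (space M) (space M)"
 and T_meas [measurable]: "T \<in> measurable M M" and Tinv_meas [measurable]: "Tinv \<in> measurable M M"
 and distr_T: "distr M M T = M"
 using mpt by (auto simp: bimeasurable_mpt_def)

lemma T_Tinv: "w \<in> space M ==> T (Tinv w) = w"
 using bij by (simp add: bij_betw_inv_into_right)

lemma Tinv_T: "w \<in> space M ==> Tinv (T w) = w"
 using bij by (simp add: bij_betw_inv_into_left)

lemma It_meas [measurable]: "It i \<in> measurable M M"
 unfolding int_iterate_def using measurable_compose_n[OF T_meas] measurable_compose_n[OF Tinv_meas] by simp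

lemma It_space: "w \<in> space M ==> It i w \<in> space M"
 using measurable_space[OF It_meas] .

lemma It_0: "It 0 w = w" by (simp add: int_iterate_def)

lemma It_Suc: assumes w: "w \<in> space M" shows "It (i + 1) w = T (It i w)"
proof (cases i)
 case (nonneg n)
 then have "nat (i + 1) = Suc n" by simp
 then show ?thesis using nonneg by (simp add: int_iterate_def)
next
 case (neg n)
 have z: "(Tinv ^^ n) w \<in> space M" using measurable_space[OF measurable_compose_n[OF Tinv_meas] w] .
 have "It i w = Tinv ((Tinv ^^ n) w)" using neg by (simp add: int_iterate_def nat_add_distrib)
 then have "T (It i w) = (Tinv ^^ n) w" using T_Tinv[OF z] by simp
 moreover have "It (i + 1) w = (Tinv ^^ n) w" using neg by (cases n) (auto simp: int_iterate_def nat_add_distrib)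
 ultimately show ?thesis by simp
qed

lemma It_pred: "w \<in> space M ==> It (i - 1) w = Tinv (It i w)"
 using It_Suc[of w "i - 1"] Tinv_T[OF It_space[of w "i - 1"]] by simp

lemma It_add: assumes w: "w \<in> space M" shows "It (i + j) w = It i (It j w)"
proof (induction i rule: int_induct[where k=0])
 case base
 then show ?case by (simp add: It_0)
next
 case (step1 i)
 have "It (i + 1 + j) w = T (It (i + j) w)" using It_Suc[OF w, of "i + j"] by (simp add: algebra_simps)
 then show ?case using step1 It_Suc[OF It_space[OF w]] by simp
next
 case (step2 i)
 have "It (i - 1 + j) w = Tinv (It (i + j) w)" using It_pred[OF w, of "i + j"] by (simp add: algebra_simps)
 then show ?case using step2 It_pred[OF It_space[OF w]] by simp
qed

lemma It_inverse: "w \<in> space M ==> It (- i) (It i w) = w" "w \<in> space M ==> It i (It (- i) w) = w"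
 using It_add[of w "- i" i] It_add[of w i "- i"] by (simp_all add: It_0)

lemma distr_Tinv: "distr M M Tinv = M"
proof -
 have "distr M M Tinv = distr (distr M M T) M Tinv" by (simp add: distr_T)
 also have "... = distr M M (Tinv \<circ> T)" by (rule distr_distr) auto
 also have "... = distr M M (\<lambda>w. w)" by (rule distr_cong) (auto simp: Tinv_T)
 finally show ?thesis by simp
qed

lemma distr_It: "distr M M (It i) = M"
proof (induction i rule: int_induct[where k=0])
 case base
 have "distr M M (It 0) = distr M M (\<lambda>w. w)" by (rule distr_cong) (auto simp: It_0)
 then show ?case by simp
next
 case (step1 i)
 have "distr M M (It (i + 1)) = distr M M (T \<circ> It i)" by (rule distr_cong) (auto simp: It_Suc)
 also have "... = distr (distr M M (It i)) M T" by (rule distr_distr[symmetric]) auto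
 finally show ?case using step1 distr_T by simp
next
 case (step2 i)
 have "distr M M (It (i - 1)) = distr M M (Tinv \<circ> It i)" by (rule distr_cong) (auto simp: It_pred)
 also have "... = distr (distr M M (It i)) M Tinv" by (rule distr_distr[symmetric]) auto
 finally show ?case using step2 distr_Tinv by simp
qed

lemma expectation_It: "g \<in> borel_measurable M ==> (\<E> w. g (It i w)) = expectation g" for g :: "'a \<Rightarrow> real"
 using integral_distr[OF It_meas[of i], of g] by (simp add: distr_It)

lemma space_F0: "space F0 = space M" using F0_sub by (simp add: subalgebra_def)

lemma F0_to_M: "g \<in> borel_measurable F0 ==> g \<in> borel_measurable M"
 using F0_sub by (rule measurable_from_subalg)

lemma sets_F: "sets (F i) = {It i -` A \<inter> space M | A. A \<in> sets F0}"
 unfolding F_def by (rule sets_vimage_algebra2) (auto simp: space_F0 It_space)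

lemma space_F: "space (F i) = space M" by (simp add: F_def)

lemma It_F: "It i \<in> measurable (F i) F0"
 unfolding F_def by (rule measurable_vimage_algebra1) (auto simp: space_F0 It_space)

lemma F_sub: "subalgebra M (F i)"
proof -
 have "It i -` A \<inter> space M \<in> sets M" if "A \<in> sets F0" for A
  using that F0_sub by (intro measurable_sets[OF It_meas]) (auto simp: subalgebra_def)
 then show ?thesis by (auto simp: subalgebra_def space_F sets_F)
qed

lemma F_Suc: "sets (F i) \<subseteq> sets (F (i + 1))"
proof
 fix B assume "B \<in> sets (F i)"
 then obtain A where A: "A \<in> sets F0" "B = It i -` A \<inter> space M" by (auto simp: sets_F)
 obtain A' where A': "A' \<in> sets F0" "A = T -` A' \<inter> space M" using F0_increasing A by blast
 have "B = It (i + 1) -` A' \<inter> space M" using A(2) A'(2) by (auto simp: It_Suc It_space)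
 then show "B \<in> sets (F (i + 1))" using A'(1) by (auto simp: sets_F)
qed

lemma F_mono: assumes "i <= j" shows "sets (F i) \<subseteq> sets (F j)"
 using assms
proof (induction j rule: int_ge_induct)
 case (step j)
 then show ?case using F_Suc[of j] by blast
qed simp

lemma Y_eq: "w \<in> space M ==> Y j w = Y (j - i) (It i w)"
 using It_add[of w "j - i" i] by (simp add: Y_def)

lemma Y_F: "Y i \<in> borel_measurable (F i)"
 unfolding Y_def by (rule measurable_comp[OF It_F Y0_meas])

lemma Y_M [measurable]: "Y i \<in> borel_measurable M"
 unfolding Y_def by (rule measurable_comp[OF It_meas F0_to_M[OF Y0_meas]])

lemma Y_law: "distr M borel (Y i) = distr M borel Y0"
proof -
 have "distr M borel (Y i) = distr (distr M M (It i)) borel Y0"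
  unfolding Y_def by (rule distr_distr[symmetric]) (auto intro: F0_to_M Y0_meas)
 then show ?thesis by (simp add: distr_It)
qed

lemma measure_law: "A \<in> sets borel ==> measure (distr M borel Y0) A = (\<E> w. indicat_real A (Y j w))"
proof -
 assume A: "A \<in> sets borel"
 have "measure (distr M borel Y0) A = measure M (Y j -` A \<inter> space M)"
  unfolding Y_law[of j, symmetric] by (rule measure_distr[OF Y_M A])
 also have "... = expectation (indicat_real (Y j -` A \<inter> space M))"
  using A by (simp add: measurable_sets[OF Y_M])
 also have "... = (\<E> w. indicat_real A (Y j w))" by (rule expect_cong) (auto simp: indicator_def)
 finally show ?thesis .
qed

lemma F_shift: assumes "brv (F i) \<xi>" shows "brv F0 (\<lambda>w. \<xi> (It (- i) w))"
proof -
 have "It (- i) \<in> measurable F0 (F i)" unfolding F_def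
 proof (rule measurable_vimage_algebra2)
  show "It (- i) \<in> space F0 \<rightarrow> space M" by (auto simp: space_F0 It_space)
  have "(\<lambda>w. It i (It (- i) w)) \<in> measurable F0 F0 \<longleftrightarrow> (\<lambda>w. w) \<in> measurable F0 F0"
   by (rule measurable_cong) (simp add: space_F0 It_inverse)
  then show "(\<lambda>w. It i (It (- i) w)) \<in> measurable F0 F0" by simp
 qed
 then have "(\<lambda>w. \<xi> (It (- i) w)) \<in> borel_measurable F0" using brv_meas[OF assms] by (rule measurable_compose)
 then show ?thesis using assms by (auto simp: brv_def)
qed

text \<open>Stationarity reduces every covariance to one with a variable of \<open>F0\<close>.\<close>

lemma assoc_shift:
 assumes \<xi>: "brv (F i) \<xi>" and g: "g \<in> borel_measurable M" and h: "\<And>w. w \<in> space M ==> h w = g (It i w)"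
 shows "assoc \<xi> h = assoc (\<lambda>w. \<xi> (It (- i) w)) g"
proof -
 have [measurable]: "(\<lambda>w. \<xi> (It (- i) w)) \<in> borel_measurable M" "g \<in> borel_measurable M"
  using F0_to_M[OF brv_meas[OF F_shift[OF \<xi>]]] g by auto
 have "(\<E> w. \<xi> w * h w) = (\<E> w. \<xi> (It (- i) (It i w)) * g (It i w))"
  by (rule expect_cong) (auto simp: It_inverse h)
 also have "... = (\<E> w. \<xi> (It (- i) w) * g w)"
  by (rule expectation_It[of "\<lambda>w. \<xi> (It (- i) w) * g w"]) measurable
 finally have 1: "(\<E> w. \<xi> w * h w) = (\<E> w. \<xi> (It (- i) w) * g w)" .
 have "expectation \<xi> = (\<E> w. \<xi> (It (- i) (It i w)))"
  by (rule expect_cong) (auto simp: It_inverse)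
 also have "... = (\<E> w. \<xi> (It (- i) w))" by (rule expectation_It[of "\<lambda>w. \<xi> (It (- i) w)"]) measurable
 finally have 2: "expectation \<xi> = (\<E> w. \<xi> (It (- i) w))" .
 have "expectation h = (\<E> w. g (It i w))" by (rule expect_cong) (auto simp: h)
 also have "... = expectation g" by (rule expectation_It) (rule g)
 finally show ?thesis using 1 2 by (simp add: assoc_def)
qed

text \<open>The \<open>L\<^sup>1\<close> norm of a conditional expectation dominates its pairings with variables bounded by 1.\<close>

lemma assoc_le_conditional:
 assumes \<eta>: "brv F0 \<eta>" "\<And>w. \<bar>\<eta> w\<bar> <= 1" and W: "brv M W"
 shows "ennreal \<bar>assoc \<eta> W\<bar> <= (\<integral>\<^sup>+w. ennreal \<bar>real_cond_exp M F0 W w - expectation W\<bar> \<partial>M)"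
proof -
 interpret F0: finite_measure_subalgebra M F0 by unfold_locales (rule F0_sub)
 have \<eta>M: "brv M \<eta>" using \<eta>(1) F0_to_M by (auto simp: brv_def)
 have i: "integrable M \<eta>" "integrable M W" "integrable M (\<lambda>w. \<eta> w * W w)"
  using \<eta>M W by (auto intro!: brv_integrable brv_mult)
 have c: "integrable M (real_cond_exp M F0 W)" by (rule F0.real_cond_exp_int(1)[OF i(2)])
 have c2: "integrable M (\<lambda>w. \<eta> w * real_cond_exp M F0 W w)" "(\<E> w. \<eta> w * real_cond_exp M F0 W w) = (\<E> w. \<eta> w * W w)"
  using F0.real_cond_exp_intg[OF i(3)] brv_meas[OF \<eta>(1)] brv_meas[OF W] by auto
 have "assoc \<eta> W = (\<E> w. \<eta> w * real_cond_exp M F0 W w - \<eta> w * expectation W)"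
  using c2 i by (simp add: assoc_def)
 also have "... = (\<E> w. \<eta> w * (real_cond_exp M F0 W w - expectation W))" by (simp add: right_diff_distrib)
 finally have "\<bar>assoc \<eta> W\<bar> <= (\<E> w. \<bar>\<eta> w * (real_cond_exp M F0 W w - expectation W)\<bar>)" by simp
 also have "... <= (\<E> w. \<bar>real_cond_exp M F0 W w - expectation W\<bar>)"
 proof (rule integral_mono)
  show "integrable M (\<lambda>w. \<bar>\<eta> w * (real_cond_exp M F0 W w - expectation W)\<bar>)"
   using c2(1) i(1) by (intro integrable_abs) (simp add: right_diff_distrib)
  fix w show "\<bar>\<eta> w * (real_cond_exp M F0 W w - expectation W)\<bar> <= \<bar>real_cond_exp M F0 W w - expectation W\<bar>"
   using \<eta>(2)[of w] by (simp add: abs_mult mult_left_le_one_le)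
 qed (use c in simp)
 finally have "ennreal \<bar>assoc \<eta> W\<bar> <= ennreal ((\<E> w. \<bar>real_cond_exp M F0 W w - expectation W\<bar>))" by (rule ennreal_leI)
 also have "... = (\<integral>\<^sup>+w. ennreal \<bar>real_cond_exp M F0 W w - expectation W\<bar> \<partial>M)"
  using c by (intro nn_integral_eq_integral[symmetric]) auto
 finally show ?thesis .
qed

text \<open>The product of centered indicators in the definition of the coefficients.\<close>

definition corner :: "nat \<Rightarrow> (nat \<Rightarrow> 'a \<Rightarrow> real) \<Rightarrow> (nat \<Rightarrow> real) \<Rightarrow> 'a \<Rightarrow> real" where
 "corner k V x w = (\<Prod>j=1..k. centered M (\<lambda>w'. indicator {..x j} (V j w')) w)"

lemma corner_bounded:
 assumes V: "\<And>j. V j \<in> borel_measurable M"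
 shows "corner k V x \<in> borel_measurable M" "\<bar>corner k V x w\<bar> <= 1"
proof -
 note [measurable] = V
 show "corner k V x \<in> borel_measurable M" unfolding corner_def centered_def by measurable
 have "\<bar>centered M (\<lambda>w'. indicator {..x j} (V j w')) w\<bar> <= 1" for j
 proof -
  have i: "integrable M (\<lambda>w. indicat_real {..x j} (V j w))" by (rule integrable_const_bound[where B=1]) (auto simp: indicator_def)
  have "0 <= (\<E> w. indicat_real {..x j} (V j w))" by (intro integral_ge_0) auto
  moreover have "(\<E> w. indicat_real {..x j} (V j w)) <= 1" using i by (intro integral_le_const) (auto simp: indicator_def)
  ultimately show ?thesis by (auto simp: centered_def indicator_def)
 qed
 then show "\<bar>corner k V x w\<bar> <= 1" unfolding corner_def abs_prod by (intro prod_le_1) auto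
qed

lemma alpha_vec_corner: "alpha_vec M F0 k V = (SUP x. \<integral>\<^sup>+w. ennreal \<bar>real_cond_exp M F0 (corner k V x) w - expectation (corner k V x)\<bar> \<partial>M)"
 unfolding alpha_vec_def Let_def corner_def ..

lemma alpha_vec_le_2:
 assumes V: "\<And>j. V j \<in> borel_measurable M" shows "alpha_vec M F0 k V <= 2"
 unfolding alpha_vec_corner
proof (rule SUP_least)
 fix x
 interpret F0: finite_measure_subalgebra M F0 by unfold_locales (rule F0_sub)
 define W where "W = corner k V x"
 have W: "W \<in> borel_measurable M" "\<And>w. \<bar>W w\<bar> <= 1" unfolding W_def using corner_bounded[OF V] by auto
 have W': "- 1 <= W w" "W w <= 1" for w using W(2)[of w] by auto
 have i: "integrable M W" by (rule integrable_const_bound[where B=1]) (use W in auto)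
 have e: "- 1 <= expectation W" "expectation W <= 1"
  using i by (intro integral_ge_const integral_le_const; simp add: W')+
 have "AE w in M. real_cond_exp M F0 W w <= 1" by (rule F0.real_cond_exp_le_c[OF i]) (simp add: W')
 moreover have "AE w in M. real_cond_exp M F0 W w \<ge> - 1" by (rule F0.real_cond_exp_ge_c[OF i]) (simp add: W')
 ultimately have "AE w in M. ennreal \<bar>real_cond_exp M F0 W w - expectation W\<bar> <= ennreal 2"
  by eventually_elim (intro ennreal_leI, use e in linarith)
 then have "(\<integral>\<^sup>+w. ennreal \<bar>real_cond_exp M F0 W w - expectation W\<bar> \<partial>M) <= (\<integral>\<^sup>+w. ennreal 2 \<partial>M)" by (rule nn_integral_mono_AE)
 also have "... = 2" by (simp add: emeasure_space_1)
 finally show "(\<integral>\<^sup>+w. ennreal \<bar>real_cond_exp M F0 (corner k V x) w - expectation (corner k V x)\<bar> \<partial>M) <= 2" by (simp add: W_def)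
qed

abbreviation "tuples n l \<equiv> {i :: nat \<Rightarrow> int. int n <= i 1 \<and> mono_on {1..l} i}"

lemma alpha_coeff_ge:
 assumes "1 <= n" "l \<in> {1..2}" "i \<in> tuples n l"
 shows "alpha_vec M F0 l (\<lambda>j. Y (i j)) <= alpha_coeff M F0 2 Y n"
proof -
 have "alpha_vec M F0 l (\<lambda>j. Y (i j)) <= (SUP i\<in>tuples n l. alpha_vec M F0 l (\<lambda>j. Y (i j)))" using assms(3) by (rule SUP_upper)
 also have "... <= (MAX l\<in>{1..2}. SUP i\<in>tuples n l. alpha_vec M F0 l (\<lambda>j. Y (i j)))" using assms(2) by (intro Max_ge) auto
 finally show ?thesis using assms(1) by (simp add: alpha_coeff_def)
qed

lemma alpha_coeff_least:
 assumes "1 <= n" "\<And>l i. l \<in> {1..2} ==> i \<in> tuples n l ==> alpha_vec M F0 l (\<lambda>j. Y (i j)) <= c"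
 shows "alpha_coeff M F0 2 Y n <= c"
proof -
 have "(MAX l\<in>{1..2}. SUP i\<in>tuples n l. alpha_vec M F0 l (\<lambda>j. Y (i j))) <= c"
 proof (rule Max.boundedI)
  fix s assume "s \<in> (\<lambda>l. SUP i\<in>tuples n l. alpha_vec M F0 l (\<lambda>j. Y (i j))) ` {1..2}"
  then obtain l where l: "l \<in> {1..2}" "s = (SUP i\<in>tuples n l. alpha_vec M F0 l (\<lambda>j. Y (i j)))" by blast
  show "s <= c" unfolding l(2) by (rule SUP_least) (rule assms(2)[OF l(1)])
 qed auto
 then show ?thesis using assms(1) by (simp add: alpha_coeff_def)
qed

lemma alpha_coeff_le_2: "1 <= n ==> alpha_coeff M F0 2 Y n <= 2"
 by (rule alpha_coeff_least) (auto intro: alpha_vec_le_2 Y_M)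

lemma alpha_coeff_antimono: "1 <= m ==> m <= n ==> alpha_coeff M F0 2 Y n <= alpha_coeff M F0 2 Y m"
 by (rule alpha_coeff_least) (auto intro!: alpha_coeff_ge)

lemma alpha_coeff_al: "1 <= m ==> alpha_coeff M F0 2 Y m = ennreal (4 * al m)"
 using alpha_coeff_le_2[of m] by (auto simp: al_def ennreal_enn2real_if top_unique)

lemma al_bounds: "0 <= al m" "al m <= 1 / 2"
proof -
 show "0 <= al m" by (simp add: al_def)
 show "al m <= 1 / 2"
 proof (cases "m = 0")
  case False
  then have "ennreal (4 * al m) <= ennreal 2" using alpha_coeff_le_2[of m] alpha_coeff_al[of m] by simp
  then have "4 * al m <= 2" by (subst (asm) ennreal_le_iff) auto
  then show ?thesis by simp
 qed (simp add: al_def)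
qed

lemma al_antimono: "m <= n ==> al n <= al m"
proof (cases "m = 0")
 case True
 then show ?thesis using al_bounds(2)[of n] by (simp add: al_def)
next
 case False
 assume "m <= n"
 then have "ennreal (4 * al n) <= ennreal (4 * al m)" using False alpha_coeff_antimono[of m n] alpha_coeff_al[of m] alpha_coeff_al[of n] by simp
 then show ?thesis using al_bounds(1)[of m] al_bounds(1)[of n] by (simp add: ennreal_le_iff)
qed

lemma assoc_corner_le:
 assumes m: "1 <= m" and \<eta>: "brv F0 \<eta>" "\<And>w. \<bar>\<eta> w\<bar> <= 1" and l: "l \<in> {1..2}" "i \<in> tuples m l"
 shows "\<bar>assoc \<eta> (corner l (\<lambda>j. Y (i j)) x)\<bar> <= 4 * al m"
proof -
 have "brv M (corner l (\<lambda>j. Y (i j)) x)" by (rule brvI[where B=1]) (auto intro: corner_bounded Y_M)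
 from assoc_le_conditional[OF \<eta> this]
 have "ennreal \<bar>assoc \<eta> (corner l (\<lambda>j. Y (i j)) x)\<bar> <= (\<integral>\<^sup>+w. ennreal \<bar>real_cond_exp M F0 (corner l (\<lambda>j. Y (i j)) x) w - expectation (corner l (\<lambda>j. Y (i j)) x)\<bar> \<partial>M)" .
 also have "... <= alpha_vec M F0 l (\<lambda>j. Y (i j))" unfolding alpha_vec_corner by (rule SUP_upper) simp
 also have "... <= alpha_coeff M F0 2 Y m" by (rule alpha_coeff_ge[OF m l])
 also have "... = ennreal (4 * al m)" by (rule alpha_coeff_al[OF m])
 finally show ?thesis using al_bounds(1)[of m] by (simp add: ennreal_le_iff)
qed

lemma assoc_tendsto:
 assumes \<eta>: "brv M \<eta>" "\<And>w. \<bar>\<eta> w\<bar> <= 1" and f: "\<And>n. f n \<in> borel_measurable M" "\<And>n w. \<bar>f n w\<bar> <= 1"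
  and lim: "\<And>w. (\<lambda>n. f n w) \<longlonglongrightarrow> g w"
 shows "(\<lambda>n. assoc \<eta> (f n)) \<longlonglongrightarrow> assoc \<eta> g"
proof -
 have gm: "g \<in> borel_measurable M" by (rule borel_measurable_LIMSEQ_real[OF lim f(1)])
 note [measurable] = brv_meas[OF \<eta>(1)] f(1) gm
 have "(\<lambda>n. expectation (f n)) \<longlonglongrightarrow> expectation g"
  by (rule integral_dominated_convergence[where w="\<lambda>_. 1"]) (use f lim in auto)
 moreover have "(\<lambda>n. (\<E> w. \<eta> w * f n w)) \<longlonglongrightarrow> (\<E> w. \<eta> w * g w)"
 proof (rule integral_dominated_convergence[where w="\<lambda>_. 1"])
  show "AE w in M. (\<lambda>n. \<eta> w * f n w) \<longlonglongrightarrow> \<eta> w * g w" by (intro AE_I2 tendsto_mult_left lim)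
  show "AE w in M. norm (\<eta> w * f n w) <= 1" for n
  proof (rule AE_I2)
   fix w show "norm (\<eta> w * f n w) <= 1" using mult_mono[OF \<eta>(2)[of w] f(2)[of n w]] by (simp add: abs_mult)
  qed
 qed auto
 ultimately show ?thesis unfolding assoc_def by (intro tendsto_diff tendsto_mult_left)
qed

lemma mean_tendsto:
 assumes D: "downset D" and x: "\<forall>y. (\<lambda>n. indicat_real {..x n} y) \<longlonglongrightarrow> indicat_real D y"
 shows "(\<lambda>n. (\<E> w. indicat_real {..x n} (Y j w))) \<longlonglongrightarrow> measure (distr M borel Y0) D"
proof -
 have [measurable]: "D \<in> sets borel" by (rule downset_borel[OF D])
 show ?thesis unfolding measure_law[OF downset_borel[OF D], of j]
  by (rule integral_dominated_convergence[where w="\<lambda>_. 1"]) (use x in \<open>auto simp: indicator_def\<close>)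
qed

text \<open>The coefficients bound the indicators of closed half-lines; dominated convergence passes to all lower sets.\<close>

lemma centered_mix1:
 assumes m: "1 <= m" "int m <= j" and D: "downset D" and \<eta>: "brv F0 \<eta>" "\<And>w. \<bar>\<eta> w\<bar> <= 1"
 shows "\<bar>assoc \<eta> (\<lambda>w. indicat_real D (Y j w))\<bar> <= 4 * al m"
proof -
 have \<eta>M: "brv M \<eta>" using \<eta>(1) F0_to_M by (auto simp: brv_def)
 obtain x :: "nat \<Rightarrow> real" where x: "\<forall>y. (\<lambda>n. indicat_real {..x n} y) \<longlonglongrightarrow> indicat_real D y" using downset_approx[OF D] by blast
 have "(\<lambda>n. assoc \<eta> (\<lambda>w. indicat_real {..x n} (Y j w))) \<longlonglongrightarrow> assoc \<eta> (\<lambda>w. indicat_real D (Y j w))"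
  by (rule assoc_tendsto[OF \<eta>M \<eta>(2)]) (use x in \<open>auto simp: indicator_def\<close>)
 then have lim: "(\<lambda>n. \<bar>assoc \<eta> (\<lambda>w. indicat_real {..x n} (Y j w))\<bar>) \<longlonglongrightarrow> \<bar>assoc \<eta> (\<lambda>w. indicat_real D (Y j w))\<bar>" by (rule tendsto_rabs)
 have "\<bar>assoc \<eta> (\<lambda>w. indicat_real {..x n} (Y j w))\<bar> <= 4 * al m" for n
 proof -
  have "brv M (\<lambda>w. indicat_real {..x n} (Y j w))" by (rule brvI[where B=1]) (auto simp: indicator_def)
  from assoc_const_diff[OF \<eta>M this, of "(\<E> w. indicat_real {..x n} (Y j w))"]
  have "assoc \<eta> (\<lambda>w. indicat_real {..x n} (Y j w)) = assoc \<eta> (corner 1 (\<lambda>_. Y j) (\<lambda>_. x n))"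
   by (simp add: corner_def[abs_def] centered_def)
  then show ?thesis using assoc_corner_le[OF m(1) \<eta>, of 1 "\<lambda>_. j" "\<lambda>_. x n"] m(2) by (simp add: monotone_on_def)
 qed
 then show ?thesis by (intro LIMSEQ_le_const2[OF lim]) blast
qed

lemma centered_mix2:
 assumes m: "1 <= m" "int m <= j" "j <= k" and D: "downset D" "downset E" and \<eta>: "brv F0 \<eta>" "\<And>w. \<bar>\<eta> w\<bar> <= 1"
 shows "\<bar>assoc \<eta> (\<lambda>w. (indicat_real D (Y j w) - measure (distr M borel Y0) D) * (indicat_real E (Y k w) - measure (distr M borel Y0) E))\<bar> <= 4 * al m"
proof -
 have \<eta>M: "brv M \<eta>" using \<eta>(1) F0_to_M by (auto simp: brv_def)
 obtain x :: "nat \<Rightarrow> real" where x: "\<forall>y. (\<lambda>n. indicat_real {..x n} y) \<longlonglongrightarrow> indicat_real D y" using downset_approx[OF D(1)] by blast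
 obtain z :: "nat \<Rightarrow> real" where z: "\<forall>y. (\<lambda>n. indicat_real {..z n} y) \<longlonglongrightarrow> indicat_real E y" using downset_approx[OF D(2)] by blast
 define i where "i l = (if l <= (1::nat) then j else k)" for l
 have i: "i \<in> tuples m 2" using m by (auto simp: i_def monotone_on_def)
 define t where "t n l = (if l <= (1::nat) then x n else z n)" for n l
 define W where "W n = corner 2 (\<lambda>l. Y (i l)) (t n)" for n
 have W_eq: "W n w = (indicat_real {..x n} (Y j w) - (\<E> w. indicat_real {..x n} (Y j w))) * (indicat_real {..z n} (Y k w) - (\<E> w. indicat_real {..z n} (Y k w)))" for n w
  by (simp add: W_def corner_def centered_def i_def t_def numeral_2_eq_2)
 have "(\<lambda>n. assoc \<eta> (W n)) \<longlonglongrightarrow> assoc \<eta> (\<lambda>w. (indicat_real D (Y j w) - measure (distr M borel Y0) D) * (indicat_real E (Y k w) - measure (distr M borel Y0) E))"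
 proof (rule assoc_tendsto[OF \<eta>M \<eta>(2)])
  show "W n \<in> borel_measurable M" "\<bar>W n w\<bar> <= 1" for n w unfolding W_def by (rule corner_bounded; rule Y_M)+
  show "(\<lambda>n. W n w) \<longlonglongrightarrow> (indicat_real D (Y j w) - measure (distr M borel Y0) D) * (indicat_real E (Y k w) - measure (distr M borel Y0) E)" for w
   unfolding W_eq by (intro tendsto_mult tendsto_diff mean_tendsto D x z x[rule_format] z[rule_format])
 qed
 then have lim: "(\<lambda>n. \<bar>assoc \<eta> (W n)\<bar>) \<longlonglongrightarrow> \<bar>assoc \<eta> (\<lambda>w. (indicat_real D (Y j w) - measure (distr M borel Y0) D) * (indicat_real E (Y k w) - measure (distr M borel Y0) E))\<bar>" by (rule tendsto_rabs)
 have "\<bar>assoc \<eta> (W n)\<bar> <= 4 * al m" for n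
  unfolding W_def by (rule assoc_corner_le[OF m(1) \<eta> _ i]) simp
 then show ?thesis by (intro LIMSEQ_le_const2[OF lim]) blast
qed

sublocale alpha_dependent M F Y al "distr M borel Y0"
proof
 show "subalgebra M (F i)" "Y i \<in> borel_measurable (F i)" "distr M borel (Y i) = distr M borel Y0" for i by (rule F_sub Y_F Y_law)+
 show "sets (F i) \<subseteq> sets (F j)" if "i <= j" for i j using that by (rule F_mono)
 show "al 0 = 1 / 2" by (simp add: al_def)
 show "al n <= al m" if "m <= n" for m n using that by (rule al_antimono)
 show "0 <= al m" for m by (rule al_bounds)
 fix \<xi> D and m :: nat and i j :: int
 assume m: "1 <= m" "i + int m <= j" and D: "downset D" and \<xi>: "brv (F i) \<xi>" "\<And>w. \<bar>\<xi> w\<bar> <= 1"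
 have [measurable]: "D \<in> sets borel" by (rule downset_borel[OF D])
 have "assoc \<xi> (\<lambda>w. indicat_real D (Y j w)) = assoc (\<lambda>w. \<xi> (It (- i) w)) (\<lambda>w. indicat_real D (Y (j - i) w))"
  by (rule assoc_shift[OF \<xi>(1)]) (auto simp: Y_eq[of _ j i])
 then show "\<bar>assoc \<xi> (\<lambda>w. indicat_real D (Y j w))\<bar> <= 4 * al m"
  using centered_mix1[OF m(1) _ D F_shift[OF \<xi>(1)] \<xi>(2), of "j - i"] m(2) by simp
 fix E and k :: int
 assume k: "j <= k" and E: "downset E"
 have [measurable]: "E \<in> sets borel" by (rule downset_borel[OF E])
 have "assoc \<xi> (\<lambda>w. (indicat_real D (Y j w) - measure (distr M borel Y0) D) * (indicat_real E (Y k w) - measure (distr M borel Y0) E))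
   = assoc (\<lambda>w. \<xi> (It (- i) w)) (\<lambda>w. (indicat_real D (Y (j - i) w) - measure (distr M borel Y0) D) * (indicat_real E (Y (k - i) w) - measure (distr M borel Y0) E))"
  by (rule assoc_shift[OF \<xi>(1)]) (auto simp: Y_eq[of _ j i] Y_eq[of _ k i])
 then show "\<bar>assoc \<xi> (\<lambda>w. (indicat_real D (Y j w) - measure (distr M borel Y0) D) * (indicat_real E (Y k w) - measure (distr M borel Y0) E))\<bar> <= 4 * al m"
  using centered_mix2[OF m(1) _ _ D E F_shift[OF \<xi>(1)] \<xi>(2), of "j - i" "k - i"] m(2) k by simp
qed

lemma quantile_antimono: "u <= v ==> quantile_function H v <= quantile_function H u"
 unfolding quantile_function_def by (rule INF_superset_mono) auto

lemma alpha_inv_antimono: "u <= v ==> alpha_inv M F0 2 Y v <= alpha_inv M F0 2 Y u"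
 unfolding alpha_inv_def by (rule INF_superset_mono) (auto intro: order_trans ennreal_leI)

lemma alpha_coeff_0: "alpha_coeff M F0 2 Y 0 = ennreal (1 / 2)" by (simp add: alpha_coeff_def)

text \<open>The coefficient of lag 0 needs separate care, as \<open>al 0\<close> is not divided by 4.\<close>

lemma alpha_inv_ge:
 assumes u: "0 < u" "u < al m" shows "of_nat (Suc m) <= alpha_inv M F0 2 Y u"
 unfolding alpha_inv_def
proof (rule INF_greatest)
 fix q assume "q \<in> {q. alpha_coeff M F0 2 Y q <= ennreal u}"
 then have q: "alpha_coeff M F0 2 Y q <= ennreal u" by simp
 have "\<not> q <= m"
 proof
  assume "q <= m"
  then have "u < al q" using al_antimono[of q m] u by simp
  moreover have "al q <= u"
  proof (cases "q = 0")
   case True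
   have "1 / 2 <= u" using q[unfolded True alpha_coeff_0] u by (subst (asm) ennreal_le_iff) auto
   then show ?thesis by (simp add: al_def True)
  next
   case False
   then have "4 * al q <= u" using q u alpha_coeff_al[of q] by (simp add: ennreal_le_iff)
   then show ?thesis using al_bounds(1)[of q] by linarith
  qed
  ultimately show False by simp
 qed
 then have "Suc m <= q" by simp
 then show "of_nat (Suc m) <= (of_nat q :: ennreal)" by (simp only: of_nat_le_iff)
qed

lemma alpha_inv_attained:
 assumes u: "0 < u" and fin: "alpha_inv M F0 2 Y u < \<infinity>"
 shows "\<exists>m. al m <= u \<and> alpha_inv M F0 2 Y u = of_nat m"
proof -
 have "\<exists>q. alpha_coeff M F0 2 Y q <= ennreal u"
 proof (rule ccontr)
  assume "\<nexists>q. alpha_coeff M F0 2 Y q <= ennreal u"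
  then have "{q. alpha_coeff M F0 2 Y q <= ennreal u} = {}" by blast
  then show False using fin by (simp add: alpha_inv_def)
 qed
 then obtain q0 where q0: "alpha_coeff M F0 2 Y q0 <= ennreal u" by blast
 define m where "m = (LEAST q. alpha_coeff M F0 2 Y q <= ennreal u)"
 have m: "alpha_coeff M F0 2 Y m <= ennreal u" unfolding m_def by (rule LeastI) (rule q0)
 have "al m <= u"
 proof (cases "m = 0")
  case True
  have "1 / 2 <= u" using m[unfolded True alpha_coeff_0] u by (subst (asm) ennreal_le_iff) auto
   then show ?thesis by (simp add: al_def True)
 next
  case False
  then have "4 * al m <= u" using m u alpha_coeff_al[of m] by (simp add: ennreal_le_iff)
  then show ?thesis using al_bounds(1)[of m] by linarith
 qed
 moreover have "alpha_inv M F0 2 Y u = of_nat m" unfolding alpha_inv_def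
 proof (rule antisym)
  show "(INF q\<in>{q. alpha_coeff M F0 2 Y q <= ennreal u}. of_nat q) <= (of_nat m :: ennreal)" by (rule INF_lower) (simp add: m)
  show "(of_nat m :: ennreal) <= (INF q\<in>{q. alpha_coeff M F0 2 Y q <= ennreal u}. of_nat q)"
   by (rule INF_greatest) (auto simp: m_def intro: Least_le)
 qed
 ultimately show ?thesis by blast
qed

definition rate :: "(real \<Rightarrow> real) \<Rightarrow> real \<Rightarrow> ennreal" where
 "rate H u = alpha_inv M F0 2 Y u * quantile_function H u"

lemma rate_antimono: "u <= v ==> rate H v <= rate H u"
 unfolding rate_def by (intro mult_mono alpha_inv_antimono quantile_antimono) auto

lemma alpha_rate_rate:
 assumes H: "tail_function H" and Q: "(\<integral>\<^sup>+u\<in>{0..1}. quantile_function H u \<partial>lborel) < \<infinity>"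
  and fin: "\<And>u. 0 < u ==> u < 1 ==> rate H u < \<infinity>"
 shows "alpha_rate M F Y al (distr M borel Y0) H (\<lambda>u. enn2real (rate H u))"
proof
 show "tail_function H" by (rule H)
 show "0 <= enn2real (rate H u)" for u by simp
 show "enn2real (rate H v) <= enn2real (rate H u)" if "0 < u" "u <= v" "v < 1" for u v
  using that fin[of u] by (intro enn2real_mono rate_antimono) auto
 show "real (Suc m) * quant H u <= enn2real (rate H u)" if u: "0 < u" "u < 1" "u < al m" for u m
 proof -
  have "ennreal (real (Suc m) * quant H u) = of_nat (Suc m) * quantile_function H u"
   unfolding quantile_function_eq[OF H u(1)] by (simp add: ennreal_mult ennreal_of_nat_eq_real_of_nat del: of_nat_Suc)
  also have "... <= rate H u" unfolding rate_def by (rule mult_right_mono[OF alpha_inv_ge[OF u(1,3)]]) simp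
  finally have "enn2real (ennreal (real (Suc m) * quant H u)) <= enn2real (rate H u)" using fin[OF u(1,2)] by (intro enn2real_mono) auto
  then show ?thesis by (simp del: of_nat_Suc)
 qed
 show "\<exists>m. al m <= u \<and> real m * quant H u <= enn2real (rate H u)" if u: "0 < u" "u < 1" "0 < quant H u" for u
 proof -
  have "alpha_inv M F0 2 Y u < \<infinity>"
   using fin[OF u(1,2)] u(3) by (auto simp: rate_def quantile_function_eq[OF H u(1)] ennreal_mult_less_top less_top)
  from alpha_inv_attained[OF u(1) this] obtain m where m: "al m <= u" "alpha_inv M F0 2 Y u = of_nat m" by blast
  have "rate H u = ennreal (real m * quant H u)"
   unfolding rate_def m(2) quantile_function_eq[OF H u(1)] by (simp add: ennreal_mult ennreal_of_nat_eq_real_of_nat)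
  then show ?thesis using m(1) by (intro exI[of _ m]) simp
 qed
 show "integrable unif01 (quant H)"
 proof (rule integrableI_bounded[OF quant_measurable[OF H]])
  have "(\<integral>\<^sup>+u. ennreal (norm (quant H u)) \<partial>unif01) = (\<integral>\<^sup>+u. quantile_function H u \<partial>unif01)"
   by (rule nn_integral_cong) (simp add: quantile_function_eq[OF H])
  also have "... <= (\<integral>\<^sup>+u\<in>{0..1}. quantile_function H u \<partial>lborel)" by (rule nn_integral_unif01_le)
  finally show "(\<integral>\<^sup>+u. ennreal (norm (quant H u)) \<partial>unif01) < \<infinity>" using Q by (rule le_less_trans)
 qed
qed

text \<open>Where the rate is infinite at one interior point it is infinite, with the quantile bounded below, on a whole interval. Both integral conditions of the theorem exclude this.\<close>

lemma rate_infinite: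
 assumes H: "tail_function H" and v: "0 < v" "v < 1" "rate H v = \<infinity>"
 shows "0 < quant H v" "\<And>u. 0 < u ==> u <= v ==> rate H u = \<infinity>" "\<And>u. 0 < u ==> u <= v ==> alpha_inv M F0 2 Y u = \<infinity>"
  "\<And>u. 0 < u ==> u <= v ==> ennreal (quant H v) <= quantile_function H u"
proof -
 have q: "quantile_function H v = ennreal (quant H v)" by (rule quantile_function_eq[OF H v(1)])
 show "0 < quant H v"
 proof (rule ccontr)
  assume "\<not> 0 < quant H v"
  then have "quant H v = 0" using quant_nonneg[of H v] by linarith
  then show False using v(3) q by (simp add: rate_def)
 qed
 show "rate H u = \<infinity>" if "u <= v" for u using rate_antimono[OF that, of H] v(3) by (simp add: top_unique)
 have "alpha_inv M F0 2 Y v = \<infinity>" using v(3) q by (auto simp: rate_def ennreal_mult_eq_top_iff)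
 then show "alpha_inv M F0 2 Y u = \<infinity>" if "u <= v" for u using alpha_inv_antimono[OF that] by (simp add: top_unique)
 show "ennreal (quant H v) <= quantile_function H u" if "u <= v" for u using quantile_antimono[OF that, of H] q by simp
qed

text \<open>If the rate were infinite on an interval, the integral would stay above a positive constant \<open>w\<close> while \<open>x powr (p - 1)\<close> grows.\<close>

lemma weak_tail:
 assumes H: "tail_function H" and p: "2 <= p"
  and sup: "(SUP x\<in>{0<..}. ennreal (x powr (p - 1)) *
   (\<integral>\<^sup>+u\<in>{0..1}. quantile_function H u * indicator {u. rate H u > ennreal x} u \<partial>lborel)) < \<infinity>"
 shows "\<exists>K\<ge>0. \<forall>x>0. ennreal (x powr (p - 1)) * (\<integral>\<^sup>+u\<in>{0..1}. quantile_function H u * indicator {u. rate H u > ennreal x} u \<partial>lborel) <= ennreal K"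
  "\<And>u. 0 < u ==> u < 1 ==> rate H u < \<infinity>"
proof -
 define I where "I x = (\<integral>\<^sup>+u\<in>{0..1}. quantile_function H u * indicator {u. rate H u > ennreal x} u \<partial>lborel)" for x
 define K where "K = enn2real (SUP x\<in>{0<..}. ennreal (x powr (p - 1)) * I x)"
 have K: "0 <= K" "(SUP x\<in>{0<..}. ennreal (x powr (p - 1)) * I x) = ennreal K" using sup by (simp_all add: K_def I_def)
 have b: "ennreal (x powr (p - 1)) * I x <= ennreal K" if "0 < x" for x
  unfolding K(2)[symmetric] by (rule SUP_upper) (use that in simp)
 then show "\<exists>K\<ge>0. \<forall>x>0. ennreal (x powr (p - 1)) * (\<integral>\<^sup>+u\<in>{0..1}. quantile_function H u * indicator {u. rate H u > ennreal x} u \<partial>lborel) <= ennreal K"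
  using K(1) unfolding I_def by blast
 show "rate H v < \<infinity>" if v: "0 < v" "v < 1" for v
 proof (rule ccontr)
  assume "\<not> rate H v < \<infinity>"
  then have inf: "rate H v = \<infinity>" by (simp add: less_top[symmetric])
  note r = rate_infinite[OF H v inf]
  define w where "w = quant H v * v"
  have w: "0 < w" using r(1) v by (simp add: w_def)
  have Ige: "ennreal w <= I x" for x
  proof -
   have "ennreal w = (\<integral>\<^sup>+u. ennreal (quant H v) * indicator {0<..v} u \<partial>lborel)"
    using v by (subst nn_integral_cmult_indicator) (auto simp: w_def ennreal_mult)
   also have "... <= I x" unfolding I_def
   proof (rule nn_integral_mono)
    fix u show "ennreal (quant H v) * indicator {0<..v} u <= quantile_function H u * indicator {u. rate H u > ennreal x} u * indicator {0..1} u"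
     using r(2)[of u] r(4)[of u] v by (auto simp: indicator_def)
   qed
   finally show ?thesis .
  qed
  define x where "x = max 1 ((K + 1) / w)"
  have x: "1 <= x" "(K + 1) / w <= x" by (auto simp: x_def)
  have "K + 1 <= x * w" using x(2) w by (simp add: pos_divide_le_eq)
  also have "... <= x powr (p - 1) * w" using powr_mono[of 1 "p - 1" x] x p w by (intro mult_right_mono) auto
  finally have "ennreal (K + 1) <= ennreal (x powr (p - 1)) * ennreal w" using w by (simp add: ennreal_mult[symmetric] ennreal_leI)
  also have "... <= ennreal (x powr (p - 1)) * I x" by (rule mult_left_mono[OF Ige]) simp
  also have "... <= ennreal K" using x by (intro b) simp
  finally show False using K(1) by (simp add: ennreal_le_iff)
 qed
qed

text \<open>If the rate were infinite at a point, the integrand would be infinite on an interval.\<close>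

lemma strong_finite:
 assumes H: "tail_function H" and p: "2 <= p"
  and int: "(\<integral>\<^sup>+u\<in>{0..1}. ennreal_powr (alpha_inv M F0 2 Y u) (p - 1) * ennreal_powr (quantile_function H u) p \<partial>lborel) < \<infinity>"
  and v: "0 < v" "v < 1"
 shows "rate H v < \<infinity>"
proof (rule ccontr)
 assume "\<not> rate H v < \<infinity>"
 then have inf: "rate H v = \<infinity>" by (simp add: less_top[symmetric])
 note r = rate_infinite[OF H v inf]
 have "(\<infinity>::ennreal) = (\<integral>\<^sup>+u. \<infinity> * indicator {0<..v} u \<partial>lborel)"
  using v by (subst nn_integral_cmult_indicator) (auto simp: ennreal_top_mult)
 also have "... <= (\<integral>\<^sup>+u\<in>{0..1}. ennreal_powr (alpha_inv M F0 2 Y u) (p - 1) * ennreal_powr (quantile_function H u) p \<partial>lborel)"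
 proof (rule nn_integral_mono)
  fix u
  show "\<infinity> * indicator {0<..v} u <= ennreal_powr (alpha_inv M F0 2 Y u) (p - 1) * ennreal_powr (quantile_function H u) p * indicator {0..1} u"
  proof (cases "u \<in> {0<..v}")
   case True
   then have u: "0 < u" "u <= v" by auto
   have "0 < quant H u" using quant_antimono[OF H u] r(1) by linarith
   then have "ennreal_powr (alpha_inv M F0 2 Y u) (p - 1) * ennreal_powr (quantile_function H u) p = \<infinity>"
    using r(3)[OF u] by (simp add: ennreal_powr_def quantile_function_eq[OF H u(1)] ennreal_top_mult)
   then show ?thesis using u v by simp
  qed simp
 qed
 finally show False using int by simp
qed

lemma strong_integrand:
 assumes H: "tail_function H" and u: "0 < u" and fin: "rate H u < \<infinity>" and p: "2 <= p"
 shows "ennreal (quant H u * enn2real (rate H u) powr (p - 1)) <= ennreal_powr (alpha_inv M F0 2 Y u) (p - 1) * ennreal_powr (quantile_function H u) p"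
proof (cases "quant H u = 0")
 case False
 then have q: "0 < quant H u" using quant_nonneg[of H u] by linarith
 have "alpha_inv M F0 2 Y u < \<infinity>"
  using fin q by (auto simp: rate_def quantile_function_eq[OF H u] ennreal_mult_less_top less_top)
 then obtain r where r: "0 <= r" "alpha_inv M F0 2 Y u = ennreal r" by (cases "alpha_inv M F0 2 Y u") auto
 have "rate H u = ennreal (r * quant H u)" using r by (simp add: rate_def quantile_function_eq[OF H u] ennreal_mult)
 then have "quant H u * enn2real (rate H u) powr (p - 1) = r powr (p - 1) * (quant H u * quant H u powr (p - 1))"
  using r q by (simp add: powr_mult)
 also have "quant H u * quant H u powr (p - 1) = quant H u powr p" using q powr_add[of "quant H u" 1 "p - 1"] by simp
 finally show ?thesis using r by (simp add: ennreal_powr_def quantile_function_eq[OF H u] ennreal_mult)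
qed simp

end

section \<open>Deviation inequalities for maxima of averages\<close>

context stationary_shift begin

text \<open>The mean of \<open>f (Y i)\<close> is the integral of \<open>f\<close> against the common law.\<close>

lemma max_average_event:
 assumes f: "f \<in> F_class H (distr M borel Y0)" and n: "1 <= n" and x: "0 < x"
 shows "{w \<in> space M. 1 / real n * (MAX k\<in>{1..n}. \<bar>\<Sum>j=1..k. centered M (\<lambda>w. f (Y (int j) w)) w\<bar>) \<ge> x}
  = {w \<in> space M. \<exists>k\<in>{1..n}. real n * x <= \<bar>\<Sum>j=1..k. ctr f (int j) w\<bar>}"
proof -
 have fm: "f \<in> borel_measurable borel" using f borel_measurable_integrable[of "distr M borel Y0" f] by (simp add: F_class_def)
 have c: "centered M (\<lambda>w. f (Y i w)) = ctr f i" for i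
  using integral_distr[OF Y_M[of i] fm] by (simp add: centered_def ctr_def[abs_def] Y_law)
 have np: "0 < real n" using n by simp
 have m: "x <= 1 / real n * (MAX k\<in>{1..n}. g k) \<longleftrightarrow> (\<exists>k\<in>{1..n}. real n * x <= g k)" for g :: "nat \<Rightarrow> real"
 proof -
  have "x <= 1 / real n * (MAX k\<in>{1..n}. g k) \<longleftrightarrow> real n * x <= (MAX k\<in>{1..n}. g k)" using np by (simp add: pos_le_divide_eq mult.commute)
  also have "... \<longleftrightarrow> (\<exists>k\<in>{1..n}. real n * x <= g k)" using n by (subst Max_ge_iff) auto
  finally show ?thesis .
 qed
 show ?thesis unfolding c m ..
qed

lemma tailQ_le:
 assumes H: "tail_function H" and A: "alpha_rate M F Y al (distr M borel Y0) H (\<lambda>u. enn2real (rate H u))" and p: "0 < t"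
  and fin: "\<And>u. 0 < u ==> u < 1 ==> rate H u < \<infinity>" and K: "0 <= K"
  and le: "ennreal (t powr (p - 1)) * (\<integral>\<^sup>+u\<in>{0..1}. quantile_function H u * indicator {u. rate H u > ennreal t} u \<partial>lborel) <= ennreal K"
 shows "t powr (p - 1) * alpha_rate.tailQ H (\<lambda>u. enn2real (rate H u)) t <= K"
proof -
 interpret A: alpha_rate M F Y al "distr M borel Y0" H "\<lambda>u. enn2real (rate H u)" by (rule A)
 have t0: "0 <= A.tailQ t" unfolding A.tailQ_def by (intro integral_ge_0) auto
 have "ennreal (A.tailQ t) = (\<integral>\<^sup>+u. ennreal (quant H u * indicator {u. t < enn2real (rate H u)} u) \<partial>unif01)"
  unfolding A.tailQ_def by (rule nn_integral_eq_integral[symmetric]) (auto intro: A.tailQ_integrable)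
 also have "... = (\<integral>\<^sup>+u. quantile_function H u * indicator {u. rate H u > ennreal t} u \<partial>unif01)"
 proof (rule nn_integral_cong)
  fix u assume "u \<in> space unif01"
  then have u: "0 < u" "u < 1" by auto
  obtain r where r: "0 <= r" "rate H u = ennreal r" using fin[OF u] by (cases "rate H u") auto
  show "ennreal (quant H u * indicator {u. t < enn2real (rate H u)} u) = quantile_function H u * indicator {u. rate H u > ennreal t} u"
   using r p by (simp add: quantile_function_eq[OF H u(1)] indicator_def ennreal_less_iff)
 qed
 also have "... <= (\<integral>\<^sup>+u\<in>{0..1}. quantile_function H u * indicator {u. rate H u > ennreal t} u \<partial>lborel)" by (rule nn_integral_unif01_le)
 finally have "ennreal (t powr (p - 1)) * ennreal (A.tailQ t) <= ennreal K" using le by (meson mult_left_mono order_trans zero_le)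
 then show ?thesis using K t0 by (simp add: ennreal_mult[symmetric] ennreal_le_iff)
qed

end

theorem theorem3p2:
  fixes M F0 :: "'a measure" and T :: "'a \<Rightarrow> 'a" and Y0 :: "'a \<Rightarrow> real"
    and f H :: "real \<Rightarrow> real" and Q R :: "real \<Rightarrow> ennreal"
    and Y X :: "int \<Rightarrow> 'a \<Rightarrow> real" and S :: "nat \<Rightarrow> 'a \<Rightarrow> real" and p :: real
  assumes "prob_space M"
    and "bimeasurable_mpt M T"
    and "subalgebra M F0"
    and "sets F0 \<subseteq> {T -` A \<inter> space M | A. A \<in> sets F0}"
    and "Y0 \<in> borel_measurable F0" and "integrable M Y0"
    and Y: "Y = (\<lambda>i. Y0 \<circ> int_iterate M T i)"
    and "tail_function H"
    and Q: "Q = quantile_function H"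
    and "(\<integral>\<^sup>+u\<in>{0..1}. Q u \<partial>lborel) < \<infinity>"
    and "f \<in> F_class H (distr M borel Y0)"
    and X: "X = (\<lambda>i. centered M (\<lambda>\<omega>. f (Y i \<omega>)))"
    and S: "S = (\<lambda>n \<omega>. \<Sum>k = 1..n. X (int k) \<omega>)"
    and R: "R = (\<lambda>u. alpha_inv M F0 2 Y u * Q u)"
    and "p \<ge> 2"
  shows
    "((SUP x\<in>{0<..}. ennreal (x powr (p - 1)) *
          (\<integral>\<^sup>+u\<in>{0..1}. Q u * indicator {u. R u > ennreal x} u \<partial>lborel)) < \<infinity> \<longrightarrow>
       (p > 2 \<longrightarrow>
          (\<forall>a\<in>{p - 1<..<p}. \<exists>C>0. \<forall>n\<ge>1. \<forall>x>0.
             measure M {\<omega> \<in> space M. 1 / real n * (MAX k\<in>{1..n}. \<bar>S k \<omega>\<bar>) \<ge> x}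
             \<le> C * (1 / (real n powr a * x powr (2 * a)) + 1 / (real n powr (p - 1) * x powr p)))) \<and>
       (p = 2 \<longrightarrow>
          (\<forall>a\<in>{1<..<2}. \<forall>c\<in>{0<..<1}. \<exists>C>0. \<forall>n\<ge>1. \<forall>x>0.
             measure M {\<omega> \<in> space M. 1 / real n * (MAX k\<in>{1..n}. \<bar>S k \<omega>\<bar>) \<ge> x}
             \<le> C * (1 / (real n powr (a * c) * x powr (a * (1 + c))) + 1 / (real n * x\<^sup>2)))))
     \<and>
     ((\<integral>\<^sup>+u\<in>{0..1}. ennreal_powr (alpha_inv M F0 2 Y u) (p - 1) * ennreal_powr (Q u) p \<partial>lborel) < \<infinity> \<longrightarrow>
       (\<forall>a\<in>{p - 1<..<p}. \<exists>C>0. \<forall>x>0.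
          (\<Sum>\<^sub>\<infinity>n\<in>{0<..}. ennreal (real n powr (p - 2) *
             measure M {\<omega> \<in> space M. 1 / real n * (MAX k\<in>{1..n}. \<bar>S k \<omega>\<bar>) \<ge> x}))
          \<le> ennreal (C * (1 / x powr (2 * a) + 1 / x powr p))))"
proof -
 interpret D: stationary_shift M F0 T Y0
  using assms by (auto intro!: stationary_shift.intro stationary_shift_axioms.intro)
 note H = \<open>tail_function H\<close> and f = \<open>f \<in> F_class H (distr M borel Y0)\<close> and p = \<open>p \<ge> 2\<close>
 have YD: "Y = D.Y" by (simp add: Y D.Y_def)
 have RD: "R = D.rate H" by (simp add: R Q YD D.rate_def[abs_def])
 have Qint: "(\<integral>\<^sup>+u\<in>{0..1}. quantile_function H u \<partial>lborel) < \<infinity>" using assms(10) by (simp add: Q)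
 define \<rho> where "\<rho> u = enn2real (D.rate H u)" for u
 define P where "P n x = measure M {w \<in> space M. 1 / real n * (MAX k\<in>{1..n}. \<bar>S k w\<bar>) \<ge> x}" for n x
 define md where "md n l = measure M {w \<in> space M. \<exists>k\<in>{1..n}. l <= \<bar>\<Sum>j=1..k. D.ctr f (int j) w\<bar>}" for n l
 have Pmd: "P n x = md n (real n * x)" if "1 <= n" "0 < x" for n x
  unfolding P_def md_def S X YD using D.max_average_event[OF f that] by simp
 have weak: "(p > 2 --> (\<forall>a\<in>{p - 1<..<p}. \<exists>C>0. \<forall>n\<ge>1. \<forall>x>0. P n x <= C * (1 / (real n powr a * x powr (2 * a)) + 1 / (real n powr (p - 1) * x powr p)))) \<and>
    (p = 2 --> (\<forall>a\<in>{1<..<2}. \<forall>c\<in>{0<..<1}. \<exists>C>0. \<forall>n\<ge>1. \<forall>x>0. P n x <= C * (1 / (real n powr (a * c) * x powr (a * (1 + c))) + 1 / (real n * x\<^sup>2))))"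
  if sup: "(SUP x\<in>{0<..}. ennreal (x powr (p - 1)) * (\<integral>\<^sup>+u\<in>{0..1}. Q u * indicator {u. R u > ennreal x} u \<partial>lborel)) < \<infinity>"
 proof -
  note wt = D.weak_tail[OF H p sup[unfolded Q RD]]
  have A: "alpha_rate M D.F D.Y D.al (distr M borel Y0) H \<rho>" unfolding \<rho>_def by (rule D.alpha_rate_rate[OF H Qint wt(2)])
  interpret A: alpha_rate M D.F D.Y D.al "distr M borel Y0" H \<rho> by (rule A)
  have md: "md n l = A.maxdev f n l" for n l by (simp add: md_def A.maxdev_def)
  obtain K where K: "0 <= K" and le: "\<forall>x>0. ennreal (x powr (p - 1)) * (\<integral>\<^sup>+u\<in>{0..1}. quantile_function H u * indicator {u. D.rate H u > ennreal x} u \<partial>lborel) <= ennreal K"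
   using wt(1) by blast
  have tail: "t powr (p - 1) * A.tailQ t <= K" if "0 < t" for t
   using D.tailQ_le[OF H A[unfolded \<rho>_def] that wt(2) K le[rule_format, OF that]] unfolding \<rho>_def .
  show ?thesis
  proof (intro conjI impI ballI)
   fix a assume p2: "2 < p" and a: "a \<in> {p - 1<..<p}"
   then have a: "p - 1 < a" "a < p" by auto
   obtain C where "0 < C" "\<forall>n\<ge>1. \<forall>x>0. A.maxdev f n (real n * x) <= C * (1 / (real n powr (a * 1) * x powr (a * (1 + 1))) + 1 / (real n powr (p - 1) * x powr p))"
    using A.weak_deviation[OF p a _ _ _ tail K f, of 1] p2 by auto
   then show "\<exists>C>0. \<forall>n\<ge>1. \<forall>x>0. P n x <= C * (1 / (real n powr a * x powr (2 * a)) + 1 / (real n powr (p - 1) * x powr p))"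
    by (intro exI[of _ C]) (simp add: Pmd md mult.commute[of a])
  next
   fix a c assume p2: "p = 2" and a: "a \<in> {1<..<2::real}" and c: "c \<in> {0<..<1::real}"
   then have a: "1 < a" "a < 2" and c: "0 < c" "c < 1" by auto
   obtain C where "0 < C" "\<forall>n\<ge>1. \<forall>x>0. A.maxdev f n (real n * x) <= C * (1 / (real n powr (a * c) * x powr (a * (1 + c))) + 1 / (real n powr (p - 1) * x powr p))"
    using A.weak_deviation[OF p _ _ c(1) _ _ tail K f, of a] a c p2 by auto
   then show "\<exists>C>0. \<forall>n\<ge>1. \<forall>x>0. P n x <= C * (1 / (real n powr (a * c) * x powr (a * (1 + c))) + 1 / (real n * x\<^sup>2))"
    by (intro exI[of _ C]) (simp add: Pmd md p2)
  qed
 qed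
 have strong: "\<forall>a\<in>{p - 1<..<p}. \<exists>C>0. \<forall>x>0. (\<Sum>\<^sub>\<infinity>n\<in>{0<..}. ennreal (real n powr (p - 2) * P n x)) <= ennreal (C * (1 / x powr (2 * a) + 1 / x powr p))"
  if int: "(\<integral>\<^sup>+u\<in>{0..1}. ennreal_powr (alpha_inv M F0 2 Y u) (p - 1) * ennreal_powr (Q u) p \<partial>lborel) < \<infinity>"
 proof
  note fin = D.strong_finite[OF H p int[unfolded Q YD]]
  have A: "alpha_rate M D.F D.Y D.al (distr M borel Y0) H \<rho>" unfolding \<rho>_def by (rule D.alpha_rate_rate[OF H Qint fin])
  interpret A: alpha_rate M D.F D.Y D.al "distr M borel Y0" H \<rho> by (rule A)
  have md: "md n l = A.maxdev f n l" for n l by (simp add: md_def A.maxdev_def)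
  have Qi: "integrable unif01 (\<lambda>u. quant H u * \<rho> u powr (p - 1))"
  proof (rule integrableI_bounded)
   show "(\<lambda>u. quant H u * \<rho> u powr (p - 1)) \<in> borel_measurable unif01" by measurable
   have "(\<integral>\<^sup>+u. ennreal (norm (quant H u * \<rho> u powr (p - 1))) \<partial>unif01) <= (\<integral>\<^sup>+u. ennreal_powr (alpha_inv M F0 2 Y u) (p - 1) * ennreal_powr (Q u) p \<partial>unif01)"
   proof (rule nn_integral_mono)
    fix u assume "u \<in> space unif01"
    then have u: "0 < u" "u < 1" by auto
    show "ennreal (norm (quant H u * \<rho> u powr (p - 1))) <= ennreal_powr (alpha_inv M F0 2 Y u) (p - 1) * ennreal_powr (Q u) p"
     using D.strong_integrand[OF H u(1) fin[OF u] p] by (simp add: \<rho>_def Q YD abs_mult)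
   qed
   also have "... <= (\<integral>\<^sup>+u\<in>{0..1}. ennreal_powr (alpha_inv M F0 2 Y u) (p - 1) * ennreal_powr (Q u) p \<partial>lborel)" by (rule nn_integral_unif01_le)
   finally show "(\<integral>\<^sup>+u. ennreal (norm (quant H u * \<rho> u powr (p - 1))) \<partial>unif01) < \<infinity>" using int by (rule le_less_trans)
  qed
  fix a assume "a \<in> {p - 1<..<p}"
  then have a: "p - 1 < a" "a < p" by auto
  obtain C where C: "0 < C" and dev: "\<forall>x>0. \<forall>N. (\<Sum>n=1..N. real n powr (p - 2) * A.maxdev f n (real n * x)) <= C * (1 / x powr (2 * a) + 1 / x powr p)"
   using A.strong_deviation[OF p a Qi f] by blast
  have "(\<Sum>\<^sub>\<infinity>n\<in>{0<..}. ennreal (real n powr (p - 2) * P n x)) <= ennreal (C * (1 / x powr (2 * a) + 1 / x powr p))" if x: "0 < x" for x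
  proof (rule infsum_le_finite_sums)
   show "(\<lambda>n. ennreal (real n powr (p - 2) * P n x)) summable_on {0<..}" by (rule nonneg_summable_on_complete) simp
   fix E :: "nat set" assume E: "finite E" "E \<subseteq> {0<..}"
   obtain N where N: "E \<subseteq> {..N}" using E(1) finite_nat_iff_bounded_le by blast
   have "(\<Sum>n\<in>E. ennreal (real n powr (p - 2) * P n x)) <= (\<Sum>n=1..N. ennreal (real n powr (p - 2) * P n x))"
    using E N by (intro sum_mono2) (auto simp: Suc_le_eq)
   also have "... = ennreal (\<Sum>n=1..N. real n powr (p - 2) * P n x)" by (rule sum_ennreal) (simp add: P_def)
   also have "(\<Sum>n=1..N. real n powr (p - 2) * P n x) = (\<Sum>n=1..N. real n powr (p - 2) * A.maxdev f n (real n * x))"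
    using x by (intro sum.cong) (auto simp: Pmd md)
   also have "ennreal ... <= ennreal (C * (1 / x powr (2 * a) + 1 / x powr p))" using dev x by (intro ennreal_leI) blast
   finally show "(\<Sum>n\<in>E. ennreal (real n powr (p - 2) * P n x)) <= ennreal (C * (1 / x powr (2 * a) + 1 / x powr p))" .
  qed
  then show "\<exists>C>0. \<forall>x>0. (\<Sum>\<^sub>\<infinity>n\<in>{0<..}. ennreal (real n powr (p - 2) * P n x)) <= ennreal (C * (1 / x powr (2 * a) + 1 / x powr p))"
   using C by blast
 qed
 show ?thesis using weak strong unfolding P_def by blast
qed

end
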